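(* Let $1<p<\infty$ and $\theta=1-\frac1p$. Let $\mathcal V$ be a $C^\infty$ subbundle, of fiber dimension $k+1$, of the tangent bundle $T\mathbb R^{n+1}$ defined near $0$, satisfying conditions (i) and (ii) described in the context. Let $\beta=\{X_1,\dots,X_{k+1}\}$ be a basis of $\mathcal V$ near $0$ and $\beta'=\{Y_1,\dots,Y_k\}$ a basis of $\mathcal V\cap T\mathbb R^n_x$ near $0$ (restricted to $\mathbb R^n_x\times\{0\}$). Then there exist a neighborhood $U$ of $0$ in $\mathbb R^{n+1}$, neighborhoods $V'\subset\subset V$ of $0$ in $\mathbb R^n_x$, a number $\delta>0$ with $e^{\tau Y_j}(V')\subseteq V$ for all $|\tau|\le\delta$ and all $j$, and a constant $C>0$ such that for every $\varphi\in C^\infty_0(U)$, writing $R\varphi(x)=\varphi(x,0)$, $$\|R\varphi\|_{L^p}+\sum_{i=1}^k\left\{\int_0^\delta\Big[t^{-\theta}\sup_{|\tau|\le t}\big\|R\varphi(e^{\tau Y_i}\,\cdot)-R\varphi\big\|_{L^p(V')}\Big]^p\frac{dt}{t}\right\}^{1/p}\le C\Big(\|\varphi\|_{L^p(U)}+\sum_{j=1}^{k+1}\|X_j\varphi\|_{L^p(U)}\Big).$$ (The left side is the norm $\|R\varphi\|_{W_{1-\frac1p,p}}$ built from $\beta'$, and the right side is $\|\varphi\|_{W_{1,p}(U,\beta)}$.)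
   Context: Coordinates on $\mathbb R^{n+1}$ are $(x,t)$, $x\in\mathbb R^n$, $t\in\mathbb R$; $\mathbb R^n_x$ is identified with $\mathbb R^n_x\times\{0\}$. For $y\in\mathbb R^{n+1}$, $T_y\mathbb R^n_x$ denotes the span of $\partial/\partial x_1,\dots,\partial/\partial x_n$ at $y$. $\mathcal V_y$ is the fiber of $\mathcal V$ at $y$. Conditions: (i) $\mathcal V_0\not\subseteq T_0\mathbb R^n_x$ (some vector of $\mathcal V_0$ has nonzero $\partial/\partial t$ component); (ii) the sections of $\mathcal V\cap T\mathbb R^n_x$ (which is a bundle of fiber dimension $k$ near $0$), restricted to $\mathbb R^n_x$, together with their brackets $[X,Y]$ span $T\mathbb R^n_x$ near $0$ in $\mathbb R^n_x$. For a vector field $Z$, $e^{\tau Z}x$ denotes the point at time $\tau$ of the integral curve of $Z$ starting at $x$. *)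

theory Defs
  imports "HOL-Analysis.Analysis"
begin

text \<open>C-infinity real-valued functions on an open set S of a Euclidean space:
  continuous, differentiable, and all first partial derivatives again C-infinity
  (greatest fixed point, i.e. partial derivatives of all orders exist and are continuous).\<close>
coinductive Cinf_on :: "'a::euclidean_space set \<Rightarrow> ('a \<Rightarrow> real) \<Rightarrow> bool"
  for S :: "'a set" where
  "\<lbrakk> continuous_on S f; \<forall>x\<in>S. f differentiable (at x);
     \<forall>b\<in>Basis. Cinf_on S (\<lambda>x. frechet_derivative f (at x) b) \<rbrakk> \<Longrightarrow> Cinf_on S f"

definition vf_smooth :: "'a::euclidean_space set \<Rightarrow> ('a \<Rightarrow> 'a) \<Rightarrow> bool" where
  "vf_smooth S Z \<longleftrightarrow> (\<forall>b\<in>Basis. Cinf_on S (\<lambda>y. Z y \<bullet> b))"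

definition lie_bracket :: "('a::euclidean_space \<Rightarrow> 'a) \<Rightarrow> ('a \<Rightarrow> 'a) \<Rightarrow> 'a \<Rightarrow> 'a" where
  "lie_bracket Z1 Z2 x = frechet_derivative Z2 (at x) (Z1 x) - frechet_derivative Z1 (at x) (Z2 x)"

definition vf_apply :: "('a::euclidean_space \<Rightarrow> 'a) \<Rightarrow> ('a \<Rightarrow> real) \<Rightarrow> 'a \<Rightarrow> real" where
  "vf_apply Z f y = frechet_derivative f (at y) (Z y)"

definition integral_curve :: "('a::euclidean_space \<Rightarrow> 'a) \<Rightarrow> 'a set \<Rightarrow> real \<Rightarrow> 'a \<Rightarrow> (real \<Rightarrow> 'a) \<Rightarrow> bool" where
  "integral_curve Z D \<tau> x \<gamma> \<longleftrightarrow> \<gamma> 0 = x \<and>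
     (\<forall>s\<in>closed_segment 0 \<tau>. \<gamma> s \<in> D \<and>
        (\<gamma> has_vector_derivative Z (\<gamma> s)) (at s within closed_segment 0 \<tau>))"

definition flow :: "('a::euclidean_space \<Rightarrow> 'a) \<Rightarrow> 'a set \<Rightarrow> real \<Rightarrow> 'a \<Rightarrow> 'a" where
  "flow Z D \<tau> x = (THE y. \<exists>\<gamma>. integral_curve Z D \<tau> x \<gamma> \<and> \<gamma> \<tau> = y)"

definition Lp_norm :: "real \<Rightarrow> 'a measure \<Rightarrow> 'a set \<Rightarrow> ('a \<Rightarrow> real) \<Rightarrow> real" where
  "Lp_norm p M S f = enn2real (\<integral>\<^sup>+x\<in>S. ennreal (\<bar>f x\<bar> powr p) \<partial>M) powr (1/p)"

text \<open>The integral  int_0^delta [t^(-theta) sup_{|tau|<=t} || R phi(e^{tau Z} .) - R phi ||_{L^p(V')}]^p dt/t,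
  with the p-th power moved inside the (monotone) supremum.\<close>
definition besov_term :: "real \<Rightarrow> real \<Rightarrow> (real^'n::finite \<Rightarrow> real^'n) \<Rightarrow> (real^'n) set
     \<Rightarrow> (real^'n) set \<Rightarrow> (real^'n \<Rightarrow> real) \<Rightarrow> ennreal" where
  "besov_term p \<delta> Z D V' f =
     (\<integral>\<^sup>+t\<in>{0<..\<delta>}. (SUP \<tau>\<in>{-t..t}.
        ennreal ((t powr (-(1 - 1/p)) * Lp_norm p lborel V' (\<lambda>x. f (flow Z D \<tau> x) - f x)) powr p / t)) \<partial>lborel)"

end

theory Submission
  imports Defs
begin

text \<open>
  Near \<open>0\<close> the bundle contains a field \<open>T\<close> with \<open>\<partial>\<^sub>t\<close> component \<open>1\<close>, and the combinations
  of the \<open>X\<^sub>j\<close> without \<open>\<partial>\<^sub>t\<close> component give a frame \<open>Z\<^sub>j\<close> tangent to the slices. To compare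
  \<open>\<phi>\<close> at \<open>(x, 0)\<close> and \<open>(exp (\<tau> Y) x, 0)\<close> for \<open>\<bar>\<tau>\<bar> \<le> t\<close>, go up along \<open>T\<close> to height \<open>t\<close>, move there, and
  come down again. The two vertical pieces are controlled by \<open>T \<phi>\<close> through a weighted Hoelder
  inequality, and integrating over \<open>t\<close> is Hardy's inequality. At height \<open>t\<close> the conjugated flow differs
  by \<open>O(t\<^sup>2)\<close> from the flow of a combination of the \<open>Z\<^sub>j\<close>, which costs only \<open>t\<close> times \<open>Z\<^sub>j \<phi>\<close>. The
  remaining discrepancy is absorbed by comparing averages over Euclidean balls of radius of order
  \<open>t\<^sup>2\<close>: by the bracket condition such a ball is covered (by Brouwer's fixed point theorem) by
  products of flows \<open>exp (r t\<^sup>2 Z\<^sub>l)\<close> and group commutators of \<open>exp (r t Z\<^sub>l)\<close> and \<open>exp (t Z\<^sub>m)\<close>, each of which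
  has length \<open>O(t)\<close>, while the parametrization has Lipschitz constant \<open>O(t\<^sup>2)\<close> in \<open>r\<close>, so that
  averages over the ball are bounded by averages over the parameter \<open>r\<close>. Only Lipschitz bounds and strict
  differentiability at \<open>0\<close> enter, which allows all fields to be extended to the whole space by
  composing them with the projection onto a small ball.
\<close>

section \<open>Flows of bounded Lipschitz fields\<close>

text \<open>The scale \<open>t\<^sup>2\<close> is forced from two sides. For
  \<open>\<bar>\<tau>\<bar> \<le> t\<close> the conjugated flow at height \<open>t\<close> and a
  flow of the slice frame have velocities that differ by O(\<open>t\<close>), so their endpoints
  differ by O(\<open>t\<^sup>2\<close>), in a direction that need not lie in the bundle. Brackets
  reach exactly this distance in every direction by a path of length O(\<open>t\<close>), and such a
  path costs one factor \<open>t\<close> times tangential derivatives, which cancels the singular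
  weight of the norm. But the path joining the two endpoints would depend on the base point, so it
  is no composition of fixed flows. Averaging avoids this choice: for a fixed parameter
  \<open>r\<close> the word of flows is the same for all base points, and its differences are
  bounded in mean by Fubini and by the bounded distortion of Lebesgue measure. The volume factor
  \<open>t ^ (2 * n)\<close> of the parametrization, \<open>n\<close> being the dimension of the
  slice, cancels against the volume of the ball. All these bounds depend on \<open>t\<close> alone
  and not on \<open>\<tau>\<close>, so the supremum over \<open>\<tau>\<close> comes for
  free.\<close>

lemma antiderivative_exists:
  fixes g :: "real \<Rightarrow> 'a::euclidean_space"
  assumes "continuous_on UNIV g"
  shows "\<exists>F. F 0 = 0 \<and> (\<forall>s. (F has_vector_derivative g s) (at s))"
proof -
  have "isCont g x" for x
    using assms by (simp add: continuous_on_eq_continuous_at)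
  then obtain F where F: "\<And>s. (F has_vector_derivative g s) (at s)"
    using einterval_antiderivative[of "-\<infinity>" "\<infinity>" g] by auto
  have "((\<lambda>s. F s - F 0) has_vector_derivative g s) (at s)" for s
    using has_vector_derivative_diff[OF F has_vector_derivative_const[of "F 0"]] by simp
  then show ?thesis by (intro exI[of _ "\<lambda>s. F s - F 0"]) auto
qed

text \<open>Mean value inequality for the curve with the uniform motion of velocity \<open>v\<close>
  subtracted. The segment allows either order of \<open>a\<close> and \<open>b\<close>, hence
  negative flow times; \<open>v = 0\<close> yields speed bounds, other values the first-order
  expansions.\<close>

lemma vector_derivative_linearization_bound:
  fixes \<gamma> :: "real \<Rightarrow> 'a::real_normed_vector"
  assumes d: "\<And>s. s \<in> closed_segment a b \<Longrightarrow> (\<gamma> has_vector_derivative \<gamma>' s) (at s within closed_segment a b)"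
    and B: "\<And>s. s \<in> closed_segment a b \<Longrightarrow> norm (\<gamma>' s - v) \<le> B"
  shows "norm (\<gamma> b - \<gamma> a - (b - a) *\<^sub>R v) \<le> B * \<bar>b - a\<bar>"
proof -
  have "norm ((\<gamma> b - b *\<^sub>R v) - (\<gamma> a - a *\<^sub>R v)) \<le> B * norm (b - a)"
  proof (rule differentiable_bound[where S="closed_segment a b" and f'="\<lambda>s h. h *\<^sub>R (\<gamma>' s - v)"])
    show "((\<lambda>b. \<gamma> b - b *\<^sub>R v) has_derivative (\<lambda>h. h *\<^sub>R (\<gamma>' s - v))) (at s within closed_segment a b)"
      if "s \<in> closed_segment a b" for s
      using d[OF that] unfolding has_vector_derivative_def
      by (auto intro!: derivative_eq_intros simp: scaleR_diff_right)
    show "onorm (\<lambda>h. h *\<^sub>R (\<gamma>' s - v)) \<le> B" if "s \<in> closed_segment a b" for s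
      by (rule onorm_le) (use B[OF that] in \<open>auto simp: mult.commute[of "\<bar>_\<bar>"] intro: mult_right_mono\<close>)
  qed auto
  then show ?thesis by (simp add: algebra_simps)
qed

text \<open>The bound on the derivative has the primitive \<open>D * exp (c * s)\<close> for
  positive times, whose increment dominates that of \<open>f\<close>; negative times follow by
  reflection. This is the estimate behind the exponentially weighted Picard iteration.\<close>

lemma exp_growth_bound:
  fixes f :: "real \<Rightarrow> 'a::real_normed_vector"
  assumes d: "\<And>s. (f has_vector_derivative f' s) (at s)"
    and B: "\<And>s. norm (f' s) \<le> D * c * exp (c * \<bar>s\<bar>)"
  shows "norm (f s - f 0) \<le> D * (exp (c * \<bar>s\<bar>) - 1)"
proof -
  have pos: "norm (g s - g 0) \<le> D * (exp (c * s) - 1)"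
    if d: "\<And>s. (g has_vector_derivative g' s) (at s)" and B: "\<And>s. norm (g' s) \<le> D * c * exp (c * \<bar>s\<bar>)"
      and s: "s > 0" for g g' s
  proof -
    have cont: "continuous_on {0..s} g"
      using d by (meson continuous_at_imp_continuous_on has_vector_derivative_continuous)
    have "norm (g s - g 0) \<le> D * exp (c * s) - D * exp (c * 0)"
    proof (rule differentiable_bound_general[OF s cont _ d, where \<phi>' = "\<lambda>x. D * c * exp (c * x)"])
      show "((\<lambda>a. D * exp (c * a)) has_vector_derivative D * c * exp (c * x)) (at x)" for x
        by (auto intro!: derivative_eq_intros simp flip: has_real_derivative_iff_has_vector_derivative)
    qed (use B in \<open>auto intro!: continuous_intros\<close>, metis abs_of_pos)
    then show ?thesis by (simp add: algebra_simps)
  qed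
  consider "s = 0" | "s > 0" | "s < 0" by linarith
  then show ?thesis
  proof cases
    case 3
    have d': "((\<lambda>s. f (- s)) has_vector_derivative - f' (- s)) (at s)" for s
    proof -
      have "((f \<circ> uminus) has_vector_derivative (- 1) *\<^sub>R f' (- s)) (at s)"
        by (rule vector_diff_chain_at) (auto intro!: derivative_eq_intros d)
      then show ?thesis by (simp add: o_def)
    qed
    have "norm (f (- (- s)) - f (- 0)) \<le> D * (exp (c * (- s)) - 1)"
      by (rule pos[OF d']) (use B[of "- _"] 3 in auto)
    then show ?thesis using 3 by simp
  qed (use pos[OF d B] in auto)
qed

text \<open>One constant serves as Lipschitz constant and as bound on the speed, and
  \<open>1 \<le> L\<close> allows passing from \<open>L\<close> to higher powers when constants are
  collected.\<close>

definition bounded_lipschitz :: "real \<Rightarrow> ('a::real_normed_vector \<Rightarrow> 'b::real_normed_vector) \<Rightarrow> bool" where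
  "bounded_lipschitz L Z \<longleftrightarrow> 1 \<le> L \<and> (\<forall>x y. norm (Z x - Z y) \<le> L * norm (x - y)) \<and> (\<forall>x. norm (Z x) \<le> L)"

lemma bounded_lipschitzD:
  assumes "bounded_lipschitz L Z"
  shows "1 \<le> L" "norm (Z x - Z y) \<le> L * norm (x - y)" "norm (Z x) \<le> L"
  using assms by (auto simp: bounded_lipschitz_def)

lemma bounded_lipschitz_continuous:
  assumes "bounded_lipschitz L Z"
  shows "continuous_on S Z"
proof -
  have "L-lipschitz_on S Z"
    using bounded_lipschitzD[OF assms] by (intro lipschitz_onI) (auto simp: dist_norm intro: order_trans[of 0 1])
  then show ?thesis by (rule lipschitz_on_continuous_on)
qed

text \<open>Picard iteration on all of the real line at once. The unknown is the displacement
  divided by the weight \<open>exp (2 * L * \<bar>s\<bar>)\<close>, a bounded continuous function,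
  and in the supremum norm of this quotient the integral operator contracts by \<open>1/2\<close>
  whatever the time.\<close>

lemma global_integral_curve_exists:
  fixes Z :: "'a::euclidean_space \<Rightarrow> 'a"
  assumes Z: "bounded_lipschitz L Z"
  shows "\<exists>\<gamma>. \<gamma> 0 = x \<and> (\<forall>s. (\<gamma> has_vector_derivative Z (\<gamma> s)) (at s))"
proof -
  note L = bounded_lipschitzD[OF Z]
  define w where "w s = exp (2 * L * \<bar>s\<bar>)" for s :: real
  have w1: "w s \<ge> 1 + 2 * L * \<bar>s\<bar>" "w s > 0" "w s \<ge> 1" for s
    using exp_ge_add_one_self[of "2 * L * \<bar>s\<bar>"] L(1) by (auto simp: w_def)
  have wcont: "continuous_on UNIV w" unfolding w_def by (auto intro!: continuous_intros)
  define N where "N \<eta> \<sigma> = Z (x + w \<sigma> *\<^sub>R apply_bcontfun \<eta> \<sigma>)" for \<eta> \<sigma>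
  have Ncont: "continuous_on UNIV (N \<eta>)" for \<eta>
    unfolding N_def
    by (rule continuous_on_compose2[OF bounded_lipschitz_continuous[OF Z]])
       (auto intro!: continuous_intros wcont)
  obtain I where I0: "\<And>\<eta>. I \<eta> 0 = 0" and I': "\<And>\<eta> s. (I \<eta> has_vector_derivative N \<eta> s) (at s)"
    using antiderivative_exists[OF Ncont] by metis
  have Icont: "continuous_on UNIV (I \<eta>)" for \<eta>
    using I' by (meson continuous_at_imp_continuous_on has_vector_derivative_continuous)
  define G where "G \<eta> s = I \<eta> s /\<^sub>R w s" for \<eta> s
  have Ibd: "norm (I \<eta> s) \<le> L * \<bar>s\<bar>" for \<eta> s
    using vector_derivative_linearization_bound[of 0 s "I \<eta>" "N \<eta>" 0 L, OF has_vector_derivative_at_within[OF I']] L(3)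
    by (simp add: N_def I0)
  \<comment> \<open>The displacement grows at most linearly and the weight faster, so the rescaled
    displacement stays bounded and lies in \<open>bcontfun\<close>.\<close>
  have Gbd: "norm (G \<eta> s) \<le> L" for \<eta> s
  proof -
    have "\<bar>s\<bar> \<le> 2 * L * \<bar>s\<bar>" using L(1) mult_right_mono[of 1 "2*L" "\<bar>s\<bar>"] by simp
    then have "\<bar>s\<bar> \<le> w s" using w1(1)[of s] by linarith
    then have "L * \<bar>s\<bar> \<le> L * w s" using L(1) by (intro mult_left_mono) auto
    then have "norm (I \<eta> s) \<le> L * w s" using Ibd[of \<eta> s] by linarith
    then show ?thesis using w1(2)[of s] by (simp add: G_def field_simps)
  qed
  have Gb: "G \<eta> \<in> bcontfun" for \<eta>
  proof -
    have "continuous_on UNIV (\<lambda>s. I \<eta> s /\<^sub>R w s)"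
      by (intro continuous_intros Icont wcont) (metis w1(2) less_irrefl)
    then show ?thesis
      using Gbd[of \<eta>] by (auto simp: bcontfun_def G_def[abs_def] intro!: boundedI[of _ L])
  qed
  define T where "T \<eta> = Bcontfun (G \<eta>)" for \<eta>
  have T: "apply_bcontfun (T \<eta>) = G \<eta>" for \<eta>
    unfolding T_def using Gb by (rule Bcontfun_inverse)
  have contr: "dist (T \<eta>1) (T \<eta>2) \<le> 1/2 * dist \<eta>1 \<eta>2" for \<eta>1 \<eta>2
  proof (rule dist_bound)
    fix s
    let ?D = "dist \<eta>1 \<eta>2"
    \<comment> \<open>The integrands differ by at most
      \<open>L * ?D * exp (2 * L * \<bar>s\<bar>)\<close>; the primitive of the exponential
      contributes \<open>1 / (2 * L)\<close>, which leaves the factor \<open>1/2\<close>.\<close>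
    have "norm ((I \<eta>1 s - I \<eta>2 s) - (I \<eta>1 0 - I \<eta>2 0)) \<le> (?D/2) * (exp (2 * L * \<bar>s\<bar>) - 1)"
    proof (rule exp_growth_bound[where f'="\<lambda>s. N \<eta>1 s - N \<eta>2 s"])
      fix s
      show "((\<lambda>s. I \<eta>1 s - I \<eta>2 s) has_vector_derivative N \<eta>1 s - N \<eta>2 s) (at s)"
        by (intro derivative_intros I')
      have "norm (N \<eta>1 s - N \<eta>2 s) \<le> L * norm ((x + w s *\<^sub>R \<eta>1 s) - (x + w s *\<^sub>R \<eta>2 s))"
        unfolding N_def by (rule L(2))
      also have "\<dots> = L * (w s * dist (\<eta>1 s) (\<eta>2 s))"
        using w1(2)[of s] by (simp add: dist_norm flip: scaleR_diff_right)
      also have "\<dots> \<le> L * (w s * ?D)"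
        using L(1) w1(2)[of s] by (intro mult_left_mono dist_bounded) auto
      finally show "norm (N \<eta>1 s - N \<eta>2 s) \<le> ?D/2 * (2 * L) * exp (2 * L * \<bar>s\<bar>)"
        by (simp add: w_def mult_ac)
    qed
    then have "norm (I \<eta>1 s - I \<eta>2 s) \<le> (?D/2) * (w s - 1)" by (simp add: I0 w_def)
    also have "\<dots> \<le> (?D/2) * w s" by (intro mult_left_mono) auto
    finally have "norm (I \<eta>1 s - I \<eta>2 s) \<le> (?D/2) * w s" .
    then show "dist (T \<eta>1 s) (T \<eta>2 s) \<le> 1/2 * ?D"
    proof -
      have "dist (T \<eta>1 s) (T \<eta>2 s) = norm (inverse (w s) *\<^sub>R (I \<eta>1 s - I \<eta>2 s))"
        by (simp only: T G_def dist_norm scaleR_diff_right)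
      also have "\<dots> = norm (I \<eta>1 s - I \<eta>2 s) / w s" using w1(2)[of s] by (simp add: divide_inverse mult.commute)
      finally show ?thesis
        using \<open>norm (I \<eta>1 s - I \<eta>2 s) \<le> (?D/2) * w s\<close> w1(2)[of s] by (simp add: pos_divide_le_eq)
    qed
  qed
  obtain \<eta> where \<eta>: "T \<eta> = \<eta>"
    using banach_fix_type[of "1/2" T] contr by auto
  define \<gamma> where "\<gamma> s = x + w s *\<^sub>R apply_bcontfun \<eta> s" for s
  have "w s *\<^sub>R apply_bcontfun \<eta> s = I \<eta> s" for s
    using w1(2)[of s] T[of \<eta>] by (simp add: \<eta> G_def)
  then have \<gamma>: "\<gamma> = (\<lambda>s. x + I \<eta> s)" by (auto simp: \<gamma>_def)
  have "(\<gamma> has_vector_derivative Z (\<gamma> s)) (at s)" for s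
  proof -
    have "N \<eta> s = Z (\<gamma> s)" by (simp add: N_def \<gamma>_def)
    then show ?thesis unfolding \<gamma> using I'[of \<eta> s] has_vector_derivative_add[OF has_vector_derivative_const[of x] I'[of \<eta> s]] by (simp add: \<gamma>)
  qed
  moreover have "\<gamma> 0 = x" by (simp add: \<gamma> I0)
  ultimately show ?thesis by blast
qed

text \<open>The derivative of \<open>(d s \<bullet> d s) * exp (- 2 * L * s)\<close> is nonpositive
  by Cauchy-Schwarz. The squared norm is used because the norm may fail to be differentiable where
  \<open>d\<close> vanishes; negative \<open>\<tau>\<close> is reduced to positive by
  reflection.\<close>

lemma gronwall:
  fixes d :: "real \<Rightarrow> 'a::real_inner"
  assumes d: "\<And>s. s \<in> closed_segment 0 \<tau> \<Longrightarrow> (d has_vector_derivative d' s) (at s within closed_segment 0 \<tau>)"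
    and B: "\<And>s. s \<in> closed_segment 0 \<tau> \<Longrightarrow> norm (d' s) \<le> L * norm (d s)"
  shows "norm (d \<tau>) \<le> exp (L * \<bar>\<tau>\<bar>) * norm (d 0)"
proof -
  have pos: "norm (g \<tau>) \<le> exp (L * \<tau>) * norm (g 0)"
    if d: "\<And>s. s \<in> {0..\<tau>} \<Longrightarrow> (g has_vector_derivative g' s) (at s within {0..\<tau>})"
      and B: "\<And>s. s \<in> {0..\<tau>} \<Longrightarrow> norm (g' s) \<le> L * norm (g s)" and "\<tau> > 0" for g g' :: "real \<Rightarrow> 'a" and \<tau>
  proof -
    let ?e = "\<lambda>s. (g s \<bullet> g s) * exp (- 2 * L * s)"
    have gc: "continuous_on {0..\<tau>} g"
      using d by (meson continuous_on_eq_continuous_within has_vector_derivative_continuous)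
    have "?e \<tau> \<le> ?e 0"
    proof (rule DERIV_nonpos_imp_decreasing_open[of 0 \<tau> ?e])
      fix s assume s: "0 < s" "s < \<tau>"
      then have "(g has_vector_derivative g' s) (at s)"
        using d[of s] by (simp add: at_within_Icc_at)
      then have "(?e has_real_derivative (2 * (g s \<bullet> g' s) - 2 * L * (g s \<bullet> g s)) * exp (- 2 * L * s)) (at s)"
        unfolding has_field_derivative_def has_vector_derivative_def
        by (auto intro!: derivative_eq_intros simp: algebra_simps inner_commute)
      moreover have "g s \<bullet> g' s \<le> norm (g s) * norm (g' s)" by (rule norm_cauchy_schwarz)
      moreover have "norm (g s) * norm (g' s) \<le> norm (g s) * (L * norm (g s))"
        using B[of s] s by (intro mult_left_mono) auto
      moreover have "norm (g s) * (L * norm (g s)) = L * (g s \<bullet> g s)"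
        by (simp add: dot_square_norm power2_eq_square)
      ultimately show "\<exists>y. (?e has_real_derivative y) (at s) \<and> y \<le> 0"
        by (intro exI[of _ "(2 * (g s \<bullet> g' s) - 2 * L * (g s \<bullet> g s)) * exp (- 2 * L * s)"])
           (auto simp: mult_nonpos_nonneg)
    qed (use \<open>\<tau> > 0\<close> in \<open>auto intro!: continuous_intros gc\<close>)
    then have "(g \<tau> \<bullet> g \<tau>) \<le> (g 0 \<bullet> g 0) * exp (2 * L * \<tau>)"
      by (simp add: exp_minus field_simps)
    then have "(norm (g \<tau>))\<^sup>2 \<le> (exp (L * \<tau>) * norm (g 0))\<^sup>2"
      by (simp add: dot_square_norm power_mult_distrib mult_ac flip: exp_double)
    then show ?thesis by (rule power2_le_imp_le) auto
  qed
  consider "\<tau> = 0" | "\<tau> > 0" | "\<tau> < 0" by linarith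
  then show ?thesis
  proof cases
    case 2
    then show ?thesis using pos[of \<tau> d d'] d B by (simp add: closed_segment_eq_real_ivl)
  next
    case 3
    have d': "((\<lambda>s. d (- s)) has_vector_derivative - d' (- s)) (at s within {0..-\<tau>})" if "s \<in> {0..-\<tau>}" for s
    proof -
      have im: "uminus ` {0..-\<tau>} = closed_segment 0 \<tau>"
        using 3 by (simp add: closed_segment_eq_real_ivl)
      have "((d \<circ> uminus) has_vector_derivative (- 1) *\<^sub>R d' (- s)) (at s within {0..-\<tau>})"
      proof (rule vector_diff_chain_within)
        show "(uminus has_vector_derivative - 1) (at s within {0..- \<tau>})"
          by (auto intro!: derivative_eq_intros)
        show "(d has_vector_derivative d' (- s)) (at (- s) within uminus ` {0..- \<tau>})"
          unfolding im using that 3 by (intro d) (auto simp: closed_segment_eq_real_ivl)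
      qed
      then show ?thesis by (simp add: o_def)
    qed
    have "norm (d (- (- \<tau>))) \<le> exp (L * (- \<tau>)) * norm (d (- 0))"
      by (rule pos[OF d']) (use B 3 in \<open>auto simp: closed_segment_eq_real_ivl\<close>)
    then show ?thesis using 3 by simp
  qed auto
qed

text \<open>A globally chosen integral curve, total in all arguments and meaningful for bounded
  Lipschitz fields. The domain-dependent \<open>flow\<close> is compared with it only at the end,
  after the fields have been extended.\<close>

definition gflow :: "('a::euclidean_space \<Rightarrow> 'a) \<Rightarrow> real \<Rightarrow> 'a \<Rightarrow> 'a" where
  "gflow Z s x = (SOME \<gamma>. \<gamma> 0 = x \<and> (\<forall>s. (\<gamma> has_vector_derivative Z (\<gamma> s)) (at s))) s"

lemma gflow:
  fixes Z :: "'a::euclidean_space \<Rightarrow> 'a"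
  assumes Z: "bounded_lipschitz L Z"
  shows gflow_0: "gflow Z 0 x = x"
    and gflow_has_vector_derivative: "((\<lambda>s. gflow Z s x) has_vector_derivative Z (gflow Z s x)) (at s within S)"
  using someI_ex[OF global_integral_curve_exists[OF Z, of x]]
  by (auto simp: gflow_def[abs_def] has_vector_derivative_at_within)

lemma gflow_unique:
  assumes Z: "bounded_lipschitz L Z" and "\<gamma> 0 = x"
    and d: "\<And>s. s \<in> closed_segment 0 \<tau> \<Longrightarrow> (\<gamma> has_vector_derivative Z (\<gamma> s)) (at s within closed_segment 0 \<tau>)"
  shows "\<gamma> \<tau> = gflow Z \<tau> x"
proof -
  have "norm (\<gamma> \<tau> - gflow Z \<tau> x) \<le> exp (L * \<bar>\<tau>\<bar>) * norm (\<gamma> 0 - gflow Z 0 x)"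
    by (rule gronwall[where \<tau>=\<tau> and d="\<lambda>s. \<gamma> s - gflow Z s x" and d'="\<lambda>s. Z (\<gamma> s) - Z (gflow Z s x)"])
       (intro derivative_intros d gflow_has_vector_derivative[OF Z] bounded_lipschitzD(2)[OF Z]; assumption)+
  then show ?thesis using assms(2) by (simp add: gflow_0[OF Z])
qed

lemma gflow_add:
  assumes Z: "bounded_lipschitz L Z"
  shows "gflow Z (s + t) x = gflow Z s (gflow Z t x)"
proof -
  have "((\<lambda>\<sigma>. gflow Z (\<sigma> + t) x) has_vector_derivative Z (gflow Z (\<sigma> + t) x)) (at \<sigma> within S)" for \<sigma> S
  proof -
    have "(((\<lambda>s. gflow Z s x) \<circ> (\<lambda>\<sigma>. \<sigma> + t)) has_vector_derivative 1 *\<^sub>R Z (gflow Z (\<sigma> + t) x)) (at \<sigma>)"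
      by (rule vector_diff_chain_at) (auto intro!: derivative_eq_intros gflow_has_vector_derivative[OF Z])
    then show ?thesis by (simp add: o_def has_vector_derivative_at_within)
  qed
  then show ?thesis
    by (intro gflow_unique[OF Z, where \<gamma> = "\<lambda>\<sigma>. gflow Z (\<sigma> + t) x"]) auto
qed

lemma gflow_inverse:
  assumes Z: "bounded_lipschitz L Z"
  shows "gflow Z (- s) (gflow Z s x) = x" "gflow Z s (gflow Z (- s) x) = x"
  using gflow_add[OF Z, of "-s" s x] gflow_add[OF Z, of s "-s" x] gflow_0[OF Z] by auto

lemma gflow_dist_time:
  assumes Z: "bounded_lipschitz L Z"
  shows "norm (gflow Z s x - gflow Z t x) \<le> L * \<bar>s - t\<bar>"
proof -
  have "norm (gflow Z s x - gflow Z t x - (s - t) *\<^sub>R 0) \<le> L * \<bar>s - t\<bar>"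
    by (rule vector_derivative_linearization_bound[where a=t and b=s and \<gamma>="\<lambda>s. gflow Z s x" and \<gamma>'="\<lambda>s. Z (gflow Z s x)"])
       (use gflow_has_vector_derivative[OF Z] bounded_lipschitzD(3)[OF Z] in simp_all)
  then show ?thesis by simp
qed

lemma gflow_dist:
  assumes Z: "bounded_lipschitz L Z"
  shows "norm (gflow Z s x - x) \<le> L * \<bar>s\<bar>"
  using gflow_dist_time[OF Z, of s x 0] by (simp add: gflow_0[OF Z])

lemma gflow_lipschitz_exp:
  assumes Z: "bounded_lipschitz L Z"
  shows "norm (gflow Z s x - gflow Z s y) \<le> exp (L * \<bar>s\<bar>) * norm (x - y)"
proof -
  have "norm (gflow Z s x - gflow Z s y) \<le> exp (L * \<bar>s\<bar>) * norm (gflow Z 0 x - gflow Z 0 y)"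
    by (rule gronwall[where \<tau>="s" and d="\<lambda>s. gflow Z s x - gflow Z s y" and d'="\<lambda>s. Z (gflow Z s x) - Z (gflow Z s y)"])
       (intro derivative_intros gflow_has_vector_derivative[OF Z] bounded_lipschitzD(2)[OF Z])+
  then show ?thesis by (simp add: gflow_0[OF Z])
qed

lemma gflow_lipschitz:
  assumes Z: "bounded_lipschitz L Z" and s: "L * \<bar>s\<bar> \<le> 1"
  shows "norm (gflow Z s x - gflow Z s y) \<le> 3 * norm (x - y)"
proof -
  have "exp (L * \<bar>s\<bar>) \<le> exp 1" using s by simp
  also have "\<dots> \<le> 3" by (rule exp_le)
  finally show ?thesis
    using gflow_lipschitz_exp[OF Z, of s x y] mult_right_mono[of "exp (L * \<bar>s\<bar>)" 3 "norm (x - y)", OF _ norm_ge_zero] by linarith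
qed

text \<open>The difference of two orbits has speed at most \<open>L\<close> times their distance,
  hence the flow minus the identity is Lipschitz with a constant of order
  \<open>\<bar>s\<bar>\<close>. This extra factor is what makes commutators of flows quadratically
  small.\<close>

lemma gflow_near_identity:
  assumes Z: "bounded_lipschitz L Z" and s: "L * \<bar>s\<bar> \<le> 1"
  shows "norm (gflow Z s x - gflow Z s y - (x - y)) \<le> 3 * L * \<bar>s\<bar> * norm (x - y)"
proof -
  note L = bounded_lipschitzD[OF Z]
  have "norm ((gflow Z s x - gflow Z s y) - (gflow Z 0 x - gflow Z 0 y) - (s - 0) *\<^sub>R 0) \<le> 3 * L * norm (x - y) * \<bar>s - 0\<bar>"
  proof (rule vector_derivative_linearization_bound[where a=0 and b=s and \<gamma>="\<lambda>s. gflow Z s x - gflow Z s y" and \<gamma>'="\<lambda>s. Z (gflow Z s x) - Z (gflow Z s y)"])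
    fix \<sigma> assume \<sigma>: "\<sigma> \<in> closed_segment 0 s"
    show "((\<lambda>s. gflow Z s x - gflow Z s y) has_vector_derivative Z (gflow Z \<sigma> x) - Z (gflow Z \<sigma> y)) (at \<sigma> within closed_segment 0 s)"
      by (intro derivative_intros gflow_has_vector_derivative[OF Z])
    have "\<bar>\<sigma>\<bar> \<le> \<bar>s\<bar>" using \<sigma> by (auto simp: closed_segment_eq_real_ivl split: if_splits)
    then have "L * \<bar>\<sigma>\<bar> \<le> 1" using s L(1) mult_left_mono[of "\<bar>\<sigma>\<bar>" "\<bar>s\<bar>" L] by linarith
    then have "L * norm (gflow Z \<sigma> x - gflow Z \<sigma> y) \<le> L * (3 * norm (x - y))"
      using L(1) by (intro mult_left_mono gflow_lipschitz[OF Z]) auto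
    then show "norm (Z (gflow Z \<sigma> x) - Z (gflow Z \<sigma> y) - 0) \<le> 3 * L * norm (x - y)"
      using L(2)[of "gflow Z \<sigma> x" "gflow Z \<sigma> y"] by simp
  qed
  then show ?thesis by (simp add: gflow_0[OF Z] mult_ac)
qed

text \<open>One Euler step: the velocity along the orbit differs from \<open>Z x\<close> by at most
  \<open>L * (L * \<bar>s\<bar>)\<close>.\<close>

lemma gflow_euler:
  assumes Z: "bounded_lipschitz L Z"
  shows "norm (gflow Z s x - x - s *\<^sub>R Z x) \<le> L\<^sup>2 * s\<^sup>2"
proof -
  note L = bounded_lipschitzD[OF Z]
  have "norm (gflow Z s x - gflow Z 0 x - (s - 0) *\<^sub>R Z x) \<le> L * (L * \<bar>s\<bar>) * \<bar>s - 0\<bar>"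
  proof (rule vector_derivative_linearization_bound[where a=0 and b=s and \<gamma>="\<lambda>s. gflow Z s x" and \<gamma>'="\<lambda>s. Z (gflow Z s x)"])
    fix \<sigma> assume \<sigma>: "\<sigma> \<in> closed_segment 0 s"
    show "((\<lambda>s. gflow Z s x) has_vector_derivative Z (gflow Z \<sigma> x)) (at \<sigma> within closed_segment 0 s)"
      by (intro gflow_has_vector_derivative[OF Z])
    have "\<bar>\<sigma>\<bar> \<le> \<bar>s\<bar>" using \<sigma> by (auto simp: closed_segment_eq_real_ivl split: if_splits)
    then have "norm (gflow Z \<sigma> x - x) \<le> L * \<bar>s\<bar>"
      using gflow_dist[OF Z, of \<sigma> x] L(1) mult_left_mono[of "\<bar>\<sigma>\<bar>" "\<bar>s\<bar>" L] by linarith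
    then have "L * norm (gflow Z \<sigma> x - x) \<le> L * (L * \<bar>s\<bar>)" using L(1) by (intro mult_left_mono) auto
    then show "norm (Z (gflow Z \<sigma> x) - Z x) \<le> L * (L * \<bar>s\<bar>)"
      using L(2)[of "gflow Z \<sigma> x" x] by linarith
  qed
  moreover have "L * (L * \<bar>s\<bar>) * \<bar>s - 0\<bar> = L\<^sup>2 * s\<^sup>2"
    by (simp add: power2_eq_square mult.assoc)
  ultimately show ?thesis by (simp add: gflow_0[OF Z])
qed

text \<open>Joint continuity provides the joint measurability needed when a time integral and a
  space integral are exchanged.\<close>

lemma gflow_continuous:
  assumes Z: "bounded_lipschitz L Z"
  shows "continuous_on UNIV (\<lambda>(s, x). gflow Z s x)"
proof -
  have "((\<lambda>(s, x). gflow Z s x) \<longlongrightarrow> gflow Z s x) (at (s, x))" for s x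
  proof (rule Lim_transform_bound[where g = "\<lambda>(s', x'). L * \<bar>s' - s\<bar> + exp (L * \<bar>s\<bar>) * norm (x' - x)", THEN LIM_zero_cancel])
    have "norm (gflow Z s' x' - gflow Z s x) \<le> L * \<bar>s' - s\<bar> + exp (L * \<bar>s\<bar>) * norm (x' - x)" for s' x'
      using gflow_dist_time[OF Z, of s' x' s] gflow_lipschitz_exp[OF Z, of s x' x]
        norm_triangle_ineq[of "gflow Z s' x' - gflow Z s x'" "gflow Z s x' - gflow Z s x"] by simp
    then show "\<forall>\<^sub>F z in at (s, x). norm ((case z of (s, x) \<Rightarrow> gflow Z s x) - gflow Z s x)
        \<le> norm (case z of (s', x') \<Rightarrow> L * \<bar>s' - s\<bar> + exp (L * \<bar>s\<bar>) * norm (x' - x))"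
      by (intro always_eventually) (auto simp: order_trans[OF _ abs_ge_self])
    have "((\<lambda>z. L * \<bar>fst z - s\<bar> + exp (L * \<bar>s\<bar>) * norm (snd z - x)) \<longlongrightarrow> L * \<bar>s - s\<bar> + exp (L * \<bar>s\<bar>) * norm (x - x)) (at (s, x))"
      by (intro tendsto_intros) (auto intro!: tendsto_eq_intros)
    then show "((\<lambda>(s', x'). L * \<bar>s' - s\<bar> + exp (L * \<bar>s\<bar>) * norm (x' - x)) \<longlongrightarrow> 0) (at (s, x))"
      by (simp add: case_prod_unfold)
  qed
  then show ?thesis
    by (auto simp: continuous_on_def intro: tendsto_within_subset)
qed

section \<open>Lipschitz images and integral inequalities\<close>

text \<open>Cover \<open>A\<close> by countably many cubes with disjoint interiors inside an open
  set of almost the same measure. The part of \<open>A\<close> in a cube of side \<open>h\<close> is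
  sent into a cube of side \<open>2 * L * n * h\<close>, \<open>n\<close> the dimension, which gives
  the constant. A Borel cover stands in for the image itself, which need not be Borel.\<close>

lemma lipschitz_image_cover_bounded:
  fixes F :: "'a::euclidean_space \<Rightarrow> 'a"
  assumes A: "A \<in> sets borel" "bounded A" and L: "L > 0" and "e > 0"
    and lip: "\<And>x y. x \<in> A \<Longrightarrow> y \<in> A \<Longrightarrow> norm (F x - F y) \<le> L * norm (x - y)"
  shows "\<exists>B\<in>sets borel. F ` A \<subseteq> B \<and>
    emeasure lborel B \<le> ennreal ((2 * L * DIM('a)) ^ DIM('a)) * (emeasure lborel A + ennreal e)"
proof -
  let ?n = "DIM('a)" and ?c = "ennreal ((2 * L * DIM('a)) ^ DIM('a))"
  obtain m where m: "m > 0" "A \<subseteq> cbox (- (m *\<^sub>R One)) (m *\<^sub>R One)"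
  proof -
    obtain a where "A \<subseteq> cbox (-a) a" using bounded_subset_cbox_symmetric[OF A(2)] by blast
    define m where "m = norm a + 1"
    have "m > 0" by (simp add: m_def add_nonneg_pos)
    moreover have "x \<in> cbox (- (m *\<^sub>R One)) (m *\<^sub>R One)" if "x \<in> A" for x
    proof -
      have "\<bar>a \<bullet> i\<bar> \<le> m" if "i \<in> Basis" for i using Basis_le_norm[OF that, of a] by (simp add: m_def)
      then show ?thesis using that \<open>A \<subseteq> cbox (-a) a\<close> by (fastforce simp: mem_box)
    qed
    ultimately show ?thesis using that by blast
  qed
  obtain U where U: "open U" "A \<subseteq> U" "emeasure lborel (U - A) < ennreal e"
    using outer_regular_lborel[OF A(1) \<open>e > 0\<close>] .
  have UA: "emeasure lborel U \<le> emeasure lborel A + ennreal e"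
  proof -
    have "emeasure lborel U = emeasure lborel (A \<union> (U - A))" using U by (simp add: Un_absorb1 Un_Diff_cancel)
    also have "\<dots> \<le> emeasure lborel A + emeasure lborel (U - A)"
      using A U by (intro emeasure_subadditive) auto
    finally show ?thesis using U(3) by (meson add_left_mono less_imp_le order_trans)
  qed
  \<comment> \<open>With this gauge every cube of the cover, having a tag in \<open>A\<close>, lies
    inside \<open>U\<close>.\<close>
  have gauge: "gauge (\<lambda>x. if x \<in> U then U else UNIV)" using U(1) by (auto simp: gauge_def)
  have bne: "box (- (m *\<^sub>R One)) (m *\<^sub>R One :: 'a) \<noteq> {}" using m(1) by (auto simp: box_ne_empty)
  obtain \<D> where \<D>: "countable \<D>"
     "\<And>K. K \<in> \<D> \<Longrightarrow> interior K \<noteq> {} \<and> (\<exists>c d. K = cbox c d)"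
     "pairwise (\<lambda>A B. interior A \<inter> interior B = {}) \<D>"
     "\<And>K. K \<in> \<D> \<Longrightarrow> \<exists>x \<in> A \<inter> K. K \<subseteq> (if x \<in> U then U else UNIV)"
     "\<And>u v. cbox u v \<in> \<D> \<Longrightarrow> \<exists>n. \<forall>i \<in> Basis. v \<bullet> i - u \<bullet> i = ((m *\<^sub>R One) \<bullet> i - (- (m *\<^sub>R One)) \<bullet> i) / 2^n"
     "A \<subseteq> \<Union>\<D>"
    using covering_lemma[OF m(2) bne gauge] by metis
  have KU: "K \<subseteq> U" if "K \<in> \<D>" for K using \<D>(4)[OF that] U(2) by (auto split: if_splits)
  have cover: "\<exists>B\<in>sets borel. F ` (A \<inter> K) \<subseteq> B \<and> emeasure lborel B \<le> ?c * emeasure lborel (interior K)"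
    if K: "K \<in> \<D>" for K
  proof -
    obtain u v where uv: "K = cbox u v" "box u v \<noteq> {}" using \<D>(2)[OF K] by (metis interior_cbox)
    obtain n where n: "\<forall>i\<in>Basis. v \<bullet> i - u \<bullet> i = ((m *\<^sub>R One) \<bullet> i - (- (m *\<^sub>R One)) \<bullet> i) / 2^n"
      using \<D>(5)[of u v] K uv(1) by blast
    define h where "h = 2 * m / 2^n"
    have h: "v \<bullet> i - u \<bullet> i = h" if "i \<in> Basis" for i
      using n that by (simp add: h_def)
    have "h > 0" using h uv(2) by (metis box_ne_empty(2) diff_gt_0_iff_gt nonempty_Basis some_in_eq)
    obtain x0 where x0: "x0 \<in> A" "x0 \<in> K" using \<D>(4)[OF K] by blast
    \<comment> \<open>\<open>?n * h\<close> bounds the Euclidean diameter of the cube through the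
      sum of the coordinates.\<close>
    define r where "r = L * (?n * h)"
    have r: "r > 0" using L \<open>h > 0\<close> by (auto simp: r_def)
    let ?B = "cbox (F x0 - r *\<^sub>R One) (F x0 + r *\<^sub>R One)"
    have "F x \<in> ?B" if x: "x \<in> A" "x \<in> K" for x
    proof -
      have "norm (x - x0) \<le> (\<Sum>i\<in>Basis. \<bar>(x - x0) \<bullet> i\<bar>)" by (rule norm_le_l1)
      also have "\<dots> \<le> (\<Sum>i\<in>(Basis::'a set). h)"
      proof (rule sum_mono)
        fix i :: 'a assume i: "i \<in> Basis"
        then show "\<bar>(x - x0) \<bullet> i\<bar> \<le> h" using h[OF i] x x0 uv(1)
          by (auto simp: mem_box inner_diff_left abs_le_iff) (smt (verit, best))+
      qed
      finally have nb: "norm (x - x0) \<le> ?n * h" by simp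
      have "norm (F x - F x0) \<le> r"
        using order_trans[OF lip[OF x(1) x0(1)] mult_left_mono[OF nb less_imp_le[OF L]]] by (simp add: r_def)
      then have "\<bar>(F x - F x0) \<bullet> i\<bar> \<le> r" if "i \<in> Basis" for i
        using Basis_le_norm[OF that, of "F x - F x0"] by linarith
      then show ?thesis by (fastforce simp: mem_box inner_diff_left inner_add_left abs_le_iff)
    qed
    moreover have "emeasure lborel ?B \<le> ?c * emeasure lborel (interior K)"
    proof -
      have e1: "emeasure lborel ?B = ennreal ((2 * r) ^ ?n)"
        using r by (subst emeasure_lborel_cbox) (auto simp: inner_diff_left inner_add_left algebra_simps)
      have "emeasure lborel (interior K) = ennreal (\<Prod>b\<in>Basis. (v - u) \<bullet> b)"
        unfolding uv(1) interior_cbox by (rule emeasure_lborel_box) (use uv(2) in \<open>auto simp: box_ne_empty less_imp_le\<close>)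
      also have "(\<Prod>b\<in>Basis. (v - u) \<bullet> b) = h ^ ?n" by (simp add: inner_diff_left h)
      finally have e2: "emeasure lborel (interior K) = ennreal (h ^ ?n)" .
      show ?thesis
        unfolding e1 e2 using L \<open>h > 0\<close>
        by (auto simp: r_def ennreal_mult[symmetric] power_mult_distrib mult_ac)
    qed
    ultimately show ?thesis by (intro bexI[of _ ?B]) auto
  qed
  then obtain Bx where Bx: "\<And>K. K \<in> \<D> \<Longrightarrow> Bx K \<in> sets borel" "\<And>K. K \<in> \<D> \<Longrightarrow> F ` (A \<inter> K) \<subseteq> Bx K"
      "\<And>K. K \<in> \<D> \<Longrightarrow> emeasure lborel (Bx K) \<le> ?c * emeasure lborel (interior K)" by metis
  \<comment> \<open>The family of cubes may be finite; indices outside its enumeration get the empty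
    set, so that one sequence covers both cases.\<close>
  define I where "I = to_nat_on \<D> ` \<D>"
  define \<kappa> where "\<kappa> = from_nat_into \<D>"
  have \<kappa>: "\<kappa> i \<in> \<D>" "to_nat_on \<D> (\<kappa> i) = i" if "i \<in> I" for i
    using that \<D>(1) by (auto simp: I_def \<kappa>_def)
  have surj: "\<exists>i\<in>I. \<kappa> i = K" if "K \<in> \<D>" for K
    using that \<D>(1) by (auto simp: I_def \<kappa>_def intro!: bexI[of _ K])
  define P where "P i = (if i \<in> I then Bx (\<kappa> i) else {})" for i
  define Q where "Q i = (if i \<in> I then interior (\<kappa> i) else {})" for i
  have PQ: "emeasure lborel (P i) \<le> ?c * emeasure lborel (Q i)" for i
    using Bx(3) \<kappa>(1) by (auto simp: P_def Q_def)
  have Pm: "range P \<subseteq> sets lborel" using Bx(1) \<kappa>(1) by (auto simp: P_def)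
  have Qm: "range Q \<subseteq> sets lborel" by (auto simp: Q_def)
  have Qd: "disjoint_family Q"
    using \<D>(3) \<kappa> unfolding disjoint_family_on_def Q_def pairwise_def by (auto split: if_splits) (metis IntI empty_iff)
  have "F ` A \<subseteq> (\<Union>i. P i)"
  proof
    fix z assume "z \<in> F ` A"
    then obtain x where x: "x \<in> A" "z = F x" by auto
    then obtain K where K: "K \<in> \<D>" "x \<in> K" using \<D>(6) by blast
    then obtain i where "i \<in> I" "\<kappa> i = K" using surj by blast
    then have "z \<in> P i" using Bx(2)[OF K(1)] x K by (auto simp: P_def)
    then show "z \<in> (\<Union>i. P i)" by blast
  qed
  moreover have "emeasure lborel (\<Union>i. P i) \<le> ?c * (emeasure lborel A + ennreal e)"
  proof -
    have "emeasure lborel (\<Union>i. P i) \<le> (\<Sum>i. emeasure lborel (P i))"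
      by (rule emeasure_subadditive_countably[OF Pm])
    also have "\<dots> \<le> (\<Sum>i. ?c * emeasure lborel (Q i))" by (intro suminf_le PQ) auto
    also have "\<dots> = ?c * emeasure lborel (\<Union>i. Q i)"
      by (simp add: ennreal_suminf_cmult suminf_emeasure[OF Qm Qd])
    also have "\<dots> \<le> ?c * emeasure lborel U"
      using KU \<kappa>(1) U(1) by (intro mult_left_mono emeasure_mono) (auto simp: Q_def split: if_splits intro: interior_subset[THEN subsetD])
    also have "\<dots> \<le> ?c * (emeasure lborel A + ennreal e)" by (intro mult_left_mono UA) auto
    finally show ?thesis .
  qed
  ultimately show ?thesis using Pm by (intro bexI[of _ "\<Union>i. P i"]) auto
qed

text \<open>\<open>A\<close> is cut into spherical shells of width 1 to reduce to bounded sets; the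
  \<open>n\<close>-th shell gets the error \<open>e / ?c * (1/2) ^ Suc n\<close>, so that the
  errors, multiplied by \<open>?c\<close>, add up to \<open>e\<close>.\<close>

lemma lipschitz_image_emeasure_le:
  fixes F :: "'a::euclidean_space \<Rightarrow> 'a"
  assumes A: "A \<in> sets borel" and L: "L > 0" and E: "E \<in> sets borel" "E \<subseteq> F ` A"
    and lip: "\<And>x y. x \<in> A \<Longrightarrow> y \<in> A \<Longrightarrow> norm (F x - F y) \<le> L * norm (x - y)"
  shows "emeasure lborel E \<le> ennreal ((2 * L * DIM('a)) ^ DIM('a)) * emeasure lborel A"
proof (rule ennreal_le_epsilon)
  fix e :: real assume "e > 0"
  let ?c = "(2 * L * DIM('a)) ^ DIM('a)"
  have c: "?c > 0" using L by simp
  define S where "S n = A \<inter> (ball 0 (real (Suc n)) - ball 0 (real n))" for n :: nat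
  have Sm: "S n \<in> sets borel" "bounded (S n)" "S n \<subseteq> A" for n
    using A by (auto simp: S_def intro: bounded_subset[OF bounded_ball])
  have Sd: "disjoint_family S"
    unfolding disjoint_family_on_def S_def
  proof (intro ballI impI, rule ccontr)
    fix m n :: nat assume mn: "m \<noteq> n"
      "A \<inter> (ball 0 (real (Suc m)) - ball 0 (real m)) \<inter> (A \<inter> (ball 0 (real (Suc n)) - ball 0 (real n))) \<noteq> {}"
    then obtain x where "norm x < Suc m" "\<not> norm x < m" "norm x < Suc n" "\<not> norm x < n" by auto
    then have "real m < real (Suc n)" "real n < real (Suc m)" by linarith+
    then show False using mn(1) by linarith
  qed
  have SA: "(\<Union>n. S n) = A"
  proof -
    have "\<exists>n. x \<in> S n" if "x \<in> A" for x
    proof (intro exI)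
      show "x \<in> S (nat \<lfloor>norm x\<rfloor>)" using that by (auto simp: S_def) linarith+
    qed
    then show ?thesis using Sm(3) by blast
  qed
  have "\<exists>B\<in>sets borel. F ` S n \<subseteq> B \<and> emeasure lborel B \<le> ennreal ?c * (emeasure lborel (S n) + ennreal (e / ?c * (1/2) ^ Suc n))" for n
    using c \<open>e > 0\<close> Sm(3) lip by (intro lipschitz_image_cover_bounded Sm L) (auto, blast)
  then obtain B where B: "\<And>n. B n \<in> sets borel" "\<And>n. F ` S n \<subseteq> B n"
     "\<And>n. emeasure lborel (B n) \<le> ennreal ?c * (emeasure lborel (S n) + ennreal (e / ?c * (1/2) ^ Suc n))"
    by metis
  have "emeasure lborel E \<le> emeasure lborel (\<Union>n. B n)"
    using E B SA by (intro emeasure_mono) (auto, blast)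
  also have "\<dots> \<le> (\<Sum>n. emeasure lborel (B n))" using B(1) by (intro emeasure_subadditive_countably) auto
  also have "\<dots> \<le> (\<Sum>n. ennreal ?c * (emeasure lborel (S n) + ennreal (e / ?c * (1/2) ^ Suc n)))"
    by (intro suminf_le B) auto
  also have "\<dots> = ennreal ?c * ((\<Sum>n. emeasure lborel (S n)) + (\<Sum>n. ennreal (e / ?c * (1/2) ^ Suc n)))"
    by (simp add: ennreal_suminf_cmult suminf_add[symmetric])
  also have "(\<Sum>n. emeasure lborel (S n)) = emeasure lborel A"
    using suminf_emeasure[of S lborel] Sm(1) Sd SA by auto
  also have "(\<Sum>n. ennreal (e / ?c * (1/2) ^ Suc n)) = ennreal (e / ?c)"
  proof -
    have "(\<lambda>n. e / ?c * (1/2) ^ Suc n) sums (e / ?c * 1)"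
      by (intro sums_mult power_half_series)
    then show ?thesis using c \<open>e > 0\<close> by (subst suminf_ennreal_eq[where x="e / ?c"]) auto
  qed
  also have "ennreal ?c * (emeasure lborel A + ennreal (e / ?c)) = ennreal ?c * emeasure lborel A + ennreal e"
    using c \<open>e > 0\<close> L by (simp add: distrib_left ennreal_mult[symmetric])
  finally show "emeasure lborel E \<le> ennreal ?c * emeasure lborel A + ennreal e" .
qed

text \<open>A one-sided substitution rule: Lebesgue measure on \<open>D\<close> is at most a
  constant times the image under \<open>F\<close> of Lebesgue measure on \<open>S\<close>, by the
  preceding measure estimate, and this inequality of measures is integrated. A parametrization with
  Lipschitz constant \<open>t\<^sup>2\<close> thus contributes \<open>t ^ (2 * n)\<close> up to a
  constant, \<open>n\<close> the dimension.\<close>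

lemma nn_integral_lipschitz_pushforward:
  fixes F :: "'a::euclidean_space \<Rightarrow> 'a" and f :: "'a \<Rightarrow> ennreal"
  assumes S: "S \<in> sets borel" and L: "L > 0" and D: "D \<in> sets borel" "D \<subseteq> F ` S"
    and lip: "\<And>x y. x \<in> S \<Longrightarrow> y \<in> S \<Longrightarrow> norm (F x - F y) \<le> L * norm (x - y)"
    and F: "F \<in> borel_measurable borel" and f: "f \<in> borel_measurable borel"
  shows "(\<integral>\<^sup>+z\<in>D. f z \<partial>lborel) \<le> ennreal ((2 * L * DIM('a)) ^ DIM('a)) * (\<integral>\<^sup>+x\<in>S. f (F x) \<partial>lborel)"
proof -
  let ?c = "ennreal ((2 * L * DIM('a)) ^ DIM('a))"
  let ?M = "density lborel (indicator D)" and ?N = "distr (density lborel (indicator S)) borel F"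
  have "?M \<le> scale_measure ?c ?N"
    unfolding le_measure_iff
  proof (simp add: space_scale_measure, rule le_funI)
    fix E :: "'a set"
    show "emeasure ?M E \<le> emeasure (scale_measure ?c ?N) E"
    proof (cases "E \<in> sets borel")
      case True
      have A: "F -` E \<inter> S \<in> sets borel" using F S True by (metis measurable_sets_borel sets.Int)
      have "emeasure ?M E = emeasure lborel (E \<inter> D)"
        using True D by (simp add: emeasure_restricted Int_commute)
      also have "\<dots> \<le> ?c * emeasure lborel (F -` E \<inter> S)"
        using D True A lip L by (intro lipschitz_image_emeasure_le[where F=F]) auto
      also have "emeasure lborel (F -` E \<inter> S) = emeasure ?N E"
        using True S F A measurable_sets_borel[OF F True]
        by (subst emeasure_distr) (simp_all add: emeasure_restricted Int_commute)
      finally show ?thesis by simp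
    qed (simp add: emeasure_notin_sets)
  qed
  then have "nn_integral ?M f \<le> nn_integral (scale_measure ?c ?N) f"
    by (rule nn_integral_mono_measure[rotated]) simp
  also have "\<dots> = ?c * nn_integral ?N f" using f by (intro nn_integral_scale_measure) simp
  also have "nn_integral ?N f = (\<integral>\<^sup>+x. f (F x) \<partial>density lborel (indicator S))"
    using F f by (intro nn_integral_distr) auto
  also have "\<dots> = (\<integral>\<^sup>+x\<in>S. f (F x) \<partial>lborel)"
    using F f S by (subst nn_integral_density) (auto simp: mult.commute)
  also have "nn_integral ?M f = (\<integral>\<^sup>+z\<in>D. f z \<partial>lborel)"
    using f D by (subst nn_integral_density) (auto simp: mult.commute)
  finally show ?thesis .
qed

section \<open>Young and Hoelder inequalities for \<open>p\<close>-th powers\<close>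

lemma abs_add_powr_le:
  fixes a b p :: real
  assumes "0 \<le> p"
  shows "\<bar>a + b\<bar> powr p \<le> 2 powr p * (\<bar>a\<bar> powr p + \<bar>b\<bar> powr p)"
proof -
  have "\<bar>a + b\<bar> powr p \<le> (2 * max \<bar>a\<bar> \<bar>b\<bar>) powr p"
    using assms by (intro powr_mono2) auto
  also have "\<dots> = 2 powr p * (max \<bar>a\<bar> \<bar>b\<bar>) powr p" by (simp add: powr_mult)
  also have "\<dots> \<le> 2 powr p * (\<bar>a\<bar> powr p + \<bar>b\<bar> powr p)"
    by (intro mult_left_mono) (auto simp: max_def)
  finally show ?thesis .
qed

text \<open>The convex function \<open>x powr p\<close> lies above its tangent at \<open>c\<close>;
  the conjugate exponent is \<open>p / (p - 1)\<close>.\<close>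

lemma young_powr:
  fixes c x p :: real
  assumes p: "p > 1" and "c \<ge> 0" "x \<ge> 0"
  shows "p * c powr (p - 1) * x \<le> x powr p + (p - 1) * c powr p"
proof -
  define q where "q = p / (p - 1)"
  have q: "q > 1" "1/p + 1/q = 1" "(p - 1) * q = p" using p by (auto simp: q_def field_simps)
  have "x * c powr (p - 1) \<le> x powr p / p + (c powr (p - 1)) powr q / q"
    using assms q by (intro Youngs_inequality) auto
  then have "p * (x * c powr (p - 1)) \<le> p * (x powr p / p + (c powr (p - 1)) powr q / q)"
    using p by (intro mult_left_mono) auto
  moreover have "p * ((c powr (p - 1)) powr q / q) = (p - 1) * c powr p"
    using p q by (simp add: powr_powr) (simp add: q_def)
  ultimately show ?thesis using p by (simp add: algebra_simps)
qed

text \<open>Integrating Young's inequality at the level \<open>c = d / m\<close>, which is the weighted mean when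
  equality holds in the hypothesis.\<close>
lemma holder_weighted:
  fixes f w :: "'a \<Rightarrow> real" and p d m :: real
  assumes p: "p > 1" and "m > 0" "d \<ge> 0"
    and [measurable]: "f \<in> borel_measurable M" "w \<in> borel_measurable M"
    and nonneg: "\<And>x. 0 \<le> f x" "\<And>x. 0 \<le> w x"
    and d: "ennreal d \<le> (\<integral>\<^sup>+x. ennreal (f x * w x) \<partial>M)"
    and m: "(\<integral>\<^sup>+x. ennreal (w x) \<partial>M) \<le> ennreal m"
  shows "ennreal (d powr p) \<le> ennreal (m powr (p - 1)) * (\<integral>\<^sup>+x. ennreal (f x powr p * w x) \<partial>M)"
proof -
  define c where "c = d / m"
  have c: "c \<ge> 0" "d = c * m" using assms by (auto simp: c_def)
  let ?I = "\<integral>\<^sup>+x. ennreal (f x powr p * w x) \<partial>M"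
  have "ennreal (p * c powr (p - 1)) * ennreal d \<le> ennreal (p * c powr (p - 1)) * (\<integral>\<^sup>+x. ennreal (f x * w x) \<partial>M)"
    by (intro mult_left_mono d) auto
  also have "\<dots> = (\<integral>\<^sup>+x. ennreal (p * c powr (p - 1) * f x * w x) \<partial>M)"
    using p nonneg by (subst nn_integral_cmult[symmetric]) (auto simp: ennreal_mult[symmetric] mult_ac)
  also have "\<dots> \<le> (\<integral>\<^sup>+x. ennreal (f x powr p * w x) + ennreal ((p - 1) * c powr p) * ennreal (w x) \<partial>M)"
  proof (intro nn_integral_mono)
    fix x
    have "p * c powr (p - 1) * f x * w x \<le> (f x powr p + (p - 1) * c powr p) * w x"
      using nonneg p c by (intro mult_right_mono young_powr) auto
    then show "ennreal (p * c powr (p - 1) * f x * w x) \<le> ennreal (f x powr p * w x) + ennreal ((p - 1) * c powr p) * ennreal (w x)"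
      using p nonneg by (auto simp: ennreal_mult[symmetric] ennreal_plus[symmetric] distrib_right simp del: ennreal_plus intro!: ennreal_leI)
  qed
  also have "\<dots> = ?I + ennreal ((p - 1) * c powr p) * (\<integral>\<^sup>+x. ennreal (w x) \<partial>M)"
    by (subst nn_integral_add) (auto simp: nn_integral_cmult)
  also have "\<dots> \<le> ?I + ennreal ((p - 1) * c powr p) * ennreal m"
    by (intro add_left_mono mult_left_mono m) auto
  finally have le: "ennreal (p * c powr (p - 1)) * ennreal d \<le> ?I + ennreal ((p - 1) * c powr p) * ennreal m" .
  have cp: "c powr (p - 1) * c = c powr p" using c(1) p by (cases "c = 0") (auto simp: powr_diff)
  have "ennreal (c powr p * m) \<le> ?I"
  proof (cases "?I = top")
    case False
    then obtain r where r: "?I = ennreal r" "r \<ge> 0" by (cases ?I rule: ennreal_cases) auto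
    have "p * c powr (p - 1) * d \<le> r + (p - 1) * c powr p * m"
      using le p assms r by (simp add: ennreal_mult[symmetric] ennreal_plus[symmetric] del: ennreal_plus)
    moreover have "p * c powr (p - 1) * d = p * c powr p * m" by (simp add: c(2) mult.assoc flip: cp)
    moreover have "(p - 1) * c powr p * m = p * c powr p * m - c powr p * m" by (simp add: algebra_simps)
    ultimately have "c powr p * m \<le> r" by linarith
    then show ?thesis by (simp add: r ennreal_leI)
  qed auto
  then have "ennreal (m powr (p - 1)) * ennreal (c powr p * m) \<le> ennreal (m powr (p - 1)) * ?I"
    by (rule mult_left_mono) auto
  moreover have "m powr (p - 1) * (c powr p * m) = d powr p"
    using \<open>m > 0\<close> c by (simp add: powr_mult powr_diff)
  ultimately show ?thesis using \<open>m > 0\<close> by (simp add: ennreal_mult[symmetric])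
qed

section \<open>Commutators of flows\<close>

text \<open>Both orders of composition equal \<open>?P y + ?Q y - y\<close> up to a mixed
  difference. Each mixed difference compares a flow minus the identity at two points whose distance
  is bounded by the other time, so it carries the product of the two times.\<close>

lemma gflow_commute_bound:
  assumes X: "bounded_lipschitz L X" and Y: "bounded_lipschitz L Y" and h: "L * \<bar>h\<bar> \<le> 1" and t: "L * \<bar>t\<bar> \<le> 1"
  shows "norm (gflow Y t (gflow X h y) - gflow X h (gflow Y t y)) \<le> 6 * L\<^sup>2 * \<bar>t\<bar> * \<bar>h\<bar>"
proof -
  let ?P = "gflow X h" and ?Q = "gflow Y t"
  have L: "1 \<le> L" using bounded_lipschitzD(1)[OF X] .
  have "norm (?Q (?P y) - ?Q y - (?P y - y)) \<le> 3 * L * \<bar>t\<bar> * norm (?P y - y)"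
    by (rule gflow_near_identity[OF Y t])
  also have "\<dots> \<le> 3 * L * \<bar>t\<bar> * (L * \<bar>h\<bar>)"
    using L by (intro mult_left_mono gflow_dist[OF X]) auto
  finally have 1: "norm (?Q (?P y) - ?Q y - (?P y - y)) \<le> 3 * L\<^sup>2 * \<bar>t\<bar> * \<bar>h\<bar>"
    by (simp add: power2_eq_square mult_ac)
  have "norm (?P (?Q y) - ?P y - (?Q y - y)) \<le> 3 * L * \<bar>h\<bar> * norm (?Q y - y)"
    by (rule gflow_near_identity[OF X h])
  also have "\<dots> \<le> 3 * L * \<bar>h\<bar> * (L * \<bar>t\<bar>)"
    using L by (intro mult_left_mono gflow_dist[OF Y]) auto
  finally have 2: "norm (?P (?Q y) - ?P y - (?Q y - y)) \<le> 3 * L\<^sup>2 * \<bar>t\<bar> * \<bar>h\<bar>"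
    by (simp add: power2_eq_square mult_ac)
  have "norm (?Q (?P y) - ?P (?Q y)) = norm ((?Q (?P y) - ?Q y - (?P y - y)) - (?P (?Q y) - ?P y - (?Q y - y)))"
    by (simp add: algebra_simps)
  then show ?thesis
    using 1 2 norm_triangle_ineq4[of "?Q (?P y) - ?Q y - (?P y - y)" "?P (?Q y) - ?P y - (?Q y - y)"] by linarith
qed

text \<open>With \<open>h = s' - s\<close> and \<open>y = gflow X s x\<close>, the two commutators
  share their outer factors and differ inside by
  \<open>gflow X (-h) (gflow Y t (gflow X h y))\<close> against \<open>gflow Y t y\<close>, a
  commutator with times \<open>h\<close> and \<open>t\<close>. Three short flows of Lipschitz
  constant 3 turn the 6 of the commutation bound into 162. The factor \<open>\<bar>t\<bar>\<close>
  is what later gives the rate \<open>t\<^sup>2\<close>.\<close>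

lemma gflow_commutator_lipschitz_time:
  assumes X: "bounded_lipschitz L X" and Y: "bounded_lipschitz L Y"
    and s: "2 * L * \<bar>s\<bar> \<le> 1" "2 * L * \<bar>s'\<bar> \<le> 1" and t: "L * \<bar>t\<bar> \<le> 1"
  shows "norm (gflow Y (-t) (gflow X (-s') (gflow Y t (gflow X s' x))) - gflow Y (-t) (gflow X (-s) (gflow Y t (gflow X s x))))
    \<le> 162 * L\<^sup>2 * \<bar>t\<bar> * \<bar>s' - s\<bar>"
proof -
  have L: "1 \<le> L" using bounded_lipschitzD(1)[OF X] .
  define h where "h = s' - s"
  define y where "y = gflow X s x"
  have h: "L * \<bar>h\<bar> \<le> 1"
  proof -
    have "L * \<bar>h\<bar> \<le> L * (\<bar>s\<bar> + \<bar>s'\<bar>)" unfolding h_def using L by (intro mult_left_mono) auto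
    then show ?thesis using s by (simp add: algebra_simps)
  qed
  have s2: "L * \<bar>s\<bar> \<le> 1" using s(1) L by (auto simp: algebra_simps)
  have 1: "gflow X s' x = gflow X h y" using gflow_add[OF X, of h s x] by (simp add: h_def y_def)
  have 2: "gflow X (-s') w = gflow X (-s) (gflow X (-h) w)" for w
    using gflow_add[OF X, of "-s" "-h" w] by (simp add: h_def)
  let ?A = "gflow X (-h) (gflow Y t (gflow X h y))" and ?B = "gflow Y t y"
  have "norm (gflow Y (-t) (gflow X (-s) ?A) - gflow Y (-t) (gflow X (-s) ?B)) \<le> 3 * (3 * norm (?A - ?B))"
    using gflow_lipschitz[OF Y, of "-t" "gflow X (-s) ?A" "gflow X (-s) ?B"] gflow_lipschitz[OF X, of "-s" ?A ?B] s2 t by simp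
  moreover have "norm (?A - ?B) \<le> 3 * norm (gflow Y t (gflow X h y) - gflow X h ?B)"
    using gflow_lipschitz[OF X, of "-h" "gflow Y t (gflow X h y)" "gflow X h ?B"] h gflow_inverse(1)[OF X, of h ?B] by simp
  moreover note gflow_commute_bound[OF X Y h t, of y]
  ultimately show ?thesis unfolding 1 2 by (simp add: h_def flip: y_def)
qed

text \<open>Strict differentiability at the origin with a fixed tolerance. It will hold for the
  fields of all sufficiently low slices with the same \<open>a\<close> and \<open>A\<close>, taken
  from the slice at height \<open>0\<close>, since \<open>\<eta>\<close> also absorbs the change of
  height.\<close>

definition nearly_affine :: "real \<Rightarrow> real \<Rightarrow> 'a \<Rightarrow> ('a \<Rightarrow> 'a) \<Rightarrow> ('a::euclidean_space \<Rightarrow> 'a) \<Rightarrow> bool" where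
  "nearly_affine \<rho> \<eta> a A X \<longleftrightarrow> (\<forall>x\<in>ball 0 \<rho>. norm (X x - a) \<le> \<eta>) \<and>
     (\<forall>x\<in>ball 0 \<rho>. \<forall>y\<in>ball 0 \<rho>. norm (X x - X y - A (x - y)) \<le> \<eta> * norm (x - y))"

lemma gflow_nearly_constant:
  assumes X: "bounded_lipschitz L X" and aff: "nearly_affine \<rho> \<eta> a A X" and x: "norm x + L * \<bar>s\<bar> < \<rho>"
  shows "norm (gflow X s x - x - s *\<^sub>R a) \<le> \<eta> * \<bar>s\<bar>"
proof -
  have L: "1 \<le> L" using bounded_lipschitzD(1)[OF X] .
  have "norm (gflow X s x - gflow X 0 x - (s - 0) *\<^sub>R a) \<le> \<eta> * \<bar>s - 0\<bar>"
  proof (rule vector_derivative_linearization_bound[where a=0 and b=s and \<gamma>="\<lambda>s. gflow X s x" and \<gamma>'="\<lambda>s. X (gflow X s x)"])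
    fix \<sigma> assume \<sigma>: "\<sigma> \<in> closed_segment 0 s"
    show "((\<lambda>s. gflow X s x) has_vector_derivative X (gflow X \<sigma> x)) (at \<sigma> within closed_segment 0 s)"
      by (intro gflow_has_vector_derivative[OF X])
    have "\<bar>\<sigma>\<bar> \<le> \<bar>s\<bar>" using \<sigma> by (auto simp: closed_segment_eq_real_ivl split: if_splits)
    then have "norm (gflow X \<sigma> x) < \<rho>"
      using gflow_dist[OF X, of \<sigma> x] L mult_left_mono[of "\<bar>\<sigma>\<bar>" "\<bar>s\<bar>" L] x
        norm_triangle_sub[of "gflow X \<sigma> x" x] by linarith
    then show "norm (X (gflow X \<sigma> x) - a) \<le> \<eta>" using aff by (simp add: nearly_affine_def)
  qed
  then show ?thesis by (simp add: gflow_0[OF X])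
qed

text \<open>The time derivative of the vector between the two \<open>Y\<close>-orbits is an
  increment of \<open>Y\<close>, close to \<open>B\<close> of that vector, and the vector stays
  close to \<open>s *\<^sub>R a\<close>. The terms with \<open>\<eta>\<close> come from the
  tolerances of \<open>Y\<close> and of \<open>X\<close>, the cubic term from the drift of the
  vector along the orbits.\<close>

lemma gflow_mixed_difference:
  assumes X: "bounded_lipschitz L X" and Y: "bounded_lipschitz L Y"
    and affX: "nearly_affine \<rho> \<eta> a A X" and affY: "nearly_affine \<rho> \<eta> b B Y"
    and B: "linear B" "\<And>v. norm (B v) \<le> L * norm v"
    and st: "\<bar>s\<bar> \<le> \<kappa>" "\<bar>t\<bar> \<le> \<kappa>" "L * \<kappa> \<le> 1" and x: "norm x + 2 * L * \<kappa> < \<rho>"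
  shows "norm (gflow Y t (gflow X s x) - gflow Y t x - (gflow X s x - x) - (s * t) *\<^sub>R B a) \<le> 4 * L * \<eta> * \<kappa>\<^sup>2 + 3 * L ^ 3 * \<kappa> ^ 3"
proof -
  have L: "1 \<le> L" using bounded_lipschitzD(1)[OF X] .
  have \<kappa>: "\<kappa> \<ge> 0" using st by linarith
  have Ls: "L * \<bar>s\<bar> \<le> L * \<kappa>" using st L by (intro mult_left_mono) auto
  have \<eta>: "\<eta> \<ge> 0"
  proof -
    have "0 * norm x \<le> 2 * L * \<kappa>" using L \<kappa> by simp
    then have "x \<in> ball 0 \<rho>" using x by (simp)
    then have "norm (X x - a) \<le> \<eta>" using affX by (simp add: nearly_affine_def)
    then show ?thesis using norm_ge_zero[of "X x - a"] by linarith
  qed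
  let ?y = "gflow X s x"
  have d: "norm (?y - x) \<le> L * \<kappa>" using gflow_dist[OF X, of s x] Ls by linarith
  have "norm (gflow Y t ?y - gflow Y t x - (gflow Y 0 ?y - gflow Y 0 x) - (t - 0) *\<^sub>R (s *\<^sub>R B a)) \<le> (4 * L * \<eta> * \<kappa> + 3 * L ^ 3 * \<kappa>\<^sup>2) * \<bar>t - 0\<bar>"
  proof (rule vector_derivative_linearization_bound[where a=0 and b=t and \<gamma>="\<lambda>\<sigma>. gflow Y \<sigma> ?y - gflow Y \<sigma> x"
        and \<gamma>'="\<lambda>\<sigma>. Y (gflow Y \<sigma> ?y) - Y (gflow Y \<sigma> x)"])
    fix \<sigma> assume \<sigma>: "\<sigma> \<in> closed_segment 0 t"
    show "((\<lambda>\<sigma>. gflow Y \<sigma> ?y - gflow Y \<sigma> x) has_vector_derivative Y (gflow Y \<sigma> ?y) - Y (gflow Y \<sigma> x)) (at \<sigma> within closed_segment 0 t)"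
      by (intro derivative_intros gflow_has_vector_derivative[OF Y])
    have "\<bar>\<sigma>\<bar> \<le> \<bar>t\<bar>" using \<sigma> by (auto simp: closed_segment_eq_real_ivl split: if_splits)
    then have \<sigma>\<kappa>: "\<bar>\<sigma>\<bar> \<le> \<kappa>" using st by linarith
    then have L\<sigma>: "L * \<bar>\<sigma>\<bar> \<le> L * \<kappa>" using L by (intro mult_left_mono) auto
    let ?c = "gflow Y \<sigma> ?y" and ?d = "gflow Y \<sigma> x"
    have L\<kappa>: "0 \<le> L * \<kappa>" using L \<kappa> by simp
    have "norm ?c < \<rho>" "norm ?d < \<rho>"
      using gflow_dist[OF Y, of \<sigma> x] gflow_dist[OF Y, of \<sigma> ?y] d L\<sigma> x L\<kappa>
        norm_triangle_sub[of ?c ?y] norm_triangle_sub[of ?d x] norm_triangle_sub[of ?y x] by linarith+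
    then have e1: "norm (Y ?c - Y ?d - B (?c - ?d)) \<le> \<eta> * norm (?c - ?d)"
      using affY by (simp add: nearly_affine_def)
    have "norm (?c - ?d) \<le> 3 * norm (?y - x)" using L\<sigma> st by (intro gflow_lipschitz[OF Y]) auto
    then have "\<eta> * norm (?c - ?d) \<le> \<eta> * (3 * (L * \<kappa>))" using d \<eta> by (intro mult_left_mono) auto
    with e1 have e1: "norm (Y ?c - Y ?d - B (?c - ?d)) \<le> 3 * L * \<eta> * \<kappa>" by (simp add: mult_ac)
    have "norm (?c - ?d - (?y - x)) \<le> 3 * (L * \<bar>\<sigma>\<bar>) * norm (?y - x)"
      using gflow_near_identity[OF Y, of \<sigma> ?y x] L\<sigma> st by (simp add: mult.assoc)
    also have "\<dots> \<le> 3 * (L * \<kappa>) * (L * \<kappa>)" using L \<kappa> L\<sigma> d by (intro mult_mono) auto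
    finally have e2: "norm (?c - ?d - (?y - x)) \<le> 3 * (L * \<kappa>)\<^sup>2" by (simp add: power2_eq_square)
    have "0 \<le> L * \<kappa>" using L \<kappa> by simp
    then have e3: "norm (?y - x - s *\<^sub>R a) \<le> \<eta> * \<bar>s\<bar>" using x Ls by (intro gflow_nearly_constant[OF X affX]) linarith
    have e3: "norm (?y - x - s *\<^sub>R a) \<le> \<eta> * \<kappa>" by (rule order_trans[OF e3]) (use \<eta> st in \<open>auto intro: mult_left_mono\<close>)
    have "norm (?c - ?d - s *\<^sub>R a) \<le> 3 * (L * \<kappa>)\<^sup>2 + \<eta> * \<kappa>"
      using e2 e3 norm_triangle_ineq[of "?c - ?d - (?y - x)" "?y - x - s *\<^sub>R a"] by simp
    then have "L * norm (?c - ?d - s *\<^sub>R a) \<le> L * (3 * (L * \<kappa>)\<^sup>2 + \<eta> * \<kappa>)" using L by (intro mult_left_mono) auto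
    then have "norm (B (?c - ?d - s *\<^sub>R a)) \<le> L * (3 * (L * \<kappa>)\<^sup>2 + \<eta> * \<kappa>)" using B(2) order_trans by blast
    then have e4: "norm (B (?c - ?d) - s *\<^sub>R B a) \<le> L * (3 * (L * \<kappa>)\<^sup>2 + \<eta> * \<kappa>)"
      by (simp add: linear_diff[OF B(1)] linear_scale[OF B(1)])
    have "norm (Y ?c - Y ?d - s *\<^sub>R B a) \<le> 3 * L * \<eta> * \<kappa> + L * (3 * (L * \<kappa>)\<^sup>2 + \<eta> * \<kappa>)"
      using e1 e4 norm_triangle_ineq[of "Y ?c - Y ?d - B (?c - ?d)" "B (?c - ?d) - s *\<^sub>R B a"] by simp
    also have "\<dots> = 4 * L * \<eta> * \<kappa> + 3 * L ^ 3 * \<kappa>\<^sup>2" by (simp add: power2_eq_square power3_eq_cube algebra_simps)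
    finally show "norm (Y ?c - Y ?d - s *\<^sub>R B a) \<le> 4 * L * \<eta> * \<kappa> + 3 * L ^ 3 * \<kappa>\<^sup>2" .
  qed
  also have "\<dots> \<le> (4 * L * \<eta> * \<kappa> + 3 * L ^ 3 * \<kappa>\<^sup>2) * \<kappa>"
    using L \<eta> \<kappa> st by (intro mult_left_mono add_nonneg_nonneg mult_nonneg_nonneg zero_le_power) auto
  also have "\<dots> = 4 * L * \<eta> * \<kappa>\<^sup>2 + 3 * L ^ 3 * \<kappa> ^ 3" by (simp add: power2_eq_square power3_eq_cube algebra_simps)
  finally show ?thesis by (simp add: gflow_0[OF Y] mult.commute)
qed

text \<open>Subtracting the two mixed differences cancels everything but
  \<open>(s * t) *\<^sub>R (B a - A b)\<close>, up to twice their error. The two remaining inverse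
  flows take \<open>?v\<close> back to \<open>x\<close> and change a difference only by a relative
  amount O(\<open>L * \<kappa>\<close>); this adds 18 and 54 to the cubic coefficient 6, giving
  78.\<close>

lemma gflow_commutator_expansion:
  assumes X: "bounded_lipschitz L X" and Y: "bounded_lipschitz L Y"
    and affX: "nearly_affine \<rho> \<eta> a A X" and affY: "nearly_affine \<rho> \<eta> b B Y"
    and A: "linear A" "\<And>v. norm (A v) \<le> L * norm v" and B: "linear B" "\<And>v. norm (B v) \<le> L * norm v"
    and st: "\<bar>s\<bar> \<le> \<kappa>" "\<bar>t\<bar> \<le> \<kappa>" "L * \<kappa> \<le> 1" and x: "norm x + 2 * L * \<kappa> < \<rho>"
  shows "norm (gflow Y (-t) (gflow X (-s) (gflow Y t (gflow X s x))) - x - (s * t) *\<^sub>R (B a - A b))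
    \<le> 8 * L * \<eta> * \<kappa>\<^sup>2 + 78 * L ^ 3 * \<kappa> ^ 3"
proof -
  have L: "1 \<le> L" using bounded_lipschitzD(1)[OF X] .
  have \<kappa>: "\<kappa> \<ge> 0" using st by linarith
  have Ls: "L * \<bar>s\<bar> \<le> L * \<kappa>" "L * \<bar>t\<bar> \<le> L * \<kappa>" using st L by (auto intro!: mult_left_mono)
  let ?w = "gflow Y t (gflow X s x)" and ?v = "gflow X s (gflow Y t x)"
  let ?e = "4 * L * \<eta> * \<kappa>\<^sup>2 + 3 * L ^ 3 * \<kappa> ^ 3"
  have 1: "norm (?w - gflow Y t x - (gflow X s x - x) - (s * t) *\<^sub>R B a) \<le> ?e"
    by (rule gflow_mixed_difference[OF X Y affX affY B st x])
  have 2: "norm (?v - gflow X s x - (gflow Y t x - x) - (t * s) *\<^sub>R A b) \<le> ?e"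
    by (rule gflow_mixed_difference[OF Y X affY affX A st(2,1,3) x])
  have eq: "(?w - gflow Y t x - (gflow X s x - x) - (s * t) *\<^sub>R B a) - (?v - gflow X s x - (gflow Y t x - x) - (t * s) *\<^sub>R A b)
    = ?w - ?v - (s * t) *\<^sub>R (B a - A b)" by (simp add: algebra_simps)
  have e1: "norm (?w - ?v - (s * t) *\<^sub>R (B a - A b)) \<le> 2 * ?e"
    using order_trans[OF norm_triangle_ineq4 add_mono[OF 1 2]] unfolding eq mult_2 .
  have "norm (?w - ?v) \<le> 6 * L\<^sup>2 * (\<bar>t\<bar> * \<bar>s\<bar>)"
    using gflow_commute_bound[OF X Y, of s t x] Ls st(3) by (simp add: mult.assoc)
  also have "\<dots> \<le> 6 * L\<^sup>2 * (\<kappa> * \<kappa>)" using st \<kappa> by (intro mult_left_mono mult_mono) auto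
  finally have wv: "norm (?w - ?v) \<le> 6 * (L * \<kappa>)\<^sup>2" by (simp add: power2_eq_square mult_ac)
  let ?w1 = "gflow X (-s) ?w" and ?v1 = "gflow X (-s) ?v"
  have m: "3 * L * \<bar>\<tau>\<bar> * q \<le> 3 * (L * \<kappa>) * q'" if "\<bar>\<tau>\<bar> \<le> \<kappa>" "0 \<le> q" "q \<le> q'" for \<tau> q q'
  proof -
    have "3 * (L * \<bar>\<tau>\<bar>) * q \<le> 3 * (L * \<kappa>) * q'" using that L \<kappa> by (intro mult_mono mult_left_mono) auto
    then show ?thesis by (simp add: mult.assoc)
  qed
  have "norm (?w1 - ?v1 - (?w - ?v)) \<le> 3 * L * \<bar>-s\<bar> * norm (?w - ?v)"
    using Ls st(3) by (intro gflow_near_identity[OF X]) auto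
  also have "\<dots> \<le> 3 * (L * \<kappa>) * (6 * (L * \<kappa>)\<^sup>2)" using st wv by (intro m) auto
  finally have e2: "norm (?w1 - ?v1 - (?w - ?v)) \<le> 18 * (L * \<kappa>) ^ 3" by (simp add: power2_eq_square power3_eq_cube)
  have "norm (?w1 - ?v1) \<le> 3 * norm (?w - ?v)" using Ls st(3) by (intro gflow_lipschitz[OF X]) auto
  then have wv1: "norm (?w1 - ?v1) \<le> 18 * (L * \<kappa>)\<^sup>2" using wv by linarith
  have "norm (gflow Y (-t) ?w1 - gflow Y (-t) ?v1 - (?w1 - ?v1)) \<le> 3 * L * \<bar>-t\<bar> * norm (?w1 - ?v1)"
    using Ls st(3) by (intro gflow_near_identity[OF Y]) auto
  also have "\<dots> \<le> 3 * (L * \<kappa>) * (18 * (L * \<kappa>)\<^sup>2)" using st wv1 by (intro m) auto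
  finally have e3: "norm (gflow Y (-t) ?w1 - gflow Y (-t) ?v1 - (?w1 - ?v1)) \<le> 54 * (L * \<kappa>) ^ 3" by (simp add: power2_eq_square power3_eq_cube)
  have v2: "gflow Y (-t) ?v1 = x" by (simp add: gflow_inverse(1)[OF X] gflow_inverse(1)[OF Y])
  have "norm (gflow Y (-t) ?w1 - x - (s * t) *\<^sub>R (B a - A b))
     = norm ((gflow Y (-t) ?w1 - gflow Y (-t) ?v1 - (?w1 - ?v1)) + (?w1 - ?v1 - (?w - ?v)) + (?w - ?v - (s * t) *\<^sub>R (B a - A b)))"
    unfolding v2 by (simp add: algebra_simps)
  also have "\<dots> \<le> 54 * (L * \<kappa>) ^ 3 + 18 * (L * \<kappa>) ^ 3 + 2 * ?e"
    by (intro norm_triangle_le add_mono e1 e2 e3)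
  also have "\<dots> = 8 * L * \<eta> * \<kappa>\<^sup>2 + 78 * L ^ 3 * \<kappa> ^ 3" by (simp add: power_mult_distrib algebra_simps)
  finally show ?thesis .
qed

section \<open>Covering a ball by commutator moves\<close>

primrec run :: "(nat \<Rightarrow> 'a::euclidean_space \<Rightarrow> 'a) \<Rightarrow> (nat \<times> real) list \<Rightarrow> 'a \<Rightarrow> 'a" where
  "run z [] x = x"
| "run z (m # ms) x = run z ms (gflow (z (fst m)) (snd m) x)"

lemma run_append: "run z (ms @ ms') x = run z ms' (run z ms x)"
  by (induction ms arbitrary: x) auto

text \<open>The code \<open>(l, None)\<close> stands for the field \<open>z l\<close>, the code \<open>(l, Some m)\<close> for the bracket of
  \<open>z l\<close> and \<open>z m\<close>; the move displaces by about \<open>r * t\<^sup>2\<close> in that direction.\<close>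
fun move :: "real \<Rightarrow> nat \<times> nat option \<Rightarrow> real \<Rightarrow> (nat \<times> real) list" where
  "move t (l, None) r = [(l, r * t\<^sup>2)]"
| "move t (l, Some m) r = [(l, r * t), (m, t), (l, - (r * t)), (m, - t)]"

fun direction :: "(nat \<Rightarrow> 'a::euclidean_space) \<Rightarrow> (nat \<Rightarrow> 'a \<Rightarrow> 'a) \<Rightarrow> nat \<times> nat option \<Rightarrow> 'a" where
  "direction a A (l, None) = a l"
| "direction a A (l, Some m) = A m (a l) - A l (a m)"

definition code_in :: "nat set \<Rightarrow> nat \<times> nat option \<Rightarrow> bool" where
  "code_in J c \<longleftrightarrow> fst c \<in> J \<and> (\<forall>m. snd c = Some m \<longrightarrow> m \<in> J)"

text \<open>As \<open>r\<close> varies in a ball this parametrizes a neighbourhood of the starting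
  point of size about \<open>t\<^sup>2\<close>: one move per basis direction, with the coordinate of
  \<open>r\<close> as its strength.\<close>

definition moves :: "real \<Rightarrow> ('a \<Rightarrow> nat \<times> nat option) \<Rightarrow> 'a list \<Rightarrow> 'a::euclidean_space \<Rightarrow> (nat \<times> real) list" where
  "moves t c bs r = concat (map (\<lambda>b. move t (c b) (r \<bullet> b)) bs)"

lemma move_bounds:
  assumes "code_in J c" "\<bar>r\<bar> \<le> K" "1 \<le> K" "0 < t" "t \<le> 1"
  shows "set (move t c r) \<subseteq> J \<times> {- (K * t)..K * t}" "length (move t c r) \<le> 4"
proof -
  have 1: "\<bar>r * t\<bar> \<le> K * t" "\<bar>t\<bar> \<le> K * t"
    using assms mult_right_mono[of 1 K t] by (auto simp: abs_mult intro: mult_right_mono)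
  have "\<bar>r * t\<^sup>2\<bar> = (\<bar>r\<bar> * t) * t" using assms by (simp add: abs_mult power2_eq_square)
  also have "\<dots> \<le> (K * t) * 1" using assms by (intro mult_mono) auto
  finally have 2: "\<bar>r * t\<^sup>2\<bar> \<le> K * t" by simp
  obtain l mo where c: "c = (l, mo)" by fastforce
  show "set (move t c r) \<subseteq> J \<times> {- (K * t)..K * t}" "length (move t c r) \<le> 4"
    using assms(1) 1 2 by (cases mo; auto simp: c code_in_def)+
qed

lemma run_dist:
  fixes L \<kappa> :: real
  assumes z: "\<And>j. j \<in> J \<Longrightarrow> bounded_lipschitz L (z j)" and ms: "set ms \<subseteq> J \<times> {- \<kappa>..\<kappa>}"
  shows "norm (run z ms x - x) \<le> length ms * (L * \<kappa>)"
  using ms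
proof (induction ms arbitrary: x)
  case (Cons m ms)
  let ?y = "gflow (z (fst m)) (snd m) x"
  have m: "fst m \<in> J" "\<bar>snd m\<bar> \<le> \<kappa>" using Cons.prems by auto
  have "norm (?y - x) \<le> L * \<bar>snd m\<bar>" by (rule gflow_dist[OF z[OF m(1)]])
  also have "\<dots> \<le> L * \<kappa>" using m(2) bounded_lipschitzD(1)[OF z[OF m(1)]] by (intro mult_left_mono) auto
  finally have "norm (?y - x) \<le> L * \<kappa>" .
  moreover have "norm (run z ms ?y - ?y) \<le> length ms * (L * \<kappa>)" using Cons by auto
  ultimately show ?case
    using norm_triangle_ineq[of "run z ms ?y - ?y" "?y - x"] by (simp add: algebra_simps)
qed simp

lemma run_lipschitz:
  assumes z: "\<And>j. j \<in> J \<Longrightarrow> bounded_lipschitz L (z j)" and ms: "set ms \<subseteq> J \<times> {- \<kappa>..\<kappa>}" and \<kappa>: "L * \<kappa> \<le> 1"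
  shows "norm (run z ms x - run z ms y) \<le> 3 ^ length ms * norm (x - y)"
  using ms
proof (induction ms arbitrary: x y)
  case (Cons m ms)
  let ?f = "gflow (z (fst m)) (snd m)"
  have m: "fst m \<in> J" "\<bar>snd m\<bar> \<le> \<kappa>" using Cons.prems by auto
  have "L * \<bar>snd m\<bar> \<le> 1"
    using mult_left_mono[OF m(2), of L] bounded_lipschitzD(1)[OF z[OF m(1)]] \<kappa> by linarith
  then have "norm (?f x - ?f y) \<le> 3 * norm (x - y)" by (rule gflow_lipschitz[OF z[OF m(1)]])
  then have 1: "3 ^ length ms * norm (?f x - ?f y) \<le> 3 ^ length ms * (3 * norm (x - y))" by (intro mult_left_mono) auto
  have "norm (run z ms (?f x) - run z ms (?f y)) \<le> 3 ^ length ms * norm (?f x - ?f y)" using Cons by auto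
  from order_trans[OF this 1] show ?case by (simp add: mult_ac)
qed simp

lemma run_continuous:
  assumes z: "\<And>j. j \<in> J \<Longrightarrow> bounded_lipschitz L (z j)" and ms: "set ms \<subseteq> J \<times> {- \<kappa>..\<kappa>}" and \<kappa>: "L * \<kappa> \<le> 1"
  shows "continuous_on UNIV (run z ms)"
proof -
  have "(3 ^ length ms)-lipschitz_on UNIV (run z ms)"
    using run_lipschitz[OF assms] by (intro lipschitz_onI) (auto simp: dist_norm)
  then show ?thesis by (rule lipschitz_on_continuous_on)
qed

text \<open>A frame at a single height. \<open>t\<close> is at once the height and the length scale
  of the moves, \<open>K\<close> bounds the strength of a move, and \<open>c\<close> assigns to
  every basis vector a field or a bracket. \<open>2 * L * K * t \<le> 1\<close> keeps all flow
  times, and the difference of two of them, in the range where flows are Lipschitz with constant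
  3.\<close>

locale bracket_frame =
  fixes z :: "nat \<Rightarrow> 'a::euclidean_space \<Rightarrow> 'a" and J :: "nat set" and L \<rho> \<eta> K t :: real
    and a :: "nat \<Rightarrow> 'a" and A :: "nat \<Rightarrow> 'a \<Rightarrow> 'a" and c :: "'a \<Rightarrow> nat \<times> nat option"
  assumes z: "\<And>j. j \<in> J \<Longrightarrow> bounded_lipschitz L (z j)"
    and aff: "\<And>j. j \<in> J \<Longrightarrow> nearly_affine \<rho> \<eta> (a j) (A j) (z j)"
    and A: "\<And>j. j \<in> J \<Longrightarrow> linear (A j)" "\<And>j v. j \<in> J \<Longrightarrow> norm (A j v) \<le> L * norm v"
    and c: "\<And>b. b \<in> Basis \<Longrightarrow> code_in J (c b)"
    and L: "1 \<le> L" and K: "1 \<le> K" and t: "0 < t" "t \<le> 1" "2 * L * K * t \<le> 1"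
begin

lemma LKt: "L * (K * t) \<le> 1" "0 \<le> L * (K * t)" "0 \<le> K * t"
  using t(1,3) L K by (auto simp: mult.assoc)

text \<open>Both kinds of move have speed O(\<open>t\<^sup>2\<close>) in \<open>r\<close>: a plain
  flow because its time is \<open>r * t\<^sup>2\<close>, a commutator because only the time
  \<open>r * t\<close> varies while the other flow contributes a factor \<open>t\<close>.\<close>

lemma move_lipschitz_param:
  assumes b: "b \<in> Basis" and r: "\<bar>r\<bar> \<le> K" "\<bar>r'\<bar> \<le> K"
  shows "norm (run z (move t (c b) r) x - run z (move t (c b) r') x) \<le> 162 * L\<^sup>2 * t\<^sup>2 * \<bar>r - r'\<bar>"
proof -
  obtain l mo where cb: "c b = (l, mo)" by fastforce
  have l: "l \<in> J" using c[OF b] by (simp add: code_in_def cb)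
  show ?thesis
  proof (cases mo)
    case None
    have "norm (run z (move t (c b) r) x - run z (move t (c b) r') x) \<le> L * \<bar>r * t\<^sup>2 - r' * t\<^sup>2\<bar>"
      using gflow_dist_time[OF z[OF l]] by (simp add: cb None)
    also have "\<dots> = L * t\<^sup>2 * \<bar>r - r'\<bar>"
      by (simp add: abs_mult mult_ac flip: left_diff_distrib)
    also have "\<dots> \<le> 162 * L\<^sup>2 * t\<^sup>2 * \<bar>r - r'\<bar>"
    proof (intro mult_right_mono)
      have "L * 1 \<le> L * (162 * L)" using L by (intro mult_left_mono) auto
      then show "L \<le> 162 * L\<^sup>2" by (simp add: power2_eq_square mult_ac)
    qed auto
    finally show ?thesis .
  next
    case (Some m)
    have m: "m \<in> J" using c[OF b] by (simp add: code_in_def cb Some)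
    have s: "2 * L * \<bar>r * t\<bar> \<le> 1" if "\<bar>r\<bar> \<le> K" for r
    proof -
      have "2 * L * (\<bar>r\<bar> * t) \<le> 2 * L * (K * t)" using that L t by (intro mult_left_mono mult_right_mono) auto
      then show ?thesis using t by (simp add: abs_mult mult.assoc)
    qed
    have "L * \<bar>t\<bar> \<le> L * (K * t)" using L K t mult_right_mono[of 1 K t] by (intro mult_left_mono) auto
    then have t1: "L * \<bar>t\<bar> \<le> 1" using LKt by linarith
    have "norm (run z (move t (c b) r) x - run z (move t (c b) r') x) \<le> 162 * L\<^sup>2 * \<bar>t\<bar> * \<bar>r * t - r' * t\<bar>"
      using gflow_commutator_lipschitz_time[OF z[OF l] z[OF m] s[OF r(2)] s[OF r(1)] t1, of x] by (simp add: cb Some)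
    also have "\<dots> = 162 * L\<^sup>2 * t\<^sup>2 * \<bar>r - r'\<bar>"
      using t by (simp add: abs_mult power2_eq_square mult_ac flip: left_diff_distrib)
    finally show ?thesis .
  qed
qed

text \<open>Error of a single move in units of \<open>t\<^sup>2\<close>. Its first part is made
  small through \<open>\<eta>\<close>, its second through \<open>t\<close>.\<close>

definition "err = (8 * L * \<eta> * K\<^sup>2 + 78 * L ^ 3 * K ^ 3 * t)"

lemma move_expansion:
  assumes b: "b \<in> Basis" and r: "\<bar>r\<bar> \<le> K" and x: "norm x + 2 * L * (K * t) < \<rho>"
  shows "norm (run z (move t (c b) r) x - x - (r * t\<^sup>2) *\<^sub>R direction a A (c b)) \<le> err * t\<^sup>2"
proof -
  obtain l mo where cb: "c b = (l, mo)" by fastforce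
  have l: "l \<in> J" using c[OF b] by (simp add: code_in_def cb)
  have "norm x < \<rho>" using x LKt by linarith
  then have "norm (z l x - a l) \<le> \<eta>" using aff[OF l] by (simp add: nearly_affine_def)
  then have \<eta>: "0 \<le> \<eta>" using norm_ge_zero[of "z l x - a l"] by linarith
  have Kt: "\<bar>r * t\<bar> \<le> K * t" "\<bar>t\<bar> \<le> K * t" "\<bar>r * t\<^sup>2\<bar> \<le> K * t"
    using move_bounds(1)[of J "(l, None)" r K t] move_bounds(1)[of J "(l, Some l)" r K t] l r K t
    by (auto simp: code_in_def abs_le_iff)
  have pos: "0 \<le> 78 * L ^ 3 * K ^ 3 * t" using L K t by simp
  show ?thesis
  proof (cases mo)
    case None
    have "L * \<bar>r * t\<^sup>2\<bar> \<le> L * (K * t)" using L Kt by (intro mult_left_mono) auto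
    then have "norm x + L * \<bar>r * t\<^sup>2\<bar> < \<rho>" using x LKt by linarith
    then have "norm (gflow (z l) (r * t\<^sup>2) x - x - (r * t\<^sup>2) *\<^sub>R a l) \<le> \<eta> * \<bar>r * t\<^sup>2\<bar>"
      by (rule gflow_nearly_constant[OF z[OF l] aff[OF l]])
    also have "\<dots> = (\<eta> * \<bar>r\<bar>) * t\<^sup>2" by (simp add: abs_mult)
    also have "\<dots> \<le> err * t\<^sup>2"
    proof (intro mult_right_mono)
      \<comment> \<open>\<open>K \<ge> 1\<close> lets the error of a plain flow, linear in
        \<open>K\<close>, fit under the quadratic one of a commutator.\<close>
      have "K \<le> K\<^sup>2" using K by (simp add: power2_eq_square)
      have "\<eta> * \<bar>r\<bar> \<le> \<eta> * K\<^sup>2" using r \<open>K \<le> K\<^sup>2\<close> \<eta> by (intro mult_left_mono) auto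
      also have "\<dots> \<le> (8 * L) * (\<eta> * K\<^sup>2)" using L \<eta> mult_right_mono[of 1 "8 * L" "\<eta> * K\<^sup>2"] by simp
      also have "(8 * L) * (\<eta> * K\<^sup>2) = 8 * L * \<eta> * K\<^sup>2" by simp
      finally show "\<eta> * \<bar>r\<bar> \<le> err" unfolding err_def using pos by linarith
    qed simp
    finally show ?thesis by (simp add: cb None)
  next
    case (Some m)
    have m: "m \<in> J" using c[OF b] by (simp add: code_in_def cb Some)
    have "norm (gflow (z m) (-t) (gflow (z l) (-(r * t)) (gflow (z m) t (gflow (z l) (r * t) x))) - x - (r * t * t) *\<^sub>R (A m (a l) - A l (a m)))
       \<le> 8 * L * \<eta> * (K * t)\<^sup>2 + 78 * L ^ 3 * (K * t) ^ 3"
      using x LKt Kt by (intro gflow_commutator_expansion[OF z[OF l] z[OF m] aff[OF l] aff[OF m]]) (auto intro: A l m)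
    also have "\<dots> = err * t\<^sup>2" by (simp add: err_def power_mult_distrib power2_eq_square power3_eq_cube algebra_simps)
    finally show ?thesis by (simp add: cb Some power2_eq_square mult.assoc)
  qed
qed

lemma moves_bounds:
  assumes "set bs \<subseteq> Basis" "norm r \<le> K"
  shows "set (moves t c bs r) \<subseteq> J \<times> {- (K * t)..K * t}" "length (moves t c bs r) \<le> 4 * length bs"
proof -
  have "\<bar>r \<bullet> b\<bar> \<le> K" if "b \<in> Basis" for b using Basis_le_norm[OF that, of r] assms(2) by linarith
  then show "set (moves t c bs r) \<subseteq> J \<times> {- (K * t)..K * t}"
    using assms move_bounds(1)[OF c _ K t(1,2)] unfolding moves_def by (fastforce simp del: move.simps)
  show "length (moves t c bs r) \<le> 4 * length bs"
    using assms(1)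
  proof (induction bs)
    case (Cons b bs)
    have "length (move t (c b) (r \<bullet> b)) \<le> 4" by (cases "(t, c b, r \<bullet> b)" rule: move.cases) auto
    then show ?case using Cons by (simp add: moves_def)
  qed (simp add: moves_def)
qed

text \<open>Each basis direction multiplies the distance so far by at most
  \<open>81 = 3 ^ 4\<close>, for up to four flows, and adds the parameter error of its own move; the
  induction therefore needs two different starting points.\<close>

lemma moves_lipschitz_param_aux:
  assumes bs: "set bs \<subseteq> Basis" and r: "norm r \<le> K" "norm r' \<le> K"
  shows "norm (run z (moves t c bs r) x - run z (moves t c bs r') y)
    \<le> 81 ^ length bs * (norm (x - y) + length bs * (162 * L\<^sup>2 * t\<^sup>2 * norm (r - r')))"
  using bs
proof (induction bs arbitrary: x y)
  case Nil
  then show ?case by (simp add: moves_def)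
next
  case (Cons b bs)
  have b: "b \<in> Basis" using Cons.prems by simp
  let ?D = "162 * L\<^sup>2 * t\<^sup>2 * norm (r - r')"
  have rb: "\<bar>r \<bullet> b\<bar> \<le> K" "\<bar>r' \<bullet> b\<bar> \<le> K" "\<bar>r \<bullet> b - r' \<bullet> b\<bar> \<le> norm (r - r')"
    using Basis_le_norm[OF b, of r] Basis_le_norm[OF b, of r'] Basis_le_norm[OF b, of "r - r'"] r by (auto simp: inner_diff_left)
  let ?f = "run z (move t (c b) (r \<bullet> b))" and ?g = "run z (move t (c b) (r' \<bullet> b))"
  have "norm (?f x - ?f y) \<le> 3 ^ length (move t (c b) (r \<bullet> b)) * norm (x - y)"
    using move_bounds(1)[OF c[OF b] rb(1) K t(1,2)] LKt(1) by (intro run_lipschitz[OF z]) auto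
  also have "\<dots> \<le> 3 ^ 4 * norm (x - y)"
    using move_bounds(2)[OF c[OF b] rb(1) K t(1,2)] by (intro mult_right_mono power_increasing) auto
  finally have 1: "norm (?f x - ?f y) \<le> 81 * norm (x - y)" by simp
  have "norm (?f y - ?g y) \<le> 162 * L\<^sup>2 * t\<^sup>2 * \<bar>r \<bullet> b - r' \<bullet> b\<bar>"
    by (rule move_lipschitz_param[OF b rb(1,2)])
  also have "\<dots> \<le> ?D" using rb(3) by (intro mult_left_mono) auto
  finally have 2: "norm (?f x - ?g y) \<le> 81 * norm (x - y) + ?D"
    using 1 norm_triangle_ineq[of "?f x - ?f y" "?f y - ?g y"] by simp
  have D: "0 \<le> ?D" by simp
  have "norm (run z (moves t c (b # bs) r) x - run z (moves t c (b # bs) r') y)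
     = norm (run z (moves t c bs r) (?f x) - run z (moves t c bs r') (?g y))"
    by (simp add: moves_def run_append)
  also have "\<dots> \<le> 81 ^ length bs * (norm (?f x - ?g y) + length bs * ?D)" using Cons by auto
  also have "\<dots> \<le> 81 ^ length bs * (81 * norm (x - y) + ?D + length bs * ?D)" using 2 by (intro mult_left_mono) auto
  also have "\<dots> \<le> 81 ^ length bs * (81 * (norm (x - y) + length (b # bs) * ?D))"
  proof (intro mult_left_mono)
    have "(1 + real (length bs)) * ?D \<le> 81 * ((1 + real (length bs)) * ?D)" using D by (simp add: mult_nonneg_nonneg)
    then show "81 * norm (x - y) + ?D + length bs * ?D \<le> 81 * (norm (x - y) + length (b # bs) * ?D)"
      by (simp add: algebra_simps)
  qed simp
  also have "\<dots> = 81 ^ length (b # bs) * (norm (x - y) + length (b # bs) * ?D)"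
    by (simp only: length_Cons power_Suc mult_ac)
  finally show ?case .
qed

text \<open>The margin in \<open>x\<close> is consumed at the rate \<open>4 * (L * (K * t))\<close>
  per move, the distance a move can travel; the remaining \<open>2 * (L * (K * t))\<close> is what
  the expansion of a single move asks for.\<close>

lemma moves_expansion:
  assumes bs: "set bs \<subseteq> Basis" and r: "norm r \<le> K" and x: "norm x + (4 * length bs + 2) * (L * (K * t)) < \<rho>"
  shows "norm (run z (moves t c bs r) x - x - t\<^sup>2 *\<^sub>R (\<Sum>b\<leftarrow>bs. (r \<bullet> b) *\<^sub>R direction a A (c b))) \<le> length bs * (err * t\<^sup>2)"
  using bs x
proof (induction bs arbitrary: x)
  case Nil
  then show ?case by (simp add: moves_def)
next
  case (Cons b bs)
  have b: "b \<in> Basis" using Cons.prems by simp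
  have rb: "\<bar>r \<bullet> b\<bar> \<le> K" using Basis_le_norm[OF b, of r] r by auto
  let ?y = "run z (move t (c b) (r \<bullet> b)) x"
  let ?v = "\<lambda>b. (r \<bullet> b) *\<^sub>R direction a A (c b)"
  let ?q = "L * (K * t)"
  have q: "0 \<le> real (length bs) * ?q" by (rule mult_nonneg_nonneg[OF of_nat_0_le_iff LKt(2)])
  have x: "norm x + (4 * length bs + 6) * ?q < \<rho>" using Cons.prems(2) by (simp add: algebra_simps)
  have "norm x + 2 * L * (K * t) < \<rho>" using x q LKt(2) by (simp add: algebra_simps)
  then have 1: "norm (?y - x - (r \<bullet> b * t\<^sup>2) *\<^sub>R direction a A (c b)) \<le> err * t\<^sup>2"
    by (rule move_expansion[OF b rb])
  have "norm (?y - x) \<le> length (move t (c b) (r \<bullet> b)) * ?q"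
    using move_bounds(1)[OF c[OF b] rb K t(1,2)] by (intro run_dist[OF z]) auto
  also have "\<dots> \<le> 4 * ?q" using move_bounds(2)[OF c[OF b] rb K t(1,2)] LKt by (intro mult_right_mono) auto
  finally have "norm ?y \<le> norm x + 4 * ?q" using norm_triangle_sub[of ?y x] by linarith
  then have "norm ?y + (4 * length bs + 2) * ?q < \<rho>" using x by (simp add: algebra_simps)
  then have 2: "norm (run z (moves t c bs r) ?y - ?y - t\<^sup>2 *\<^sub>R (\<Sum>b\<leftarrow>bs. ?v b)) \<le> length bs * (err * t\<^sup>2)"
    using Cons by auto
  have "run z (moves t c (b # bs) r) x - x - t\<^sup>2 *\<^sub>R (\<Sum>b\<leftarrow>b # bs. ?v b)
    = (run z (moves t c bs r) ?y - ?y - t\<^sup>2 *\<^sub>R (\<Sum>b\<leftarrow>bs. ?v b)) + (?y - x - (r \<bullet> b * t\<^sup>2) *\<^sub>R direction a A (c b))"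
    by (simp add: moves_def run_append algebra_simps)
  then show ?case
    using norm_triangle_mono[OF 2 1] by (simp add: algebra_simps)
qed

text \<open>After division by \<open>t\<^sup>2\<close> the displacement \<open>\<theta>\<close>
  differs by at most 1 from the linear isomorphism \<open>T\<close> on \<open>cball 0 K\<close>.
  Solving \<open>\<theta> r = w\<close> means finding a fixed point of
  \<open>G (w - (\<theta> r - T r))\<close> in \<open>r\<close>, with \<open>G\<close> the inverse
  of \<open>T\<close>, and \<open>\<beta> * (M + 1) \<le> K\<close> makes the ball
  invariant.\<close>

lemma ball_covered_by_moves:
  assumes bs: "distinct bs" "set bs = Basis"
    and inv: "\<And>w. \<exists>r. (\<Sum>b\<in>Basis. (r \<bullet> b) *\<^sub>R direction a A (c b)) = w \<and> norm r \<le> \<beta> * norm w"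
    and \<beta>: "\<beta> \<ge> 0" "\<beta> * (M + 1) \<le> K" and e: "DIM('a) * err \<le> 1"
    and x: "norm x + (4 * DIM('a) + 2) * (L * (K * t)) < \<rho>"
  shows "cball x (M * t\<^sup>2) \<subseteq> (\<lambda>r. run z (moves t c bs r) x) ` cball 0 K"
proof
  fix y assume y: "y \<in> cball x (M * t\<^sup>2)"
  let ?n = "DIM('a)"
  have len: "length bs = ?n" using bs distinct_card[of bs] by simp
  define T where "T r = (\<Sum>b\<in>Basis. (r \<bullet> b) *\<^sub>R direction a A (c b))" for r
  have T: "linear T"
    by (rule linearI) (simp_all add: T_def inner_add_left scaleR_add_left sum.distrib scaleR_sum_right)
  have surj: "surj T"
    unfolding surj_def
  proof
    fix w
    show "\<exists>r. w = T r" using inv[of w] unfolding T_def by blast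
  qed
  then have inj: "inj T" using linear_surjective_imp_injective[OF T] by blast
  obtain G where G: "linear G" "G \<circ> T = id" using linear_injective_left_inverse[OF T inj] by auto
  have GT: "G (T r) = r" for r using G(2) by (metis comp_apply id_apply)
  have TG: "T (G w) = w" for w using surj GT by (metis surj_def)
  have Gn: "norm (G w) \<le> \<beta> * norm w" for w
  proof -
    obtain r where "T r = w" "norm r \<le> \<beta> * norm w" using inv unfolding T_def by blast
    then show ?thesis using GT by auto
  qed
  let ?\<Phi> = "\<lambda>r. run z (moves t c bs r) x"
  define \<theta> where "\<theta> r = (1 / t\<^sup>2) *\<^sub>R (?\<Phi> r - x)" for r
  have cont: "continuous_on (cball 0 K) ?\<Phi>"
  proof -
    have "(81 ^ ?n * (?n * (162 * L\<^sup>2 * t\<^sup>2)))-lipschitz_on (cball 0 K) ?\<Phi>"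
      using moves_lipschitz_param_aux[of bs _ _ x x] bs len
      by (intro lipschitz_onI) (auto simp: dist_norm mult.assoc)
    then show ?thesis by (rule lipschitz_on_continuous_on)
  qed
  have near: "norm (\<theta> r - T r) \<le> 1" if "norm r \<le> K" for r
  proof -
    have "norm (?\<Phi> r - x - t\<^sup>2 *\<^sub>R T r) \<le> ?n * (err * t\<^sup>2)"
      using moves_expansion[of bs r x] bs that x len by (simp add: T_def sum_list_distinct_conv_sum_set)
    moreover have "\<theta> r - T r = (1 / t\<^sup>2) *\<^sub>R (?\<Phi> r - x - t\<^sup>2 *\<^sub>R T r)"
      using t by (simp add: \<theta>_def algebra_simps)
    moreover from this have "norm (\<theta> r - T r) = norm (?\<Phi> r - x - t\<^sup>2 *\<^sub>R T r) / t\<^sup>2" by simp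
    ultimately have "norm (\<theta> r - T r) \<le> ?n * err"
      using t by (simp add: pos_divide_le_eq mult.assoc)
    then show ?thesis using e by linarith
  qed
  define w where "w = (1 / t\<^sup>2) *\<^sub>R (y - x)"
  have w: "norm w \<le> M" using y t by (simp add: w_def dist_norm norm_minus_commute pos_divide_le_eq)
  have Kpos: "0 < K" using K by simp
  have "continuous_on (cball 0 K) (\<lambda>r. G (w - (\<theta> r - T r)))"
    using T G(1) cont unfolding \<theta>_def
    by (intro continuous_intros linear_continuous_on_compose[of _ _ G] linear_continuous_on_compose[of _ _ T]) auto
  moreover have "(\<lambda>r. G (w - (\<theta> r - T r))) \<in> cball (0::'a) K \<rightarrow> cball 0 K"
  proof
    fix r :: 'a assume "r \<in> cball 0 K"
    then have "norm (\<theta> r - T r) \<le> 1" by (intro near) auto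
    then have "norm (w - (\<theta> r - T r)) \<le> M + 1" using w norm_triangle_ineq4[of w "\<theta> r - T r"] by linarith
    then have "norm (G (w - (\<theta> r - T r))) \<le> \<beta> * (M + 1)"
      using Gn[of "w - (\<theta> r - T r)"] \<beta>(1) by (meson mult_left_mono order_trans)
    then show "G (w - (\<theta> r - T r)) \<in> cball 0 K" using \<beta>(2) by simp
  qed
  ultimately obtain r where r: "r \<in> cball 0 K" "G (w - (\<theta> r - T r)) = r"
    using brouwer_ball[OF Kpos, of 0 "\<lambda>r. G (w - (\<theta> r - T r))"] by blast
  have "T r = w - (\<theta> r - T r)" using TG[of "w - (\<theta> r - T r)"] r(2) by simp
  then have "\<theta> r = w" by simp
  then have "?\<Phi> r = y" using t by (simp add: \<theta>_def w_def)
  then show "y \<in> ?\<Phi> ` cball 0 K" using r(1) by blast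
qed

end

section \<open>Differences along flows in the mean\<close>

text \<open>The indicator sits inside \<open>ennreal\<close> so that it can act as the weight, or as
  part of the weight, in \<open>holder_weighted\<close>.\<close>

lemma abs_diff_le_nn_integral_deriv:
  fixes h h' :: "real \<Rightarrow> real"
  assumes "a \<le> b" and h: "\<And>s. s \<in> {a..b} \<Longrightarrow> (h has_real_derivative h' s) (at s within {a..b})"
    and cont: "continuous_on {a..b} h'"
  shows "ennreal \<bar>h b - h a\<bar> \<le> (\<integral>\<^sup>+s. ennreal (\<bar>h' s\<bar> * indicator {a..b} s) \<partial>lborel)"
proof -
  have 1: "(h' has_integral (h b - h a)) {a..b}"
    using assms(1) h by (intro fundamental_theorem_of_calculus) (auto simp flip: has_real_derivative_iff_has_vector_derivative)
  have 2: "(\<lambda>s. \<bar>h' s\<bar>) integrable_on {a..b}"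
    by (intro integrable_continuous_interval continuous_intros cont)
  then have 3: "((\<lambda>s. \<bar>h' s\<bar>) has_integral integral {a..b} (\<lambda>s. \<bar>h' s\<bar>)) {a..b}" by (rule integrable_integral)
  have "\<bar>h b - h a\<bar> \<le> integral {a..b} (\<lambda>s. \<bar>h' s\<bar>)"
    using integral_norm_bound_integral[of h' "{a..b}" "\<lambda>s. \<bar>h' s\<bar>"] 1 2 by (auto simp: integrable_on_def integral_unique[OF 1])
  then have "ennreal \<bar>h b - h a\<bar> \<le> ennreal (integral {a..b} (\<lambda>s. \<bar>h' s\<bar>))" by (rule ennreal_leI)
  also have "\<dots> = (\<integral>\<^sup>+s. ennreal \<bar>h' s\<bar> * indicator {a..b} s \<partial>lborel)"
    using 3 by (intro nn_integral_has_integral_lebesgue'[symmetric]) auto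
  also have "\<dots> = (\<integral>\<^sup>+s. ennreal (\<bar>h' s\<bar> * indicator {a..b} s) \<partial>lborel)"
    by (intro nn_integral_cong) (auto split: split_indicator)
  finally show ?thesis .
qed

text \<open>It is the inverse whose Lipschitz constant enters: the one-sided substitution rule is
  applied to the map \<open>H'\<close> and the integrand \<open>f \<circ> H\<close>.\<close>

lemma nn_integral_compose_bilipschitz:
  fixes H H' :: "'a::euclidean_space \<Rightarrow> 'a" and f :: "'a \<Rightarrow> ennreal"
  assumes lip: "\<And>x y. norm (H' x - H' y) \<le> \<Lambda> * norm (x - y)" and \<Lambda>: "\<Lambda> > 0"
    and inv: "\<And>x. H' (H x) = x" "\<And>x. H (H' x) = x"
    and H: "H \<in> borel_measurable borel" and f: "f \<in> borel_measurable borel"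
  shows "(\<integral>\<^sup>+x. f (H x) \<partial>lborel) \<le> ennreal ((2 * \<Lambda> * DIM('a)) ^ DIM('a)) * (\<integral>\<^sup>+x. f x \<partial>lborel)"
proof -
  have "\<Lambda>-lipschitz_on UNIV H'" using lip \<Lambda> by (intro lipschitz_onI) (auto simp: dist_norm)
  then have H': "H' \<in> borel_measurable borel"
    by (intro borel_measurable_continuous_onI) (rule lipschitz_on_continuous_on)
  have "(\<integral>\<^sup>+x\<in>UNIV. f (H x) \<partial>lborel) \<le> ennreal ((2 * \<Lambda> * DIM('a)) ^ DIM('a)) * (\<integral>\<^sup>+x\<in>UNIV. f (H (H' x)) \<partial>lborel)"
    using lip \<Lambda> inv H f H' measurable_compose[OF H f]
    by (intro nn_integral_lipschitz_pushforward[where F=H']) (auto, metis rangeI)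
  then show ?thesis by (simp add: inv)
qed

text \<open>Measure distortion \<open>(2 * 3 * n) ^ n\<close> of a map whose inverse has Lipschitz
  constant 3, as short-time flows do.\<close>

definition flow_const :: "'a::euclidean_space itself \<Rightarrow> real" where
  "flow_const _ = (6 * real DIM('a)) ^ DIM('a)"

lemma flow_const_ge_1: "1 \<le> flow_const TYPE('a::euclidean_space)"
proof -
  have "1 \<le> real DIM('a)" by (simp add: Suc_leI)
  then show ?thesis unfolding flow_const_def by (intro one_le_power) linarith
qed

lemma gflow_measurable:
  assumes "bounded_lipschitz L Z"
  shows "gflow Z s \<in> borel_measurable borel"
proof -
  have "continuous_on UNIV (\<lambda>x. (\<lambda>(s, x). gflow Z s x) (s, x))"
    by (rule continuous_on_compose2[OF gflow_continuous[OF assms]]) (auto intro!: continuous_intros)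
  then show ?thesis by (intro borel_measurable_continuous_onI) simp
qed

lemma nn_integral_gflow:
  fixes Z :: "'a::euclidean_space \<Rightarrow> 'a"
  assumes Z: "bounded_lipschitz L Z" and s: "L * \<bar>s\<bar> \<le> 1" and f: "f \<in> borel_measurable borel"
  shows "(\<integral>\<^sup>+x. f (gflow Z s x) \<partial>lborel) \<le> ennreal (flow_const TYPE('a)) * (\<integral>\<^sup>+x. f x \<partial>lborel)"
  using nn_integral_compose_bilipschitz[of "gflow Z (-s)" 3 "gflow Z s" f] gflow_lipschitz[OF Z, of "-s"] s f
    gflow_inverse[OF Z] gflow_measurable[OF Z] by (simp add: flow_const_def)

text \<open>The \<open>p\<close>-th power of the norm, with values in \<open>ennreal\<close>: sums,
  Fubini and monotonicity then apply without checking integrability, and roots are taken only at the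
  end.\<close>

definition lpint :: "real \<Rightarrow> ('a::euclidean_space \<Rightarrow> real) \<Rightarrow> ennreal" where
  "lpint p f = (\<integral>\<^sup>+x. ennreal (\<bar>f x\<bar> powr p) \<partial>lborel)"

lemma lpint_add:
  assumes "0 \<le> p" and [measurable]: "f \<in> borel_measurable borel" "g \<in> borel_measurable borel"
  shows "lpint p (\<lambda>x. f x + g x) \<le> ennreal (2 powr p) * (lpint p f + lpint p g)"
proof -
  have "lpint p (\<lambda>x. f x + g x) \<le> (\<integral>\<^sup>+x. ennreal (2 powr p) * (ennreal (\<bar>f x\<bar> powr p) + ennreal (\<bar>g x\<bar> powr p)) \<partial>lborel)"
    unfolding lpint_def
    by (intro nn_integral_mono) (use abs_add_powr_le[OF assms(1)] in \<open>auto simp: ennreal_mult[symmetric] ennreal_plus[symmetric] simp del: ennreal_plus intro!: ennreal_leI\<close>)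
  also have "\<dots> = ennreal (2 powr p) * (lpint p f + lpint p g)"
    unfolding lpint_def by (simp add: nn_integral_cmult nn_integral_add)
  finally show ?thesis .
qed

text \<open>Integrate the derivative along the orbit, apply Jensen's inequality in time, exchange
  the integrals and use that the flow distorts Lebesgue measure boundedly. Time is rescaled to
  \<open>\<sigma> * s\<close> with \<open>\<sigma>\<close> in the unit interval, which treats both
  signs of \<open>s\<close> alike.\<close>

lemma lpint_gflow_difference:
  fixes Z :: "'a::euclidean_space \<Rightarrow> 'a"
  assumes p: "p > 1" and Z: "bounded_lipschitz L Z" and s: "L * \<bar>s\<bar> \<le> 1"
    and u: "\<And>x. (u has_derivative du x) (at x)" and g: "continuous_on UNIV (\<lambda>x. du x (Z x))"
  shows "lpint p (\<lambda>x. u (gflow Z s x) - u x) \<le> ennreal (flow_const TYPE('a) * \<bar>s\<bar> powr p) * lpint p (\<lambda>x. du x (Z x))"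
proof -
  define G where "G x = du x (Z x)" for x
  have Gc: "continuous_on UNIV G" using g by (simp add: G_def[abs_def])
  have flowc: "continuous_on UNIV (\<lambda>(\<sigma>, x). gflow Z (\<sigma> * s) x)"
  proof -
    have "continuous_on UNIV (\<lambda>z. (\<lambda>(s, x). gflow Z s x) (fst z * s, snd z))"
      by (rule continuous_on_compose2[OF gflow_continuous[OF Z]]) (auto intro!: continuous_intros)
    then show ?thesis by (simp add: case_prod_unfold)
  qed
  have GPc: "continuous_on UNIV (\<lambda>(\<sigma>, x). G (gflow Z (\<sigma> * s) x))"
    using continuous_on_compose2[OF Gc flowc] by (simp add: case_prod_unfold)
  have GPm[measurable]: "(\<lambda>(\<sigma>, x). G (gflow Z (\<sigma> * s) x)) \<in> borel_measurable (borel \<Otimes>\<^sub>M borel)"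
    unfolding borel_prod by (rule borel_measurable_continuous_onI[OF GPc])
  have GPc1: "continuous_on UNIV (\<lambda>\<sigma>. G (gflow Z (\<sigma> * s) x))" for x
  proof -
    have "continuous_on UNIV (\<lambda>\<sigma>::real. (\<sigma>, x))" by (intro continuous_intros)
    from continuous_on_compose2[OF GPc this] show ?thesis by simp
  qed
  have [measurable]: "G \<in> borel_measurable borel" by (rule borel_measurable_continuous_onI[OF Gc])
  have pt: "ennreal (\<bar>u (gflow Z s x) - u x\<bar> powr p)
    \<le> (\<integral>\<^sup>+\<sigma>. ennreal (\<bar>s\<bar> powr p) * (ennreal (\<bar>G (gflow Z (\<sigma> * s) x)\<bar> powr p) * indicator {0..1} \<sigma>) \<partial>lborel)" for x
  proof -
    have [measurable]: "(\<lambda>\<sigma>. G (gflow Z (\<sigma> * s) x)) \<in> borel_measurable borel"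
      by (rule borel_measurable_continuous_onI[OF GPc1])
    have der: "((\<lambda>\<sigma>. u (gflow Z (\<sigma> * s) x)) has_real_derivative s * G (gflow Z (\<sigma> * s) x)) (at \<sigma> within {0..1})" for \<sigma>
    proof -
      have "((\<lambda>\<sigma>. gflow Z (\<sigma> * s) x) has_derivative (\<lambda>h. (h * s) *\<^sub>R Z (gflow Z (\<sigma> * s) x))) (at \<sigma> within {0..1})"
      proof -
        have 1: "((\<lambda>\<sigma>. \<sigma> * s) has_derivative (\<lambda>h. h * s)) (at \<sigma> within {0..1})"
          by (auto intro!: derivative_eq_intros)
        show ?thesis
          by (rule has_derivative_compose[OF 1 gflow_has_vector_derivative[OF Z, of x "\<sigma> * s" UNIV, unfolded has_vector_derivative_def]])
      qed
      from has_derivative_compose[OF this u[of "gflow Z (\<sigma> * s) x"]]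
      have "((\<lambda>\<sigma>. u (gflow Z (\<sigma> * s) x)) has_derivative (\<lambda>h. du (gflow Z (\<sigma> * s) x) ((h * s) *\<^sub>R Z (gflow Z (\<sigma> * s) x)))) (at \<sigma> within {0..1})" .
      moreover have "du (gflow Z (\<sigma> * s) x) ((h * s) *\<^sub>R Z (gflow Z (\<sigma> * s) x)) = (s * G (gflow Z (\<sigma> * s) x)) * h" for h
        using linear_scale[OF has_derivative_linear[OF u]] by (simp add: G_def)
      ultimately show ?thesis by (simp add: has_field_derivative_def)
    qed
    have "ennreal \<bar>u (gflow Z (1 * s) x) - u (gflow Z (0 * s) x)\<bar> \<le> (\<integral>\<^sup>+\<sigma>. ennreal (\<bar>s * G (gflow Z (\<sigma> * s) x)\<bar> * indicator {0..1} \<sigma>) \<partial>lborel)"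
      by (rule abs_diff_le_nn_integral_deriv[of 0 1 "\<lambda>\<sigma>. u (gflow Z (\<sigma> * s) x)"])
         (auto intro!: der continuous_intros continuous_on_subset[OF GPc1])
    then have "ennreal \<bar>u (gflow Z s x) - u x\<bar> \<le> (\<integral>\<^sup>+\<sigma>. ennreal (\<bar>s * G (gflow Z (\<sigma> * s) x)\<bar> * indicator {0..1} \<sigma>) \<partial>lborel)"
      by (simp add: gflow_0[OF Z])
    \<comment> \<open>The weight is the indicator of the unit interval, of mass 1.\<close>
    from holder_weighted[OF p _ _ _ _ _ _ this, of 1]
    have "ennreal (\<bar>u (gflow Z s x) - u x\<bar> powr p) \<le> ennreal (1 powr (p - 1)) * (\<integral>\<^sup>+\<sigma>. ennreal (\<bar>s * G (gflow Z (\<sigma> * s) x)\<bar> powr p * indicator {0..1} \<sigma>) \<partial>lborel)"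
      by (auto simp: ennreal_indicator)
    also have "\<dots> = (\<integral>\<^sup>+\<sigma>. ennreal (\<bar>s\<bar> powr p) * (ennreal (\<bar>G (gflow Z (\<sigma> * s) x)\<bar> powr p) * indicator {0..1} \<sigma>) \<partial>lborel)"
      by (auto intro!: nn_integral_cong simp: abs_mult powr_mult ennreal_mult[symmetric] split: split_indicator)
    finally show ?thesis .
  qed
  have "lpint p (\<lambda>x. u (gflow Z s x) - u x)
     \<le> (\<integral>\<^sup>+x. (\<integral>\<^sup>+\<sigma>. ennreal (\<bar>s\<bar> powr p) * (ennreal (\<bar>G (gflow Z (\<sigma> * s) x)\<bar> powr p) * indicator {0..1} \<sigma>) \<partial>lborel) \<partial>lborel)"
    unfolding lpint_def by (intro nn_integral_mono pt)
  also have "\<dots> = (\<integral>\<^sup>+\<sigma>. (\<integral>\<^sup>+x. ennreal (\<bar>s\<bar> powr p) * (ennreal (\<bar>G (gflow Z (\<sigma> * s) x)\<bar> powr p) * indicator {0..1} \<sigma>) \<partial>lborel) \<partial>lborel)"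
    by (rule lborel_pair.Fubini'[of "\<lambda>\<sigma> x. ennreal (\<bar>s\<bar> powr p) * (ennreal (\<bar>G (gflow Z (\<sigma> * s) x)\<bar> powr p) * indicator {0..1} \<sigma>)"]) measurable
  also have "\<dots> \<le> (\<integral>\<^sup>+\<sigma>. ennreal (flow_const TYPE('a) * \<bar>s\<bar> powr p) * lpint p G * indicator {0..1::real} \<sigma> \<partial>lborel)"
  proof (rule nn_integral_mono)
    fix \<sigma> :: real
    show "(\<integral>\<^sup>+x. ennreal (\<bar>s\<bar> powr p) * (ennreal (\<bar>G (gflow Z (\<sigma> * s) x)\<bar> powr p) * indicator {0..1} \<sigma>) \<partial>lborel)
      \<le> ennreal (flow_const TYPE('a) * \<bar>s\<bar> powr p) * lpint p G * indicator {0..1} \<sigma>"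
    proof (cases "\<sigma> \<in> {0..1}")
      case True
      have [measurable]: "gflow Z (\<sigma> * s) \<in> borel_measurable borel" by (rule gflow_measurable[OF Z])
      have L: "L \<ge> 1" using bounded_lipschitzD(1)[OF Z] .
      have "L * \<bar>\<sigma> * s\<bar> \<le> L * \<bar>s\<bar>" using True L by (intro mult_left_mono) (auto simp: abs_mult mult_left_le_one_le)
      then have "L * \<bar>\<sigma> * s\<bar> \<le> 1" using s by linarith
      then have "(\<integral>\<^sup>+x. ennreal (\<bar>G (gflow Z (\<sigma> * s) x)\<bar> powr p) \<partial>lborel) \<le> ennreal (flow_const TYPE('a)) * lpint p G"
        unfolding lpint_def by (intro nn_integral_gflow[OF Z, of "\<sigma> * s" "\<lambda>x. ennreal (\<bar>G x\<bar> powr p)"]) auto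
      then have "ennreal (\<bar>s\<bar> powr p) * (\<integral>\<^sup>+x. ennreal (\<bar>G (gflow Z (\<sigma> * s) x)\<bar> powr p) \<partial>lborel)
        \<le> ennreal (\<bar>s\<bar> powr p) * (ennreal (flow_const TYPE('a)) * lpint p G)" by (rule mult_left_mono) auto
      also have "\<dots> = ennreal (flow_const TYPE('a) * \<bar>s\<bar> powr p) * lpint p G"
        using flow_const_ge_1[where 'a='a] by (simp add: ennreal_mult mult_ac)
      finally show ?thesis using True by (simp add: nn_integral_cmult)
    qed simp
  qed
  also have "\<dots> = ennreal (flow_const TYPE('a) * \<bar>s\<bar> powr p) * lpint p G" by (simp add: nn_integral_cmult)
  finally show ?thesis by (simp add: G_def[abs_def])
qed

text \<open>Cost of one flow in a word: \<open>2 powr p\<close> for splitting off a term and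
  \<open>flow_const\<close> for pulling the rest back through the flow.\<close>

definition step_const :: "'a::euclidean_space itself \<Rightarrow> real \<Rightarrow> real" where
  "step_const _ p = 2 powr p * flow_const TYPE('a)"

lemma step_const_ge_1: "p \<ge> 0 \<Longrightarrow> 1 \<le> step_const TYPE('a::euclidean_space) p"
  unfolding step_const_def
  using mult_mono[OF ge_one_powr_ge_zero[of 2 p] flow_const_ge_1[where 'a='a]] by simp

text \<open>Telescoping along the word: the first flow is compared with the identity, and the
  difference produced by the remaining word is evaluated after that flow. The exponential dependence
  on the length is harmless, as the words used have at most four letters per dimension.\<close>

lemma lpint_run_difference:
  fixes z :: "nat \<Rightarrow> 'a::euclidean_space \<Rightarrow> 'a"
  assumes p: "p > 1" and z: "\<And>j. j \<in> J \<Longrightarrow> bounded_lipschitz L (z j)" and J: "finite J"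
    and ms: "set ms \<subseteq> J \<times> {- \<kappa>..\<kappa>}" and \<kappa>: "L * \<kappa> \<le> 1"
    and u: "\<And>x. (u has_derivative du x) (at x)" and g: "\<And>j. j \<in> J \<Longrightarrow> continuous_on UNIV (\<lambda>x. du x (z j x))"
  shows "lpint p (\<lambda>x. u (run z ms x) - u x)
    \<le> ennreal (length ms * step_const TYPE('a) p ^ length ms * \<kappa> powr p) * (\<Sum>j\<in>J. lpint p (\<lambda>x. du x (z j x)))"
  using ms
proof (induction ms)
  case Nil
  then show ?case using p by (simp add: lpint_def)
next
  case (Cons m ms)
  let ?B = "step_const TYPE('a) p" and ?c = "flow_const TYPE('a)" and ?G = "\<Sum>j\<in>J. lpint p (\<lambda>x. du x (z j x))"
  let ?P = "gflow (z (fst m)) (snd m)" and ?l = "length ms"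
  have B: "1 \<le> ?B" using p by (intro step_const_ge_1) auto
  have c: "1 \<le> ?c" by (rule flow_const_ge_1)
  have m: "fst m \<in> J" "\<bar>snd m\<bar> \<le> \<kappa>" and ms: "set ms \<subseteq> J \<times> {- \<kappa>..\<kappa>}" using Cons.prems by auto
  note Z = z[OF m(1)]
  have Lm: "L * \<bar>snd m\<bar> \<le> 1" using mult_left_mono[OF m(2), of L] bounded_lipschitzD(1)[OF Z] \<kappa> by linarith
  have uc: "continuous_on UNIV u" using u has_derivative_continuous continuous_at_imp_continuous_on by blast
  have um[measurable]: "u \<in> borel_measurable borel" by (rule borel_measurable_continuous_onI[OF uc])
  have [measurable]: "?P \<in> borel_measurable borel" by (rule gflow_measurable[OF Z])
  have [measurable]: "run z ms \<in> borel_measurable borel"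
    by (rule borel_measurable_continuous_onI[OF run_continuous[OF z ms \<kappa>]])
  have "lpint p (\<lambda>x. u (run z (m # ms) x) - u x) = lpint p (\<lambda>x. (u (run z ms (?P x)) - u (?P x)) + (u (?P x) - u x))"
    by simp
  also have "\<dots> \<le> ennreal (2 powr p) * (lpint p (\<lambda>x. u (run z ms (?P x)) - u (?P x)) + lpint p (\<lambda>x. u (?P x) - u x))"
    using p by (intro lpint_add) auto
  also have "\<dots> \<le> ennreal (2 powr p) * (ennreal (?c * (?l * ?B ^ ?l * \<kappa> powr p)) * ?G + ennreal (?c * \<kappa> powr p) * ?G)"
  proof (intro mult_left_mono add_mono)
    have "lpint p (\<lambda>x. u (run z ms (?P x)) - u (?P x)) \<le> ennreal ?c * lpint p (\<lambda>x. u (run z ms x) - u x)"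
      unfolding lpint_def by (rule nn_integral_gflow[OF Z Lm, of "\<lambda>x. ennreal (\<bar>u (run z ms x) - u x\<bar> powr p)"]) measurable
    also have "\<dots> \<le> ennreal ?c * (ennreal (?l * ?B ^ ?l * \<kappa> powr p) * ?G)"
      by (intro mult_left_mono Cons.IH ms) auto
    also have "\<dots> = ennreal (?c * (?l * ?B ^ ?l * \<kappa> powr p)) * ?G"
      using B c by (simp add: ennreal_mult mult.assoc)
    finally show "lpint p (\<lambda>x. u (run z ms (?P x)) - u (?P x)) \<le> ennreal (?c * (?l * ?B ^ ?l * \<kappa> powr p)) * ?G" .
    have "lpint p (\<lambda>x. u (?P x) - u x) \<le> ennreal (?c * \<bar>snd m\<bar> powr p) * lpint p (\<lambda>x. du x (z (fst m) x))"
      by (rule lpint_gflow_difference[OF p Z Lm u g[OF m(1)]])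
    also have "\<dots> \<le> ennreal (?c * \<kappa> powr p) * ?G"
    proof (intro mult_mono)
      show "ennreal (?c * \<bar>snd m\<bar> powr p) \<le> ennreal (?c * \<kappa> powr p)"
        using c m(2) p by (intro ennreal_leI mult_left_mono powr_mono2) auto
      show "lpint p (\<lambda>x. du x (z (fst m) x)) \<le> ?G"
        using m(1) J by (intro member_le_sum) auto
    qed auto
    finally show "lpint p (\<lambda>x. u (?P x) - u x) \<le> ennreal (?c * \<kappa> powr p) * ?G" .
  qed auto
  also have "\<dots> = ennreal (2 powr p * (?c * (?l * ?B ^ ?l * \<kappa> powr p) + ?c * \<kappa> powr p)) * ?G"
    using B c by (simp add: ennreal_mult ennreal_plus distrib_right[symmetric] mult.assoc[symmetric])
  also have "\<dots> \<le> ennreal (length (m # ms) * ?B ^ length (m # ms) * \<kappa> powr p) * ?G"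
  proof (intro mult_right_mono ennreal_leI)
    have "2 powr p * (?c * (?l * ?B ^ ?l * \<kappa> powr p) + ?c * \<kappa> powr p) = (?l * ?B ^ Suc ?l + ?B) * \<kappa> powr p"
      by (simp add: step_const_def algebra_simps)
    also have "\<dots> \<le> (?l * ?B ^ Suc ?l + ?B ^ Suc ?l) * \<kappa> powr p"
      using B power_increasing[of 1 "Suc ?l" ?B] by (intro mult_right_mono add_left_mono) auto
    finally show "2 powr p * (?c * (?l * ?B ^ ?l * \<kappa> powr p) + ?c * \<kappa> powr p) \<le> length (m # ms) * ?B ^ length (m # ms) * \<kappa> powr p"
      by (simp add: algebra_simps)
  qed auto
  finally show ?case .
qed

section \<open>Averages over balls with radius of order \<open>t\<^sup>2\<close>\<close>

context bracket_frame
begin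

definition "lip_const = 81 ^ DIM('a) * (1 + DIM('a) * (162 * L\<^sup>2))"

text \<open>Product of the measure distortion of the parametrization, the volume of the parameter
  ball, and the cost of a word of at most four flows per dimension with times up to
  \<open>K * t\<close>; all powers of \<open>t\<close> are left out.\<close>

definition "ball_const p = (2 * lip_const * DIM('a)) ^ DIM('a) * measure lborel (cball (0::'a) K)
    * (4 * DIM('a) * step_const TYPE('a) p ^ (4 * DIM('a)) * K powr p)"

text \<open>For each \<open>x\<close> near the support the ball is covered by endpoints of words, so
  the integral over \<open>y\<close> becomes one over the parameter \<open>r\<close> with the factor
  \<open>t ^ (2 * n)\<close>, \<open>n\<close> the dimension. After exchanging the integrals
  \<open>r\<close> is fixed, and the word is one and the same composition of flows for all
  \<open>x\<close>.\<close>

lemma ball_average_difference: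
  assumes p: "p > 1" and J: "finite J"
    and inv: "\<And>w. \<exists>r. (\<Sum>b\<in>Basis. (r \<bullet> b) *\<^sub>R direction a A (c b)) = w \<and> norm r \<le> \<beta> * norm w"
    and \<beta>: "\<beta> \<ge> 0" "\<beta> * (M + 1) \<le> K" and e: "DIM('a) * err \<le> 1"
    and u: "\<And>x. (u has_derivative du x) (at x)" and g: "\<And>j. j \<in> J \<Longrightarrow> continuous_on UNIV (\<lambda>x. du x (z j x))"
    and supp: "\<And>x. \<rho>\<^sub>1 \<le> norm x \<Longrightarrow> u x = 0"
    and \<rho>: "\<rho>\<^sub>1 + M * t\<^sup>2 + (4 * DIM('a) + 2) * (L * (K * t)) < \<rho>" and M: "M \<ge> 0"
  shows "(\<integral>\<^sup>+x. (\<integral>\<^sup>+y\<in>cball x (M * t\<^sup>2). ennreal (\<bar>u x - u y\<bar> powr p) \<partial>lborel) \<partial>lborel)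
    \<le> ennreal (ball_const p * (t ^ (2 * DIM('a)) * t powr p)) * (\<Sum>j\<in>J. lpint p (\<lambda>x. du x (z j x)))"
proof -
  let ?n = "DIM('a)" and ?G = "\<Sum>j\<in>J. lpint p (\<lambda>x. du x (z j x))"
  obtain bs :: "'a list" where bs: "distinct bs" "set bs = Basis"
    using finite_distinct_list[OF finite_Basis] by metis
  have len: "length bs = ?n" using bs distinct_card[of bs] by simp
  have Kpos: "0 < K" using K by simp
  have [measurable]: "cball (0::'a) K \<in> sets borel" by auto
  have uc: "continuous_on UNIV u" using u has_derivative_continuous continuous_at_imp_continuous_on by blast
  have um[measurable]: "u \<in> borel_measurable borel" by (rule borel_measurable_continuous_onI[OF uc])
  \<comment> \<open>Projecting the parameter to the ball extends the parametrization to all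
    \<open>r\<close>, globally Lipschitz in both variables and hence jointly measurable, without
    changing it on \<open>cball 0 K\<close>.\<close>
  define clip where "clip = closest_point (cball (0::'a) K)"
  have clip: "norm (clip r) \<le> K" "norm (clip r - clip r') \<le> norm (r - r')" "norm r \<le> K \<Longrightarrow> clip r = r" for r r'
  proof -
    have "clip r \<in> cball 0 K" unfolding clip_def using Kpos by (intro closest_point_in_set) auto
    then show "norm (clip r) \<le> K" by simp
    show "norm (clip r - clip r') \<le> norm (r - r')"
      using closest_point_lipschitz[of "cball (0::'a) K" r r'] Kpos by (auto simp: clip_def dist_norm)
    show "norm r \<le> K \<Longrightarrow> clip r = r" unfolding clip_def by (intro closest_point_self) auto
  qed
  define \<Phi> where "\<Phi> r x = run z (moves t c bs (clip r)) x" for r x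
  let ?\<Lambda> = "lip_const * t\<^sup>2"
  have joint: "norm (\<Phi> r x - \<Phi> r' y) \<le> 81 ^ ?n * (norm (x - y) + ?n * (162 * L\<^sup>2 * t\<^sup>2 * norm (r - r')))" for r r' x y
  proof -
    have "norm (\<Phi> r x - \<Phi> r' y) \<le> 81 ^ ?n * (norm (x - y) + ?n * (162 * L\<^sup>2 * t\<^sup>2 * norm (clip r - clip r')))"
      unfolding \<Phi>_def using moves_lipschitz_param_aux[of bs "clip r" "clip r'" x y] bs len clip(1) by simp
    also have "\<dots> \<le> 81 ^ ?n * (norm (x - y) + ?n * (162 * L\<^sup>2 * t\<^sup>2 * norm (r - r')))"
      using clip(2) by (intro mult_left_mono add_left_mono) auto
    finally show ?thesis .
  qed
  have lip_r: "norm (\<Phi> r x - \<Phi> r' x) \<le> ?\<Lambda> * norm (r - r')" for r r' x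
  proof -
    have "norm (\<Phi> r x - \<Phi> r' x) \<le> 81 ^ ?n * (?n * (162 * L\<^sup>2 * t\<^sup>2 * norm (r - r')))" using joint[of r x r' x] by simp
    also have "\<dots> \<le> 81 ^ ?n * ((1 + ?n * (162 * L\<^sup>2)) * t\<^sup>2 * norm (r - r'))"
      by (intro mult_left_mono) (auto simp: algebra_simps)
    finally show ?thesis by (simp add: lip_const_def mult.assoc)
  qed
  have lip0: "0 < lip_const" unfolding lip_const_def by (intro mult_pos_pos add_pos_nonneg) auto
  have \<Lambda>: "0 < ?\<Lambda>" using lip0 t by simp
  have \<Phi>c: "continuous_on UNIV (\<lambda>(r, x). \<Phi> r x)"
  proof -
    have "(81 ^ ?n * (1 + ?n * (162 * L\<^sup>2 * t\<^sup>2)))-lipschitz_on UNIV (\<lambda>(r, x). \<Phi> r x)"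
    proof (intro lipschitz_onI)
      fix v w :: "'a \<times> 'a"
      obtain r x r' y where vw: "v = (r, x)" "w = (r', y)" by fastforce
      have 1: "norm (x - y) \<le> dist v w" "norm (r - r') \<le> dist v w"
        using dist_snd_le[of v w] dist_fst_le[of v w] by (auto simp: vw dist_norm)
      have "norm (\<Phi> r x - \<Phi> r' y) \<le> 81 ^ ?n * (dist v w + ?n * (162 * L\<^sup>2 * t\<^sup>2 * dist v w))"
        by (rule order_trans[OF joint]) (intro mult_left_mono add_mono 1, auto)
      then show "dist ((\<lambda>(r, x). \<Phi> r x) v) ((\<lambda>(r, x). \<Phi> r x) w) \<le> 81 ^ ?n * (1 + ?n * (162 * L\<^sup>2 * t\<^sup>2)) * dist v w"
        by (simp add: vw dist_norm algebra_simps)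
    qed auto
    then show ?thesis by (rule lipschitz_on_continuous_on)
  qed
  have \<Phi>m[measurable]: "(\<lambda>(r, x). \<Phi> r x) \<in> borel_measurable (borel \<Otimes>\<^sub>M borel)"
    unfolding borel_prod by (rule borel_measurable_continuous_onI[OF \<Phi>c])
  have \<Phi>m1[measurable]: "(\<lambda>r. \<Phi> r x) \<in> borel_measurable borel" for x
    using measurable_compose[OF measurable_Pair1' \<Phi>m, of x] measurable_compose[of "\<lambda>r. (r, x)" borel "borel \<Otimes>\<^sub>M borel" "\<lambda>(r, x). \<Phi> r x" borel] by simp
  let ?c1 = "(2 * ?\<Lambda> * ?n) ^ ?n"
  have inner: "(\<integral>\<^sup>+y\<in>cball x (M * t\<^sup>2). ennreal (\<bar>u x - u y\<bar> powr p) \<partial>lborel)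
     \<le> ennreal ?c1 * (\<integral>\<^sup>+r\<in>cball 0 K. ennreal (\<bar>u (\<Phi> r x) - u x\<bar> powr p) \<partial>lborel)" for x
  proof (cases "norm x < \<rho>\<^sub>1 + M * t\<^sup>2")
    case True
    have "cball x (M * t\<^sup>2) \<subseteq> (\<lambda>r. run z (moves t c bs r) x) ` cball 0 K"
      using True \<rho> by (intro ball_covered_by_moves[OF bs inv \<beta> e]) auto
    also have "\<dots> = (\<lambda>r. \<Phi> r x) ` cball 0 K" by (intro image_cong) (auto simp: \<Phi>_def clip(3))
    finally have "(\<integral>\<^sup>+y\<in>cball x (M * t\<^sup>2). ennreal (\<bar>u x - u y\<bar> powr p) \<partial>lborel)
     \<le> ennreal ?c1 * (\<integral>\<^sup>+r\<in>cball 0 K. ennreal (\<bar>u x - u (\<Phi> r x)\<bar> powr p) \<partial>lborel)"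
      using lip_r \<Lambda> \<Phi>m1 by (intro nn_integral_lipschitz_pushforward[where F="\<lambda>r. \<Phi> r x"]) auto
    then show ?thesis by (simp add: abs_minus_commute)
  next
    case False
    have "0 \<le> M * t\<^sup>2" using M by simp
    then have "u x = 0" using False by (intro supp) linarith
    moreover have "u y = 0" if "y \<in> cball x (M * t\<^sup>2)" for y
      using False that norm_triangle_sub[of x y] by (intro supp) (auto simp: dist_norm)
    ultimately have "(\<integral>\<^sup>+y\<in>cball x (M * t\<^sup>2). ennreal (\<bar>u x - u y\<bar> powr p) \<partial>lborel) = (\<integral>\<^sup>+y. 0 \<partial>(lborel::'a measure))"
      by (intro nn_integral_cong) (auto split: split_indicator)
    then show ?thesis by simp
  qed
  let ?N = "4 * ?n" and ?B = "step_const TYPE('a) p"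
  have B: "1 \<le> ?B" using p by (intro step_const_ge_1) auto
  have lpr: "lpint p (\<lambda>x. u (\<Phi> r x) - u x) \<le> ennreal (real ?N * ?B ^ ?N * (K * t) powr p) * ?G" for r
  proof -
    have sb: "set (moves t c bs (clip r)) \<subseteq> J \<times> {- (K * t)..K * t}" "length (moves t c bs (clip r)) \<le> ?N"
      using moves_bounds[of bs "clip r"] bs clip(1) len by auto
    have "lpint p (\<lambda>x. u (\<Phi> r x) - u x) \<le> ennreal (length (moves t c bs (clip r)) * ?B ^ length (moves t c bs (clip r)) * (K * t) powr p) * ?G"
      unfolding \<Phi>_def by (rule lpint_run_difference[OF p z J sb(1) LKt(1) u g])
    also have "\<dots> \<le> ennreal (real ?N * ?B ^ ?N * (K * t) powr p) * ?G"
      using sb(2) B by (intro mult_right_mono ennreal_leI mult_mono power_increasing) auto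
    finally show ?thesis .
  qed
  have "(\<integral>\<^sup>+x. (\<integral>\<^sup>+r\<in>cball 0 K. ennreal (\<bar>u (\<Phi> r x) - u x\<bar> powr p) \<partial>lborel) \<partial>lborel)
     = (\<integral>\<^sup>+r. (\<integral>\<^sup>+x. ennreal (\<bar>u (\<Phi> r x) - u x\<bar> powr p) * indicator (cball 0 K) r \<partial>lborel) \<partial>lborel)"
    by (rule lborel_pair.Fubini'[of "\<lambda>r x. ennreal (\<bar>u (\<Phi> r x) - u x\<bar> powr p) * indicator (cball 0 K) r"]) measurable
  also have "\<dots> \<le> (\<integral>\<^sup>+r. ennreal (real ?N * ?B ^ ?N * (K * t) powr p) * ?G * indicator (cball (0::'a) K) r \<partial>lborel)"
  proof (rule nn_integral_mono)
    fix r :: 'a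
    show "(\<integral>\<^sup>+x. ennreal (\<bar>u (\<Phi> r x) - u x\<bar> powr p) * indicator (cball 0 K) r \<partial>lborel)
      \<le> ennreal (real ?N * ?B ^ ?N * (K * t) powr p) * ?G * indicator (cball 0 K) r"
      using lpr[of r] unfolding lpint_def by (auto split: split_indicator)
  qed
  also have "\<dots> = ennreal (real ?N * ?B ^ ?N * (K * t) powr p) * ?G * ennreal (measure lborel (cball (0::'a) K))"
    using emeasure_lborel_cball_finite[of "0::'a" K]
    by (subst nn_integral_cmult) (auto simp: emeasure_eq_ennreal_measure)
  finally have R: "(\<integral>\<^sup>+x. (\<integral>\<^sup>+r\<in>cball 0 K. ennreal (\<bar>u (\<Phi> r x) - u x\<bar> powr p) \<partial>lborel) \<partial>lborel) \<le> ennreal (real ?N * ?B ^ ?N * (K * t) powr p) * ?G * ennreal (measure lborel (cball (0::'a) K))" .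
  have "(\<integral>\<^sup>+x. (\<integral>\<^sup>+y\<in>cball x (M * t\<^sup>2). ennreal (\<bar>u x - u y\<bar> powr p) \<partial>lborel) \<partial>lborel)
    \<le> (\<integral>\<^sup>+x. ennreal ?c1 * (\<integral>\<^sup>+r\<in>cball 0 K. ennreal (\<bar>u (\<Phi> r x) - u x\<bar> powr p) \<partial>lborel) \<partial>lborel)"
    by (intro nn_integral_mono inner)
  also have "\<dots> = ennreal ?c1 * (\<integral>\<^sup>+x. (\<integral>\<^sup>+r\<in>cball 0 K. ennreal (\<bar>u (\<Phi> r x) - u x\<bar> powr p) \<partial>lborel) \<partial>lborel)"
    by (rule nn_integral_cmult) measurable
  also have "\<dots> \<le> ennreal ?c1 * (ennreal (real ?N * ?B ^ ?N * (K * t) powr p) * ?G * ennreal (measure lborel (cball (0::'a) K)))" by (intro mult_left_mono R) auto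
  also have "\<dots> = ennreal (ball_const p * (t ^ (2 * ?n) * t powr p)) * ?G"
  proof -
    have "ennreal ?c1 * (ennreal (real ?N * ?B ^ ?N * (K * t) powr p) * ?G * ennreal (measure lborel (cball (0::'a) K)))
      = ennreal (?c1 * (real ?N * ?B ^ ?N * (K * t) powr p) * measure lborel (cball (0::'a) K)) * ?G"
    proof -
      have eq: "ennreal a * (ennreal b * H * ennreal c) = ennreal (a * b * c) * H" if "0 \<le> a" "0 \<le> b" "0 \<le> c" for a b c H
        using that by (simp add: ennreal_mult mult_ac)
      show ?thesis using \<Lambda> B by (intro eq) auto
    qed
    also have "?c1 * (real ?N * ?B ^ ?N * (K * t) powr p) * measure lborel (cball (0::'a) K) = ball_const p * (t ^ (2 * ?n) * t powr p)"
      using K t unfolding power_mult[of t 2 ?n] by (simp add: ball_const_def powr_mult power_mult_distrib mult_ac)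
    finally show ?thesis .
  qed
  finally show ?thesis .
qed

text \<open>Insert a third point \<open>w\<close>, averaged over the ball of radius
  \<open>t\<^sup>2\<close> about \<open>P y\<close>; it lies within
  \<open>(M + 1) * t\<^sup>2\<close> of both \<open>P y\<close> and \<open>Q y\<close>, so both
  differences are ball averages composed with maps that distort measure by at most
  \<open>\<Lambda>\<close>. Division by the volume of the small ball removes the factor
  \<open>t ^ (2 * DIM('a))\<close>.\<close>

lemma lpint_nearby_maps_difference:
  assumes p: "p > 1" and J: "finite J"
    and inv: "\<And>w. \<exists>r. (\<Sum>b\<in>Basis. (r \<bullet> b) *\<^sub>R direction a A (c b)) = w \<and> norm r \<le> \<beta> * norm w"
    and \<beta>: "\<beta> \<ge> 0" "\<beta> * (M + 2) \<le> K" and e: "DIM('a) * err \<le> 1"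
    and u: "\<And>x. (u has_derivative du x) (at x)" and g: "\<And>j. j \<in> J \<Longrightarrow> continuous_on UNIV (\<lambda>x. du x (z j x))"
    and supp: "\<And>x. \<rho>\<^sub>1 \<le> norm x \<Longrightarrow> u x = 0"
    and \<rho>: "\<rho>\<^sub>1 + (M + 1) * t\<^sup>2 + (4 * DIM('a) + 2) * (L * (K * t)) < \<rho>" and M: "M \<ge> 0"
    and near: "\<And>y. norm (P y - Q y) \<le> M * t\<^sup>2" and \<Lambda>: "\<Lambda> \<ge> 0"
    and P[measurable]: "P \<in> borel_measurable borel" and Q[measurable]: "Q \<in> borel_measurable borel"
    and Pb: "\<And>f. f \<in> borel_measurable borel \<Longrightarrow> (\<integral>\<^sup>+x. f (P x) \<partial>lborel) \<le> ennreal \<Lambda> * (\<integral>\<^sup>+x. f x \<partial>lborel)"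
    and Qb: "\<And>f. f \<in> borel_measurable borel \<Longrightarrow> (\<integral>\<^sup>+x. f (Q x) \<partial>lborel) \<le> ennreal \<Lambda> * (\<integral>\<^sup>+x. f x \<partial>lborel)"
  shows "lpint p (\<lambda>y. u (P y) - u (Q y))
    \<le> ennreal (2 powr p * (2 * \<Lambda> * ball_const p) / unit_ball_vol (DIM('a)) * t powr p) * (\<Sum>j\<in>J. lpint p (\<lambda>x. du x (z j x)))"
proof -
  let ?n = "DIM('a)" and ?G = "\<Sum>j\<in>J. lpint p (\<lambda>x. du x (z j x))"
  have uc: "continuous_on UNIV u" using u has_derivative_continuous continuous_at_imp_continuous_on by blast
  have um[measurable]: "u \<in> borel_measurable borel" by (rule borel_measurable_continuous_onI[OF uc])
  \<comment> \<open>The ball is expressed by a condition on the distance, which is jointly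
    measurable in \<open>x\<close> and \<open>y\<close>.\<close>
  define I where "I x = (\<integral>\<^sup>+y. ennreal (\<bar>u x - u y\<bar> powr p) * (if dist x y \<le> (M + 1) * t\<^sup>2 then 1 else 0) \<partial>lborel)" for x
  have Im[measurable]: "I \<in> borel_measurable borel" unfolding I_def by measurable
  have IG: "(\<integral>\<^sup>+x. I x \<partial>lborel) \<le> ennreal (ball_const p * (t ^ (2 * ?n) * t powr p)) * ?G"
  proof -
    have "(\<integral>\<^sup>+x. I x \<partial>lborel) = (\<integral>\<^sup>+x. (\<integral>\<^sup>+y\<in>cball x ((M + 1) * t\<^sup>2). ennreal (\<bar>u x - u y\<bar> powr p) \<partial>lborel) \<partial>lborel)"
      unfolding I_def by (intro nn_integral_cong) (auto split: split_indicator)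
    also have "\<dots> \<le> ennreal (ball_const p * (t ^ (2 * ?n) * t powr p)) * ?G"
    proof (rule ball_average_difference[OF p J inv _ _ e u g supp])
      show "\<beta> * (M + 1 + 1) \<le> K" using \<beta>(2) by (simp add: algebra_simps)
    qed (use \<beta> M \<rho> in auto)
    finally show ?thesis .
  qed
  let ?v = "unit_ball_vol (real ?n) * (t\<^sup>2) ^ ?n"
  have v: "0 < ?v" using t by simp
  have bc: "0 \<le> ball_const p"
    unfolding ball_const_def lip_const_def using step_const_ge_1[of p, where 'a='a] p L
    by (intro mult_nonneg_nonneg zero_le_power add_nonneg_nonneg) auto
  have pt: "ennreal ?v * ennreal (\<bar>u (P y) - u (Q y)\<bar> powr p) \<le> ennreal (2 powr p) * (I (P y) + I (Q y))" for y
  proof -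
    have "ennreal ?v * ennreal (\<bar>u (P y) - u (Q y)\<bar> powr p) = (\<integral>\<^sup>+w. ennreal (\<bar>u (P y) - u (Q y)\<bar> powr p) * indicator (cball (P y) (t\<^sup>2)) w \<partial>lborel)"
      by (subst nn_integral_cmult) (auto simp: emeasure_cball mult.commute intro!: borel_measurable_indicator)
    also have "\<dots> \<le> (\<integral>\<^sup>+w. ennreal (2 powr p) * (ennreal (\<bar>u (P y) - u w\<bar> powr p) * (if dist (P y) w \<le> (M + 1) * t\<^sup>2 then 1 else 0)
         + ennreal (\<bar>u (Q y) - u w\<bar> powr p) * (if dist (Q y) w \<le> (M + 1) * t\<^sup>2 then 1 else 0)) \<partial>lborel)"
    proof (rule nn_integral_mono)
      fix w
      show "ennreal (\<bar>u (P y) - u (Q y)\<bar> powr p) * indicator (cball (P y) (t\<^sup>2)) w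
        \<le> ennreal (2 powr p) * (ennreal (\<bar>u (P y) - u w\<bar> powr p) * (if dist (P y) w \<le> (M + 1) * t\<^sup>2 then 1 else 0)
         + ennreal (\<bar>u (Q y) - u w\<bar> powr p) * (if dist (Q y) w \<le> (M + 1) * t\<^sup>2 then 1 else 0))"
      proof (cases "dist (P y) w \<le> t\<^sup>2")
        case True
        have "0 \<le> M * t\<^sup>2" using M by simp
        then have 1: "dist (P y) w \<le> (M + 1) * t\<^sup>2" using True by (simp add: algebra_simps)
        have 2: "dist (Q y) w \<le> (M + 1) * t\<^sup>2"
          using True near[of y] dist_triangle[of "Q y" w "P y"] by (simp add: dist_norm norm_minus_commute algebra_simps)
        have "\<bar>u (P y) - u (Q y)\<bar> powr p \<le> 2 powr p * (\<bar>u (P y) - u w\<bar> powr p + \<bar>u (Q y) - u w\<bar> powr p)"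
          using abs_add_powr_le[of p "u (P y) - u w" "u w - u (Q y)"] p by (simp add: abs_minus_commute)
        then have "ennreal (\<bar>u (P y) - u (Q y)\<bar> powr p) \<le> ennreal (2 powr p) * (ennreal (\<bar>u (P y) - u w\<bar> powr p) + ennreal (\<bar>u (Q y) - u w\<bar> powr p))"
          by (simp add: ennreal_mult[symmetric] ennreal_plus[symmetric] ennreal_leI del: ennreal_plus)
        then show ?thesis using 1 2 True by simp
      qed simp
    qed
    also have "\<dots> = ennreal (2 powr p) * (I (P y) + I (Q y))"
      unfolding I_def by (subst nn_integral_cmult, measurable, subst nn_integral_add, measurable)
    finally show ?thesis .
  qed
  have "ennreal ?v * lpint p (\<lambda>y. u (P y) - u (Q y)) = (\<integral>\<^sup>+y. ennreal ?v * ennreal (\<bar>u (P y) - u (Q y)\<bar> powr p) \<partial>lborel)"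
    unfolding lpint_def by (rule nn_integral_cmult[symmetric]) measurable
  also have "\<dots> \<le> (\<integral>\<^sup>+y. ennreal (2 powr p) * (I (P y) + I (Q y)) \<partial>lborel)" by (intro nn_integral_mono pt)
  also have "\<dots> = ennreal (2 powr p) * ((\<integral>\<^sup>+y. I (P y) \<partial>lborel) + (\<integral>\<^sup>+y. I (Q y) \<partial>lborel))"
    by (subst nn_integral_cmult, measurable, subst nn_integral_add, measurable)
  also have "\<dots> \<le> ennreal (2 powr p) * (ennreal \<Lambda> * (ennreal (ball_const p * (t ^ (2 * ?n) * t powr p)) * ?G)
      + ennreal \<Lambda> * (ennreal (ball_const p * (t ^ (2 * ?n) * t powr p)) * ?G))"
    by (intro mult_left_mono add_mono order_trans[OF Pb[OF Im]] order_trans[OF Qb[OF Im]] IG) auto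
  also have "\<dots> = ennreal (2 powr p * (2 * (\<Lambda> * (ball_const p * (t ^ (2 * ?n) * t powr p))))) * ?G"
    using \<Lambda> bc t by (simp add: ennreal_mult mult.assoc mult_2[symmetric])
  finally have le: "ennreal ?v * lpint p (\<lambda>y. u (P y) - u (Q y)) \<le> ennreal (2 powr p * (2 * (\<Lambda> * (ball_const p * (t ^ (2 * ?n) * t powr p))))) * ?G" .
  have "lpint p (\<lambda>y. u (P y) - u (Q y)) = ennreal (1 / ?v) * (ennreal ?v * lpint p (\<lambda>y. u (P y) - u (Q y)))"
  proof -
    have "?v \<noteq> 0" using v by linarith
    from nonzero_eq_divide_eq[THEN iffD1, OF this refl] have "1 / ?v * ?v = 1" .
    then have "ennreal (1 / ?v) * ennreal ?v = 1" using v by (subst ennreal_mult[symmetric]) auto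
    then show ?thesis by (simp only: mult.assoc[symmetric] mult_1)
  qed
  also have "\<dots> \<le> ennreal (1 / ?v) * (ennreal (2 powr p * (2 * (\<Lambda> * (ball_const p * (t ^ (2 * ?n) * t powr p))))) * ?G)"
    by (intro mult_left_mono le) auto
  also have "\<dots> = ennreal (1 / ?v * (2 powr p * (2 * (\<Lambda> * (ball_const p * (t ^ (2 * ?n) * t powr p)))))) * ?G"
    using v \<Lambda> bc t by (subst mult.assoc[symmetric], subst ennreal_mult[symmetric]) auto
  also have "1 / ?v * (2 powr p * (2 * (\<Lambda> * (ball_const p * (t ^ (2 * ?n) * t powr p)))))
      = 2 powr p * (2 * \<Lambda> * ball_const p) / unit_ball_vol (DIM('a)) * t powr p"
    using t unfolding power_mult[of t 2 ?n] by (simp add: field_simps)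
  finally show ?thesis .
qed

end

section \<open>The transversal field\<close>

text \<open>After exchanging the integrals, the integral of \<open>t powr (- 1 - \<beta>)\<close>
  over \<open>t \<ge> s\<close> is \<open>s powr (- \<beta>) / \<beta>\<close>, which cancels the
  inner weight exactly.\<close>

lemma hardy_weighted:
  fixes G :: "real \<Rightarrow> ennreal" and \<beta> \<delta> :: real
  assumes \<beta>: "\<beta> > 0" and [measurable]: "G \<in> borel_measurable borel"
  shows "(\<integral>\<^sup>+t\<in>{0<..\<delta>}. ennreal (t powr (- 1 - \<beta>)) * (\<integral>\<^sup>+s\<in>{0<..t}. ennreal (s powr \<beta>) * G s \<partial>lborel) \<partial>lborel)
    \<le> ennreal (1 / \<beta>) * (\<integral>\<^sup>+s\<in>{0<..\<delta>}. G s \<partial>lborel)"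
proof -
  let ?k = "\<lambda>t s. ennreal (t powr (- 1 - \<beta>)) * (ennreal (s powr \<beta>) * G s) * (if 0 < s \<and> s \<le> t \<and> t \<le> \<delta> then 1 else 0)"
  have "(\<integral>\<^sup>+t\<in>{0<..\<delta>}. ennreal (t powr (- 1 - \<beta>)) * (\<integral>\<^sup>+s\<in>{0<..t}. ennreal (s powr \<beta>) * G s \<partial>lborel) \<partial>lborel)
     = (\<integral>\<^sup>+t. (\<integral>\<^sup>+s. ?k t s \<partial>lborel) \<partial>lborel)"
  proof (rule nn_integral_cong)
    fix t :: real
    have "(\<integral>\<^sup>+s. ?k t s \<partial>lborel) = (\<integral>\<^sup>+s. (ennreal (t powr (- 1 - \<beta>)) * indicator {0<..\<delta>} t) * (ennreal (s powr \<beta>) * G s * indicator {0<..t} s) \<partial>lborel)"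
      by (intro nn_integral_cong) (auto split: split_indicator)
    also have "\<dots> = (ennreal (t powr (- 1 - \<beta>)) * indicator {0<..\<delta>} t) * (\<integral>\<^sup>+s\<in>{0<..t}. ennreal (s powr \<beta>) * G s \<partial>lborel)"
      by (rule nn_integral_cmult) measurable
    finally show "ennreal (t powr (- 1 - \<beta>)) * (\<integral>\<^sup>+s\<in>{0<..t}. ennreal (s powr \<beta>) * G s \<partial>lborel) * indicator {0<..\<delta>} t = (\<integral>\<^sup>+s. ?k t s \<partial>lborel)"
      by (simp add: mult_ac)
  qed
  also have "\<dots> = (\<integral>\<^sup>+s. (\<integral>\<^sup>+t. ?k t s \<partial>lborel) \<partial>lborel)"
    by (rule lborel_pair.Fubini'[of "\<lambda>s t. ?k t s"]) measurable
  also have "\<dots> \<le> (\<integral>\<^sup>+s. ennreal (1 / \<beta>) * (G s * indicator {0<..\<delta>} s) \<partial>lborel)"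
  proof (rule nn_integral_mono)
    fix s :: real
    show "(\<integral>\<^sup>+t. ?k t s \<partial>lborel) \<le> ennreal (1 / \<beta>) * (G s * indicator {0<..\<delta>} s)"
    proof (cases "0 < s \<and> s \<le> \<delta>")
      case True
      have "((\<lambda>t. t powr (- 1 - \<beta>)) has_integral - (s powr (- 1 - \<beta> + 1)) / (- 1 - \<beta> + 1)) {s..}"
        using True \<beta> by (intro has_integral_powr_to_inf) auto
      then have "(\<integral>\<^sup>+t. ennreal (t powr (- 1 - \<beta>)) * indicator {s..} t \<partial>lborel) = ennreal (- (s powr (- 1 - \<beta> + 1)) / (- 1 - \<beta> + 1))"
        by (intro nn_integral_has_integral_lebesgue') auto
      also have "- (s powr (- 1 - \<beta> + 1)) / (- 1 - \<beta> + 1) = s powr (- \<beta>) / \<beta>" by simp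
      finally have int: "(\<integral>\<^sup>+t. ennreal (t powr (- 1 - \<beta>)) * indicator {s..} t \<partial>lborel) = ennreal (s powr (- \<beta>) / \<beta>)" .
      have "(\<integral>\<^sup>+t. ?k t s \<partial>lborel) \<le> (\<integral>\<^sup>+t. (ennreal (s powr \<beta>) * G s) * (ennreal (t powr (- 1 - \<beta>)) * indicator {s..} t) \<partial>lborel)"
        by (intro nn_integral_mono) (auto simp: mult_ac split: split_indicator)
      also have "\<dots> = (ennreal (s powr \<beta>) * G s) * ennreal (s powr (- \<beta>) / \<beta>)"
        by (subst nn_integral_cmult) (auto simp: int)
      also have "\<dots> = ennreal (s powr \<beta> * (s powr (- \<beta>) / \<beta>)) * G s"
        using \<beta> by (subst ennreal_mult) (auto simp: mult_ac)
      also have "s powr \<beta> * (s powr (- \<beta>) / \<beta>) = 1 / \<beta>"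
        using True by (simp add: powr_minus field_simps)
      finally show ?thesis using True by simp
    next
      case False
      then have "(\<integral>\<^sup>+t. ?k t s \<partial>lborel) = (\<integral>\<^sup>+t. 0 \<partial>(lborel::real measure))"
        by (intro nn_integral_cong) auto
      then show ?thesis by simp
    qed
  qed
  also have "\<dots> = ennreal (1 / \<beta>) * (\<integral>\<^sup>+s\<in>{0<..\<delta>}. G s \<partial>lborel)"
    by (rule nn_integral_cmult) measurable
  finally show ?thesis .
qed

text \<open>The vertical speed is 1, so flow time is height: the flow carries the slice at height
  \<open>0\<close> onto the slice at height \<open>t\<close>, with \<open>lift t\<close> and
  \<open>drop t\<close> as mutually inverse identifications of the two slices.\<close>

locale vertical_field =
  fixes T :: "'a::euclidean_space \<times> real \<Rightarrow> 'a \<times> real" and L :: real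
  assumes T: "bounded_lipschitz L T" and snd_T: "\<And>y. snd (T y) = 1"
begin

definition lift :: "real \<Rightarrow> 'a \<Rightarrow> 'a" where "lift t x = fst (gflow T t (x, 0))"
definition drop :: "real \<Rightarrow> 'a \<Rightarrow> 'a" where "drop t y = fst (gflow T (- t) (y, t))"

lemma L: "1 \<le> L" using bounded_lipschitzD(1)[OF T] .

lemma snd_gflow: "snd (gflow T t y) = snd y + t"
proof -
  have "((\<lambda>s. snd (gflow T s y) - s) has_vector_derivative 0) (at s within UNIV)" for s
  proof -
    have "((\<lambda>s. snd (gflow T s y)) has_vector_derivative snd (T (gflow T s y))) (at s)"
      by (rule bounded_linear.has_vector_derivative[OF bounded_linear_snd gflow_has_vector_derivative[OF T]])
    then have "((\<lambda>s. snd (gflow T s y) - s) has_vector_derivative 1 - 1) (at s)"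
      unfolding snd_T by (intro derivative_intros)
    then show ?thesis by simp
  qed
  then obtain c where c: "\<And>s. snd (gflow T s y) - s = c"
    using has_vector_derivative_zero_constant[of UNIV "\<lambda>s. snd (gflow T s y) - s"] by auto
  show ?thesis using c[of t] c[of 0] by (simp add: gflow_0[OF T])
qed

lemma gflow_lift: "gflow T t (x, 0) = (lift t x, t)"
  using snd_gflow[of t "(x, 0)"] by (auto simp: lift_def prod_eq_iff)

lemma gflow_drop: "gflow T (- t) (y, t) = (drop t y, 0)"
  using snd_gflow[of "- t" "(y, t)"] by (auto simp: drop_def prod_eq_iff)

lemma lift_drop: "lift t (drop t y) = y" "drop t (lift t x) = x"
  using gflow_inverse(2)[OF T, of t "(y, t)"] gflow_inverse(1)[OF T, of t "(x, 0)"]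
  by (auto simp: gflow_lift gflow_drop)

lemma lift_continuous: "continuous_on UNIV (\<lambda>(t, x). lift t x)"
proof -
  have "continuous_on UNIV (\<lambda>z. fst ((\<lambda>(s, x). gflow T s x) (fst z, (snd z, 0))))"
    by (intro continuous_on_fst continuous_on_compose2[OF gflow_continuous[OF T]]) (auto intro!: continuous_intros)
  then show ?thesis by (simp add: lift_def case_prod_unfold)
qed

lemma drop_lipschitz:
  assumes "L * \<bar>t\<bar> \<le> 1"
  shows "norm (drop t x - drop t y) \<le> 3 * norm (x - y)"
  using gflow_lipschitz[OF T, of "-t" "(x, t)" "(y, t)"] assms by (simp add: gflow_drop norm_Pair)

lemma lift_lipschitz:
  assumes "L * \<bar>t\<bar> \<le> 1"
  shows "norm (lift t x - lift t y) \<le> 3 * norm (x - y)"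
  using gflow_lipschitz[OF T, of "t" "(x, 0)" "(y, 0)"] assms by (simp add: gflow_lift norm_Pair)

lemma lift_near_identity:
  assumes "L * \<bar>t\<bar> \<le> 1"
  shows "norm (lift t x - lift t y - (x - y)) \<le> 3 * L * \<bar>t\<bar> * norm (x - y)"
  using gflow_near_identity[OF T, of "t" "(x, 0)" "(y, 0)"] assms by (simp add: gflow_lift norm_Pair)

lemma lift_dist: "norm (lift t x - x) \<le> L * \<bar>t\<bar>"
proof -
  have "norm (lift t x - x) \<le> norm (gflow T t (x, 0) - (x, 0))"
    using norm_fst_le[of "lift t x - x" t] by (simp add: gflow_lift)
  then show ?thesis using gflow_dist[OF T, of t "(x, 0)"] by linarith
qed

lemma lift_measurable [measurable]: "lift t \<in> borel_measurable borel"
proof -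
  have "continuous_on UNIV (\<lambda>x. (\<lambda>(t, x). lift t x) (t, x))"
    by (rule continuous_on_compose2[OF lift_continuous]) (auto intro!: continuous_intros)
  then show ?thesis by (intro borel_measurable_continuous_onI) simp
qed

lemma nn_integral_lift:
  assumes "L * \<bar>t\<bar> \<le> 1" and f: "f \<in> borel_measurable borel"
  shows "(\<integral>\<^sup>+x. f (lift t x) \<partial>lborel) \<le> ennreal (flow_const TYPE('a)) * (\<integral>\<^sup>+x. f x \<partial>lborel)"
  using nn_integral_compose_bilipschitz[of "drop t" 3 "lift t" f] drop_lipschitz[OF assms(1)] f lift_drop
  by (simp add: flow_const_def)

text \<open>The integrand along the curve is split as \<open>s powr (1/p) * \<bar>G\<bar>\<close>
  times the weight \<open>s powr (- (1/p))\<close>, which is integrable at \<open>0\<close> because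
  \<open>p > 1\<close>. Raising to the power \<open>p\<close> leaves \<open>s powr (1 - 1/p)\<close>
  inside; this and the power of \<open>t\<close> outside have the shape that Hardy's inequality
  requires.\<close>

lemma lpint_lift_difference:
  assumes p: "p > 1" and t: "0 < t" "L * t \<le> 1"
    and \<phi>: "\<And>y. (\<phi> has_derivative d\<phi> y) (at y)" and cont: "continuous_on UNIV (\<lambda>y. d\<phi> y (T y))"
  shows "lpint p (\<lambda>x. \<phi> (lift t x, t) - \<phi> (x, 0))
    \<le> ennreal (flow_const TYPE('a) * (1 / (1 - 1/p)) powr (p - 1) * t powr ((1 - 1/p) * (p - 1)))
      * (\<integral>\<^sup>+s\<in>{0<..t}. ennreal (s powr (1 - 1/p)) * lpint p (\<lambda>x. d\<phi> (x, s) (T (x, s))) \<partial>lborel)"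
proof -
  define \<beta> where "\<beta> = 1 - 1/p"
  have \<beta>: "\<beta> > 0" "\<beta> < 1" using p by (auto simp: \<beta>_def)
  define G where "G y = d\<phi> y (T y)" for y
  have Gc: "continuous_on UNIV G" using cont by (simp add: G_def[abs_def])
  have GLc: "continuous_on UNIV (\<lambda>(s, x). G (lift s x, s))"
  proof -
    have "continuous_on UNIV (\<lambda>z. G ((\<lambda>(t, x). lift t x) z, fst z))"
      by (rule continuous_on_compose2[OF Gc]) (auto intro!: continuous_intros lift_continuous)
    then show ?thesis by (simp add: case_prod_unfold)
  qed
  have [measurable]: "(\<lambda>(s, x). G (lift s x, s)) \<in> borel_measurable (borel \<Otimes>\<^sub>M borel)"
    unfolding borel_prod by (rule borel_measurable_continuous_onI[OF GLc])
  have GLc1: "continuous_on UNIV (\<lambda>s. G (lift s x, s))" for x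
  proof -
    have "continuous_on UNIV (\<lambda>s::real. (s, x))" by (intro continuous_intros)
    from continuous_on_compose2[OF GLc this] show ?thesis by simp
  qed
  have [measurable]: "G \<in> borel_measurable (borel \<Otimes>\<^sub>M borel)"
    unfolding borel_prod by (rule borel_measurable_continuous_onI[OF Gc])
  let ?w = "\<lambda>s. s powr (- (1/p)) * indicator {0<..t} s"
  have wint: "(\<integral>\<^sup>+s. ennreal (?w s) \<partial>lborel) \<le> ennreal (t powr \<beta> / \<beta>)"
  proof -
    have "((\<lambda>s. s powr (- (1/p))) has_integral (t powr (- (1/p) + 1) / (- (1/p) + 1))) {0..t}"
      using p t by (intro has_integral_powr_from_0) auto
    then have "(\<integral>\<^sup>+s. ennreal (s powr (- (1/p))) * indicator {0..t} s \<partial>lborel) = ennreal (t powr \<beta> / \<beta>)"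
      by (subst nn_integral_has_integral_lebesgue') (auto simp: \<beta>_def)
    moreover have "(\<integral>\<^sup>+s. ennreal (?w s) \<partial>lborel) \<le> (\<integral>\<^sup>+s. ennreal (s powr (- (1/p))) * indicator {0..t} s \<partial>lborel)"
      by (intro nn_integral_mono) (auto split: split_indicator)
    ultimately show ?thesis by simp
  qed
  let ?m = "t powr \<beta> / \<beta>"
  have pt: "ennreal (\<bar>\<phi> (lift t x, t) - \<phi> (x, 0)\<bar> powr p)
    \<le> ennreal (?m powr (p - 1)) * (\<integral>\<^sup>+s. ennreal (s powr \<beta>) * ennreal (\<bar>G (lift s x, s)\<bar> powr p) * indicator {0<..t} s \<partial>lborel)" for x
  proof -
    have [measurable]: "(\<lambda>s. G (lift s x, s)) \<in> borel_measurable borel"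
      by (rule borel_measurable_continuous_onI[OF GLc1])
    have der: "((\<lambda>s. \<phi> (lift s x, s)) has_real_derivative G (lift s x, s)) (at s within {0..t})" for s
    proof -
      have "((\<lambda>s. gflow T s (x, 0)) has_derivative (\<lambda>h. h *\<^sub>R T (gflow T s (x, 0)))) (at s within {0..t})"
        using gflow_has_vector_derivative[OF T] by (simp add: has_vector_derivative_def)
      from has_derivative_compose[OF this \<phi>]
      have "((\<lambda>s. \<phi> (gflow T s (x, 0))) has_derivative (\<lambda>h. d\<phi> (gflow T s (x, 0)) (h *\<^sub>R T (gflow T s (x, 0))))) (at s within {0..t})" .
      moreover have "d\<phi> (gflow T s (x, 0)) (h *\<^sub>R T (gflow T s (x, 0))) = G (lift s x, s) * h" for h
        using linear_scale[OF has_derivative_linear[OF \<phi>]] by (simp add: G_def gflow_lift)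
      ultimately show ?thesis by (simp add: has_field_derivative_def gflow_lift)
    qed
    have "ennreal \<bar>\<phi> (lift t x, t) - \<phi> (lift 0 x, 0)\<bar> \<le> (\<integral>\<^sup>+s. ennreal (\<bar>G (lift s x, s)\<bar> * indicator {0..t} s) \<partial>lborel)"
      using t by (intro abs_diff_le_nn_integral_deriv[of 0 t "\<lambda>s. \<phi> (lift s x, s)"])
         (auto intro!: der continuous_on_subset[OF GLc1])
    also have "lift 0 x = x" by (simp add: lift_def gflow_0[OF T])
    also have "(\<integral>\<^sup>+s. ennreal (\<bar>G (lift s x, s)\<bar> * indicator {0..t} s) \<partial>lborel)
       = (\<integral>\<^sup>+s. ennreal ((\<bar>s\<bar> powr (1/p) * \<bar>G (lift s x, s)\<bar>) * ?w s) \<partial>lborel)"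
    \<comment> \<open>The two integrands may differ at \<open>s = 0\<close>, where the right-hand
      one is \<open>0\<close>.\<close>
    proof (rule nn_integral_cong_AE)
      have "AE s in lborel. s \<noteq> (0::real)" by (rule AE_lborel_singleton)
      then show "AE s in lborel. ennreal (\<bar>G (lift s x, s)\<bar> * indicator {0..t} s) = ennreal ((\<bar>s\<bar> powr (1/p) * \<bar>G (lift s x, s)\<bar>) * ?w s)"
        by eventually_elim (auto simp: powr_minus field_simps split: split_indicator)
    qed
    finally have "ennreal \<bar>\<phi> (lift t x, t) - \<phi> (x, 0)\<bar> \<le> (\<integral>\<^sup>+s. ennreal ((\<bar>s\<bar> powr (1/p) * \<bar>G (lift s x, s)\<bar>) * ?w s) \<partial>lborel)" .
    from holder_weighted[OF p _ _ _ _ _ _ this wint]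
    have "ennreal (\<bar>\<phi> (lift t x, t) - \<phi> (x, 0)\<bar> powr p)
       \<le> ennreal (?m powr (p - 1)) * (\<integral>\<^sup>+s. ennreal ((\<bar>s\<bar> powr (1/p) * \<bar>G (lift s x, s)\<bar>) powr p * ?w s) \<partial>lborel)"
      using t \<beta> by auto
    also have "(\<integral>\<^sup>+s. ennreal ((\<bar>s\<bar> powr (1/p) * \<bar>G (lift s x, s)\<bar>) powr p * ?w s) \<partial>lborel)
      = (\<integral>\<^sup>+s. ennreal (s powr \<beta>) * ennreal (\<bar>G (lift s x, s)\<bar> powr p) * indicator {0<..t} s \<partial>lborel)"
    proof (rule nn_integral_cong)
      fix s :: real
      have "(s powr (1/p) * \<bar>G (lift s x, s)\<bar>) powr p * s powr (- (1/p)) = s powr \<beta> * \<bar>G (lift s x, s)\<bar> powr p" if "s > 0"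
      proof -
        have "s * s powr (- (1/p)) = s powr \<beta>" using powr_add[of s 1 "- (1/p)"] that by (simp add: \<beta>_def)
        then show ?thesis using that p by (simp add: powr_mult powr_powr mult_ac)
      qed
      then show "ennreal ((\<bar>s\<bar> powr (1/p) * \<bar>G (lift s x, s)\<bar>) powr p * ?w s) = ennreal (s powr \<beta>) * ennreal (\<bar>G (lift s x, s)\<bar> powr p) * indicator {0<..t} s"
        by (auto simp: ennreal_mult[symmetric] split: split_indicator)
    qed
    finally show ?thesis .
  qed
  let ?k = "\<lambda>s x. ennreal (s powr \<beta>) * ennreal (\<bar>G (lift s x, s)\<bar> powr p) * indicator {0<..t} s"
  have "lpint p (\<lambda>x. \<phi> (lift t x, t) - \<phi> (x, 0)) \<le> (\<integral>\<^sup>+x. ennreal (?m powr (p - 1)) * (\<integral>\<^sup>+s. ?k s x \<partial>lborel) \<partial>lborel)"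
    unfolding lpint_def by (intro nn_integral_mono pt)
  also have "\<dots> = ennreal (?m powr (p - 1)) * (\<integral>\<^sup>+x. (\<integral>\<^sup>+s. ?k s x \<partial>lborel) \<partial>lborel)"
    by (rule nn_integral_cmult) measurable
  also have "\<dots> = ennreal (?m powr (p - 1)) * (\<integral>\<^sup>+s. (\<integral>\<^sup>+x. ?k s x \<partial>lborel) \<partial>lborel)"
    by (subst lborel_pair.Fubini'[of ?k]) auto
  also have "\<dots> \<le> ennreal (?m powr (p - 1)) * (\<integral>\<^sup>+s. ennreal (flow_const TYPE('a)) * (ennreal (s powr \<beta>) * lpint p (\<lambda>x. G (x, s)) * indicator {0<..t} s) \<partial>lborel)"
  proof (intro mult_left_mono nn_integral_mono)
    fix s :: real
    show "(\<integral>\<^sup>+x. ?k s x \<partial>lborel) \<le> ennreal (flow_const TYPE('a)) * (ennreal (s powr \<beta>) * lpint p (\<lambda>x. G (x, s)) * indicator {0<..t} s)"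
    proof (cases "s \<in> {0<..t}")
      case True
      have "L * \<bar>s\<bar> \<le> L * t" using True L by (intro mult_left_mono) auto
      then have "L * \<bar>s\<bar> \<le> 1" using t by linarith
      then have "(\<integral>\<^sup>+x. ennreal (\<bar>G (lift s x, s)\<bar> powr p) \<partial>lborel) \<le> ennreal (flow_const TYPE('a)) * lpint p (\<lambda>x. G (x, s))"
        unfolding lpint_def by (intro nn_integral_lift[of s "\<lambda>y. ennreal (\<bar>G (y, s)\<bar> powr p)"]) measurable
      then have "ennreal (s powr \<beta>) * (\<integral>\<^sup>+x. ennreal (\<bar>G (lift s x, s)\<bar> powr p) \<partial>lborel) \<le> ennreal (s powr \<beta>) * (ennreal (flow_const TYPE('a)) * lpint p (\<lambda>x. G (x, s)))"
        by (rule mult_left_mono) auto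
      then show ?thesis using True by (simp add: nn_integral_cmult mult_ac)
    qed simp
  qed simp
  also have "\<dots> = ennreal (?m powr (p - 1)) * (ennreal (flow_const TYPE('a)) * (\<integral>\<^sup>+s\<in>{0<..t}. ennreal (s powr \<beta>) * lpint p (\<lambda>x. G (x, s)) \<partial>lborel))"
    unfolding lpint_def by (subst nn_integral_cmult) auto
  also have "\<dots> = ennreal (?m powr (p - 1) * flow_const TYPE('a)) * (\<integral>\<^sup>+s\<in>{0<..t}. ennreal (s powr \<beta>) * lpint p (\<lambda>x. G (x, s)) \<partial>lborel)"
    using flow_const_ge_1[where 'a='a] by (simp add: ennreal_mult mult.assoc)
  also have "?m powr (p - 1) * flow_const TYPE('a) = flow_const TYPE('a) * (1 / \<beta>) powr (p - 1) * t powr (\<beta> * (p - 1))"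
    using t \<beta> by (simp add: powr_divide powr_powr)
  finally show ?thesis by (simp add: G_def \<beta>_def)
qed

end

section \<open>The trace estimate for a frame\<close>

text \<open>Only one continuous derivative is recorded, since the estimates use no more. Function
  and derivative vanish already on the sphere of radius \<open>r\<close>, so a field
  \<open>V\<close> may be altered outside the open ball without changing
  \<open>d\<phi> y (V y)\<close>.\<close>

definition test_function :: "real \<Rightarrow> ('b::euclidean_space \<Rightarrow> real) \<Rightarrow> ('b \<Rightarrow> 'b \<Rightarrow> real) \<Rightarrow> bool" where
  "test_function r \<phi> d\<phi> \<longleftrightarrow> (\<forall>y. (\<phi> has_derivative d\<phi> y) (at y)) \<and> (\<forall>v. continuous_on UNIV (\<lambda>y. d\<phi> y v)) \<and>
     (\<forall>y. r \<le> norm y \<longrightarrow> \<phi> y = 0 \<and> (\<forall>v. d\<phi> y v = 0))"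

lemma test_functionD:
  assumes "test_function r \<phi> d\<phi>"
  shows "(\<phi> has_derivative d\<phi> y) (at y)" "continuous_on UNIV (\<lambda>y. d\<phi> y v)" "linear (d\<phi> y)"
    "r \<le> norm y \<Longrightarrow> \<phi> y = 0" "r \<le> norm y \<Longrightarrow> d\<phi> y v = 0" "continuous_on UNIV \<phi>"
proof -
  show d: "(\<phi> has_derivative d\<phi> y) (at y)" for y using assms by (simp add: test_function_def)
  show "linear (d\<phi> y)" by (rule has_derivative_linear[OF d])
  show "continuous_on UNIV \<phi>" by (rule continuous_at_imp_continuous_on) (blast intro: has_derivative_continuous d)
qed (use assms in \<open>simp_all add: test_function_def\<close>)

lemma test_function_field_continuous:
  assumes \<phi>: "test_function r \<phi> d\<phi>" and h: "continuous_on UNIV h" and V: "continuous_on UNIV V"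
  shows "continuous_on UNIV (\<lambda>x. d\<phi> (h x) (V x))"
proof -
  have "d\<phi> (h x) (V x) = (\<Sum>b\<in>Basis. (V x \<bullet> b) * d\<phi> (h x) b)" for x
  proof -
    have "d\<phi> (h x) (\<Sum>b\<in>Basis. (V x \<bullet> b) *\<^sub>R b) = (\<Sum>b\<in>Basis. (V x \<bullet> b) * d\<phi> (h x) b)"
      using test_functionD(3)[OF \<phi>, of "h x"] by (simp add: linear_sum linear_scale)
    then show ?thesis by (simp add: euclidean_representation)
  qed
  then show ?thesis
    by (auto intro!: continuous_intros V continuous_on_compose2[OF test_functionD(2)[OF \<phi>] h])
qed

text \<open>The sum is at most the number of terms times the largest one. The constant is crude but
  valid for every exponent \<open>p \<ge> 0\<close>; it is used both for \<open>p\<close> and for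
  \<open>1/p\<close>.\<close>

lemma sum_powr_le:
  fixes f :: "'i \<Rightarrow> real"
  assumes "finite J" "p \<ge> 0" "\<And>j. j \<in> J \<Longrightarrow> 0 \<le> f j"
  shows "(\<Sum>j\<in>J. f j) powr p \<le> (card J) powr p * (\<Sum>j\<in>J. f j powr p)"
proof (cases "J = {}")
  case False
  then obtain k where k: "k \<in> J" "f k = Max (f ` J)" using assms(1) by (metis (mono_tags) Max_in finite_imageI imageE image_is_empty)
  have "(\<Sum>j\<in>J. f j) \<le> card J * f k" using assms(1) k(2) by (intro sum_bounded_above) auto
  then have "(\<Sum>j\<in>J. f j) powr p \<le> (card J * f k) powr p" using assms by (intro powr_mono2 sum_nonneg) auto
  also have "\<dots> = card J powr p * f k powr p" using assms k by (simp add: powr_mult)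
  also have "f k powr p \<le> (\<Sum>j\<in>J. f j powr p)" using k assms(1) by (intro member_le_sum) auto
  finally show ?thesis by (simp add: mult_left_mono)
qed (use assms in auto)

lemma lpint_le_sum:
  assumes p: "p \<ge> 0" and J: "finite J" and B: "B \<ge> 0"
    and le: "\<And>x. \<bar>f x\<bar> \<le> B * (\<Sum>j\<in>J. \<bar>g j x\<bar>)" and g: "\<And>j. j \<in> J \<Longrightarrow> g j \<in> borel_measurable borel"
  shows "lpint p f \<le> ennreal ((B * card J) powr p) * (\<Sum>j\<in>J. lpint p (g j))"
proof -
  have "lpint p f \<le> (\<integral>\<^sup>+x. ennreal ((B * card J) powr p) * (\<Sum>j\<in>J. ennreal (\<bar>g j x\<bar> powr p)) \<partial>lborel)"
    unfolding lpint_def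
  proof (rule nn_integral_mono)
    fix x
    have "\<bar>f x\<bar> powr p \<le> (B * (\<Sum>j\<in>J. \<bar>g j x\<bar>)) powr p" using le p by (intro powr_mono2) auto
    also have "\<dots> = B powr p * (\<Sum>j\<in>J. \<bar>g j x\<bar>) powr p" by (rule powr_mult)
    also have "\<dots> \<le> B powr p * (card J powr p * (\<Sum>j\<in>J. \<bar>g j x\<bar> powr p))"
      using J p by (intro mult_left_mono sum_powr_le) auto
    also have "\<dots> = (B * card J) powr p * (\<Sum>j\<in>J. \<bar>g j x\<bar> powr p)" using B by (simp add: powr_mult)
    finally show "ennreal (\<bar>f x\<bar> powr p) \<le> ennreal ((B * card J) powr p) * (\<Sum>j\<in>J. ennreal (\<bar>g j x\<bar> powr p))"
      by (simp add: sum_ennreal ennreal_mult[symmetric] sum_nonneg ennreal_leI)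
  qed
  also have "\<dots> = ennreal ((B * card J) powr p) * (\<Sum>j\<in>J. lpint p (g j))"
    unfolding lpint_def using g by (subst nn_integral_cmult) (auto simp: nn_integral_sum simp del: sum_ennreal)
  finally show ?thesis .
qed

text \<open>All heights \<open>0 < t \<le> \<delta>\<close> together, with constants uniform in
  \<open>t\<close>. \<open>Y i\<close> acts on the bottom slice; \<open>Yt i t\<close> is its
  counterpart at height \<open>t\<close>, close to it and spanned with bounded coefficients by the
  frame \<open>z j t\<close>. The number \<open>7 * L\<^sup>2\<close> is the constant with which the
  conjugated flow and the flow of \<open>Yt i t\<close> agree to order
  \<open>t\<^sup>2\<close>.\<close>

locale trace_frame = vertical_field T L for T :: "'a::euclidean_space \<times> real \<Rightarrow> 'a \<times> real" and L :: real +
  fixes p \<delta> K \<rho> \<rho>\<^sub>1 \<eta> \<beta> B :: real and J I :: "nat set" and z :: "nat \<Rightarrow> real \<Rightarrow> 'a \<Rightarrow> 'a"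
    and Y :: "nat \<Rightarrow> 'a \<Rightarrow> 'a" and Yt :: "nat \<Rightarrow> real \<Rightarrow> 'a \<Rightarrow> 'a"
    and a :: "nat \<Rightarrow> 'a" and A :: "nat \<Rightarrow> 'a \<Rightarrow> 'a" and c :: "'a \<Rightarrow> nat \<times> nat option"
  assumes p: "1 < p" and J: "finite J" and \<delta>: "0 < \<delta>" "\<delta> \<le> 1" "L * \<delta> \<le> 1" and B: "0 \<le> B"
    and Y: "\<And>i. i \<in> I \<Longrightarrow> bounded_lipschitz L (Y i)"
    and Yt: "\<And>i t. i \<in> I \<Longrightarrow> bounded_lipschitz L (Yt i t)"
    and Yt_near: "\<And>i t x. i \<in> I \<Longrightarrow> 0 < t \<Longrightarrow> t \<le> \<delta> \<Longrightarrow> norm (Yt i t x - Y i x) \<le> L * t"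
    and Yt_span: "\<And>i t x. i \<in> I \<Longrightarrow> 0 < t \<Longrightarrow> t \<le> \<delta> \<Longrightarrow> norm x < \<rho>\<^sub>1 \<Longrightarrow>
        \<exists>q. (\<forall>j\<in>J. \<bar>q j\<bar> \<le> B) \<and> Yt i t x = (\<Sum>j\<in>J. q j *\<^sub>R z j t x)"
    and frame: "\<And>t. 0 < t \<Longrightarrow> t \<le> \<delta> \<Longrightarrow> bracket_frame (\<lambda>j. z j t) J L \<rho> \<eta> K t a A c"
    and err: "\<And>t. 0 < t \<Longrightarrow> t \<le> \<delta> \<Longrightarrow> DIM('a) * (8 * L * \<eta> * K\<^sup>2 + 78 * L ^ 3 * K ^ 3 * t) \<le> 1"
    and \<rho>: "\<rho>\<^sub>1 + (7 * L\<^sup>2 + 1) * \<delta>\<^sup>2 + (4 * DIM('a) + 2) * (L * (K * \<delta>)) < \<rho>"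
    and inv: "\<And>w. \<exists>r. (\<Sum>b\<in>Basis. (r \<bullet> b) *\<^sub>R direction a A (c b)) = w \<and> norm r \<le> \<beta> * norm w"
    and \<beta>: "\<beta> \<ge> 0" "\<beta> * (7 * L\<^sup>2 + 2) \<le> K"
begin

definition "tangential \<phi>d t = (\<Sum>j\<in>J. lpint p (\<lambda>x. \<phi>d (x, t) (z j t x, 0)))"
definition "vertical \<phi>d t = lpint p (\<lambda>x. \<phi>d (x, t) (T (x, t)))"

lemma slice_derivative:
  assumes "test_function \<rho>\<^sub>1 \<phi> d\<phi>"
  shows "((\<lambda>x. \<phi> (x, t)) has_derivative (\<lambda>v. d\<phi> (x, t) (v, 0))) (at x)"
proof -
  have "((\<lambda>x. (x, t)) has_derivative (\<lambda>v. (v, 0))) (at x)" by (auto intro!: derivative_eq_intros)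
  from has_derivative_compose[OF this test_functionD(1)[OF assms]] show ?thesis by simp
qed

lemma slice_continuous:
  assumes \<phi>: "test_function \<rho>\<^sub>1 \<phi> d\<phi>" and V: "bounded_lipschitz M V"
  shows "continuous_on UNIV (\<lambda>x. d\<phi> (x, t) (V x, 0))"
  by (rule test_function_field_continuous[OF \<phi>])
     (auto intro!: continuous_intros bounded_lipschitz_continuous[OF V])

lemma Lt: assumes "0 < t" "t \<le> \<delta>" "\<bar>\<tau>\<bar> \<le> t" shows "L * \<bar>t\<bar> \<le> 1" "L * \<bar>\<tau>\<bar> \<le> 1"
proof -
  have "L * \<bar>t\<bar> \<le> L * \<delta>" "L * \<bar>\<tau>\<bar> \<le> L * \<delta>" using assms L by (auto intro!: mult_left_mono)
  then show "L * \<bar>t\<bar> \<le> 1" "L * \<bar>\<tau>\<bar> \<le> 1" using \<delta> by linarith+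
qed

definition "conj_flow i t \<tau> y = lift t (gflow (Y i) \<tau> (drop t y))"

text \<open>Four errors add up to 7: 3 because lifting is the identity up to a Lipschitz part of
  order \<open>t\<close>, 1 for each of the two Euler steps, and 2 because \<open>Y i\<close> at
  \<open>drop t y\<close> and \<open>Yt i t\<close> at \<open>y\<close> differ by at most
  \<open>2 * L\<^sup>2 * t\<close>.\<close>

lemma conj_flow_near:
  assumes i: "i \<in> I" and t: "0 < t" "t \<le> \<delta>" and \<tau>: "\<bar>\<tau>\<bar> \<le> t"
  shows "norm (conj_flow i t \<tau> y - gflow (Yt i t) \<tau> y) \<le> 7 * L\<^sup>2 * t\<^sup>2"
proof -
  note Lt = Lt[OF t \<tau>]
  define x where "x = drop t y"
  have y: "lift t x = y" by (simp add: x_def lift_drop)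
  let ?F = "gflow (Y i) \<tau> x" and ?E = "gflow (Yt i t) \<tau> y"
  have L1: "L \<le> L\<^sup>2" using L by (simp add: power2_eq_square)
  have \<tau>2: "\<tau>\<^sup>2 \<le> t\<^sup>2" using \<tau> t by (metis abs_of_pos power2_le_iff_abs_le abs_le_square_iff)
  have "norm (?F - x) \<le> L * t" using gflow_dist[OF Y[OF i], of \<tau> x] \<tau> L mult_left_mono[of "\<bar>\<tau>\<bar>" t L] by linarith
  then have "3 * L * \<bar>t\<bar> * norm (?F - x) \<le> 3 * L * t * (L * t)" using L t by (intro mult_mono) auto
  then have 1: "norm (lift t ?F - lift t x - (?F - x)) \<le> 3 * L\<^sup>2 * t\<^sup>2"
    using lift_near_identity[OF Lt(1), of ?F x] by (simp add: power2_eq_square mult_ac)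
  have 2: "norm (?F - x - \<tau> *\<^sub>R Y i x) \<le> L\<^sup>2 * t\<^sup>2"
    by (rule order_trans[OF gflow_euler[OF Y[OF i]]]) (use \<tau>2 in \<open>auto intro: mult_left_mono\<close>)
  have 3: "norm (?E - y - \<tau> *\<^sub>R Yt i t y) \<le> L\<^sup>2 * t\<^sup>2"
    by (rule order_trans[OF gflow_euler[OF Yt[OF i]]]) (use \<tau>2 in \<open>auto intro: mult_left_mono\<close>)
  have xy: "norm (x - y) \<le> L * t" using lift_dist[of t x] t by (simp add: y norm_minus_commute)
  have "norm (Y i x - Y i y) \<le> L * (L * t)"
    using bounded_lipschitzD(2)[OF Y[OF i], of x y] mult_left_mono[OF xy, of L] L by linarith
  moreover have "norm (Y i y - Yt i t y) \<le> L * t" using Yt_near[OF i t, of y] by (simp add: norm_minus_commute)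
  moreover have "L * t \<le> L\<^sup>2 * t" using L1 t by (intro mult_right_mono) auto
  ultimately have "norm (Y i x - Yt i t y) \<le> 2 * L\<^sup>2 * t"
    using norm_triangle_ineq[of "Y i x - Y i y" "Y i y - Yt i t y"] by (simp add: power2_eq_square mult_ac)
  then have "\<bar>\<tau>\<bar> * norm (Y i x - Yt i t y) \<le> t * (2 * L\<^sup>2 * t)" using \<tau> t by (intro mult_mono) auto
  then have 4: "norm (\<tau> *\<^sub>R (Y i x - Yt i t y)) \<le> 2 * L\<^sup>2 * t\<^sup>2" by (simp add: power2_eq_square mult_ac)
  have "conj_flow i t \<tau> y - ?E = (lift t ?F - lift t x - (?F - x)) + (?F - x - \<tau> *\<^sub>R Y i x) - (?E - y - \<tau> *\<^sub>R Yt i t y) + \<tau> *\<^sub>R (Y i x - Yt i t y)"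
    by (simp add: conj_flow_def y algebra_simps flip: x_def)
  also have "norm \<dots> \<le> 3 * L\<^sup>2 * t\<^sup>2 + L\<^sup>2 * t\<^sup>2 + L\<^sup>2 * t\<^sup>2 + 2 * L\<^sup>2 * t\<^sup>2"
    by (intro norm_triangle_mono 4 order_trans[OF norm_triangle_ineq4] add_mono 1 2 3)
  finally show ?thesis by simp
qed

text \<open>\<open>54 = 2 * 27\<close>: lift, flow and drop each have Lipschitz constant 3.\<close>

definition "bilip = (54 * real DIM('a)) ^ DIM('a)"

lemma conj_flow_measurable: assumes "i \<in> I" "0 < t" "t \<le> \<delta>" "\<bar>\<tau>\<bar> \<le> t" shows "conj_flow i t \<tau> \<in> borel_measurable borel"
proof -
  have d: "drop t \<in> borel_measurable borel"
  proof -
    have "3-lipschitz_on UNIV (drop t)" using drop_lipschitz Lt[OF assms(2-4)] by (intro lipschitz_onI) (auto simp: dist_norm)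
    then show ?thesis by (intro borel_measurable_continuous_onI) (rule lipschitz_on_continuous_on)
  qed
  show ?thesis unfolding conj_flow_def[abs_def]
    by (intro measurable_compose[OF _ lift_measurable] measurable_compose[OF d gflow_measurable[OF Y[OF assms(1)]]])
qed

lemma nn_integral_conj_flow:
  assumes i: "i \<in> I" and t: "0 < t" "t \<le> \<delta>" "\<bar>\<tau>\<bar> \<le> t" and f: "f \<in> borel_measurable borel"
  shows "(\<integral>\<^sup>+x. f (conj_flow i t \<tau> x) \<partial>lborel) \<le> ennreal bilip * (\<integral>\<^sup>+x. f x \<partial>lborel)"
proof -
  note Lt = Lt[OF t]
  have lip: "norm (conj_flow i t (-\<tau>) x - conj_flow i t (-\<tau>) y) \<le> 27 * norm (x - y)" for x y
    unfolding conj_flow_def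
    using lift_lipschitz[OF Lt(1), of "gflow (Y i) (-\<tau>) (drop t x)" "gflow (Y i) (-\<tau>) (drop t y)"]
      gflow_lipschitz[OF Y[OF i], of "-\<tau>" "drop t x" "drop t y"] drop_lipschitz[OF Lt(1), of x y] Lt(2) by simp
  have inv: "conj_flow i t (-\<tau>) (conj_flow i t \<tau> x) = x" "conj_flow i t \<tau> (conj_flow i t (-\<tau>) x) = x" for x
    by (simp_all add: conj_flow_def lift_drop gflow_inverse[OF Y[OF i]])
  have "(\<integral>\<^sup>+x. f (conj_flow i t \<tau> x) \<partial>lborel) \<le> ennreal ((2 * 27 * real DIM('a)) ^ DIM('a)) * (\<integral>\<^sup>+x. f x \<partial>lborel)"
    by (rule nn_integral_compose_bilipschitz[OF lip _ inv conj_flow_measurable[OF i t] f]) simp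
  moreover have "2 * 27 * real DIM('a) = 54 * real DIM('a)" by simp
  ultimately show ?thesis unfolding bilip_def by metis
qed

lemma flow_const_le_bilip: "flow_const TYPE('a) \<le> bilip"
  unfolding flow_const_def bilip_def by (intro power_mono) auto

text \<open>The constant of the comparison of nearby maps with \<open>\<Lambda> = bilip\<close>,
  written out because \<open>ball_const\<close> belongs to a frame at one height, whereas this
  number must be seen not to depend on \<open>t\<close>.\<close>

definition "near_const = 2 powr p * (2 * bilip * ((2 * (81 ^ DIM('a) * (1 + DIM('a) * (162 * L\<^sup>2))) * DIM('a)) ^ DIM('a) * measure lborel (cball (0::'a) K)
    * (4 * DIM('a) * step_const TYPE('a) p ^ (4 * DIM('a)) * K powr p))) / unit_ball_vol (DIM('a))"

lemma near_const_nonneg: "0 \<le> near_const"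
proof -
  have "0 \<le> step_const TYPE('a) p" using step_const_ge_1[of p, where 'a='a] p by linarith
  then show ?thesis
    unfolding near_const_def bilip_def using L
    by (intro divide_nonneg_nonneg mult_nonneg_nonneg zero_le_power add_nonneg_nonneg) simp_all
qed

lemma lpint_conj_flow_near:
  assumes i: "i \<in> I" and t: "0 < t" "t \<le> \<delta>" "\<bar>\<tau>\<bar> \<le> t" and \<phi>: "test_function \<rho>\<^sub>1 \<phi> d\<phi>"
  shows "lpint p (\<lambda>y. \<phi> (conj_flow i t \<tau> y, t) - \<phi> (gflow (Yt i t) \<tau> y, t)) \<le> ennreal (near_const * t powr p) * tangential d\<phi> t"
proof -
  interpret bf: bracket_frame "\<lambda>j. z j t" J L \<rho> \<eta> K t a A c by (rule frame[OF t(1,2)])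
  have K: "K \<ge> 0" using bf.K by simp
  have Et: "(\<integral>\<^sup>+x. f (gflow (Yt i t) \<tau> x) \<partial>lborel) \<le> ennreal bilip * (\<integral>\<^sup>+x. f x \<partial>lborel)"
    if "f \<in> borel_measurable borel" for f
  proof -
    have "(\<integral>\<^sup>+x. f (gflow (Yt i t) \<tau> x) \<partial>lborel) \<le> ennreal (flow_const TYPE('a)) * (\<integral>\<^sup>+x. f x \<partial>lborel)"
      by (rule nn_integral_gflow[OF Yt[OF i] Lt(2)[OF t] that])
    also have "\<dots> \<le> ennreal bilip * (\<integral>\<^sup>+x. f x \<partial>lborel)" by (intro mult_right_mono ennreal_leI flow_const_le_bilip) auto
    finally show ?thesis .
  qed
  have "lpint p (\<lambda>y. \<phi> (conj_flow i t \<tau> y, t) - \<phi> (gflow (Yt i t) \<tau> y, t))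
    \<le> ennreal (2 powr p * (2 * bilip * bf.ball_const p) / unit_ball_vol (DIM('a)) * t powr p) * (\<Sum>j\<in>J. lpint p (\<lambda>x. d\<phi> (x, t) (z j t x, 0)))"
  proof (rule bf.lpint_nearby_maps_difference[OF p J inv \<beta>, where u="\<lambda>x. \<phi> (x, t)" and du="\<lambda>x v. d\<phi> (x, t) (v, 0)" and \<rho>\<^sub>1=\<rho>\<^sub>1])
    show "real DIM('a) * bf.err \<le> 1" unfolding bf.err_def by (rule err[OF t(1,2)])
    show "((\<lambda>x. \<phi> (x, t)) has_derivative (\<lambda>v. d\<phi> (x, t) (v, 0))) (at x)" for x by (rule slice_derivative[OF \<phi>])
    show "continuous_on UNIV (\<lambda>x. d\<phi> (x, t) (z j t x, 0))" if "j \<in> J" for j by (rule slice_continuous[OF \<phi> bf.z[OF that]])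
    show "\<phi> (x, t) = 0" if "\<rho>\<^sub>1 \<le> norm x" for x
      using that norm_fst_le[of x t] by (intro test_functionD(4)[OF \<phi>]) linarith
    have "t\<^sup>2 \<le> \<delta>\<^sup>2" using t by (intro power_mono) auto
    then have "(7 * L\<^sup>2 + 1) * t\<^sup>2 \<le> (7 * L\<^sup>2 + 1) * \<delta>\<^sup>2" by (intro mult_left_mono) auto
    moreover have "(4 * DIM('a) + 2) * (L * (K * t)) \<le> (4 * DIM('a) + 2) * (L * (K * \<delta>))"
      using t L K by (intro mult_left_mono) auto
    ultimately show "\<rho>\<^sub>1 + (7 * L\<^sup>2 + 1) * t\<^sup>2 + real (4 * DIM('a) + 2) * (L * (K * t)) < \<rho>" using \<rho> by linarith
    show "norm (conj_flow i t \<tau> y - gflow (Yt i t) \<tau> y) \<le> 7 * L\<^sup>2 * t\<^sup>2" for y by (rule conj_flow_near[OF i t])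
    show "bilip \<ge> 0" by (simp add: bilip_def)
  qed (auto intro: Et nn_integral_conj_flow[OF i t] conj_flow_measurable[OF i t] gflow_measurable[OF Yt[OF i]])
  then show ?thesis unfolding tangential_def near_const_def bf.ball_const_def bf.lip_const_def .
qed

definition "middle_const = 2 powr p * flow_const TYPE('a) * (near_const + flow_const TYPE('a) * (B * card J) powr p)"

lemma middle_const_nonneg: "0 \<le> middle_const"
  unfolding middle_const_def using near_const_nonneg flow_const_ge_1[where 'a='a]
  by (intro mult_nonneg_nonneg add_nonneg_nonneg) simp_all

text \<open>In terms of the lifted point the difference is one between \<open>conj_flow\<close> and
  the identity at height \<open>t\<close>. It is split at the flow of \<open>Yt i t\<close>: the
  first part is a comparison of nearby maps, the second is a genuine flow, and the derivative along
  its field is a bounded combination of frame derivatives.\<close>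

lemma lpint_lifted_difference:
  assumes i: "i \<in> I" and t: "0 < t" "t \<le> \<delta>" "\<bar>\<tau>\<bar> \<le> t" and \<phi>: "test_function \<rho>\<^sub>1 \<phi> d\<phi>"
  shows "lpint p (\<lambda>x. \<phi> (lift t (gflow (Y i) \<tau> x), t) - \<phi> (lift t x, t)) \<le> ennreal (middle_const * t powr p) * tangential d\<phi> t"
proof -
  interpret bf: bracket_frame "\<lambda>j. z j t" J L \<rho> \<eta> K t a A c by (rule frame[OF t(1,2)])
  let ?E = "gflow (Yt i t) \<tau>" and ?H = "conj_flow i t \<tau>" and ?c = "flow_const TYPE('a)"
  have c: "1 \<le> ?c" by (rule flow_const_ge_1)
  have uc: "continuous_on UNIV (\<lambda>x. \<phi> (x, t))"
    by (rule continuous_on_compose2[OF test_functionD(6)[OF \<phi>]]) (auto intro!: continuous_intros)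
  have [measurable]: "(\<lambda>x. \<phi> (x, t)) \<in> borel_measurable borel" by (rule borel_measurable_continuous_onI[OF uc])
  have [measurable]: "?H \<in> borel_measurable borel" by (rule conj_flow_measurable[OF i t])
  have [measurable]: "?E \<in> borel_measurable borel" by (rule gflow_measurable[OF Yt[OF i]])
  have Hm[measurable]: "(\<lambda>y. \<phi> (?H y, t)) \<in> borel_measurable borel" "(\<lambda>y. \<phi> (?E y, t)) \<in> borel_measurable borel"
    by (rule measurable_compose[of _ borel borel "\<lambda>x. \<phi> (x, t)"]; measurable)+
  have "lpint p (\<lambda>x. d\<phi> (x, t) (Yt i t x, 0)) \<le> ennreal ((B * card J) powr p) * tangential d\<phi> t"
    unfolding tangential_def
  proof (rule lpint_le_sum[OF _ J B])
    fix x
    show "\<bar>d\<phi> (x, t) (Yt i t x, 0)\<bar> \<le> B * (\<Sum>j\<in>J. \<bar>d\<phi> (x, t) (z j t x, 0)\<bar>)"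
    proof (cases "norm x < \<rho>\<^sub>1")
      case True
      then obtain q where q: "\<forall>j\<in>J. \<bar>q j\<bar> \<le> B" "Yt i t x = (\<Sum>j\<in>J. q j *\<^sub>R z j t x)" using Yt_span[OF i t(1,2)] by blast
      have lin: "linear (\<lambda>v. d\<phi> (x, t) (v, 0))" by (rule has_derivative_linear[OF slice_derivative[OF \<phi>]])
      have "d\<phi> (x, t) (Yt i t x, 0) = (\<Sum>j\<in>J. q j * d\<phi> (x, t) (z j t x, 0))"
        unfolding q(2) using linear_sum[OF lin, of "\<lambda>j. q j *\<^sub>R z j t x" J] linear_scale[OF lin] by simp
      also have "\<bar>\<dots>\<bar> \<le> (\<Sum>j\<in>J. B * \<bar>d\<phi> (x, t) (z j t x, 0)\<bar>)"
        by (rule order_trans[OF sum_abs]) (use q(1) in \<open>auto intro!: sum_mono mult_right_mono simp: abs_mult\<close>)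
      finally show ?thesis by (simp add: sum_distrib_left)
    next
      case False
      then have "d\<phi> (x, t) v = 0" for v using norm_fst_le[of x t] by (intro test_functionD(5)[OF \<phi>]) linarith
      then show ?thesis using B by (simp add: sum_nonneg)
    qed
  next
    show "(\<lambda>x. d\<phi> (x, t) (z j t x, 0)) \<in> borel_measurable borel" if "j \<in> J" for j
      by (rule borel_measurable_continuous_onI[OF slice_continuous[OF \<phi> bf.z[OF that]]])
  qed (use p in auto)
  then have E0: "ennreal (?c * \<bar>\<tau>\<bar> powr p) * lpint p (\<lambda>x. d\<phi> (x, t) (Yt i t x, 0))
     \<le> ennreal (?c * t powr p) * (ennreal ((B * card J) powr p) * tangential d\<phi> t)"
    using c t p by (intro mult_mono ennreal_leI mult_left_mono powr_mono2) auto
  have E: "lpint p (\<lambda>y. \<phi> (?E y, t) - \<phi> (y, t)) \<le> ennreal (?c * (B * card J) powr p * t powr p) * tangential d\<phi> t"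
  proof -
    have "lpint p (\<lambda>y. \<phi> (?E y, t) - \<phi> (y, t)) \<le> ennreal (?c * \<bar>\<tau>\<bar> powr p) * lpint p (\<lambda>x. d\<phi> (x, t) (Yt i t x, 0))"
      by (rule lpint_gflow_difference[OF p Yt[OF i] Lt(2)[OF t], where u="\<lambda>x. \<phi> (x, t)" and du="\<lambda>x v. d\<phi> (x, t) (v, 0)"])
         (auto intro: slice_derivative[OF \<phi>] slice_continuous[OF \<phi> Yt[OF i]])
    also note E0
    also have "ennreal (?c * t powr p) * (ennreal ((B * card J) powr p) * tangential d\<phi> t) = ennreal (?c * (B * card J) powr p * t powr p) * tangential d\<phi> t"
      using c by (simp add: ennreal_mult mult_ac)
    finally show ?thesis .
  qed
  have "lpint p (\<lambda>y. \<phi> (?H y, t) - \<phi> (y, t)) = lpint p (\<lambda>y. (\<phi> (?H y, t) - \<phi> (?E y, t)) + (\<phi> (?E y, t) - \<phi> (y, t)))" by simp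
  also have "\<dots> \<le> ennreal (2 powr p) * (lpint p (\<lambda>y. \<phi> (?H y, t) - \<phi> (?E y, t)) + lpint p (\<lambda>y. \<phi> (?E y, t) - \<phi> (y, t)))"
    using p by (intro lpint_add) auto
  also have "\<dots> \<le> ennreal (2 powr p) * (ennreal (near_const * t powr p) * tangential d\<phi> t + ennreal (?c * (B * card J) powr p * t powr p) * tangential d\<phi> t)"
    by (intro mult_left_mono add_mono E lpint_conj_flow_near[OF i t \<phi>]) auto
  also have "\<dots> = ennreal (2 powr p * (near_const * t powr p + ?c * (B * card J) powr p * t powr p)) * tangential d\<phi> t"
    using c near_const_nonneg by (simp add: ennreal_mult ennreal_plus distrib_right mult.assoc)
  finally have HE: "lpint p (\<lambda>y. \<phi> (?H y, t) - \<phi> (y, t)) \<le> ennreal (2 powr p * (near_const * t powr p + ?c * (B * card J) powr p * t powr p)) * tangential d\<phi> t" .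
  have "lpint p (\<lambda>x. \<phi> (lift t (gflow (Y i) \<tau> x), t) - \<phi> (lift t x, t)) = (\<integral>\<^sup>+x. ennreal (\<bar>\<phi> (?H (lift t x), t) - \<phi> (lift t x, t)\<bar> powr p) \<partial>lborel)"
    by (simp add: lpint_def conj_flow_def lift_drop)
  also have "\<dots> \<le> ennreal ?c * lpint p (\<lambda>y. \<phi> (?H y, t) - \<phi> (y, t))"
    unfolding lpint_def by (rule nn_integral_lift[OF Lt(1)[OF t], of "\<lambda>y. ennreal (\<bar>\<phi> (?H y, t) - \<phi> (y, t)\<bar> powr p)"]) measurable
  also have "\<dots> \<le> ennreal ?c * (ennreal (2 powr p * (near_const * t powr p + ?c * (B * card J) powr p * t powr p)) * tangential d\<phi> t)"
    by (intro mult_left_mono HE) auto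
  also have "\<dots> = ennreal (middle_const * t powr p) * tangential d\<phi> t"
  proof -
    have "ennreal ?c * (ennreal x * G) = ennreal (?c * x) * G" if "0 \<le> x" for x G using c that by (simp add: ennreal_mult mult.assoc)
    moreover have "?c * (2 powr p * (near_const * t powr p + ?c * (B * card J) powr p * t powr p)) = middle_const * t powr p"
      by (simp add: middle_const_def algebra_simps)
    ultimately show ?thesis using c near_const_nonneg by simp
  qed
  finally show ?thesis .
qed

section \<open>Vertical pieces and the two bounds for the trace\<close>

definition "vert_const = flow_const TYPE('a) * (1 / (1 - 1/p)) powr (p - 1)"
definition "vert_int \<phi>d t = (\<integral>\<^sup>+s\<in>{0<..t}. ennreal (s powr (1 - 1/p)) * vertical \<phi>d s \<partial>lborel)"

lemma vert_const_nonneg: "0 \<le> vert_const"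
  using flow_const_ge_1[where 'a='a] by (simp add: vert_const_def)

lemma T_continuous:
  assumes "test_function \<rho>\<^sub>1 \<phi> d\<phi>"
  shows "continuous_on UNIV (\<lambda>y. d\<phi> y (T y))"
  by (rule test_function_field_continuous[OF assms]) (auto intro!: continuous_intros bounded_lipschitz_continuous[OF T])

lemma lpint_lift:
  assumes t: "0 < t" "t \<le> \<delta>" and \<phi>: "test_function \<rho>\<^sub>1 \<phi> d\<phi>"
  shows "lpint p (\<lambda>x. \<phi> (lift t x, t) - \<phi> (x, 0)) \<le> ennreal (vert_const * t powr ((1 - 1/p) * (p - 1))) * vert_int d\<phi> t"
proof -
  have "L * t \<le> 1" using Lt(1)[OF t, of t] t by simp
  from lpint_lift_difference[OF p t(1) this test_functionD(1)[OF \<phi>] T_continuous[OF \<phi>]]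
  show ?thesis unfolding vert_const_def vert_int_def vertical_def .
qed

definition "trace_const = 2 powr p * (2 powr p * (flow_const TYPE('a) * vert_const + vert_const + middle_const))"

lemma trace_const_nonneg: "0 \<le> trace_const"
  unfolding trace_const_def using vert_const_nonneg middle_const_nonneg flow_const_ge_1[where 'a='a]
  by (intro mult_nonneg_nonneg add_nonneg_nonneg) simp_all

lemma lpint_trace_difference:
  assumes i: "i \<in> I" and t: "0 < t" "t \<le> \<delta>" "\<bar>\<tau>\<bar> \<le> t" and \<phi>: "test_function \<rho>\<^sub>1 \<phi> d\<phi>"
  shows "lpint p (\<lambda>x. \<phi> (gflow (Y i) \<tau> x, 0) - \<phi> (x, 0))
    \<le> ennreal trace_const * (ennreal (t powr ((1 - 1/p) * (p - 1))) * vert_int d\<phi> t + ennreal (t powr p) * tangential d\<phi> t)"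
proof -
  let ?F = "gflow (Y i) \<tau>" and ?c = "flow_const TYPE('a)" and ?e = "t powr ((1 - 1/p) * (p - 1))"
  let ?V = "ennreal ?e * vert_int d\<phi> t" and ?Z = "ennreal (t powr p) * tangential d\<phi> t"
  have c: "1 \<le> ?c" by (rule flow_const_ge_1)
  have sl: "(\<lambda>x. \<phi> (x, s)) \<in> borel_measurable borel" for s
    by (intro borel_measurable_continuous_onI continuous_on_compose2[OF test_functionD(6)[OF \<phi>]]) (auto intro!: continuous_intros)
  have [measurable]: "?F \<in> borel_measurable borel" by (rule gflow_measurable[OF Y[OF i]])
  have m1: "(\<lambda>x. \<phi> (lift t x, t)) \<in> borel_measurable borel" by (rule measurable_compose[OF lift_measurable sl])
  have m2: "(\<lambda>x. \<phi> (?F x, 0)) \<in> borel_measurable borel" by (rule measurable_compose[OF _ sl]) measurable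
  have m3: "(\<lambda>x. \<phi> (lift t (?F x), t)) \<in> borel_measurable borel" by (rule measurable_compose[OF _ m1]) measurable
  note [measurable] = sl m1 m2 m3
  have 3: "lpint p (\<lambda>x. \<phi> (lift t x, t) - \<phi> (x, 0)) \<le> ennreal vert_const * ?V"
    using lpint_lift[OF t(1,2) \<phi>] vert_const_nonneg by (simp add: ennreal_mult mult.assoc)
  \<comment> \<open>The vertical piece over the moved point is the one over \<open>x\<close>
    composed with the flow \<open>?F\<close>, up to sign.\<close>
  have "lpint p (\<lambda>x. \<phi> (?F x, 0) - \<phi> (lift t (?F x), t)) = (\<integral>\<^sup>+x. ennreal (\<bar>\<phi> (lift t (?F x), t) - \<phi> (?F x, 0)\<bar> powr p) \<partial>lborel)"
    by (simp add: lpint_def abs_minus_commute)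
  also have "\<dots> \<le> ennreal ?c * lpint p (\<lambda>x. \<phi> (lift t x, t) - \<phi> (x, 0))"
    unfolding lpint_def by (rule nn_integral_gflow[OF Y[OF i] Lt(2)[OF t], of "\<lambda>y. ennreal (\<bar>\<phi> (lift t y, t) - \<phi> (y, 0)\<bar> powr p)"]) measurable
  also have "\<dots> \<le> ennreal ?c * (ennreal vert_const * ?V)" by (intro mult_left_mono 3) auto
  finally have 1: "lpint p (\<lambda>x. \<phi> (?F x, 0) - \<phi> (lift t (?F x), t)) \<le> ennreal (?c * vert_const) * ?V"
    using c vert_const_nonneg by (simp add: ennreal_mult mult.assoc)
  have 2: "lpint p (\<lambda>x. \<phi> (lift t (?F x), t) - \<phi> (lift t x, t)) \<le> ennreal middle_const * ?Z"
    using lpint_lifted_difference[OF i t \<phi>] middle_const_nonneg by (simp add: ennreal_mult mult.assoc)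
  have two: "X \<le> ennreal (2 powr p) * X" for X
  proof -
    have "1 \<le> ennreal (2 powr p)" using ennreal_leI[OF ge_one_powr_ge_zero[of 2 p]] p by simp
    from mult_right_mono[OF this, of X] show ?thesis by simp
  qed
  have "lpint p (\<lambda>x. \<phi> (?F x, 0) - \<phi> (x, 0))
    = lpint p (\<lambda>x. (\<phi> (?F x, 0) - \<phi> (lift t (?F x), t)) + ((\<phi> (lift t (?F x), t) - \<phi> (lift t x, t)) + (\<phi> (lift t x, t) - \<phi> (x, 0))))" by simp
  also have "\<dots> \<le> ennreal (2 powr p) * (lpint p (\<lambda>x. \<phi> (?F x, 0) - \<phi> (lift t (?F x), t))
     + lpint p (\<lambda>x. (\<phi> (lift t (?F x), t) - \<phi> (lift t x, t)) + (\<phi> (lift t x, t) - \<phi> (x, 0))))"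
    using p by (intro lpint_add) auto
  also have "\<dots> \<le> ennreal (2 powr p) * (ennreal (2 powr p) * (ennreal (?c * vert_const) * ?V)
     + ennreal (2 powr p) * (ennreal middle_const * ?Z + ennreal vert_const * ?V))"
    using p by (intro mult_left_mono add_mono order_trans[OF 1 two] order_trans[OF lpint_add] 2 3) auto
  also have "\<dots> = ennreal (2 powr p * (2 powr p)) * (ennreal (?c * vert_const + vert_const) * ?V + ennreal middle_const * ?Z)"
    using c vert_const_nonneg by (simp add: ennreal_mult ennreal_plus algebra_simps)
  also have "\<dots> \<le> ennreal (2 powr p * (2 powr p)) * (ennreal (?c * vert_const + vert_const + middle_const) * ?V + ennreal (?c * vert_const + vert_const + middle_const) * ?Z)"
  proof -
    have "0 \<le> ?c * vert_const" using c vert_const_nonneg by simp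
    then have *: "?c * vert_const + vert_const \<le> ?c * vert_const + vert_const + middle_const"
      "middle_const \<le> ?c * vert_const + vert_const + middle_const"
      using vert_const_nonneg middle_const_nonneg by linarith+
    show ?thesis
      by (rule mult_left_mono[OF add_mono[OF mult_right_mono[OF ennreal_leI[OF *(1)]] mult_right_mono[OF ennreal_leI[OF *(2)]]]]) simp_all
  qed
  also have "\<dots> = ennreal trace_const * (?V + ?Z)"
    unfolding trace_const_def distrib_left[symmetric]
    using c vert_const_nonneg middle_const_nonneg
    by (subst mult.assoc[symmetric], subst ennreal_mult[symmetric]) (auto simp: mult.assoc)
  finally show ?thesis .
qed

lemma vertical_measurable:
  assumes \<phi>: "test_function \<rho>\<^sub>1 \<phi> d\<phi>"
  shows "vertical d\<phi> \<in> borel_measurable borel"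
proof -
  have [measurable]: "(\<lambda>y. d\<phi> y (T y)) \<in> borel_measurable (borel \<Otimes>\<^sub>M borel)"
    unfolding borel_prod by (rule borel_measurable_continuous_onI[OF T_continuous[OF \<phi>]])
  show ?thesis unfolding vertical_def[abs_def] lpint_def by measurable
qed

text \<open>The bound on the difference does not involve \<open>\<tau>\<close>, so it passes to the
  supremum. Since \<open>- p + (1 - 1/p) * (p - 1) = - 1 - (1 - 1/p)\<close>, the vertical part is
  in the form of Hardy's inequality, while in the tangential part the powers of \<open>t\<close>
  cancel. Measurability of \<open>tangential\<close> in \<open>t\<close> is assumed because the
  locale does not say how \<open>z j t\<close> depends on \<open>t\<close>.\<close>

theorem besov_integral_bound:
  assumes i: "i \<in> I" and \<phi>: "test_function \<rho>\<^sub>1 \<phi> d\<phi>" and tm: "tangential d\<phi> \<in> borel_measurable borel"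
  shows "(\<integral>\<^sup>+t\<in>{0<..\<delta>}. (SUP \<tau>\<in>{-t..t}. ennreal (t powr (- p)) * lpint p (\<lambda>x. \<phi> (gflow (Y i) \<tau> x, 0) - \<phi> (x, 0))) \<partial>lborel)
    \<le> ennreal (trace_const * (1 / (1 - 1/p) + 1)) * ((\<integral>\<^sup>+t\<in>{0<..\<delta>}. vertical d\<phi> t \<partial>lborel) + (\<integral>\<^sup>+t\<in>{0<..\<delta>}. tangential d\<phi> t \<partial>lborel))"
proof -
  define \<gamma> where "\<gamma> = 1 - 1/p"
  have \<gamma>: "\<gamma> > 0" using p by (simp add: \<gamma>_def)
  note [measurable] = tm vertical_measurable[OF \<phi>]
  \<comment> \<open>The domain of integration varies with \<open>t\<close>; written as a condition
    on the pair it is jointly measurable.\<close>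
  have vm[measurable]: "vert_int d\<phi> \<in> borel_measurable borel"
  proof -
    have "vert_int d\<phi> = (\<lambda>t. \<integral>\<^sup>+s. ennreal (s powr (1 - 1/p)) * vertical d\<phi> s * (if 0 < s \<and> s \<le> t then 1 else 0) \<partial>lborel)"
      unfolding vert_int_def by (intro ext nn_integral_cong) (auto split: split_indicator)
    then show ?thesis by simp
  qed
  have pt: "(SUP \<tau>\<in>{-t..t}. ennreal (t powr (- p)) * lpint p (\<lambda>x. \<phi> (gflow (Y i) \<tau> x, 0) - \<phi> (x, 0)))
     \<le> ennreal trace_const * (ennreal (t powr (- 1 - \<gamma>)) * vert_int d\<phi> t + tangential d\<phi> t)" if t: "0 < t" "t \<le> \<delta>" for t
  proof (rule SUP_least)
    fix \<tau> assume "\<tau> \<in> {-t..t}"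
    then have \<tau>: "\<bar>\<tau>\<bar> \<le> t" by auto
    have "ennreal (t powr (- p)) * lpint p (\<lambda>x. \<phi> (gflow (Y i) \<tau> x, 0) - \<phi> (x, 0))
      \<le> ennreal (t powr (- p)) * (ennreal trace_const * (ennreal (t powr (\<gamma> * (p - 1))) * vert_int d\<phi> t + ennreal (t powr p) * tangential d\<phi> t))"
      unfolding \<gamma>_def by (intro mult_left_mono lpint_trace_difference[OF i t \<tau> \<phi>]) auto
    also have "\<dots> = ennreal trace_const * ((ennreal (t powr (- p)) * ennreal (t powr (\<gamma> * (p - 1)))) * vert_int d\<phi> t + (ennreal (t powr (- p)) * ennreal (t powr p)) * tangential d\<phi> t)"
      by (simp add: algebra_simps)
    also have "ennreal (t powr (- p)) * ennreal (t powr p) = 1" using t by (simp add: ennreal_mult[symmetric] powr_add[symmetric])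
    also have "ennreal (t powr (- p)) * ennreal (t powr (\<gamma> * (p - 1))) = ennreal (t powr (- 1 - \<gamma>))"
    proof -
      have "- p + \<gamma> * (p - 1) = - 1 - \<gamma>" using p by (simp add: \<gamma>_def field_simps)
      then show ?thesis using t by (simp add: ennreal_mult[symmetric] powr_add[symmetric])
    qed
    finally show "ennreal (t powr (- p)) * lpint p (\<lambda>x. \<phi> (gflow (Y i) \<tau> x, 0) - \<phi> (x, 0))
      \<le> ennreal trace_const * (ennreal (t powr (- 1 - \<gamma>)) * vert_int d\<phi> t + tangential d\<phi> t)" by simp
  qed
  have "(\<integral>\<^sup>+t\<in>{0<..\<delta>}. (SUP \<tau>\<in>{-t..t}. ennreal (t powr (- p)) * lpint p (\<lambda>x. \<phi> (gflow (Y i) \<tau> x, 0) - \<phi> (x, 0))) \<partial>lborel)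
    \<le> (\<integral>\<^sup>+t. ennreal trace_const * (ennreal (t powr (- 1 - \<gamma>)) * vert_int d\<phi> t * indicator {0<..\<delta>} t + tangential d\<phi> t * indicator {0<..\<delta>} t) \<partial>lborel)"
    by (intro nn_integral_mono) (use pt in \<open>auto split: split_indicator\<close>)
  also have "\<dots> = ennreal trace_const * ((\<integral>\<^sup>+t\<in>{0<..\<delta>}. ennreal (t powr (- 1 - \<gamma>)) * vert_int d\<phi> t \<partial>lborel) + (\<integral>\<^sup>+t\<in>{0<..\<delta>}. tangential d\<phi> t \<partial>lborel))"
    by (subst nn_integral_cmult, measurable, subst nn_integral_add, measurable)
  also have "\<dots> \<le> ennreal trace_const * (ennreal (1 / \<gamma>) * (\<integral>\<^sup>+t\<in>{0<..\<delta>}. vertical d\<phi> t \<partial>lborel) + (\<integral>\<^sup>+t\<in>{0<..\<delta>}. tangential d\<phi> t \<partial>lborel))"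
    using hardy_weighted[OF \<gamma> vertical_measurable[OF \<phi>], of \<delta>] unfolding vert_int_def \<gamma>_def
    by (intro mult_left_mono add_mono) auto
  also have "\<dots> \<le> ennreal trace_const * (ennreal (1 / \<gamma> + 1) * (\<integral>\<^sup>+t\<in>{0<..\<delta>}. vertical d\<phi> t \<partial>lborel) + ennreal (1 / \<gamma> + 1) * (\<integral>\<^sup>+t\<in>{0<..\<delta>}. tangential d\<phi> t \<partial>lborel))"
  proof (intro mult_left_mono add_mono mult_right_mono ennreal_leI)
    have "1 * X \<le> ennreal (1 / \<gamma> + 1) * X" for X using \<gamma> by (intro mult_right_mono) auto
    then show "(\<integral>\<^sup>+t\<in>{0<..\<delta>}. tangential d\<phi> t \<partial>lborel) \<le> ennreal (1 / \<gamma> + 1) * (\<integral>\<^sup>+t\<in>{0<..\<delta>}. tangential d\<phi> t \<partial>lborel)" by simp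
  qed auto
  also have "\<dots> = ennreal (trace_const * (1 / \<gamma> + 1)) * ((\<integral>\<^sup>+t\<in>{0<..\<delta>}. vertical d\<phi> t \<partial>lborel) + (\<integral>\<^sup>+t\<in>{0<..\<delta>}. tangential d\<phi> t \<partial>lborel))"
    unfolding distrib_left[symmetric] using trace_const_nonneg \<gamma>
    by (subst mult.assoc[symmetric], subst ennreal_mult[symmetric]) auto
  finally show ?thesis by (simp add: \<gamma>_def)
qed

text \<open>\<open>\<phi> (x, 0)\<close> is compared with \<open>\<phi> (lift t x, t)\<close> for
  every height and the inequality is averaged over \<open>0 < t \<le> \<delta>\<close>, which is
  where \<open>1 / \<delta>\<close> comes from. As \<open>\<delta> \<le> 1\<close>, the powers of
  \<open>s\<close> and \<open>t\<close> in the vertical bound are at most 1.\<close>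

theorem trace_lp_bound:
  assumes \<phi>: "test_function \<rho>\<^sub>1 \<phi> d\<phi>"
  shows "lpint p (\<lambda>x. \<phi> (x, 0)) \<le> ennreal (2 powr p * (vert_const + flow_const TYPE('a)) / \<delta>)
    * ((\<integral>\<^sup>+t\<in>{0<..\<delta>}. lpint p (\<lambda>x. \<phi> (x, t)) \<partial>lborel) + (\<integral>\<^sup>+t\<in>{0<..\<delta>}. vertical d\<phi> t \<partial>lborel))"
proof -
  let ?c = "flow_const TYPE('a)"
  let ?V = "\<integral>\<^sup>+t\<in>{0<..\<delta>}. vertical d\<phi> t \<partial>lborel" and ?P = "\<integral>\<^sup>+t\<in>{0<..\<delta>}. lpint p (\<lambda>x. \<phi> (x, t)) \<partial>lborel"
  let ?D = "vert_const + ?c"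
  have c: "1 \<le> ?c" by (rule flow_const_ge_1)
  note vc = vert_const_nonneg
  have [measurable]: "\<phi> \<in> borel_measurable (borel \<Otimes>\<^sub>M borel)"
    unfolding borel_prod by (rule borel_measurable_continuous_onI[OF test_functionD(6)[OF \<phi>]])
  have sl[measurable]: "(\<lambda>x. \<phi> (x, s)) \<in> borel_measurable borel" for s by measurable
  have pm[measurable]: "(\<lambda>t. lpint p (\<lambda>x. \<phi> (x, t))) \<in> borel_measurable borel"
    unfolding lpint_def by measurable
  have pt: "lpint p (\<lambda>x. \<phi> (x, 0)) \<le> ennreal (2 powr p) * (ennreal vert_const * ?V + ennreal ?c * lpint p (\<lambda>x. \<phi> (x, t)))"
    if t: "0 < t" "t \<le> \<delta>" for t
  proof -
    have [measurable]: "(\<lambda>x. \<phi> (lift t x, t)) \<in> borel_measurable borel" by (rule measurable_compose[OF lift_measurable sl])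
    have "lpint p (\<lambda>x. \<phi> (x, 0)) = lpint p (\<lambda>x. (\<phi> (x, 0) - \<phi> (lift t x, t)) + \<phi> (lift t x, t))" by simp
    also have "\<dots> \<le> ennreal (2 powr p) * (lpint p (\<lambda>x. \<phi> (x, 0) - \<phi> (lift t x, t)) + lpint p (\<lambda>x. \<phi> (lift t x, t)))"
      using p by (intro lpint_add) auto
    also have "\<dots> \<le> ennreal (2 powr p) * (ennreal vert_const * ?V + ennreal ?c * lpint p (\<lambda>x. \<phi> (x, t)))"
    proof (intro mult_left_mono add_mono)
      have t1: "t \<le> 1" using t \<delta> by linarith
      have "lpint p (\<lambda>x. \<phi> (x, 0) - \<phi> (lift t x, t)) = lpint p (\<lambda>x. \<phi> (lift t x, t) - \<phi> (x, 0))"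
        by (simp add: lpint_def abs_minus_commute)
      also have "\<dots> \<le> ennreal (vert_const * t powr ((1 - 1/p) * (p - 1))) * vert_int d\<phi> t" by (rule lpint_lift[OF t \<phi>])
      also have "\<dots> \<le> ennreal vert_const * ?V"
      proof (intro mult_mono ennreal_leI)
        have "t powr ((1 - 1/p) * (p - 1)) \<le> 1 powr ((1 - 1/p) * (p - 1))" using t t1 p by (intro powr_mono2) auto
        then show "vert_const * t powr ((1 - 1/p) * (p - 1)) \<le> vert_const" using vc mult_left_mono[of _ 1 vert_const] by simp
        show "vert_int d\<phi> t \<le> ?V"
          unfolding vert_int_def
        proof (rule nn_integral_mono)
          fix s :: real
          have "ennreal (s powr (1 - 1/p)) * vertical d\<phi> s \<le> 1 * vertical d\<phi> s" if "0 < s" "s \<le> t"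
          proof (intro mult_right_mono)
            have "s powr (1 - 1/p) \<le> 1 powr (1 - 1/p)" using that t1 p by (intro powr_mono2) auto
            then show "ennreal (s powr (1 - 1/p)) \<le> 1" by simp
          qed auto
          then show "ennreal (s powr (1 - 1/p)) * vertical d\<phi> s * indicator {0<..t} s \<le> vertical d\<phi> s * indicator {0<..\<delta>} s"
            using t by (auto split: split_indicator)
        qed
      qed auto
      finally show "lpint p (\<lambda>x. \<phi> (x, 0) - \<phi> (lift t x, t)) \<le> ennreal vert_const * ?V" .
      show "lpint p (\<lambda>x. \<phi> (lift t x, t)) \<le> ennreal ?c * lpint p (\<lambda>x. \<phi> (x, t))"
        unfolding lpint_def by (rule nn_integral_lift[OF Lt(1)[OF t, of t], of "\<lambda>y. ennreal (\<bar>\<phi> (y, t)\<bar> powr p)"]) (use t in \<open>auto\<close>)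
    qed auto
    finally show ?thesis .
  qed
  have "ennreal \<delta> * lpint p (\<lambda>x. \<phi> (x, 0)) = (\<integral>\<^sup>+t. lpint p (\<lambda>x. \<phi> (x, 0)) * indicator {0<..\<delta>} t \<partial>lborel)"
    using \<delta> by (subst nn_integral_cmult) (auto simp: mult.commute)
  also have "\<dots> \<le> (\<integral>\<^sup>+t. ennreal (2 powr p) * (ennreal vert_const * ?V * indicator {0<..\<delta>} t + ennreal ?c * (lpint p (\<lambda>x. \<phi> (x, t)) * indicator {0<..\<delta>} t)) \<partial>lborel)"
    by (intro nn_integral_mono) (use pt in \<open>auto split: split_indicator\<close>)
  also have "\<dots> = ennreal (2 powr p) * (ennreal vert_const * ?V * ennreal \<delta> + ennreal ?c * ?P)"
  proof -
    have "(\<integral>\<^sup>+t. ennreal vert_const * ?V * indicator {0<..\<delta>} t \<partial>lborel) = ennreal vert_const * ?V * ennreal \<delta>"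
      using \<delta> by (subst nn_integral_cmult) auto
    moreover have "(\<integral>\<^sup>+t. ennreal ?c * (lpint p (\<lambda>x. \<phi> (x, t)) * indicator {0<..\<delta>} t) \<partial>lborel) = ennreal ?c * ?P"
      by (rule nn_integral_cmult) measurable
    ultimately show ?thesis by (subst nn_integral_cmult, measurable, subst nn_integral_add, measurable)
  qed
  also have "\<dots> \<le> ennreal (2 powr p) * (ennreal ?D * ?V + ennreal ?D * ?P)"
  proof (intro mult_left_mono add_mono)
    have "ennreal vert_const * ?V * ennreal \<delta> \<le> ennreal ?D * ?V * 1"
      using c vc \<delta> by (intro mult_mono ennreal_leI) auto
    then show "ennreal vert_const * ?V * ennreal \<delta> \<le> ennreal ?D * ?V" by simp
    show "ennreal ?c * ?P \<le> ennreal ?D * ?P" using c vc by (intro mult_right_mono ennreal_leI) auto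
  qed auto
  finally have le: "ennreal \<delta> * lpint p (\<lambda>x. \<phi> (x, 0)) \<le> ennreal (2 powr p * ?D) * (?P + ?V)"
    using c vc by (simp add: ennreal_mult distrib_left[symmetric] mult.assoc add.commute)
  have "lpint p (\<lambda>x. \<phi> (x, 0)) = ennreal (1 / \<delta>) * (ennreal \<delta> * lpint p (\<lambda>x. \<phi> (x, 0)))"
    using \<delta> by (subst mult.assoc[symmetric], subst ennreal_mult[symmetric]) auto
  also have "\<dots> \<le> ennreal (1 / \<delta>) * (ennreal (2 powr p * ?D) * (?P + ?V))" by (intro mult_left_mono le) auto
  also have "\<dots> = ennreal (2 powr p * ?D / \<delta>) * (?P + ?V)"
    using c vc \<delta> by (subst mult.assoc[symmetric], subst ennreal_mult[symmetric]) auto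
  finally show ?thesis .
qed

end

section \<open>Strict derivatives and frames\<close>

text \<open>Differentiability with both endpoints free near \<open>x\<close>. Unlike the ordinary
  derivative it yields a Lipschitz bound near \<open>x\<close> and the two-point estimate required
  by \<open>nearly_affine\<close>.\<close>

definition has_strict_derivative :: "('b::real_normed_vector \<Rightarrow> 'c::real_normed_vector) \<Rightarrow> ('b \<Rightarrow> 'c) \<Rightarrow> 'b \<Rightarrow> bool" where
  "has_strict_derivative f D x \<longleftrightarrow> bounded_linear D \<and>
     (\<forall>\<epsilon>>0. \<exists>d>0. \<forall>y\<in>ball x d. \<forall>y'\<in>ball x d. norm (f y - f y' - D (y - y')) \<le> \<epsilon> * norm (y - y'))"

lemma strict_derivativeD:
  assumes "has_strict_derivative f D x" "\<epsilon> > 0"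
  obtains d where "d > 0" "\<And>y y'. norm (y - x) < d \<Longrightarrow> norm (y' - x) < d \<Longrightarrow> norm (f y - f y' - D (y - y')) \<le> \<epsilon> * norm (y - y')"
proof -
  obtain d where "d > 0" "\<forall>y\<in>ball x d. \<forall>y'\<in>ball x d. norm (f y - f y' - D (y - y')) \<le> \<epsilon> * norm (y - y')"
    using assms unfolding has_strict_derivative_def by blast
  then show ?thesis using that by (simp add: dist_norm norm_minus_commute)
qed

lemma strict_derivative_lipschitz:
  assumes f: "has_strict_derivative f D x"
  obtains d L where "d > 0" "L > 0" "\<And>y y'. norm (y - x) < d \<Longrightarrow> norm (y' - x) < d \<Longrightarrow> norm (f y - f y') \<le> L * norm (y - y')"
proof -
  obtain d where d: "d > 0" "\<And>y y'. norm (y - x) < d \<Longrightarrow> norm (y' - x) < d \<Longrightarrow> norm (f y - f y' - D (y - y')) \<le> 1 * norm (y - y')"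
    using strict_derivativeD[OF f, of 1] by auto
  obtain K where K: "K > 0" "\<And>v. norm (D v) \<le> norm v * K"
    using f bounded_linear.pos_bounded unfolding has_strict_derivative_def by blast
  show ?thesis
  proof (rule that[OF d(1), of "1 + K"])
    show "1 + K > 0" using K by simp
    fix y y' assume "norm (y - x) < d" "norm (y' - x) < d"
    then show "norm (f y - f y') \<le> (1 + K) * norm (y - y')"
      using d(2)[of y y'] K(2)[of "y - y'"] norm_triangle_sub[of "f y - f y'" "D (y - y')"] by (simp add: algebra_simps)
  qed
qed

lemma strict_derivative_has_derivative:
  assumes f: "has_strict_derivative f D x"
  shows "(f has_derivative D) (at x)"
  unfolding has_derivative_at_alt
proof (intro conjI allI impI)
  show "bounded_linear D" using f by (simp add: has_strict_derivative_def)
  fix e :: real assume "e > 0"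
  then obtain d where "d > 0" "\<And>y y'. norm (y - x) < d \<Longrightarrow> norm (y' - x) < d \<Longrightarrow> norm (f y - f y' - D (y - y')) \<le> e * norm (y - y')"
    using strict_derivativeD[OF f] by metis
  then show "\<exists>d>0. \<forall>y. norm (y - x) < d \<longrightarrow> norm (f y - f x - D (y - x)) \<le> e * norm (y - x)" by auto
qed

lemma strict_derivative_add:
  assumes f: "has_strict_derivative f D x" and g: "has_strict_derivative g E x"
  shows "has_strict_derivative (\<lambda>y. f y + g y) (\<lambda>v. D v + E v) x"
  unfolding has_strict_derivative_def
proof (intro conjI allI impI)
  show "bounded_linear (\<lambda>v. D v + E v)" using f g by (intro bounded_linear_add) (auto simp: has_strict_derivative_def)
  fix e :: real assume e: "e > 0"
  obtain d1 where d1: "d1 > 0" "\<And>y y'. norm (y - x) < d1 \<Longrightarrow> norm (y' - x) < d1 \<Longrightarrow> norm (f y - f y' - D (y - y')) \<le> e/2 * norm (y - y')"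
    using strict_derivativeD[OF f, of "e/2"] e by auto
  obtain d2 where d2: "d2 > 0" "\<And>y y'. norm (y - x) < d2 \<Longrightarrow> norm (y' - x) < d2 \<Longrightarrow> norm (g y - g y' - E (y - y')) \<le> e/2 * norm (y - y')"
    using strict_derivativeD[OF g, of "e/2"] e by auto
  show "\<exists>d>0. \<forall>y\<in>ball x d. \<forall>y'\<in>ball x d. norm (f y + g y - (f y' + g y') - (D (y - y') + E (y - y'))) \<le> e * norm (y - y')"
  proof (intro exI[of _ "min d1 d2"] conjI ballI)
    fix y y' assume "y \<in> ball x (min d1 d2)" "y' \<in> ball x (min d1 d2)"
    then have "norm (f y - f y' - D (y - y')) \<le> e/2 * norm (y - y')" "norm (g y - g y' - E (y - y')) \<le> e/2 * norm (y - y')"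
      using d1(2)[of y y'] d2(2)[of y y'] by (auto simp: dist_norm norm_minus_commute)
    then have "norm ((f y - f y' - D (y - y')) + (g y - g y' - E (y - y'))) \<le> e/2 * norm (y - y') + e/2 * norm (y - y')"
      by (rule norm_triangle_mono)
    then show "norm (f y + g y - (f y' + g y') - (D (y - y') + E (y - y'))) \<le> e * norm (y - y')"
      by (simp add: algebra_simps)
  qed (use d1 d2 in auto)
qed

lemma strict_derivative_const: "has_strict_derivative (\<lambda>y. c) (\<lambda>v. 0) x"
  unfolding has_strict_derivative_def by (auto intro: exI[of _ 1])

lemma strict_derivative_sum:
  assumes "finite S" "\<And>b. b \<in> S \<Longrightarrow> has_strict_derivative (f b) (D b) x"
  shows "has_strict_derivative (\<lambda>y. \<Sum>b\<in>S. f b y) (\<lambda>v. \<Sum>b\<in>S. D b v) x"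
  using assms
proof (induction S)
  case empty
  then show ?case by (simp add: strict_derivative_const)
next
  case (insert b S)
  then show ?case using strict_derivative_add[of "f b" "D b" x "\<lambda>y. \<Sum>b\<in>S. f b y" "\<lambda>v. \<Sum>b\<in>S. D b v"] by simp
qed

lemma strict_derivative_bounded_linear:
  assumes f: "has_strict_derivative f D x" and h: "bounded_linear h"
  shows "has_strict_derivative (\<lambda>y. h (f y)) (\<lambda>v. h (D v)) x"
  unfolding has_strict_derivative_def
proof (intro conjI allI impI)
  show "bounded_linear (\<lambda>v. h (D v))" using f h bounded_linear_compose by (auto simp: has_strict_derivative_def)
  fix e :: real assume e: "e > 0"
  obtain K where K: "K > 0" "\<And>v. norm (h v) \<le> norm v * K" using h bounded_linear.pos_bounded by blast
  obtain d where d: "d > 0" "\<And>y y'. norm (y - x) < d \<Longrightarrow> norm (y' - x) < d \<Longrightarrow> norm (f y - f y' - D (y - y')) \<le> e/K * norm (y - y')"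
    using strict_derivativeD[OF f, of "e/K"] e K by auto
  show "\<exists>d>0. \<forall>y\<in>ball x d. \<forall>y'\<in>ball x d. norm (h (f y) - h (f y') - h (D (y - y'))) \<le> e * norm (y - y')"
  proof (intro exI[of _ d] conjI ballI)
    fix y y' assume "y \<in> ball x d" "y' \<in> ball x d"
    then have "norm (f y - f y' - D (y - y')) * K \<le> (e/K * norm (y - y')) * K"
      using d(2)[of y y'] K by (intro mult_right_mono) (auto simp: dist_norm norm_minus_commute)
    then have "norm (h (f y - f y' - D (y - y'))) \<le> e * norm (y - y')"
      using K(2)[of "f y - f y' - D (y - y')"] K(1) by simp
    then show "norm (h (f y) - h (f y') - h (D (y - y'))) \<le> e * norm (y - y')"
      by (simp add: linear_diff[OF bounded_linear.linear[OF h]])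
  qed (use d in auto)
qed

lemma strict_derivative_scaleR:
  fixes f :: "'b::real_normed_vector \<Rightarrow> real"
  assumes f: "has_strict_derivative f D x" and g: "has_strict_derivative g E x"
  shows "has_strict_derivative (\<lambda>y. f y *\<^sub>R g y) (\<lambda>v. f x *\<^sub>R E v + D v *\<^sub>R g x) x"
  unfolding has_strict_derivative_def
proof (intro conjI allI impI)
  show "bounded_linear (\<lambda>v. f x *\<^sub>R E v + D v *\<^sub>R g x)"
    using f g by (auto simp: has_strict_derivative_def intro!: bounded_linear_intros)
  obtain d0 L where L: "d0 > 0" "L > 0" "\<And>y y'. norm (y - x) < d0 \<Longrightarrow> norm (y' - x) < d0 \<Longrightarrow> norm (f y - f y') \<le> L * norm (y - y')"
    using strict_derivative_lipschitz[OF f] by metis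
  obtain d0' L' where L': "d0' > 0" "L' > 0" "\<And>y y'. norm (y - x) < d0' \<Longrightarrow> norm (y' - x) < d0' \<Longrightarrow> norm (g y - g y') \<le> L' * norm (y - y')"
    using strict_derivative_lipschitz[OF g] by metis
  fix e :: real assume e: "e > 0"
  define M where "M = \<bar>f x\<bar> + norm (g x) + 1"
  have M: "M > 0" by (simp add: M_def add_nonneg_pos)
  obtain d1 where d1: "d1 > 0" "\<And>y y'. norm (y - x) < d1 \<Longrightarrow> norm (y' - x) < d1 \<Longrightarrow> norm (f y - f y' - D (y - y')) \<le> e/(4*M) * norm (y - y')"
    using strict_derivativeD[OF f, of "e/(4*M)"] e M by auto
  obtain d2 where d2: "d2 > 0" "\<And>y y'. norm (y - x) < d2 \<Longrightarrow> norm (y' - x) < d2 \<Longrightarrow> norm (g y - g y' - E (y - y')) \<le> e/(4*M) * norm (y - y')"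
    using strict_derivativeD[OF g, of "e/(4*M)"] e M by auto
  \<comment> \<open>Of the four error terms below, two are first-order errors, handled by
    \<open>d1\<close> and \<open>d2\<close>, and two are products of increments, for which
    \<open>d\<close> must be at most \<open>e / (4 * L * L')\<close>.\<close>
  define d where "d = min (min d1 d2) (min (min d0 d0') (e / (4 * L * L')))"
  have d: "d > 0" "d \<le> d1" "d \<le> d2" "d \<le> d0" "d \<le> d0'" "d \<le> e / (4 * L * L')" using d1 d2 L L' e by (auto simp: d_def)
  show "\<exists>d>0. \<forall>y\<in>ball x d. \<forall>y'\<in>ball x d. norm (f y *\<^sub>R g y - f y' *\<^sub>R g y' - (f x *\<^sub>R E (y - y') + D (y - y') *\<^sub>R g x)) \<le> e * norm (y - y')"
  proof (intro exI[of _ d] conjI ballI)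
    fix y y' assume "y \<in> ball x d" "y' \<in> ball x d"
    then have y: "norm (y - x) < d" "norm (y' - x) < d" by (auto simp: dist_norm norm_minus_commute)
    let ?n = "norm (y - y')"
    have LdL: "L * d * L' \<le> e / 4" using d(6) L(2) L'(2) by (simp add: field_simps)
    have a: "norm (f x *\<^sub>R (g y - g y' - E (y - y'))) \<le> e/4 * ?n"
    proof -
      have "\<bar>f x\<bar> * norm (g y - g y' - E (y - y')) \<le> M * (e/(4*M) * ?n)" using d2(2)[of y y'] y d M by (intro mult_mono) (auto simp: M_def)
      also have "M * (e/(4*M) * ?n) = e/4 * ?n" using M by simp
      finally show ?thesis by simp
    qed
    have b: "norm ((f y - f y' - D (y - y')) *\<^sub>R g x) \<le> e/4 * ?n"
    proof -
      have "norm (f y - f y' - D (y - y')) * norm (g x) \<le> (e/(4*M) * ?n) * M" using d1(2)[of y y'] y d M e by (intro mult_mono) (auto simp: M_def)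
      also have "(e/(4*M) * ?n) * M = e/4 * ?n" using M by simp
      finally show ?thesis by simp
    qed
    have c: "norm ((f y - f x) *\<^sub>R (g y - g y')) \<le> e/4 * ?n"
    proof -
      have "\<bar>f y - f x\<bar> * norm (g y - g y') \<le> (L * d) * (L' * ?n)"
      proof (intro mult_mono)
        have "\<bar>f y - f x\<bar> \<le> L * norm (y - x)" using L(3)[of y x] y d L by auto
        also have "\<dots> \<le> L * d" using L y by (intro mult_left_mono) auto
        finally show "\<bar>f y - f x\<bar> \<le> L * d" .
        show "norm (g y - g y') \<le> L' * ?n" using L'(3)[of y y'] y d by auto
      qed (use L d in auto)
      also have "\<dots> = (L * d * L') * ?n" by simp
      also have "\<dots> \<le> e/4 * ?n" using LdL by (intro mult_right_mono) auto
      finally show ?thesis by simp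
    qed
    have c': "norm ((f y - f y') *\<^sub>R (g y' - g x)) \<le> e/4 * ?n"
    proof -
      have "\<bar>f y - f y'\<bar> * norm (g y' - g x) \<le> (L * ?n) * (L' * d)"
      proof (intro mult_mono)
        have "norm (g y' - g x) \<le> L' * norm (y' - x)" using L'(3)[of y' x] y d L' by auto
        also have "\<dots> \<le> L' * d" using L' y by (intro mult_left_mono) auto
        finally show "norm (g y' - g x) \<le> L' * d" .
        show "\<bar>f y - f y'\<bar> \<le> L * ?n" using L(3)[of y y'] y d by auto
      qed (use L L' d in auto)
      also have "\<dots> = (L * d * L') * ?n" by simp
      also have "\<dots> \<le> e/4 * ?n" using LdL by (intro mult_right_mono) auto
      finally show ?thesis by simp
    qed
    have "f y *\<^sub>R g y - f y' *\<^sub>R g y' - (f x *\<^sub>R E (y - y') + D (y - y') *\<^sub>R g x)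
       = f x *\<^sub>R (g y - g y' - E (y - y')) + (f y - f y' - D (y - y')) *\<^sub>R g x + (f y - f x) *\<^sub>R (g y - g y') + (f y - f y') *\<^sub>R (g y' - g x)"
      by (simp add: algebra_simps)
    also have "norm \<dots> \<le> e/4 * ?n + e/4 * ?n + e/4 * ?n + e/4 * ?n"
      by (intro norm_triangle_mono a b c c')
    finally show "norm (f y *\<^sub>R g y - f y' *\<^sub>R g y' - (f x *\<^sub>R E (y - y') + D (y - y') *\<^sub>R g x)) \<le> e * ?n" by simp
  qed (use d in auto)
qed

lemma Cinf_onD:
  assumes "Cinf_on S f"
  shows "continuous_on S f" "x \<in> S \<Longrightarrow> (f has_derivative frechet_derivative f (at x)) (at x)"
    "b \<in> Basis \<Longrightarrow> continuous_on S (\<lambda>x. frechet_derivative f (at x) b)"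
proof -
  from assms have *: "continuous_on S f" "\<forall>x\<in>S. f differentiable (at x)" "\<forall>b\<in>Basis. Cinf_on S (\<lambda>x. frechet_derivative f (at x) b)"
    by (auto elim: Cinf_on.cases)
  show "continuous_on S f" by (rule *)
  show "x \<in> S \<Longrightarrow> (f has_derivative frechet_derivative f (at x)) (at x)" using *(2) frechet_derivative_works by blast
  assume "b \<in> Basis"
  then have "Cinf_on S (\<lambda>x. frechet_derivative f (at x) b)" using * by blast
  then show "continuous_on S (\<lambda>x. frechet_derivative f (at x) b)" by (auto elim: Cinf_on.cases)
qed

text \<open>Mean value inequality for \<open>f\<close> minus its derivative at \<open>x\<close>, on
  a ball where every partial derivative is within \<open>e / ?n\<close> of its value at
  \<open>x\<close>, \<open>?n\<close> being the dimension.\<close>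

lemma Cinf_on_strict_derivative:
  fixes f :: "'b::euclidean_space \<Rightarrow> real"
  assumes f: "Cinf_on S f" and S: "open S" "x \<in> S"
  shows "has_strict_derivative f (frechet_derivative f (at x)) x"
  unfolding has_strict_derivative_def
proof (intro conjI allI impI)
  let ?F = "\<lambda>y. frechet_derivative f (at y)"
  show "bounded_linear (?F x)" using Cinf_onD(2)[OF f S(2)] by (rule has_derivative_bounded_linear)
  fix e :: real assume e: "e > 0"
  let ?n = "real DIM('b)"
  have "\<forall>b\<in>Basis. \<exists>d>0. \<forall>y. dist y x < d \<longrightarrow> y \<in> S \<longrightarrow> \<bar>?F y b - ?F x b\<bar> < e / ?n"
  proof
    fix b :: 'b assume "b \<in> Basis"
    then have "continuous_on S (\<lambda>y. ?F y b)" by (rule Cinf_onD(3)[OF f])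
    moreover have "e / ?n > 0" using e by simp
    ultimately obtain d where "d > 0" "\<forall>y\<in>S. dist y x < d \<longrightarrow> dist (?F y b) (?F x b) < e / ?n"
      using S(2) unfolding continuous_on_iff by blast
    then show "\<exists>d>0. \<forall>y. dist y x < d \<longrightarrow> y \<in> S \<longrightarrow> \<bar>?F y b - ?F x b\<bar> < e / ?n"
      by (auto simp: dist_real_def)
  qed
  then obtain d where d: "\<And>b. b \<in> Basis \<Longrightarrow> d b > 0" "\<And>b y. b \<in> Basis \<Longrightarrow> dist y x < d b \<Longrightarrow> y \<in> S \<Longrightarrow> \<bar>?F y b - ?F x b\<bar> < e / ?n"
    by metis
  obtain d0 where d0: "d0 > 0" "ball x d0 \<subseteq> S" using S open_contains_ball by blast
  define d1 where "d1 = min d0 (Min (d ` Basis))"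
  have d1: "d1 > 0" "d1 \<le> d0" "\<And>b. b \<in> Basis \<Longrightarrow> d1 \<le> d b"
    using d(1) d0(1) by (auto simp: d1_def min_le_iff_disj)
  have on: "onorm (\<lambda>v. ?F y v - ?F x v) \<le> e" if y: "y \<in> ball x d1" for y
  proof (rule onorm_le)
    fix v
    have yS: "y \<in> S" using y d1(2) d0(2) by auto
    have lin: "linear (?F y)" "linear (?F x)" using Cinf_onD(2)[OF f yS] Cinf_onD(2)[OF f S(2)] has_derivative_linear by blast+
    have "?F y v - ?F x v = (\<Sum>b\<in>Basis. (v \<bullet> b) * (?F y b - ?F x b))"
      using linear_sum[OF lin(1), of "\<lambda>b. (v \<bullet> b) *\<^sub>R b" Basis] linear_sum[OF lin(2), of "\<lambda>b. (v \<bullet> b) *\<^sub>R b" Basis]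
      by (simp add: euclidean_representation linear_scale[OF lin(1)] linear_scale[OF lin(2)] right_diff_distrib sum_subtractf)
    also have "\<bar>\<dots>\<bar> \<le> (\<Sum>b\<in>(Basis::'b set). norm v * (e / ?n))"
    proof (rule order_trans[OF sum_abs], rule sum_mono)
      fix b :: 'b assume b: "b \<in> Basis"
      have "\<bar>?F y b - ?F x b\<bar> \<le> e / ?n" using d(2)[OF b, of y] y d1(3)[OF b] yS by (force simp: dist_commute)
      then show "\<bar>v \<bullet> b * (?F y b - ?F x b)\<bar> \<le> norm v * (e / ?n)"
        using Basis_le_norm[OF b, of v] unfolding abs_mult by (intro mult_mono) auto
    qed
    also have "\<dots> = e * norm v" by simp
    finally show "norm (?F y v - ?F x v) \<le> e * norm v" by simp
  qed
  show "\<exists>d>0. \<forall>y\<in>ball x d. \<forall>y'\<in>ball x d. norm (f y - f y' - ?F x (y - y')) \<le> e * norm (y - y')"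
  proof (intro exI[of _ d1] conjI ballI)
    fix y y' assume y: "y \<in> ball x d1" "y' \<in> ball x d1"
    have linx: "bounded_linear (?F x)" using Cinf_onD(2)[OF f S(2)] by (rule has_derivative_bounded_linear)
    have "norm ((f y - ?F x y) - (f y' - ?F x y')) \<le> e * norm (y - y')"
    proof (rule differentiable_bound[OF convex_ball[of x d1], where f'="\<lambda>w v. ?F w v - ?F x v"])
      fix w assume w: "w \<in> ball x d1"
      then have wS: "w \<in> S" using d1(2) d0(2) by auto
      show "((\<lambda>a. f a - ?F x a) has_derivative (\<lambda>v. ?F w v - ?F x v)) (at w within ball x d1)"
        by (intro has_derivative_diff has_derivative_at_withinI[OF Cinf_onD(2)[OF f wS]] bounded_linear_imp_has_derivative linx)
      show "onorm (\<lambda>v. ?F w v - ?F x v) \<le> e" by (rule on[OF w])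
    qed (use y in auto)
    then show "norm (f y - f y' - ?F x (y - y')) \<le> e * norm (y - y')"
      by (simp add: linear_diff[OF bounded_linear.linear[OF linx]] algebra_simps)
  qed (use d1 in auto)
qed

lemma vf_smooth_strict_derivative:
  fixes X :: "'b::euclidean_space \<Rightarrow> 'b"
  assumes X: "vf_smooth S X" and S: "open S" "x \<in> S"
  shows "\<exists>D. has_strict_derivative X D x"
proof -
  have "has_strict_derivative (\<lambda>y. (X y \<bullet> b) *\<^sub>R b) (\<lambda>v. frechet_derivative (\<lambda>y. X y \<bullet> b) (at x) v *\<^sub>R b) x" if "b \<in> Basis" for b
    using X that Cinf_on_strict_derivative[OF _ S]
    by (intro strict_derivative_bounded_linear[where h="\<lambda>r. r *\<^sub>R b"] bounded_linear_scaleR_left) (auto simp: vf_smooth_def)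
  then have "has_strict_derivative (\<lambda>y. \<Sum>b\<in>Basis. (X y \<bullet> b) *\<^sub>R b) (\<lambda>v. \<Sum>b\<in>Basis. frechet_derivative (\<lambda>y. X y \<bullet> b) (at x) v *\<^sub>R b) x"
    by (rule strict_derivative_sum[OF finite_Basis])
  then show ?thesis unfolding euclidean_representation by blast
qed

text \<open>The dual functionals, \<open>1\<close> on one member and \<open>0\<close> on the others,
  are bounded and recover the coefficients. The \<open>+ 1\<close> in \<open>M\<close> keeps it
  positive for empty \<open>J\<close>.\<close>

lemma independent_family_lower_bound:
  fixes w :: "nat \<Rightarrow> 'b::euclidean_space"
  assumes J: "finite J" and inj: "inj_on w J" and ind: "independent (w ` J)"
  shows "\<exists>m>0. \<forall>c. m * (\<Sum>j\<in>J. \<bar>c j\<bar>) \<le> norm (\<Sum>j\<in>J. c j *\<^sub>R w j)"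
proof -
  have "\<exists>l. linear l \<and> (\<forall>i\<in>J. l (w i) = (if i = j then 1 else (0::real)))" for j
  proof -
    obtain l where l: "linear l" "\<forall>x\<in>w ` J. l x = (if x = w j \<and> j \<in> J then 1 else (0::real))"
      using linear_independent_extend[OF ind, of "\<lambda>x. if x = w j \<and> j \<in> J then 1 else (0::real)"] by auto
    then show ?thesis using inj by (intro exI[of _ l]) (auto simp: inj_on_def)
  qed
  then obtain l where l: "\<And>j. linear (l j)" "\<And>j i. i \<in> J \<Longrightarrow> l j (w i) = (if i = j then 1 else (0::real))" by metis
  have bl: "bounded_linear (l j)" for j using l(1) linear_conv_bounded_linear by blast
  have "\<forall>j. \<exists>K>0. \<forall>v. norm (l j v) \<le> norm v * K" using bounded_linear.pos_bounded[OF bl] by blast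
  then obtain K where K: "\<And>j. K j > 0" "\<And>j v. norm (l j v) \<le> norm v * K j" by metis
  define M where "M = (\<Sum>j\<in>J. K j) + 1"
  have "0 \<le> (\<Sum>j\<in>J. K j)" using K(1) by (intro sum_nonneg) (simp add: less_imp_le)
  then have M: "M > 0" by (simp add: M_def)
  have "1 / M * (\<Sum>j\<in>J. \<bar>c j\<bar>) \<le> norm (\<Sum>j\<in>J. c j *\<^sub>R w j)" for c
  proof -
    let ?v = "\<Sum>j\<in>J. c j *\<^sub>R w j"
    have "c j = l j ?v" if "j \<in> J" for j
    proof -
      have "l j ?v = (\<Sum>i\<in>J. c i * (if i = j then 1 else 0))"
        by (simp add: linear_sum[OF l(1)] linear_scale[OF l(1)] l(2) cong: sum.cong)
      also have "\<dots> = c j" using J that by (subst sum.remove[OF J that]) (auto intro!: sum.neutral)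
      finally show ?thesis by simp
    qed
    then have "(\<Sum>j\<in>J. \<bar>c j\<bar>) \<le> (\<Sum>j\<in>J. norm ?v * K j)"
      using K(2)[of _ ?v] by (intro sum_mono) auto
    also have "\<dots> \<le> norm ?v * M" by (simp add: M_def sum_distrib_left[symmetric] distrib_left)
    finally show ?thesis using M by (simp add: field_simps)
  qed
  then show ?thesis using M by (intro exI[of _ "1/M"]) auto
qed

lemma lower_bound_perturb:
  fixes \<zeta> \<zeta>' :: "nat \<Rightarrow> 'b::real_normed_vector"
  assumes lb: "\<And>c. m * (\<Sum>j\<in>J. \<bar>c j\<bar>) \<le> norm (\<Sum>j\<in>J. c j *\<^sub>R \<zeta> j)"
    and near: "\<And>j. j \<in> J \<Longrightarrow> norm (\<zeta>' j - \<zeta> j) \<le> m / 2"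
  shows "m / 2 * (\<Sum>j\<in>J. \<bar>c j\<bar>) \<le> norm (\<Sum>j\<in>J. c j *\<^sub>R \<zeta>' j)"
proof -
  have "norm (\<Sum>j\<in>J. c j *\<^sub>R (\<zeta>' j - \<zeta> j)) \<le> (\<Sum>j\<in>J. \<bar>c j\<bar> * (m/2))"
    by (rule order_trans[OF norm_sum], rule sum_mono, simp only: norm_scaleR, rule mult_left_mono[OF near]) auto
  then have "norm (\<Sum>j\<in>J. c j *\<^sub>R (\<zeta>' j - \<zeta> j)) \<le> m/2 * (\<Sum>j\<in>J. \<bar>c j\<bar>)" by (simp add: sum_distrib_left mult.commute)
  moreover have "(\<Sum>j\<in>J. c j *\<^sub>R \<zeta> j) = (\<Sum>j\<in>J. c j *\<^sub>R \<zeta>' j) - (\<Sum>j\<in>J. c j *\<^sub>R (\<zeta>' j - \<zeta> j))"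
    by (simp add: scaleR_diff_right sum_subtractf)
  ultimately show ?thesis
    using lb[of c] norm_triangle_ineq4[of "\<Sum>j\<in>J. c j *\<^sub>R \<zeta>' j" "\<Sum>j\<in>J. c j *\<^sub>R (\<zeta>' j - \<zeta> j)"] by simp
qed

text \<open>The increments of the coefficients are themselves the frame coefficients, at
  \<open>y\<close>, of the increment of \<open>Z\<close> corrected by that of the frame, and
  \<open>lb\<close> bounds them. Since \<open>lb\<close> also forces uniqueness, the bounds hold for
  coefficients picked pointwise.\<close>

lemma frame_coefficients_lipschitz:
  fixes \<zeta> :: "nat \<Rightarrow> 'b::real_normed_vector \<Rightarrow> 'c::real_normed_vector"
  assumes J: "finite J" and m: "m > 0" and lb: "\<And>y c. y \<in> S \<Longrightarrow> m * (\<Sum>j\<in>J. \<bar>c j\<bar>) \<le> norm (\<Sum>j\<in>J. c j *\<^sub>R \<zeta> j y)"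
    and \<Lambda>: "\<Lambda> \<ge> 0" and \<zeta>: "\<And>j y y'. j \<in> J \<Longrightarrow> y \<in> S \<Longrightarrow> y' \<in> S \<Longrightarrow> norm (\<zeta> j y - \<zeta> j y') \<le> \<Lambda> * norm (y - y')"
    and Z: "\<And>y y'. y \<in> S \<Longrightarrow> y' \<in> S \<Longrightarrow> norm (Z y - Z y') \<le> \<Lambda> * norm (y - y')" "\<And>y. y \<in> S \<Longrightarrow> norm (Z y) \<le> \<Lambda>"
    and q: "\<And>y. y \<in> S \<Longrightarrow> Z y = (\<Sum>j\<in>J. q j y *\<^sub>R \<zeta> j y)" and j: "j \<in> J"
  shows "y \<in> S \<Longrightarrow> \<bar>q j y\<bar> \<le> \<Lambda> / m"
    and "y \<in> S \<Longrightarrow> y' \<in> S \<Longrightarrow> \<bar>q j y - q j y'\<bar> \<le> \<Lambda> / m * (1 + \<Lambda> / m) * norm (y - y')"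
proof -
  have S1: "(\<Sum>j\<in>J. \<bar>q j y\<bar>) \<le> \<Lambda> / m" if y: "y \<in> S" for y
    using lb[OF y, of "\<lambda>j. q j y"] q[OF y] Z(2)[OF y] m by (simp add: field_simps)
  have le: "\<bar>c j\<bar> \<le> (\<Sum>j\<in>J. \<bar>c j\<bar>)" for c :: "nat \<Rightarrow> real" using J j by (intro member_le_sum) auto
  show "\<bar>q j y\<bar> \<le> \<Lambda> / m" if "y \<in> S" using le[of "\<lambda>j. q j y"] S1[OF that] by linarith
  show "\<bar>q j y - q j y'\<bar> \<le> \<Lambda> / m * (1 + \<Lambda> / m) * norm (y - y')" if y: "y \<in> S" "y' \<in> S"
  proof -
    let ?n = "norm (y - y')"
    have eq: "(\<Sum>j\<in>J. (q j y - q j y') *\<^sub>R \<zeta> j y) = (Z y - Z y') - (\<Sum>j\<in>J. q j y' *\<^sub>R (\<zeta> j y - \<zeta> j y'))"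
      unfolding q[OF y(1)] q[OF y(2)] by (simp add: scaleR_diff_left scaleR_diff_right sum_subtractf)
    have "norm (\<Sum>j\<in>J. q j y' *\<^sub>R (\<zeta> j y - \<zeta> j y')) \<le> (\<Sum>j\<in>J. \<bar>q j y'\<bar> * (\<Lambda> * ?n))"
      by (rule order_trans[OF norm_sum]) (auto intro!: sum_mono mult_left_mono \<zeta> y)
    also have "\<dots> = (\<Sum>j\<in>J. \<bar>q j y'\<bar>) * (\<Lambda> * ?n)" by (simp add: sum_distrib_right)
    also have "\<dots> \<le> \<Lambda> / m * (\<Lambda> * ?n)" using S1[OF y(2)] \<Lambda> by (intro mult_right_mono) auto
    finally have "norm (\<Sum>j\<in>J. (q j y - q j y') *\<^sub>R \<zeta> j y) \<le> \<Lambda> * ?n + \<Lambda> / m * (\<Lambda> * ?n)"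
      unfolding eq using Z(1)[OF y] norm_triangle_ineq4[of "Z y - Z y'" "\<Sum>j\<in>J. q j y' *\<^sub>R (\<zeta> j y - \<zeta> j y')"] by linarith
    then have "m * (\<Sum>j\<in>J. \<bar>q j y - q j y'\<bar>) \<le> \<Lambda> * ?n + \<Lambda> / m * (\<Lambda> * ?n)"
      using lb[OF y(1), of "\<lambda>j. q j y - q j y'"] by linarith
    then have "(\<Sum>j\<in>J. \<bar>q j y - q j y'\<bar>) \<le> (\<Lambda> * ?n + \<Lambda> / m * (\<Lambda> * ?n)) / m" using m by (simp add: pos_le_divide_eq mult.commute)
    also have "\<dots> = \<Lambda> / m * (1 + \<Lambda> / m) * ?n" using m by (simp add: field_simps)
    finally show ?thesis using le[of "\<lambda>j. q j y - q j y'"] by linarith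
  qed
qed

lemma quadratic_has_derivative_zero:
  fixes h :: "'b::real_normed_vector \<Rightarrow> real"
  assumes h: "(h has_derivative D) (at 0)" and d: "d > 0" and C: "C > 0"
    and le: "\<And>x. norm x < d \<Longrightarrow> \<bar>h x - h 0\<bar> \<le> C * (norm x)\<^sup>2"
  shows "D v = 0"
proof -
  have "(h has_derivative (\<lambda>v. 0)) (at 0)"
    unfolding has_derivative_at_alt
  proof (intro conjI allI impI)
    fix e :: real assume e: "e > 0"
    show "\<exists>d>0. \<forall>y. norm (y - 0) < d \<longrightarrow> norm (h y - h 0 - 0) \<le> e * norm (y - 0)"
    proof (intro exI[of _ "min d (e / C)"] conjI allI impI)
      fix y :: 'b assume y: "norm (y - 0) < min d (e / C)"
      then have "C * norm y \<le> e" using C by (simp add: field_simps)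
      then have "C * norm y * norm y \<le> e * norm y" by (rule mult_right_mono) simp
      then show "norm (h y - h 0 - 0) \<le> e * norm (y - 0)" using le[of y] y by (simp add: power2_eq_square mult.assoc)
    qed (use d e C in auto)
  qed simp
  then have "D = (\<lambda>v. 0)" by (rule has_derivative_unique[OF h])
  then show ?thesis by simp
qed

text \<open>A functional that vanishes on the frame at \<open>0\<close> sees only the values of the coefficients of a
  section there, not their derivatives.\<close>
lemma annihilator_section_derivative:
  fixes \<zeta> :: "nat \<Rightarrow> 'a::euclidean_space \<Rightarrow> 'a"
  assumes J: "finite J" and m: "m > 0" and d: "d > 0"
    and lb: "\<And>y c. norm y < d \<Longrightarrow> m * (\<Sum>j\<in>J. \<bar>c j\<bar>) \<le> norm (\<Sum>j\<in>J. c j *\<^sub>R \<zeta> j y)"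
    and \<Lambda>: "\<Lambda> > 0" and \<zeta>: "\<And>j y y'. j \<in> J \<Longrightarrow> norm y < d \<Longrightarrow> norm y' < d \<Longrightarrow> norm (\<zeta> j y - \<zeta> j y') \<le> \<Lambda> * norm (y - y')"
    and D: "\<And>j. j \<in> J \<Longrightarrow> (\<zeta> j has_derivative A j) (at 0)"
    and Z: "has_strict_derivative Z DZ 0" and q: "\<And>y. norm y < d \<Longrightarrow> Z y = (\<Sum>j\<in>J. q j y *\<^sub>R \<zeta> j y)"
    and w: "\<And>j. j \<in> J \<Longrightarrow> w \<bullet> \<zeta> j 0 = 0"
  shows "w \<bullet> DZ v = (\<Sum>j\<in>J. q j 0 * (w \<bullet> A j v))"
proof -
  obtain d1 L where L: "d1 > 0" "L > 0" "\<And>y y'. norm (y - 0) < d1 \<Longrightarrow> norm (y' - 0) < d1 \<Longrightarrow> norm (Z y - Z y') \<le> L * norm (y - y')"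
    using strict_derivative_lipschitz[OF Z] by metis
  define e where "e = min 1 (min d d1)"
  have e: "e > 0" "e \<le> 1" "e \<le> d" "e \<le> d1" using d L by (auto simp: e_def)
  define M where "M = \<Lambda> + L + norm (Z 0)"
  have M: "M > 0" "\<Lambda> \<le> M" "L \<le> M" using \<Lambda> L by (auto simp: M_def add_pos_nonneg)
  have Zb: "norm (Z y) \<le> M" if "norm y < e" for y
  proof -
    have "norm (Z y - Z 0) \<le> L * norm (y - 0)" using that e L by (intro L(3)) auto
    also have "\<dots> \<le> L * 1" using that e L by (intro mult_left_mono) auto
    finally show ?thesis using norm_triangle_sub[of "Z y" "Z 0"] \<Lambda> by (simp add: M_def)
  qed
  have Lip: "norm (\<zeta> j y - \<zeta> j y') \<le> M * norm (y - y')" if "j \<in> J" "norm y < e" "norm y' < e" for j y y'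
    using \<zeta>[OF that(1), of y y'] that e M mult_right_mono[OF M(2), of "norm (y - y')"] by auto
  define Q where "Q = M / m * (1 + M / m)"
  have "M / m > 0" using M m by simp
  then have Q: "Q > 0" unfolding Q_def by (intro mult_pos_pos) linarith+
  have coef: "\<bar>q j y - q j 0\<bar> \<le> Q * norm y" if j: "j \<in> J" and y: "norm y < e" for j y
  proof -
    have "\<bar>q j y - q j 0\<bar> \<le> M / m * (1 + M / m) * norm (y - 0)"
    proof (rule frame_coefficients_lipschitz(2)[where S="ball 0 e" and \<zeta>=\<zeta> and Z=Z, OF J m])
      show "norm (Z y - Z y') \<le> M * norm (y - y')" if "y \<in> ball 0 e" "y' \<in> ball 0 e" for y y'
        using L(3)[of y y'] that e M(3) mult_right_mono[OF M(3), of "norm (y - y')"] by auto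
    qed (use lb Lip Zb q e M j y in auto)
    then show ?thesis by (simp add: Q_def)
  qed
  define h where "h x = w \<bullet> Z x - (\<Sum>j\<in>J. q j 0 * (w \<bullet> \<zeta> j x))" for x
  define C where "C = (\<Sum>j\<in>J. Q * (norm w * M)) + 1"
  have C: "C > 0" using Q M by (auto simp: C_def intro!: add_nonneg_pos sum_nonneg mult_nonneg_nonneg)
  have "((\<lambda>x. w \<bullet> Z x - (\<Sum>j\<in>J. q j 0 * (w \<bullet> \<zeta> j x))) has_derivative (\<lambda>v. w \<bullet> DZ v - (\<Sum>j\<in>J. q j 0 * (w \<bullet> A j v)))) (at 0)"
    by (auto intro!: derivative_eq_intros strict_derivative_has_derivative[OF Z] D)
  then have dh: "(h has_derivative (\<lambda>v. w \<bullet> DZ v - (\<Sum>j\<in>J. q j 0 * (w \<bullet> A j v)))) (at 0)" by (simp add: h_def[abs_def])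
  \<comment> \<open>Both factors are O(\<open>norm x\<close>): the coefficients are Lipschitz and
    \<open>w\<close> annihilates the frame at \<open>0\<close>. So \<open>h\<close> is of second
    order and its derivative vanishes.\<close>
  have hx: "h x = (\<Sum>j\<in>J. (q j x - q j 0) * (w \<bullet> \<zeta> j x))" if "norm x < d" for x
    using q[OF that] by (simp add: h_def inner_sum_right left_diff_distrib sum_subtractf)
  have "w \<bullet> DZ v - (\<Sum>j\<in>J. q j 0 * (w \<bullet> A j v)) = 0"
  proof (rule quadratic_has_derivative_zero[OF dh e(1) C])
    fix x :: 'a assume x: "norm x < e"
    have "\<bar>h x\<bar> \<le> (\<Sum>j\<in>J. (Q * norm x) * (norm w * (M * norm x)))"
    proof -
      have "\<bar>(q j x - q j 0) * (w \<bullet> \<zeta> j x)\<bar> \<le> (Q * norm x) * (norm w * (M * norm x))" if j: "j \<in> J" for j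
        unfolding abs_mult
      proof (rule mult_mono[OF coef[OF j x]])
        have "w \<bullet> \<zeta> j x = w \<bullet> (\<zeta> j x - \<zeta> j 0)" using w[OF j] by (simp add: inner_diff_right)
        also have "\<bar>\<dots>\<bar> \<le> norm w * norm (\<zeta> j x - \<zeta> j 0)" by (rule Cauchy_Schwarz_ineq2)
        also have "\<dots> \<le> norm w * (M * norm x)" using Lip[OF j x, of 0] e(1) by (intro mult_left_mono) auto
        finally show "\<bar>w \<bullet> \<zeta> j x\<bar> \<le> norm w * (M * norm x)" .
      qed (use Q in auto)
      then show ?thesis unfolding hx[OF order_less_le_trans[OF x e(3)]]
        by (intro order_trans[OF sum_abs] sum_mono) auto
    qed
    also have "\<dots> \<le> C * (norm x)\<^sup>2" by (simp add: C_def power2_eq_square sum_distrib_right algebra_simps)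
    finally show "\<bar>h x - h 0\<bar> \<le> C * (norm x)\<^sup>2" using hx[of 0] d by simp
  qed
  then show ?thesis by simp
qed

text \<open>A basis is picked among the fields and brackets; \<open>\<beta>\<close> bounds the norm
  of the inverse of the map from coordinates to combinations.\<close>

lemma basis_from_codes:
  fixes a :: "nat \<Rightarrow> 'a::euclidean_space" and A :: "nat \<Rightarrow> 'a \<Rightarrow> 'a"
  assumes span: "span (direction a A ` {c. code_in J c}) = UNIV"
  shows "\<exists>(c :: 'a \<Rightarrow> nat \<times> nat option) \<beta>. (\<forall>b\<in>Basis. code_in J (c b)) \<and> \<beta> \<ge> 0 \<and>
    (\<forall>w. \<exists>r. (\<Sum>b\<in>Basis. (r \<bullet> b) *\<^sub>R direction a A (c b)) = w \<and> norm r \<le> \<beta> * norm w)"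
proof -
  let ?V = "direction a A ` {c. code_in J c}"
  obtain B where B: "B \<subseteq> ?V" "independent B" "?V \<subseteq> span B" using maximal_independent_subset by blast
  have sB: "span B = UNIV" using B(3) span by (metis span_mono span_span top.extremum_uniqueI)
  have fin: "finite B" using B(2) independent_imp_finite by blast
  have "card B = DIM('a)" using B(2) sB by (metis dim_UNIV dim_span dim_eq_card_independent)
  then obtain h where h: "bij_betw h (Basis::'a set) B" using fin finite_same_card_bij[of "Basis::'a set" B] by auto
  have "\<forall>b\<in>Basis. \<exists>c. code_in J c \<and> direction a A c = h b"
  proof
    fix b :: 'a assume "b \<in> Basis"
    then have "h b \<in> ?V" using h B(1) bij_betwE by blast
    then obtain c where "h b = direction a A c" "c \<in> {c. code_in J c}" by (rule imageE)
    then show "\<exists>c. code_in J c \<and> direction a A c = h b" by (intro exI[of _ c]) simp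
  qed
  then obtain c where c: "\<And>b. b \<in> Basis \<Longrightarrow> code_in J (c b)" "\<And>b. b \<in> Basis \<Longrightarrow> direction a A (c b) = h b" by metis
  define T where "T r = (\<Sum>b\<in>Basis. (r \<bullet> b) *\<^sub>R h b)" for r
  have T: "linear T" by (rule linearI) (simp_all add: T_def inner_add_left scaleR_add_left sum.distrib scaleR_sum_right)
  have "B \<subseteq> range T"
  proof
    fix v assume "v \<in> B"
    then obtain b where b: "b \<in> Basis" "h b = v" using h by (auto simp: bij_betw_def)
    have "T b = (\<Sum>b'\<in>Basis. (if b' = b then h b else 0))" unfolding T_def
      using b(1) by (intro sum.cong) (auto simp: inner_Basis)
    then have "T b = v" using b by simp
    then show "v \<in> range T" by blast
  qed
  then have "span B \<subseteq> range T" using T by (intro span_minimal linear_subspace_image) auto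
  then have "surj T" using sB by auto
  then obtain g where g: "linear g" "T \<circ> g = id" using linear_surjective_right_inverse[OF T] by blast
  have "bounded_linear g" using g(1) linear_conv_bounded_linear by blast
  then obtain \<beta> where \<beta>: "\<beta> > 0" "\<And>w. norm (g w) \<le> norm w * \<beta>"
    using bounded_linear.pos_bounded by blast
  have "\<exists>r. (\<Sum>b\<in>Basis. (r \<bullet> b) *\<^sub>R direction a A (c b)) = w \<and> norm r \<le> \<beta> * norm w" for w
  proof (intro exI[of _ "g w"] conjI)
    have "T (g w) = w" using g(2) by (metis comp_apply id_apply)
    then show "(\<Sum>b\<in>Basis. (g w \<bullet> b) *\<^sub>R direction a A (c b)) = w" by (simp add: T_def c(2))
    show "norm (g w) \<le> \<beta> * norm w" using \<beta>(2)[of w] by (simp add: mult.commute)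
  qed
  then show ?thesis
    using c(1) \<beta>(1) by (intro exI[of _ c] exI[of _ \<beta>]) auto
qed

lemma strict_derivative_uminus:
  assumes "has_strict_derivative f D x"
  shows "has_strict_derivative (\<lambda>y. - f y) (\<lambda>v. - D v) x"
  using strict_derivative_bounded_linear[OF assms bounded_linear_minus[OF bounded_linear_ident]] by simp

section \<open>Uniform bounds for finite families\<close>

lemma strict_derivative_family_bounds:
  fixes f :: "'i \<Rightarrow> 'b::real_normed_vector \<Rightarrow> 'c::real_normed_vector"
  assumes "finite S" "\<And>i. i \<in> S \<Longrightarrow> \<exists>D. has_strict_derivative (f i) D 0"
  shows "\<exists>d>0. \<exists>\<Lambda>\<ge>1. \<forall>i\<in>S. (\<forall>y y'. norm y < d \<longrightarrow> norm y' < d \<longrightarrow> norm (f i y - f i y') \<le> \<Lambda> * norm (y - y')) \<and>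
     (\<forall>y. norm y < d \<longrightarrow> norm (f i y) \<le> \<Lambda>)"
  using assms
proof (induction S)
  case empty
  then show ?case by (intro exI[of _ 1]) auto
next
  case (insert i S)
  then obtain d \<Lambda> where d: "d > 0" "\<Lambda> \<ge> 1" "\<And>i y y'. i \<in> S \<Longrightarrow> norm y < d \<Longrightarrow> norm y' < d \<Longrightarrow> norm (f i y - f i y') \<le> \<Lambda> * norm (y - y')"
     "\<And>i y. i \<in> S \<Longrightarrow> norm y < d \<Longrightarrow> norm (f i y) \<le> \<Lambda>" by (metis insertI2)
  obtain D where "has_strict_derivative (f i) D 0" using insert.prems by blast
  then obtain d' L where L: "d' > 0" "L > 0" "\<And>y y'. norm (y - 0) < d' \<Longrightarrow> norm (y' - 0) < d' \<Longrightarrow> norm (f i y - f i y') \<le> L * norm (y - y')"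
    by (rule strict_derivative_lipschitz) blast
  define e where "e = min 1 (min d d')"
  define M where "M = \<Lambda> + L + norm (f i 0)"
  have e: "e > 0" "e \<le> 1" "e \<le> d" "e \<le> d'" using d L by (auto simp: e_def)
  have M: "M \<ge> 1" "\<Lambda> \<le> M" "L \<le> M" using d L by (auto simp: M_def add_increasing2)
  have old: "norm (f j y - f j y') \<le> M * norm (y - y')" "norm (f j y) \<le> M" if "j \<in> S" "norm y < e" "norm y' < e" for j y y'
    using d(3)[OF that(1), of y y'] d(4)[OF that(1), of y] that e M(2) mult_right_mono[OF M(2), of "norm (y - y')"] by auto
  have new: "norm (f i y - f i y') \<le> M * norm (y - y')" if "norm y < e" "norm y' < e" for y y'
    using L(3)[of y y'] that e mult_right_mono[OF M(3), of "norm (y - y')"] by auto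
  have new': "norm (f i y) \<le> M" if "norm y < e" for y
  proof -
    have "norm (f i y - f i 0) \<le> L * norm (y - 0)" using that e L by (intro L(3)) auto
    also have "\<dots> \<le> L * 1" using that e L by (intro mult_left_mono) auto
    finally show ?thesis using norm_triangle_sub[of "f i y" "f i 0"] d(2) by (simp add: M_def)
  qed
  show ?case
    using e(1) M(1) old(1) old(2)[of _ _ 0] new new' by (intro exI[of _ e] conjI exI[of _ M]) auto
qed

lemma positive_lower_bound:
  fixes S :: "real set"
  assumes "finite S" "\<forall>e\<in>S. 0 < e"
  shows "\<exists>d>0. \<forall>e\<in>S. d \<le> e"
  using assms
proof (induction S)
  case (insert e S)
  then obtain d where "d > 0" "\<forall>e\<in>S. d \<le> e" by auto
  then show ?case using insert.prems by (intro exI[of _ "min d e"]) auto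
qed (auto intro: exI[of _ 1])

section \<open>The tangential frame of the subbundle\<close>

locale subbundle =
  fixes k :: nat and \<V> :: "'a::euclidean_space \<times> real \<Rightarrow> ('a \<times> real) set" and W :: "('a \<times> real) set"
    and X :: "nat \<Rightarrow> 'a \<times> real \<Rightarrow> 'a \<times> real" and W' :: "'a set" and Y :: "nat \<Rightarrow> 'a \<Rightarrow> 'a"
  assumes W: "open W" "0 \<in> W"
    and X_smooth: "\<forall>j\<le>k. vf_smooth W (X j)"
    and X_indep: "\<forall>y\<in>W. inj_on (\<lambda>j. X j y) {..k} \<and> independent ((\<lambda>j. X j y) ` {..k})"
    and V_span: "\<forall>y\<in>W. \<V> y = span ((\<lambda>j. X j y) ` {..k})"
    and W': "open W'" "0 \<in> W'" "\<forall>x\<in>W'. (x, 0) \<in> W"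
    and Y_smooth: "\<forall>i<k. vf_smooth W' (Y i)"
    and Y_span: "\<forall>x\<in>W'. (\<lambda>v. (v, 0)) ` span ((\<lambda>i. Y i x) ` {..<k}) = \<V> (x, 0) \<inter> {v. snd v = 0}"
    and cond_i: "\<exists>v\<in>\<V> 0. snd v \<noteq> 0"
    and cond_ii: "\<exists>N. open N \<and> 0 \<in> N \<and> N \<subseteq> W' \<and>
        (\<forall>x\<in>N. span ({Z x | Z. vf_smooth N Z \<and> (\<forall>y\<in>N. (Z y, 0) \<in> \<V> (y, 0))}
                  \<union> {lie_bracket Z1 Z2 x | Z1 Z2.
                       vf_smooth N Z1 \<and> (\<forall>y\<in>N. (Z1 y, 0) \<in> \<V> (y, 0)) \<and>
                       vf_smooth N Z2 \<and> (\<forall>y\<in>N. (Z2 y, 0) \<in> \<V> (y, 0))}) = UNIV)"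
begin

lemma transversal_index: "\<exists>j\<le>k. snd (X j 0) \<noteq> 0"
proof (rule ccontr)
  assume "\<not> ?thesis"
  then have "(\<lambda>j. X j 0) ` {..k} \<subseteq> {v. snd v = 0}" by auto
  moreover have "subspace {v :: 'a \<times> real. snd v = 0}" by (auto simp: subspace_def)
  ultimately have "span ((\<lambda>j. X j 0) ` {..k}) \<subseteq> {v. snd v = 0}" by (rule span_minimal)
  then show False using cond_i V_span W(2) by auto
qed

definition "j0 = (SOME j. j \<le> k \<and> snd (X j 0) \<noteq> 0)"

lemma j0: "j0 \<le> k" "snd (X j0 0) \<noteq> 0"
  using someI_ex[OF transversal_index] unfolding j0_def by auto

definition "J = {..k} - {j0}"
definition "\<sigma> y = snd (X j0 y)"
text \<open>The horizontal part of
  \<open>\<sigma> y *\<^sub>R X j y - snd (X j y) *\<^sub>R X j0 y\<close>, whose vertical component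
  cancels. Multiplying by \<open>\<sigma>\<close> instead of dividing keeps it a polynomial in the
  components of the fields, so strict differentiability follows from the product rule.\<close>

definition "\<zeta> j y = \<sigma> y *\<^sub>R fst (X j y) - snd (X j y) *\<^sub>R fst (X j0 y)"

lemma J: "finite J" "j \<in> J \<Longrightarrow> j \<le> k" "insert j0 J = {..k}" "j0 \<notin> J"
  using j0 by (auto simp: J_def)

lemma sum_J: "(\<Sum>j\<le>k. g j) = g j0 + (\<Sum>j\<in>J. g j)" for g :: "nat \<Rightarrow> 'b::comm_monoid_add"
  using sum.insert[of J j0 g] J(1,3,4) by simp

lemma X_strict: "j \<le> k \<Longrightarrow> \<exists>D. has_strict_derivative (X j) D 0"
  using X_smooth W by (intro vf_smooth_strict_derivative) auto

lemma zeta_strict: "j \<le> k \<Longrightarrow> \<exists>D. has_strict_derivative (\<zeta> j) D 0"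
proof -
  assume j: "j \<le> k"
  obtain D D0 where D: "has_strict_derivative (X j) D 0" "has_strict_derivative (X j0) D0 0"
    using X_strict[OF j] X_strict[OF j0(1)] by blast
  note f = strict_derivative_bounded_linear[OF _ bounded_linear_fst] and s = strict_derivative_bounded_linear[OF _ bounded_linear_snd]
  have "\<zeta> j = (\<lambda>y. snd (X j0 y) *\<^sub>R fst (X j y) + - (snd (X j y) *\<^sub>R fst (X j0 y)))"
    by (simp add: fun_eq_iff \<zeta>_def \<sigma>_def)
  then show ?thesis
    using strict_derivative_add[OF strict_derivative_scaleR[OF s[OF D(2)] f[OF D(1)]]
        strict_derivative_uminus[OF strict_derivative_scaleR[OF s[OF D(1)] f[OF D(2)]]]] by auto
qed

text \<open>The coefficients of the vector in the \<open>X j y\<close> serve, after division by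
  \<open>\<sigma> y\<close>, for the \<open>\<zeta> j y\<close>: in the sum the subtracted part is
  multiplied by the vertical component of the vector, which is \<open>0\<close>. The index
  \<open>j0\<close> drops out as \<open>\<zeta> j0\<close> vanishes.\<close>

lemma tangent_representation:
  assumes y: "y \<in> W" "\<sigma> y \<noteq> 0" and v: "(v, 0) \<in> \<V> y"
  shows "\<exists>q. v = (\<Sum>j\<in>J. q j *\<^sub>R \<zeta> j y)"
proof -
  have "(v, 0) \<in> span ((\<lambda>j. X j y) ` {..k})" using v V_span y by simp
  then obtain u where u: "(v, 0) = (\<Sum>w\<in>(\<lambda>j. X j y) ` {..k}. u w *\<^sub>R w)" by (subst (asm) span_finite) auto
  define q where "q j = u (X j y)" for j
  have "(\<Sum>w\<in>(\<lambda>j. X j y) ` {..k}. u w *\<^sub>R w) = (\<Sum>j\<le>k. q j *\<^sub>R X j y)"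
    using X_indep y by (simp add: sum.reindex q_def)
  with u have eq: "(v, 0) = (\<Sum>j\<le>k. q j *\<^sub>R X j y)" by simp
  have fs: "v = (\<Sum>j\<le>k. q j *\<^sub>R fst (X j y))" and sn: "0 = (\<Sum>j\<le>k. q j * snd (X j y))"
    using arg_cong[OF eq, of fst] arg_cong[OF eq, of snd] by (simp_all add: fst_sum snd_sum)
  have "(\<Sum>j\<le>k. q j *\<^sub>R \<zeta> j y) = \<sigma> y *\<^sub>R (\<Sum>j\<le>k. q j *\<^sub>R fst (X j y)) - (\<Sum>j\<le>k. q j * snd (X j y)) *\<^sub>R fst (X j0 y)"
    by (simp add: \<zeta>_def scaleR_diff_right sum_subtractf scaleR_sum_right scaleR_sum_left mult.commute)
  also have "\<dots> = \<sigma> y *\<^sub>R v" using fs sn by simp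
  finally have "\<sigma> y *\<^sub>R v = (\<Sum>j\<le>k. q j *\<^sub>R \<zeta> j y)" ..
  also have "\<dots> = (\<Sum>j\<in>J. q j *\<^sub>R \<zeta> j y)" unfolding sum_J by (simp add: \<zeta>_def \<sigma>_def)
  finally have "v = inverse (\<sigma> y) *\<^sub>R (\<Sum>j\<in>J. q j *\<^sub>R \<zeta> j y)" using y(2) by (metis scaleR_one scaleR_scaleR left_inverse)
  then show ?thesis by (intro exI[of _ "\<lambda>j. inverse (\<sigma> y) * q j"]) (simp add: scaleR_sum_right)
qed

text \<open>A combination of the \<open>\<zeta> j 0\<close> is the horizontal vector with
  \<open>X\<close>-coefficients \<open>\<sigma> 0 * c j\<close> and a correction at
  \<open>j0\<close>, so the lower bound for the independent \<open>X j 0\<close> carries over with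
  the factor \<open>\<bar>\<sigma> 0\<bar>\<close>.\<close>

lemma zeta_lower_bound_0: "\<exists>m>0. \<forall>c. m * (\<Sum>j\<in>J. \<bar>c j\<bar>) \<le> norm (\<Sum>j\<in>J. c j *\<^sub>R \<zeta> j 0)"
proof -
  obtain m where m: "m > 0" "\<And>c. m * (\<Sum>j\<le>k. \<bar>c j\<bar>) \<le> norm (\<Sum>j\<le>k. c j *\<^sub>R X j 0)"
    using independent_family_lower_bound[of "{..k}" "\<lambda>j. X j 0"] X_indep W(2) by auto
  have s: "\<bar>\<sigma> 0\<bar> > 0" using j0(2) by (simp add: \<sigma>_def)
  have "m * \<bar>\<sigma> 0\<bar> * (\<Sum>j\<in>J. \<bar>c j\<bar>) \<le> norm (\<Sum>j\<in>J. c j *\<^sub>R \<zeta> j 0)" for c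
  proof -
    define c' where "c' j = (if j = j0 then - (\<Sum>j\<in>J. c j * snd (X j 0)) else \<sigma> 0 * c j)" for j
    have c': "c' j = \<sigma> 0 * c j" if "j \<in> J" for j using that J(4) by (auto simp: c'_def)
    have "(\<Sum>j\<le>k. c' j *\<^sub>R X j 0) = ((\<Sum>j\<in>J. c j *\<^sub>R \<zeta> j 0), 0)"
    proof (rule prod_eqI)
      have "fst (\<Sum>j\<le>k. c' j *\<^sub>R X j 0) = (\<Sum>j\<le>k. c' j *\<^sub>R fst (X j 0))" by (simp add: fst_sum)
      also have "\<dots> = c' j0 *\<^sub>R fst (X j0 0) + (\<Sum>j\<in>J. (\<sigma> 0 * c j) *\<^sub>R fst (X j 0))"
        unfolding sum_J by (simp add: c')
      also have "\<dots> = (\<Sum>j\<in>J. c j *\<^sub>R \<zeta> j 0)"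
        by (simp add: c'_def \<zeta>_def scaleR_diff_right sum_subtractf scaleR_sum_left mult.commute)
      finally show "fst (\<Sum>j\<le>k. c' j *\<^sub>R X j 0) = fst ((\<Sum>j\<in>J. c j *\<^sub>R \<zeta> j 0), 0::real)" by simp
      have "snd (\<Sum>j\<le>k. c' j *\<^sub>R X j 0) = (\<Sum>j\<le>k. c' j * snd (X j 0))" by (simp add: snd_sum)
      also have "\<dots> = c' j0 * \<sigma> 0 + (\<Sum>j\<in>J. (\<sigma> 0 * c j) * snd (X j 0))"
        unfolding sum_J by (simp add: c' \<sigma>_def)
      also have "\<dots> = 0" by (simp add: c'_def sum_distrib_left mult_ac)
      finally show "snd (\<Sum>j\<le>k. c' j *\<^sub>R X j 0) = snd ((\<Sum>j\<in>J. c j *\<^sub>R \<zeta> j 0), 0::real)" by simp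
    qed
    then have "m * (\<Sum>j\<le>k. \<bar>c' j\<bar>) \<le> norm (\<Sum>j\<in>J. c j *\<^sub>R \<zeta> j 0)" using m(2)[of c'] by (simp add: norm_Pair)
    moreover have "\<bar>\<sigma> 0\<bar> * (\<Sum>j\<in>J. \<bar>c j\<bar>) \<le> (\<Sum>j\<le>k. \<bar>c' j\<bar>)"
      unfolding sum_J by (simp add: c' abs_mult sum_distrib_left)
    ultimately show ?thesis
      by (intro order_trans[OF eq_refl[OF mult.assoc] order_trans[OF mult_left_mono[OF _ less_imp_le[OF m(1)]]]])
  qed
  then show ?thesis using m(1) s by (intro exI[of _ "m * \<bar>\<sigma> 0\<bar>"]) auto
qed

lemma uniform_bounds:
  "\<exists>d \<Lambda> m. 0 < d \<and> d \<le> 1 \<and> 1 \<le> \<Lambda> \<and> 0 < m \<and>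
    (\<forall>y. norm y < d \<longrightarrow> y \<in> W \<and> m \<le> \<bar>\<sigma> y\<bar> \<and> (\<forall>c. m * (\<Sum>j\<in>J. \<bar>c j\<bar>) \<le> norm (\<Sum>j\<in>J. c j *\<^sub>R \<zeta> j y))) \<and>
    (\<forall>x. norm x < d \<longrightarrow> x \<in> W') \<and>
    (\<forall>j\<le>k. (\<forall>y y'. norm y < d \<longrightarrow> norm y' < d \<longrightarrow> norm (X j y - X j y') \<le> \<Lambda> * norm (y - y')) \<and> (\<forall>y. norm y < d \<longrightarrow> norm (X j y) \<le> \<Lambda>)) \<and>
    (\<forall>j\<in>J. (\<forall>y y'. norm y < d \<longrightarrow> norm y' < d \<longrightarrow> norm (\<zeta> j y - \<zeta> j y') \<le> \<Lambda> * norm (y - y')) \<and> (\<forall>y. norm y < d \<longrightarrow> norm (\<zeta> j y) \<le> \<Lambda>)) \<and>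
    (\<forall>i<k. (\<forall>y y'. norm y < d \<longrightarrow> norm y' < d \<longrightarrow> norm (Y i y - Y i y') \<le> \<Lambda> * norm (y - y')) \<and> (\<forall>y. norm y < d \<longrightarrow> norm (Y i y) \<le> \<Lambda>))"
proof -
  obtain d1 \<Lambda>1 where 1: "d1 > 0" "\<Lambda>1 \<ge> 1" "\<And>j y y'. j \<le> k \<Longrightarrow> norm y < d1 \<Longrightarrow> norm y' < d1 \<Longrightarrow> norm (X j y - X j y') \<le> \<Lambda>1 * norm (y - y')"
      "\<And>j y. j \<le> k \<Longrightarrow> norm y < d1 \<Longrightarrow> norm (X j y) \<le> \<Lambda>1"
    using strict_derivative_family_bounds[of "{..k}" X] X_strict by auto
  obtain d2 \<Lambda>2 where 2: "d2 > 0" "\<Lambda>2 \<ge> 1" "\<And>j y y'. j \<in> J \<Longrightarrow> norm y < d2 \<Longrightarrow> norm y' < d2 \<Longrightarrow> norm (\<zeta> j y - \<zeta> j y') \<le> \<Lambda>2 * norm (y - y')"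
      "\<And>j y. j \<in> J \<Longrightarrow> norm y < d2 \<Longrightarrow> norm (\<zeta> j y) \<le> \<Lambda>2"
    using strict_derivative_family_bounds[of J \<zeta>] zeta_strict J by auto
  have "\<exists>D. has_strict_derivative (Y i) D 0" if "i < k" for i
    using Y_smooth W' that by (intro vf_smooth_strict_derivative) auto
  then obtain d3 \<Lambda>3 where 3: "d3 > 0" "\<Lambda>3 \<ge> 1" "\<And>i y y'. i < k \<Longrightarrow> norm y < d3 \<Longrightarrow> norm y' < d3 \<Longrightarrow> norm (Y i y - Y i y') \<le> \<Lambda>3 * norm (y - y')"
      "\<And>i y. i < k \<Longrightarrow> norm y < d3 \<Longrightarrow> norm (Y i y) \<le> \<Lambda>3"
    using strict_derivative_family_bounds[of "{..<k}" Y] by auto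
  obtain d4 where 4: "d4 > 0" "ball 0 d4 \<subseteq> W" using W open_contains_ball by blast
  obtain d5 where 5: "d5 > 0" "ball 0 d5 \<subseteq> W'" using W' open_contains_ball by blast
  obtain m0 where m0: "m0 > 0" "\<And>c. m0 * (\<Sum>j\<in>J. \<bar>c j\<bar>) \<le> norm (\<Sum>j\<in>J. c j *\<^sub>R \<zeta> j 0)" using zeta_lower_bound_0 by auto
  have s: "\<bar>\<sigma> 0\<bar> > 0" using j0(2) by (simp add: \<sigma>_def)
  define \<Lambda> where "\<Lambda> = \<Lambda>1 + \<Lambda>2 + \<Lambda>3"
  have \<Lambda>: "\<Lambda> \<ge> 1" "\<Lambda>1 \<le> \<Lambda>" "\<Lambda>2 \<le> \<Lambda>" "\<Lambda>3 \<le> \<Lambda>" using 1 2 3 by (auto simp: \<Lambda>_def)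
  \<comment> \<open>These two radii keep the variation of the frame within \<open>m0 / 2\<close> and
    that of \<open>\<sigma>\<close> within half of its absolute value at \<open>0\<close>.\<close>
  have "m0 / (2 * \<Lambda>) > 0" "\<bar>\<sigma> 0\<bar> / (2 * \<Lambda>) > 0" using m0(1) s \<Lambda>(1) by auto
  then obtain d where "0 < d" "\<forall>e\<in>{1, d1, d2, d3, d4, d5, m0 / (2 * \<Lambda>), \<bar>\<sigma> 0\<bar> / (2 * \<Lambda>)}. d \<le> e"
    using positive_lower_bound[of "{1, d1, d2, d3, d4, d5, m0 / (2 * \<Lambda>), \<bar>\<sigma> 0\<bar> / (2 * \<Lambda>)}"] 1(1) 2(1) 3(1) 4(1) 5(1) by auto
  then have d: "0 < d" "d \<le> 1" "d \<le> d1" "d \<le> d2" "d \<le> d3" "d \<le> d4" "d \<le> d5" "d \<le> m0 / (2 * \<Lambda>)" "d \<le> \<bar>\<sigma> 0\<bar> / (2 * \<Lambda>)"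
    by simp_all
  have \<Lambda>d: "\<Lambda> * d \<le> m0 / 2" "\<Lambda> * d \<le> \<bar>\<sigma> 0\<bar> / 2" using d(8,9) \<Lambda>(1) by (auto simp: field_simps)
  have up: "a * r \<le> \<Lambda> * r" if "a \<le> \<Lambda>" "0 \<le> r" for a r using that by (rule mult_right_mono)
  define m where "m = min (m0 / 2) (\<bar>\<sigma> 0\<bar> / 2)"
  have m: "0 < m" "m \<le> m0 / 2" "m \<le> \<bar>\<sigma> 0\<bar> / 2" using m0 s by (auto simp: m_def)
  have XL: "norm (X j y - X j y') \<le> \<Lambda> * norm (y - y')" if "j \<le> k" "norm y < d" "norm y' < d" for j y y'
    using 1(3)[OF that(1), of y y'] that d up[OF \<Lambda>(2), of "norm (y - y')"] by auto
  have ZL: "norm (\<zeta> j y - \<zeta> j y') \<le> \<Lambda> * norm (y - y')" if "j \<in> J" "norm y < d" "norm y' < d" for j y y'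
    using 2(3)[OF that(1), of y y'] that d up[OF \<Lambda>(3), of "norm (y - y')"] by auto
  have YL: "norm (Y j y - Y j y') \<le> \<Lambda> * norm (y - y')" if "j < k" "norm y < d" "norm y' < d" for j y y'
    using 3(3)[OF that(1), of y y'] that d up[OF \<Lambda>(4), of "norm (y - y')"] by auto
  have small: "\<Lambda> * norm y \<le> \<Lambda> * d" if "norm y < d" for y :: "'a \<times> real" using that \<Lambda>(1) by (intro mult_left_mono) auto
  have lb: "m * (\<Sum>j\<in>J. \<bar>c j\<bar>) \<le> norm (\<Sum>j\<in>J. c j *\<^sub>R \<zeta> j y)" if y: "norm y < d" for y c
  proof -
    have "m0 / 2 * (\<Sum>j\<in>J. \<bar>c j\<bar>) \<le> norm (\<Sum>j\<in>J. c j *\<^sub>R \<zeta> j y)"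
    proof (rule lower_bound_perturb[OF m0(2)])
      show "norm (\<zeta> j y - \<zeta> j 0) \<le> m0 / 2" if "j \<in> J" for j
        using ZL[OF that y, of 0] d(1) small[OF y] \<Lambda>d(1) by simp
    qed
    moreover have "m * (\<Sum>j\<in>J. \<bar>c j\<bar>) \<le> m0 / 2 * (\<Sum>j\<in>J. \<bar>c j\<bar>)" using m by (intro mult_right_mono sum_nonneg) auto
    ultimately show ?thesis by linarith
  qed
  have sg: "m \<le> \<bar>\<sigma> y\<bar>" if y: "norm y < d" for y
  proof -
    have "\<bar>\<sigma> y - \<sigma> 0\<bar> \<le> norm (X j0 y - X j0 0)"
      using norm_snd_le[of "snd (X j0 y - X j0 0)" "fst (X j0 y - X j0 0)"] unfolding prod.collapse by (simp add: \<sigma>_def)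
    also have "\<dots> \<le> \<bar>\<sigma> 0\<bar> / 2" using XL[OF j0(1) y, of 0] d(1) small[OF y] \<Lambda>d(2) by simp
    finally show ?thesis using m(3) by linarith
  qed
  have XB: "norm (X j y) \<le> \<Lambda>" if "j \<le> k" "norm y < d" for j y
    using 1(4)[OF that(1), of y] that(2) d(3) \<Lambda>(2) by linarith
  have ZB: "norm (\<zeta> j y) \<le> \<Lambda>" if "j \<in> J" "norm y < d" for j y
    using 2(4)[OF that(1), of y] that(2) d(4) \<Lambda>(3) by linarith
  have YB: "norm (Y i y) \<le> \<Lambda>" if "i < k" "norm y < d" for i y
    using 3(4)[OF that(1), of y] that(2) d(5) \<Lambda>(4) by linarith
  have yW: "y \<in> W" if "norm y < d" for y using 4(2) that d(6) by auto
  have xW: "x \<in> W'" if "norm x < d" for x using 5(2) that d(7) by auto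
  show ?thesis
    by (rule exI[of _ d], rule exI[of _ \<Lambda>], rule exI[of _ m])
       (simp add: d(1,2) \<Lambda>(1) m(1) lb sg XL ZL YL XB ZB YB yW xW)
qed

section \<open>The bracket condition for the frame at the origin\<close>

definition "frame_deriv j = (SOME D. has_strict_derivative (\<zeta> j) D 0)"

lemma frame_deriv: "j \<in> J \<Longrightarrow> has_strict_derivative (\<zeta> j) (frame_deriv j) 0"
  unfolding frame_deriv_def using someI_ex[OF zeta_strict] J(2) by blast

definition "a0 j = \<zeta> j 0"
definition "A0 j v = frame_deriv j (v, 0)"

lemma slice_strict: "j \<in> J \<Longrightarrow> has_strict_derivative (\<lambda>x. \<zeta> j (x, 0)) (A0 j) 0"
  unfolding has_strict_derivative_def
proof (intro conjI allI impI)
  assume j: "j \<in> J"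
  have "bounded_linear (frame_deriv j)" using frame_deriv[OF j] by (simp add: has_strict_derivative_def)
  then have "bounded_linear (\<lambda>v. frame_deriv j (v, 0))"
    by (rule bounded_linear_compose) (intro bounded_linear_Pair bounded_linear_ident bounded_linear_zero)
  then show "bounded_linear (A0 j)" by (simp add: A0_def[abs_def])
  fix e :: real assume "e > 0"
  then obtain d where d: "d > 0" "\<And>y y'. norm (y - 0) < d \<Longrightarrow> norm (y' - 0) < d \<Longrightarrow> norm (\<zeta> j y - \<zeta> j y' - frame_deriv j (y - y')) \<le> e * norm (y - y')"
    using strict_derivativeD[OF frame_deriv[OF j]] by metis
  show "\<exists>d>0. \<forall>y\<in>ball 0 d. \<forall>y'\<in>ball 0 d. norm (\<zeta> j (y, 0) - \<zeta> j (y', 0) - A0 j (y - y')) \<le> e * norm (y - y')"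
    using d(1) d(2)[of "(_, 0)" "(_, 0)"] by (intro exI[of _ d]) (auto simp: A0_def norm_Pair)
qed

text \<open>Condition (ii) speaks of arbitrary sections, the moves only of the frame. If
  \<open>w\<close> annihilates the frame and its brackets at \<open>0\<close>, then the derivatives
  of the coefficients of two sections \<open>Z1\<close> and \<open>Z2\<close> are invisible to
  \<open>w\<close>, and its product with their bracket is a combination of the numbers
  \<open>w \<bullet> (A0 j (a0 l) - A0 l (a0 j))\<close>, all zero. So \<open>w\<close> would
  annihilate the whole space.\<close>

lemma bracket_span: "span (direction a0 A0 ` {c. code_in J c}) = UNIV"
proof (rule ccontr)
  let ?S = "direction a0 A0 ` {c. code_in J c}"
  assume "span ?S \<noteq> UNIV"
  then obtain w where w: "w \<noteq> 0" "\<And>x. x \<in> span ?S \<Longrightarrow> w \<bullet> x = 0"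
    using span_not_UNIV_orthogonal[of ?S] by blast
  have wa: "w \<bullet> a0 j = 0" if "j \<in> J" for j
    using that by (intro w(2) span_base image_eqI[of _ _ "(j, None)"]) (auto simp: code_in_def)
  have wb: "w \<bullet> (A0 m (a0 l) - A0 l (a0 m)) = 0" if "l \<in> J" "m \<in> J" for l m
    using that by (intro w(2) span_base image_eqI[of _ _ "(l, Some m)"]) (auto simp: code_in_def)
  obtain N where N: "open N" "0 \<in> N" "N \<subseteq> W'"
    "span ({Z 0 | Z. vf_smooth N Z \<and> (\<forall>y\<in>N. (Z y, 0) \<in> \<V> (y, 0))}
          \<union> {lie_bracket Z1 Z2 0 | Z1 Z2. vf_smooth N Z1 \<and> (\<forall>y\<in>N. (Z1 y, 0) \<in> \<V> (y, 0)) \<and>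
               vf_smooth N Z2 \<and> (\<forall>y\<in>N. (Z2 y, 0) \<in> \<V> (y, 0))}) = UNIV"
    using cond_ii by blast
  obtain d \<Lambda> m where d: "0 < d" "1 \<le> \<Lambda>" "0 < m"
    and b1: "\<And>y. norm y < d \<Longrightarrow> y \<in> W \<and> m \<le> \<bar>\<sigma> y\<bar> \<and> (\<forall>c. m * (\<Sum>j\<in>J. \<bar>c j\<bar>) \<le> norm (\<Sum>j\<in>J. c j *\<^sub>R \<zeta> j y))"
    and b2: "\<And>j y y'. j \<in> J \<Longrightarrow> norm y < d \<Longrightarrow> norm y' < d \<Longrightarrow> norm (\<zeta> j y - \<zeta> j y') \<le> \<Lambda> * norm (y - y')"
    using uniform_bounds by (elim exE conjE) blast
  obtain d' where d': "d' > 0" "ball 0 d' \<subseteq> N" using N open_contains_ball by blast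
  define e where "e = min d d'"
  have e: "e > 0" "e \<le> d" "e \<le> d'" using d d' by (auto simp: e_def)
  \<comment> \<open>For a single section, the frame coefficients at \<open>0\<close> determine both
    its value and what \<open>w\<close> sees of its derivative.\<close>
  have sec: "\<exists>q DZ. has_strict_derivative Z DZ 0 \<and> Z 0 = (\<Sum>j\<in>J. q j *\<^sub>R a0 j) \<and> (\<forall>v. w \<bullet> DZ v = (\<Sum>j\<in>J. q j * (w \<bullet> A0 j v)))"
    if Z: "vf_smooth N Z" "\<forall>y\<in>N. (Z y, 0) \<in> \<V> (y, 0)" for Z
  proof -
    obtain DZ where DZ: "has_strict_derivative Z DZ 0" using vf_smooth_strict_derivative[OF Z(1) N(1,2)] by blast
    have "\<exists>q. Z y = (\<Sum>j\<in>J. q j *\<^sub>R \<zeta> j (y, 0))" if y: "norm y < e" for y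
    proof -
      have y1: "norm (y, 0::real) < d" using y e by (simp add: norm_Pair)
      have "\<sigma> (y, 0) \<noteq> 0" "(y, 0) \<in> W" using b1[OF y1] d(3) by auto
      moreover have "y \<in> ball 0 d'" using y e by simp
      then have "(Z y, 0) \<in> \<V> (y, 0)" using Z(2) d'(2) by blast
      ultimately show ?thesis using tangent_representation by blast
    qed
    then obtain q where q: "\<And>y. norm y < e \<Longrightarrow> Z y = (\<Sum>j\<in>J. q y j *\<^sub>R \<zeta> j (y, 0))" by metis
    have "w \<bullet> DZ v = (\<Sum>j\<in>J. q 0 j * (w \<bullet> A0 j v))" for v
    proof (rule annihilator_section_derivative[OF J(1) d(3) e(1), where \<Lambda>=\<Lambda> and Z=Z and \<zeta>="\<lambda>j y. \<zeta> j (y, 0)" and q="\<lambda>j y. q y j"])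
      show "m * (\<Sum>j\<in>J. \<bar>c j\<bar>) \<le> norm (\<Sum>j\<in>J. c j *\<^sub>R \<zeta> j (y, 0))" if "norm y < e" for y c
        using b1[of "(y, 0)"] that e by (simp add: norm_Pair)
      show "0 < \<Lambda>" using d by simp
      show "norm (\<zeta> j (y, 0) - \<zeta> j (y', 0)) \<le> \<Lambda> * norm (y - y')" if "j \<in> J" "norm y < e" "norm y' < e" for j y y'
        using b2[OF that(1), of "(y, 0)" "(y', 0)"] that e by (simp add: norm_Pair)
      show "((\<lambda>y. \<zeta> j (y, 0)) has_derivative A0 j) (at 0)" if "j \<in> J" for j
        by (rule strict_derivative_has_derivative[OF slice_strict[OF that]])
      show "w \<bullet> \<zeta> j (0, 0) = 0" if "j \<in> J" for j using wa[OF that] by (simp add: a0_def zero_prod_def)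
    qed (use DZ q in auto)
    moreover have "Z 0 = (\<Sum>j\<in>J. q 0 j *\<^sub>R a0 j)" using q[of 0] e(1) by (simp add: a0_def zero_prod_def)
    ultimately show ?thesis using DZ by blast
  qed
  have lie: "w \<bullet> lie_bracket Z1 Z2 0 = 0"
    if Z: "vf_smooth N Z1" "\<forall>y\<in>N. (Z1 y, 0) \<in> \<V> (y, 0)" "vf_smooth N Z2" "\<forall>y\<in>N. (Z2 y, 0) \<in> \<V> (y, 0)" for Z1 Z2
  proof -
    obtain q1 D1 where 1: "has_strict_derivative Z1 D1 0" "Z1 0 = (\<Sum>j\<in>J. q1 j *\<^sub>R a0 j)" "\<And>v. w \<bullet> D1 v = (\<Sum>j\<in>J. q1 j * (w \<bullet> A0 j v))"
      using sec[OF Z(1,2)] by blast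
    obtain q2 D2 where 2: "has_strict_derivative Z2 D2 0" "Z2 0 = (\<Sum>j\<in>J. q2 j *\<^sub>R a0 j)" "\<And>v. w \<bullet> D2 v = (\<Sum>j\<in>J. q2 j * (w \<bullet> A0 j v))"
      using sec[OF Z(3,4)] by blast
    have D: "frechet_derivative Z1 (at 0) = D1" "frechet_derivative Z2 (at 0) = D2"
      using frechet_derivative_at[OF strict_derivative_has_derivative] 1(1) 2(1) by metis+
    have lin: "linear (A0 j)" if "j \<in> J" for j
      using slice_strict[OF that] by (auto simp: has_strict_derivative_def dest: bounded_linear.linear)
    have s1: "A0 j (Z1 0) = (\<Sum>l\<in>J. q1 l *\<^sub>R A0 j (a0 l))" "A0 j (Z2 0) = (\<Sum>l\<in>J. q2 l *\<^sub>R A0 j (a0 l))" if "j \<in> J" for j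
      unfolding 1(2) 2(2) by (simp_all add: linear_sum[OF lin[OF that]] linear_scale[OF lin[OF that]])
    have "w \<bullet> lie_bracket Z1 Z2 0 = (\<Sum>j\<in>J. q2 j * (w \<bullet> A0 j (Z1 0))) - (\<Sum>l\<in>J. q1 l * (w \<bullet> A0 l (Z2 0)))"
      by (simp add: lie_bracket_def D inner_diff_right 1(3) 2(3))
    also have "\<dots> = (\<Sum>j\<in>J. \<Sum>l\<in>J. q2 j * q1 l * (w \<bullet> A0 j (a0 l))) - (\<Sum>l\<in>J. \<Sum>j\<in>J. q1 l * q2 j * (w \<bullet> A0 l (a0 j)))"
      by (simp add: s1 inner_sum_right sum_distrib_left mult.assoc)
    also have "(\<Sum>l\<in>J. \<Sum>j\<in>J. q1 l * q2 j * (w \<bullet> A0 l (a0 j))) = (\<Sum>j\<in>J. \<Sum>l\<in>J. q1 l * q2 j * (w \<bullet> A0 l (a0 j)))"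
      by (rule sum.swap)
    also have "(\<Sum>j\<in>J. \<Sum>l\<in>J. q2 j * q1 l * (w \<bullet> A0 j (a0 l))) - (\<Sum>j\<in>J. \<Sum>l\<in>J. q1 l * q2 j * (w \<bullet> A0 l (a0 j)))
       = (\<Sum>j\<in>J. \<Sum>l\<in>J. q2 j * q1 l * (w \<bullet> (A0 j (a0 l) - A0 l (a0 j))))"
      by (simp add: inner_diff_right right_diff_distrib sum_subtractf mult_ac)
    also have "\<dots> = 0" by (intro sum.neutral ballI) (simp add: wb)
    finally show ?thesis .
  qed
  have "w \<bullet> Z 0 = 0" if Z: "vf_smooth N Z" "\<forall>y\<in>N. (Z y, 0) \<in> \<V> (y, 0)" for Z
  proof -
    obtain q where "Z 0 = (\<Sum>j\<in>J. q j *\<^sub>R a0 j)" using sec[OF Z] by blast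
    then show ?thesis by (simp add: inner_sum_right wa)
  qed
  then have "{Z 0 | Z. vf_smooth N Z \<and> (\<forall>y\<in>N. (Z y, 0) \<in> \<V> (y, 0))}
          \<union> {lie_bracket Z1 Z2 0 | Z1 Z2. vf_smooth N Z1 \<and> (\<forall>y\<in>N. (Z1 y, 0) \<in> \<V> (y, 0)) \<and>
               vf_smooth N Z2 \<and> (\<forall>y\<in>N. (Z2 y, 0) \<in> \<V> (y, 0))} \<subseteq> {v. w \<bullet> v = 0}"
    using lie by blast
  from span_minimal[OF this subspace_hyperplane] have "UNIV \<subseteq> {v. w \<bullet> v = 0}" unfolding N(4) .
  then have "w \<bullet> w = 0" by blast
  then show False using w(1) by simp
qed

end

section \<open>Global extensions of the fields\<close>

definition clip :: "real \<Rightarrow> 'b::euclidean_space \<Rightarrow> 'b" where "clip r = closest_point (cball 0 r)"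

lemma clip:
  fixes x :: "'b::euclidean_space"
  assumes "r > 0"
  shows clip_norm: "norm (clip r x) \<le> r" and clip_lipschitz: "norm (clip r x - clip r x') \<le> norm (x - x')"
    and clip_id: "norm x \<le> r \<Longrightarrow> clip r x = x"
proof -
  have "clip r x \<in> cball 0 r" unfolding clip_def using assms by (intro closest_point_in_set) auto
  then show "norm (clip r x) \<le> r" by simp
  show "norm (clip r x - clip r x') \<le> norm (x - x')"
    using closest_point_lipschitz[of "cball (0::'b) r" x x'] assms by (auto simp: clip_def dist_norm)
  show "norm x \<le> r \<Longrightarrow> clip r x = x" unfolding clip_def by (intro closest_point_self) auto
qed

lemma norm_Pair_mono: "norm a \<le> norm a' \<Longrightarrow> norm b \<le> norm b' \<Longrightarrow> norm (a, b) \<le> norm (a', b')"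
  unfolding norm_Pair by (intro real_sqrt_le_mono add_mono power_mono) auto

lemma bounded_lipschitz_mono: "bounded_lipschitz L Z \<Longrightarrow> L \<le> L' \<Longrightarrow> bounded_lipschitz L' Z"
  unfolding bounded_lipschitz_def by (meson mult_right_mono norm_ge_zero order_trans)

lemma bounded_lipschitz_scaleR:
  fixes f :: "'a::real_normed_vector \<Rightarrow> real"
  assumes f: "bounded_lipschitz L f" and g: "bounded_lipschitz M g"
  shows "bounded_lipschitz (2 * L * M) (\<lambda>x. f x *\<^sub>R g x)"
proof -
  note f = bounded_lipschitzD[OF f] and g = bounded_lipschitzD[OF g]
  have LM: "1 \<le> L * M" using mult_mono[OF f(1) g(1)] f(1) by simp
  have "norm (f x *\<^sub>R g x - f y *\<^sub>R g y) \<le> 2 * L * M * norm (x - y)" for x y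
  proof -
    have "\<bar>f x\<bar> * norm (g x - g y) \<le> L * (M * norm (x - y))" using f(1) f(3)[of x] g(2)[of x y] by (intro mult_mono) auto
    moreover have "\<bar>f x - f y\<bar> * norm (g y) \<le> (L * norm (x - y)) * M" using f(1) f(2)[of x y] g(3)[of y] by (intro mult_mono) auto
    moreover have "f x *\<^sub>R g x - f y *\<^sub>R g y = f x *\<^sub>R (g x - g y) + (f x - f y) *\<^sub>R g y" by (simp add: algebra_simps)
    ultimately show ?thesis
      using norm_triangle_ineq[of "f x *\<^sub>R (g x - g y)" "(f x - f y) *\<^sub>R g y"] by (simp add: mult_ac)
  qed
  moreover have "norm (f x *\<^sub>R g x) \<le> 2 * L * M" for x
  proof -
    have "\<bar>f x\<bar> * norm (g x) \<le> L * M" using f(1) f(3)[of x] g(3)[of x] by (intro mult_mono) auto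
    then show ?thesis using LM by simp
  qed
  ultimately show ?thesis using LM unfolding bounded_lipschitz_def by (auto simp: mult.assoc)
qed

lemma bounded_lipschitz_sum:
  fixes L :: real
  assumes "L \<ge> 1" and f: "\<And>j. j \<in> S \<Longrightarrow> bounded_lipschitz L (f j)"
  shows "bounded_lipschitz ((1 + real (card S)) * L) (\<lambda>x. \<Sum>j\<in>S. f j x)"
proof -
  have L0: "L \<ge> 0" using assms by simp
  have "norm ((\<Sum>j\<in>S. f j x) - (\<Sum>j\<in>S. f j y)) \<le> (1 + real (card S)) * L * norm (x - y)" for x y
  proof -
    have "norm (\<Sum>j\<in>S. f j x - f j y) \<le> (\<Sum>j\<in>S. L * norm (x - y))"
      by (rule order_trans[OF norm_sum], rule sum_mono) (rule bounded_lipschitzD(2)[OF f])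
    also have "\<dots> \<le> (1 + real (card S)) * L * norm (x - y)" using L0 by (simp add: algebra_simps)
    finally show ?thesis by (simp add: sum_subtractf)
  qed
  moreover have "norm (\<Sum>j\<in>S. f j x) \<le> (1 + real (card S)) * L" for x
  proof -
    have "norm (\<Sum>j\<in>S. f j x) \<le> (\<Sum>j\<in>S. L)"
      by (rule order_trans[OF norm_sum], rule sum_mono) (rule bounded_lipschitzD(3)[OF f])
    then show ?thesis using L0 by (simp add: algebra_simps)
  qed
  moreover have "1 \<le> (1 + real (card S)) * L" using assms(1) L0 by (simp add: algebra_simps add_increasing2)
  ultimately show ?thesis unfolding bounded_lipschitz_def by auto
qed

text \<open>\<open>2 * r < d\<close> because the two components of a point are projected separately
  to radius \<open>r\<close>, and the resulting pair must stay where the bounds hold.\<close>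

locale clipped_subbundle = subbundle k \<V> W X W' Y
  for k and \<V> :: "'a::euclidean_space \<times> real \<Rightarrow> ('a \<times> real) set" and W X W' Y +
  fixes d \<Lambda> m r :: real
  assumes d: "0 < r" "2 * r < d" "1 \<le> \<Lambda>" "0 < m"
    and in_W: "\<And>y. norm y < d \<Longrightarrow> y \<in> W" and \<sigma>_bound: "\<And>y. norm y < d \<Longrightarrow> m \<le> \<bar>\<sigma> y\<bar>"
    and lower: "\<And>y c. norm y < d \<Longrightarrow> m * (\<Sum>j\<in>J. \<bar>c j\<bar>) \<le> norm (\<Sum>j\<in>J. c j *\<^sub>R \<zeta> j y)"
    and in_W': "\<And>x. norm x < d \<Longrightarrow> x \<in> W'"
    and X_lip: "\<And>j y y'. j \<le> k \<Longrightarrow> norm y < d \<Longrightarrow> norm y' < d \<Longrightarrow> norm (X j y - X j y') \<le> \<Lambda> * norm (y - y')"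
    and X_bd: "\<And>j y. j \<le> k \<Longrightarrow> norm y < d \<Longrightarrow> norm (X j y) \<le> \<Lambda>"
    and \<zeta>_lip: "\<And>j y y'. j \<in> J \<Longrightarrow> norm y < d \<Longrightarrow> norm y' < d \<Longrightarrow> norm (\<zeta> j y - \<zeta> j y') \<le> \<Lambda> * norm (y - y')"
    and \<zeta>_bd: "\<And>j y. j \<in> J \<Longrightarrow> norm y < d \<Longrightarrow> norm (\<zeta> j y) \<le> \<Lambda>"
    and Y_lip: "\<And>i x x'. i < k \<Longrightarrow> norm x < d \<Longrightarrow> norm x' < d \<Longrightarrow> norm (Y i x - Y i x') \<le> \<Lambda> * norm (x - x')"
    and Y_bd: "\<And>i x. i < k \<Longrightarrow> norm x < d \<Longrightarrow> norm (Y i x) \<le> \<Lambda>"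
begin

text \<open>Componentwise projection, not projection of the pair: it maps slices into slices and
  leaves heights up to \<open>r\<close> unchanged, so the extended frame at height \<open>t\<close>
  is still built from the frame of that slice.\<close>

definition "clip2 y = (clip r (fst y), clip r (snd y))" for y :: "'a \<times> real"

lemma clip2_norm: "norm (clip2 y) < d"
proof -
  have "norm (clip2 y) \<le> norm (clip r (fst y)) + norm (clip r (snd y))" unfolding clip2_def by (rule norm_Pair_le)
  then show ?thesis using clip_norm[OF d(1), of "fst y"] clip_norm[OF d(1), of "snd y"] d(2) by linarith
qed

lemma clip2_lipschitz: "norm (clip2 y - clip2 y') \<le> norm (y - y')"
proof -
  have "norm (clip r (fst y) - clip r (fst y'), clip r (snd y) - clip r (snd y')) \<le> norm (fst y - fst y', snd y - snd y')"
    by (intro norm_Pair_mono clip_lipschitz d)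
  moreover have "(fst y - fst y', snd y - snd y') = y - y'" by (simp add: prod_eq_iff)
  ultimately show ?thesis by (simp add: clip2_def)
qed

lemma clip_lt: "norm (clip r x) < d"
  using clip_norm[OF d(1), of x] d(1,2) by linarith

definition "z j t x = \<zeta> j (clip2 (x, t))"
definition "Tf y = inverse (\<sigma> (clip2 y)) *\<^sub>R X j0 (clip2 y)"
definition "Yc i x = Y i (clip r x)"
text \<open>Chosen pointwise; near the origin the lower bound on the frame makes the coefficients
  with index in \<open>J\<close> unique and Lipschitz.\<close>

definition "q i x = (SOME q. Y i x = (\<Sum>j\<in>J. q j *\<^sub>R \<zeta> j (x, 0)))"
text \<open>Transplants \<open>Y i\<close> to height \<open>t\<close>: the coefficients come from
  the bottom slice, the frame from the slice at height \<open>t\<close>.\<close>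

definition "Yt i t x = (\<Sum>j\<in>J. q i (clip r x) j *\<^sub>R z j t x)"

lemma z_bounded_lipschitz: "j \<in> J \<Longrightarrow> bounded_lipschitz \<Lambda> (z j t)"
  unfolding bounded_lipschitz_def z_def
proof (intro conjI allI d(3) \<zeta>_bd clip2_norm)
  fix x y assume j: "j \<in> J"
  have "norm (\<zeta> j (clip2 (x, t)) - \<zeta> j (clip2 (y, t))) \<le> \<Lambda> * norm (clip2 (x, t) - clip2 (y, t))"
    by (intro \<zeta>_lip j clip2_norm)
  also have "\<dots> \<le> \<Lambda> * norm (x - y)"
    using clip2_lipschitz[of "(x, t)" "(y, t)"] d(3) by (intro mult_left_mono) (auto simp: norm_Pair)
  finally show "norm (\<zeta> j (clip2 (x, t)) - \<zeta> j (clip2 (y, t))) \<le> \<Lambda> * norm (x - y)" .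
qed

lemma Yc_bounded_lipschitz: "i < k \<Longrightarrow> bounded_lipschitz \<Lambda> (Yc i)"
  unfolding bounded_lipschitz_def Yc_def
proof (intro conjI allI d(3) Y_bd clip_lt)
  fix x y assume i: "i < k"
  have "norm (Y i (clip r x) - Y i (clip r y)) \<le> \<Lambda> * norm (clip r x - clip r y)" by (intro Y_lip i clip_lt)
  also have "\<dots> \<le> \<Lambda> * norm (x - y)" using clip_lipschitz[OF d(1), of x y] d(3) by (intro mult_left_mono) auto
  finally show "norm (Y i (clip r x) - Y i (clip r y)) \<le> \<Lambda> * norm (x - y)" .
qed

lemma snd_Tf: "snd (Tf y) = 1"
proof -
  have "\<sigma> (clip2 y) \<noteq> 0" using \<sigma>_bound[OF clip2_norm, of y] d(4) by auto
  then show ?thesis by (simp add: Tf_def \<sigma>_def)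
qed

lemma \<sigma>_lip: "norm y < d \<Longrightarrow> norm y' < d \<Longrightarrow> \<bar>\<sigma> y - \<sigma> y'\<bar> \<le> \<Lambda> * norm (y - y')"
  using X_lip[OF j0(1), of y y'] norm_snd_le[of "snd (X j0 y - X j0 y')" "fst (X j0 y - X j0 y')"]
  unfolding prod.collapse by (simp add: \<sigma>_def)

lemma Tf_bounded_lipschitz: "bounded_lipschitz (2 * (1 + 1 / m + \<Lambda> / m\<^sup>2) * \<Lambda>) Tf"
proof -
  have "bounded_lipschitz (1 + 1 / m + \<Lambda> / m\<^sup>2) (\<lambda>y. inverse (\<sigma> (clip2 y)))"
    unfolding bounded_lipschitz_def
  proof (intro conjI allI)
    have pos: "0 \<le> 1 / m" "0 \<le> \<Lambda> / m\<^sup>2" using d by auto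
    then show "1 \<le> 1 + 1 / m + \<Lambda> / m\<^sup>2" by linarith
    fix y y'
    let ?s = "\<sigma> (clip2 y)" and ?s' = "\<sigma> (clip2 y')"
    have s: "m \<le> \<bar>?s\<bar>" "m \<le> \<bar>?s'\<bar>" using \<sigma>_bound clip2_norm by auto
    have "norm (inverse ?s) \<le> 1 / m" using s(1) d(4) by (simp add: inverse_eq_divide frac_le)
    then show "norm (inverse ?s) \<le> 1 + 1 / m + \<Lambda> / m\<^sup>2" using pos by linarith
    have ne: "?s \<noteq> 0" "?s' \<noteq> 0" using s d(4) by auto
    have mm: "m\<^sup>2 \<le> \<bar>?s\<bar> * \<bar>?s'\<bar>" unfolding power2_eq_square using s d(4) by (intro mult_mono) auto
    have "norm (inverse ?s - inverse ?s') = \<bar>?s - ?s'\<bar> / (\<bar>?s\<bar> * \<bar>?s'\<bar>)"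
      using ne by (simp add: field_simps abs_divide abs_mult flip: abs_minus_commute[of ?s ?s'])
    also have "\<dots> \<le> (\<Lambda> * norm (y - y')) / m\<^sup>2"
    proof (rule frac_le)
      have "\<bar>?s - ?s'\<bar> \<le> \<Lambda> * norm (clip2 y - clip2 y')" by (intro \<sigma>_lip clip2_norm)
      also have "\<dots> \<le> \<Lambda> * norm (y - y')" using clip2_lipschitz d(3) by (intro mult_left_mono) auto
      finally show "\<bar>?s - ?s'\<bar> \<le> \<Lambda> * norm (y - y')" .
    qed (use d mm in auto)
    also have "\<dots> = \<Lambda> / m\<^sup>2 * norm (y - y')" by simp
    also have "\<dots> \<le> (1 + 1 / m + \<Lambda> / m\<^sup>2) * norm (y - y')" using pos by (intro mult_right_mono) auto
    finally show "norm (inverse ?s - inverse ?s') \<le> (1 + 1 / m + \<Lambda> / m\<^sup>2) * norm (y - y')" .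
  qed
  moreover have "bounded_lipschitz \<Lambda> (\<lambda>y. X j0 (clip2 y))"
    unfolding bounded_lipschitz_def
  proof (intro conjI allI d(3) X_bd j0(1) clip2_norm)
    fix y y'
    have "norm (X j0 (clip2 y) - X j0 (clip2 y')) \<le> \<Lambda> * norm (clip2 y - clip2 y')" by (intro X_lip j0(1) clip2_norm)
    also have "\<dots> \<le> \<Lambda> * norm (y - y')" using clip2_lipschitz d(3) by (intro mult_left_mono) auto
    finally show "norm (X j0 (clip2 y) - X j0 (clip2 y')) \<le> \<Lambda> * norm (y - y')" .
  qed
  ultimately show ?thesis unfolding Tf_def[abs_def] by (rule bounded_lipschitz_scaleR)
qed

lemma q: "i < k \<Longrightarrow> norm x < d \<Longrightarrow> Y i x = (\<Sum>j\<in>J. q i x j *\<^sub>R \<zeta> j (x, 0))"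
proof -
  assume i: "i < k" and x: "norm x < d"
  have "Y i x \<in> span ((\<lambda>i. Y i x) ` {..<k})" using i by (intro span_base) auto
  then have "(Y i x, 0) \<in> \<V> (x, 0)" using Y_span in_W'[OF x] by blast
  moreover have "norm (x, 0::real) < d" using x by (simp add: norm_Pair)
  ultimately have "\<exists>q. Y i x = (\<Sum>j\<in>J. q j *\<^sub>R \<zeta> j (x, 0))"
    using tangent_representation[of "(x, 0)" "Y i x"] in_W[of "(x, 0)"] \<sigma>_bound[of "(x, 0)"] d(4) by fastforce
  then show ?thesis unfolding q_def by (rule someI_ex)
qed

lemma q_bounds:
  assumes i: "i < k" and j: "j \<in> J"
  shows "norm x < d \<Longrightarrow> \<bar>q i x j\<bar> \<le> \<Lambda> / m"
    and "norm x < d \<Longrightarrow> norm x' < d \<Longrightarrow> \<bar>q i x j - q i x' j\<bar> \<le> \<Lambda> / m * (1 + \<Lambda> / m) * norm (x - x')"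
proof -
  have l: "norm y < d \<Longrightarrow> m * (\<Sum>j\<in>J. \<bar>c j\<bar>) \<le> norm (\<Sum>j\<in>J. c j *\<^sub>R \<zeta> j (y, 0))" for y c
    using lower[of "(y, 0)" c] by (simp add: norm_Pair)
  have zl: "norm (\<zeta> j (y, 0) - \<zeta> j (y', 0)) \<le> \<Lambda> * norm (y - y')" if "j \<in> J" "norm y < d" "norm y' < d" for j y y'
    using \<zeta>_lip[OF that(1), of "(y, 0)" "(y', 0)"] that by (simp add: norm_Pair)
  note * = frame_coefficients_lipschitz[where S="ball 0 d" and \<zeta>="\<lambda>j x. \<zeta> j (x, 0)" and Z="Y i" and q="\<lambda>j x. q i x j" and m=m and \<Lambda>=\<Lambda> and J=J]
  have \<Lambda>0: "\<Lambda> \<ge> 0" using d by simp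
  show "norm x < d \<Longrightarrow> \<bar>q i x j\<bar> \<le> \<Lambda> / m"
    by (rule *(1)) (use J(1) d(4) l zl Y_lip[OF i] Y_bd[OF i] q[OF i] j \<Lambda>0 in auto)
  show "norm x < d \<Longrightarrow> norm x' < d \<Longrightarrow> \<bar>q i x j - q i x' j\<bar> \<le> \<Lambda> / m * (1 + \<Lambda> / m) * norm (x - x')"
    by (rule *(2)) (use J(1) d(4) l zl Y_lip[OF i] Y_bd[OF i] q[OF i] j \<Lambda>0 in auto)
qed

definition "Lq = 1 + \<Lambda> / m + \<Lambda> / m * (1 + \<Lambda> / m)"

lemma q_bounded_lipschitz: "i < k \<Longrightarrow> j \<in> J \<Longrightarrow> bounded_lipschitz Lq (\<lambda>x. q i (clip r x) j)"
  unfolding bounded_lipschitz_def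
proof (intro conjI allI)
  assume i: "i < k" and j: "j \<in> J"
  have pos: "0 \<le> \<Lambda> / m" using d by simp
  have pos2: "0 \<le> \<Lambda> / m * (1 + \<Lambda> / m)" using mult_nonneg_nonneg[OF pos, of "1 + \<Lambda> / m"] pos by linarith
  show "1 \<le> Lq" using pos pos2 by (simp add: Lq_def)
  fix x y
  show "norm (q i (clip r x) j) \<le> Lq" using q_bounds(1)[OF i j clip_lt, of x] pos2 by (simp add: Lq_def)
  have "\<bar>q i (clip r x) j - q i (clip r y) j\<bar> \<le> \<Lambda> / m * (1 + \<Lambda> / m) * norm (clip r x - clip r y)"
    by (rule q_bounds(2)[OF i j clip_lt clip_lt])
  also have "\<dots> \<le> Lq * norm (x - y)"
    using clip_lipschitz[OF d(1), of x y] pos pos2 unfolding Lq_def by (intro mult_mono) auto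
  finally show "norm (q i (clip r x) j - q i (clip r y) j) \<le> Lq * norm (x - y)" by simp
qed

lemma Lq_ge_1: "1 \<le> Lq"
proof -
  have pos: "0 \<le> \<Lambda> / m" using d by simp
  then show ?thesis using mult_nonneg_nonneg[OF pos, of "1 + \<Lambda> / m"] unfolding Lq_def by linarith
qed

lemma Yt_bounded_lipschitz: "i < k \<Longrightarrow> bounded_lipschitz ((1 + real (card J)) * (2 * Lq * \<Lambda>)) (Yt i t)"
  unfolding Yt_def[abs_def]
proof (rule bounded_lipschitz_sum)
  assume "i < k"
  show "1 \<le> 2 * Lq * \<Lambda>" using mult_mono[OF Lq_ge_1 d(3)] Lq_ge_1 by simp
  show "bounded_lipschitz (2 * Lq * \<Lambda>) (\<lambda>x. q i (clip r x) j *\<^sub>R z j t x)" if "j \<in> J" for j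
    using \<open>i < k\<close> that by (intro bounded_lipschitz_scaleR q_bounded_lipschitz z_bounded_lipschitz)
qed

lemma clip_0: "clip r 0 = 0"
  by (rule clip_id) (use d in auto)

lemma Yt_near_Yc:
  assumes i: "i < k"
  shows "norm (Yt i t x - Yc i x) \<le> card J * (\<Lambda> / m * \<Lambda>) * \<bar>t\<bar>"
proof -
  have "Yt i t x - Yc i x = (\<Sum>j\<in>J. q i (clip r x) j *\<^sub>R (\<zeta> j (clip2 (x, t)) - \<zeta> j (clip r x, 0)))"
    unfolding Yt_def Yc_def q[OF i clip_lt] z_def by (simp add: scaleR_diff_right sum_subtractf)
  also have "norm \<dots> \<le> (\<Sum>j\<in>J. \<Lambda> / m * (\<Lambda> * \<bar>t\<bar>))"
  proof (rule order_trans[OF norm_sum], rule sum_mono, simp only: norm_scaleR, rule mult_mono)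
    fix j assume j: "j \<in> J"
    show "\<bar>q i (clip r x) j\<bar> \<le> \<Lambda> / m" by (rule q_bounds(1)[OF i j clip_lt])
    have "norm (\<zeta> j (clip2 (x, t)) - \<zeta> j (clip r x, 0)) = norm (\<zeta> j (clip2 (x, t)) - \<zeta> j (clip2 (x, 0)))"
      by (simp add: clip2_def clip_0)
    also have "\<dots> \<le> \<Lambda> * norm (clip2 (x, t) - clip2 (x, 0))" by (intro \<zeta>_lip j clip2_norm)
    also have "\<dots> \<le> \<Lambda> * \<bar>t\<bar>" using clip2_lipschitz[of "(x, t)" "(x, 0)"] d(3) by (intro mult_left_mono) (auto simp: norm_Pair)
    finally show "norm (\<zeta> j (clip2 (x, t)) - \<zeta> j (clip r x, 0)) \<le> \<Lambda> * \<bar>t\<bar>" .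
  qed (use d in auto)
  finally show ?thesis by (simp add: mult_ac)
qed

lemma A0_bounded: "\<exists>C\<ge>0. \<forall>j\<in>J. \<forall>v. norm (A0 j v) \<le> C * norm v"
proof -
  have "\<forall>j\<in>J. \<exists>C>0. \<forall>v. norm (A0 j v) \<le> norm v * C"
    using slice_strict bounded_linear.pos_bounded unfolding has_strict_derivative_def by blast
  then obtain C where C: "\<And>j. j \<in> J \<Longrightarrow> C j > 0" "\<And>j v. j \<in> J \<Longrightarrow> norm (A0 j v) \<le> norm v * C j" by metis
  have "norm (A0 j v) \<le> (\<Sum>j\<in>J. C j) * norm v" if j: "j \<in> J" for j v
  proof -
    have "C j \<le> (\<Sum>j\<in>J. C j)" using j J(1) C(1) by (intro member_le_sum) (auto intro: less_imp_le)
    then have "norm v * C j \<le> norm v * (\<Sum>j\<in>J. C j)" by (rule mult_left_mono) simp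
    then show ?thesis using C(2)[OF j, of v] by (simp add: mult.commute)
  qed
  moreover have "0 \<le> (\<Sum>j\<in>J. C j)" using C(1) by (intro sum_nonneg) (auto intro: less_imp_le)
  ultimately show ?thesis by blast
qed

text \<open>Strict differentiability in the whole space applies to the pairs \<open>(x, t)\<close>
  and \<open>(y, t)\<close>, whose difference is horizontal; this is why one derivative
  \<open>A0 j\<close> serves every low slice.\<close>

lemma nearly_affine_small:
  assumes \<eta>: "\<eta> > 0"
  shows "\<exists>\<rho>>0. \<rho> \<le> r \<and> (\<forall>j\<in>J. \<forall>t. \<bar>t\<bar> < \<rho> \<longrightarrow> nearly_affine \<rho> \<eta> (a0 j) (A0 j) (z j t))"
proof -
  have "\<forall>j\<in>J. \<exists>e>0. \<forall>y y'. norm y < e \<longrightarrow> norm y' < e \<longrightarrow> norm (\<zeta> j y - \<zeta> j y' - frame_deriv j (y - y')) \<le> \<eta> * norm (y - y')"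
  proof
    fix j assume "j \<in> J"
    from strict_derivativeD[OF frame_deriv[OF this] \<eta>]
    show "\<exists>e>0. \<forall>y y'. norm y < e \<longrightarrow> norm y' < e \<longrightarrow> norm (\<zeta> j y - \<zeta> j y' - frame_deriv j (y - y')) \<le> \<eta> * norm (y - y')" by (metis diff_zero)
  qed
  then obtain e where e: "\<And>j. j \<in> J \<Longrightarrow> e j > 0"
     "\<And>j y y'. j \<in> J \<Longrightarrow> norm y < e j \<Longrightarrow> norm y' < e j \<Longrightarrow> norm (\<zeta> j y - \<zeta> j y' - frame_deriv j (y - y')) \<le> \<eta> * norm (y - y')"
    by metis
  \<comment> \<open>Halves of the \<open>e j\<close>, since \<open>norm (x, t)\<close> is only known
    to be below \<open>2 * \<rho>\<close>; \<open>\<eta> / (2 * \<Lambda>)\<close> bounds the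
    deviation from the value at \<open>0\<close> in the same way.\<close>
  have "\<exists>\<rho>>0. \<forall>x\<in>insert r (insert (\<eta> / (2 * \<Lambda>)) ((\<lambda>j. e j / 2) ` J)). \<rho> \<le> x"
    using e(1) J(1) \<eta> d by (intro positive_lower_bound) auto
  then obtain \<rho> where \<rho>: "\<rho> > 0" "\<rho> \<le> r" "\<rho> \<le> \<eta> / (2 * \<Lambda>)" "\<And>j. j \<in> J \<Longrightarrow> \<rho> \<le> e j / 2" by auto
  have "nearly_affine \<rho> \<eta> (a0 j) (A0 j) (z j t)" if j: "j \<in> J" and t: "\<bar>t\<bar> < \<rho>" for j t
    unfolding nearly_affine_def
  proof (intro conjI ballI)
    have zx: "z j t x = \<zeta> j (x, t)" if "x \<in> ball 0 \<rho>" for x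
      using that t \<rho>(2) clip_id[OF d(1), of x] clip_id[OF d(1), of t] by (simp add: z_def clip2_def)
    have nx: "norm (x, t) < 2 * \<rho>" if "x \<in> ball 0 \<rho>" for x :: 'a
      using that t norm_Pair_le[of x t] by simp
    fix x :: 'a assume x: "x \<in> ball 0 \<rho>"
    have "norm (\<zeta> j (x, t) - \<zeta> j 0) \<le> \<Lambda> * norm ((x, t) - 0)"
      using nx[OF x] \<rho>(2) d(1,2) by (intro \<zeta>_lip j) auto
    also have "\<dots> \<le> \<Lambda> * (2 * \<rho>)" using nx[OF x] d(3) by (intro mult_left_mono) auto
    also have "\<dots> \<le> \<eta>" using \<rho>(3) d(3) by (simp add: field_simps)
    finally show "norm (z j t x - a0 j) \<le> \<eta>" by (simp add: zx[OF x] a0_def)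
    fix y :: 'a assume y: "y \<in> ball 0 \<rho>"
    have "norm (\<zeta> j (x, t) - \<zeta> j (y, t) - frame_deriv j ((x, t) - (y, t))) \<le> \<eta> * norm ((x, t) - (y, t))"
      using nx[OF x] nx[OF y] \<rho>(4)[OF j] by (intro e(2) j) linarith+
    then show "norm (z j t x - z j t y - A0 j (x - y)) \<le> \<eta> * norm (x - y)"
      by (simp add: zx[OF x] zx[OF y] A0_def norm_Pair)
  qed
  then show ?thesis using \<rho>(1,2) by blast
qed

text \<open>The constants are chosen in the order \<open>L\<close>, \<open>\<beta>\<close>,
  \<open>K\<close>, \<open>\<eta>\<close>, \<open>\<rho>\<close>, \<open>\<delta>\<close>, each
  depending only on earlier ones and on the given data; in particular \<open>K\<close> must be known
  before \<open>\<eta>\<close>, which in turn fixes \<open>\<rho>\<close>.\<close>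

lemma trace_frame_exists:
  assumes p: "1 < p"
  shows "\<exists>L \<delta> K \<rho> \<rho>\<^sub>1 \<eta> \<beta> B c. trace_frame Tf L p \<delta> K \<rho> \<rho>\<^sub>1 \<eta> \<beta> B J {..<k} z Yc Yt a0 A0 c \<and>
    0 < \<rho>\<^sub>1 \<and> \<rho>\<^sub>1 < r \<and> L * \<delta> < r / 2"
proof -
  obtain CA where CA: "CA \<ge> 0" "\<And>j v. j \<in> J \<Longrightarrow> norm (A0 j v) \<le> CA * norm v" using A0_bounded by blast
  define L where "L = 2 * (1 + 1 / m + \<Lambda> / m\<^sup>2) * \<Lambda> + \<Lambda> + (1 + real (card J)) * (2 * Lq * \<Lambda>) + card J * (\<Lambda> / m * \<Lambda>) + CA"
  have parts: "0 \<le> 2 * (1 + 1 / m + \<Lambda> / m\<^sup>2) * \<Lambda>" "0 \<le> (1 + real (card J)) * (2 * Lq * \<Lambda>)" "0 \<le> card J * (\<Lambda> / m * \<Lambda>)"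
    using d Lq_ge_1 by (auto intro!: mult_nonneg_nonneg add_nonneg_nonneg)
  have L: "1 \<le> L" "\<Lambda> \<le> L" "2 * (1 + 1 / m + \<Lambda> / m\<^sup>2) * \<Lambda> \<le> L" "(1 + real (card J)) * (2 * Lq * \<Lambda>) \<le> L" "card J * (\<Lambda> / m * \<Lambda>) \<le> L" "CA \<le> L"
    using parts CA(1) d(3) unfolding L_def by linarith+
  obtain c :: "'a \<Rightarrow> nat \<times> nat option" and \<beta> where c: "\<And>b. b \<in> Basis \<Longrightarrow> code_in J (c b)" "\<beta> \<ge> 0"
     "\<And>w. \<exists>r. (\<Sum>b\<in>Basis. (r \<bullet> b) *\<^sub>R direction a0 A0 (c b)) = w \<and> norm r \<le> \<beta> * norm w"
    using basis_from_codes[OF bracket_span] by blast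
  define K where "K = max 1 (\<beta> * (7 * L\<^sup>2 + 2))"
  have K: "1 \<le> K" "\<beta> * (7 * L\<^sup>2 + 2) \<le> K" by (auto simp: K_def)
  let ?n = "real DIM('a)"
  have n: "?n \<ge> 1" by (simp add: Suc_leI)
  \<comment> \<open>Makes the \<open>\<eta>\<close>-part of the error, times the dimension, exactly
    \<open>1 / 2\<close>.\<close>
  define \<eta> where "\<eta> = 1 / (16 * ?n * L * K\<^sup>2)"
  have \<eta>: "\<eta> > 0" using L K n by (auto simp: \<eta>_def)
  obtain \<rho> where \<rho>: "\<rho> > 0" "\<rho> \<le> r" "\<And>j t. j \<in> J \<Longrightarrow> \<bar>t\<bar> < \<rho> \<Longrightarrow> nearly_affine \<rho> \<eta> (a0 j) (A0 j) (z j t)"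
    using nearly_affine_small[OF \<eta>] by blast
  \<comment> \<open>Coefficient of \<open>\<delta>\<close> in the margin for \<open>\<rho>\<close>,
    after \<open>\<delta>\<^sup>2 \<le> \<delta>\<close>.\<close>
  define Q where "Q = (7 * L\<^sup>2 + 1) + (4 * ?n + 2) * (L * K)"
  have Q: "Q > 0" using L K n unfolding Q_def by (intro add_pos_nonneg) auto
  have pos: "2 * L * K > 0" "156 * ?n * L ^ 3 * K ^ 3 > 0" using L K n by auto
  \<comment> \<open>In this order: heights at most 1, short flow times, the other half of the error
    budget (\<open>156 = 2 * 78\<close>), validity of the affine approximation, the margin that
    \<open>\<rho>\<^sub>1 = \<rho> / 2\<close> leaves, and orbits from the half ball that cannot
    leave the ball of radius \<open>r\<close>.\<close>
  have "\<exists>\<delta>>0. \<forall>x\<in>{1, 1 / (2 * L * K), 1 / (156 * ?n * L ^ 3 * K ^ 3), \<rho> / 2, \<rho> / (4 * Q), r / (4 * L)}. \<delta> \<le> x"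
  proof (rule positive_lower_bound)
    have "0 < 1 / (2 * L * K)" "0 < 1 / (156 * ?n * L ^ 3 * K ^ 3)" "0 < \<rho> / (4 * Q)" "0 < r / (4 * L)"
      using pos \<rho>(1) Q d(1) L(1) by (intro divide_pos_pos; simp)+
    then show "\<forall>x\<in>{1, 1 / (2 * L * K), 1 / (156 * ?n * L ^ 3 * K ^ 3), \<rho> / 2, \<rho> / (4 * Q), r / (4 * L)}. 0 < x"
      using \<rho>(1) by (simp only: ball_simps simp_thms) simp
  qed simp
  then obtain \<delta> where \<delta>: "\<delta> > 0" "\<delta> \<le> 1" "\<delta> \<le> 1 / (2 * L * K)" "\<delta> \<le> 1 / (156 * ?n * L ^ 3 * K ^ 3)" "\<delta> \<le> \<rho> / 2" "\<delta> \<le> \<rho> / (4 * Q)" "\<delta> \<le> r / (4 * L)"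
    by (auto simp only: ball_simps)
  have d1: "2 * L * K * \<delta> \<le> 1" using \<delta>(3) pos(1) by (simp add: pos_le_divide_eq mult.commute)
  have d2: "156 * ?n * L ^ 3 * K ^ 3 * \<delta> \<le> 1" using \<delta>(4) pos(2) by (simp add: pos_le_divide_eq mult.commute)
  have d3: "4 * (Q * \<delta>) \<le> \<rho>" using \<delta>(6) Q by (simp add: pos_le_divide_eq mult_ac)
  have d4: "4 * (L * \<delta>) \<le> r" using \<delta>(7) L(1) by (simp add: pos_le_divide_eq mult_ac)
  have LK: "L * \<delta> \<le> L * K * \<delta>" using L K \<delta>(1) mult_left_mono[OF K(1), of "L * \<delta>"] by (simp add: mult_ac)
  have LK0: "0 \<le> L * K * \<delta>" using L K \<delta>(1) by simp
  have frame: "trace_frame Tf L p \<delta> K \<rho> (\<rho> / 2) \<eta> \<beta> (\<Lambda> / m) J {..<k} z Yc Yt a0 A0 c"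
  proof (intro trace_frame.intro vertical_field.intro trace_frame_axioms.intro)
    show "bounded_lipschitz L Tf" by (rule bounded_lipschitz_mono[OF Tf_bounded_lipschitz L(3)])
    show "snd (Tf y) = 1" for y by (rule snd_Tf)
    show "1 < p" by (rule p)
    show "finite J" by (rule J)
    show "0 < \<delta>" "\<delta> \<le> 1" by (rule \<delta>)+
    show "L * \<delta> \<le> 1" using d1 LK LK0 by linarith
    show "0 \<le> \<Lambda> / m" using d by simp
    show "bounded_lipschitz L (Yc i)" if "i \<in> {..<k}" for i using that by (intro bounded_lipschitz_mono[OF Yc_bounded_lipschitz L(2)]) simp
    show "bounded_lipschitz L (Yt i t)" if "i \<in> {..<k}" for i t using that by (intro bounded_lipschitz_mono[OF Yt_bounded_lipschitz L(4)]) simp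
    show "norm (Yt i t x - Yc i x) \<le> L * t" if "i \<in> {..<k}" "0 < t" for i t x
    proof -
      have "norm (Yt i t x - Yc i x) \<le> card J * (\<Lambda> / m * \<Lambda>) * \<bar>t\<bar>" using that by (intro Yt_near_Yc) simp
      also have "\<dots> \<le> L * t" 
        by (subst abs_of_pos[OF that(2)]) (rule mult_right_mono[OF L(5) less_imp_le[OF that(2)]])
      finally show ?thesis .
    qed
    show "\<exists>q. (\<forall>j\<in>J. \<bar>q j\<bar> \<le> \<Lambda> / m) \<and> Yt i t x = (\<Sum>j\<in>J. q j *\<^sub>R z j t x)" if "i \<in> {..<k}" for i t x
      using that q_bounds(1)[OF _ _ clip_lt] by (intro exI[of _ "q i (clip r x)"]) (auto simp: Yt_def)
    show "bracket_frame (\<lambda>j. z j t) J L \<rho> \<eta> K t a0 A0 c" if t: "0 < t" "t \<le> \<delta>" for t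
    proof (rule bracket_frame.intro)
      show "bounded_lipschitz L (z j t)" if "j \<in> J" for j by (rule bounded_lipschitz_mono[OF z_bounded_lipschitz[OF that] L(2)])
      show "nearly_affine \<rho> \<eta> (a0 j) (A0 j) (z j t)" if "j \<in> J" for j using t \<delta>(5) \<rho>(1) by (intro \<rho>(3) that) simp
      show "linear (A0 j)" if "j \<in> J" for j using slice_strict[OF that] by (auto simp: has_strict_derivative_def dest: bounded_linear.linear)
      show "norm (A0 j v) \<le> L * norm v" if "j \<in> J" for j v
        using CA(2)[OF that, of v] mult_right_mono[OF L(6), of "norm v"] by simp
      show "code_in J (c b)" if "b \<in> Basis" for b by (rule c(1)[OF that])
      show "1 \<le> L" "1 \<le> K" "0 < t" by (fact L K t)+
      show "t \<le> 1" using t \<delta>(2) by linarith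
      have "2 * L * K * t \<le> 2 * L * K * \<delta>" using pos(1) t by (intro mult_left_mono) auto
      then show "2 * L * K * t \<le> 1" using d1 by linarith
    qed
    show "DIM('a) * (8 * L * \<eta> * K\<^sup>2 + 78 * L ^ 3 * K ^ 3 * t) \<le> 1" if t: "0 < t" "t \<le> \<delta>" for t
    proof -
      have "?n * (8 * L * \<eta> * K\<^sup>2) = 1 / 2" using L K n by (simp add: \<eta>_def field_simps)
      moreover have "156 * ?n * L ^ 3 * K ^ 3 * t \<le> 156 * ?n * L ^ 3 * K ^ 3 * \<delta>" using pos(2) t by (intro mult_left_mono) auto
      moreover have "?n * (78 * L ^ 3 * K ^ 3 * t) = 156 * ?n * L ^ 3 * K ^ 3 * t / 2" by simp
      ultimately show ?thesis using d2 unfolding distrib_left by linarith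
    qed
    have "(7 * L\<^sup>2 + 1) * \<delta>\<^sup>2 \<le> (7 * L\<^sup>2 + 1) * \<delta>" using \<delta>(1,2) by (intro mult_left_mono) (auto simp: power2_eq_square mult_left_le)
    then have "(7 * L\<^sup>2 + 1) * \<delta>\<^sup>2 + (4 * ?n + 2) * (L * (K * \<delta>)) \<le> Q * \<delta>" by (simp add: Q_def algebra_simps)
    moreover have "Q * \<delta> < \<rho> / 2" using d3 \<rho>(1) by linarith
    moreover have nn: "real (4 * DIM('a) + 2) = 4 * ?n + 2" by simp
    ultimately show "\<rho> / 2 + (7 * L\<^sup>2 + 1) * \<delta>\<^sup>2 + real (4 * DIM('a) + 2) * (L * (K * \<delta>)) < \<rho>" unfolding nn by linarith
    show "\<exists>r. (\<Sum>b\<in>Basis. (r \<bullet> b) *\<^sub>R direction a0 A0 (c b)) = w \<and> norm r \<le> \<beta> * norm w" for w by (rule c(3))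
    show "0 \<le> \<beta>" "\<beta> * (7 * L\<^sup>2 + 2) \<le> K" by (fact c K)+
  qed
  have "0 < \<rho> / 2" "\<rho> / 2 < r" "L * \<delta> < r / 2" using d4 d(1) \<rho>(1,2) by linarith+
  with frame have "trace_frame Tf L p \<delta> K \<rho> (\<rho> / 2) \<eta> \<beta> (\<Lambda> / m) J {..<k} z Yc Yt a0 A0 c \<and>
    0 < \<rho> / 2 \<and> \<rho> / 2 < r \<and> L * \<delta> < r / 2" by (intro conjI)
  then show ?thesis
    by - (rule exI[of _ L], rule exI[of _ \<delta>], rule exI[of _ K], rule exI[of _ \<rho>], rule exI[of _ "\<rho> / 2"],
        rule exI[of _ \<eta>], rule exI[of _ \<beta>], rule exI[of _ "\<Lambda> / m"], rule exI[of _ c], assumption)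
qed

end

section \<open>Slices, finiteness, and derivatives along the original fields\<close>

lemma lpint_slices_le:
  fixes f :: "'a::euclidean_space \<times> real \<Rightarrow> real"
  assumes f: "continuous_on UNIV f"
  shows "(\<lambda>t. lpint p (\<lambda>x. f (x, t))) \<in> borel_measurable borel"
    and "(\<integral>\<^sup>+t\<in>S. lpint p (\<lambda>x. f (x, t)) \<partial>lborel) \<le> lpint p f"
proof -
  have fm: "f \<in> borel_measurable (borel \<Otimes>\<^sub>M borel)" unfolding borel_prod by (rule borel_measurable_continuous_onI[OF f])
  note [measurable] = fm
  show "(\<lambda>t. lpint p (\<lambda>x. f (x, t))) \<in> borel_measurable borel" unfolding lpint_def by measurable
  have "(\<integral>\<^sup>+t\<in>S. lpint p (\<lambda>x. f (x, t)) \<partial>lborel) \<le> (\<integral>\<^sup>+t. lpint p (\<lambda>x. f (x, t)) \<partial>lborel)"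
    by (intro nn_integral_mono) (auto split: split_indicator)
  also have "\<dots> = (\<integral>\<^sup>+y. ennreal (\<bar>f y\<bar> powr p) \<partial>(lborel \<Otimes>\<^sub>M lborel))"
    unfolding lpint_def by (rule lborel_pair.nn_integral_snd) measurable
  also have "\<dots> = lpint p f" unfolding lpint_def lborel_prod ..
  finally show "(\<integral>\<^sup>+t\<in>S. lpint p (\<lambda>x. f (x, t)) \<partial>lborel) \<le> lpint p f" .
qed

text \<open>Finiteness is what allows the passage from \<open>ennreal\<close> to real norms in the
  final inequality.\<close>

lemma lpint_finite:
  fixes f :: "'b::euclidean_space \<Rightarrow> real"
  assumes p: "p > 0" and f: "continuous_on UNIV f" and supp: "\<And>y. R \<le> norm y \<Longrightarrow> f y = 0"
  shows "lpint p f < \<infinity>"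
proof -
  have "compact (f ` cball 0 R)" by (intro compact_continuous_image continuous_on_subset[OF f]) auto
  then obtain C where C: "\<And>y. y \<in> cball 0 R \<Longrightarrow> \<bar>f y\<bar> \<le> C" using compact_imp_bounded bounded_iff by (metis imageI real_norm_def)
  have "lpint p f \<le> (\<integral>\<^sup>+y. ennreal (\<bar>C\<bar> powr p) * indicator (cball 0 R) (y::'b) \<partial>lborel)"
    unfolding lpint_def
  proof (rule nn_integral_mono)
    fix y :: 'b
    show "ennreal (\<bar>f y\<bar> powr p) \<le> ennreal (\<bar>C\<bar> powr p) * indicator (cball 0 R) y"
    proof (cases "norm y \<le> R")
      case True
      then have "\<bar>f y\<bar> powr p \<le> \<bar>C\<bar> powr p" using C[of y] p by (intro powr_mono2) auto
      then show ?thesis using True by (simp add: ennreal_leI)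
    qed (use supp[of y] p in auto)
  qed
  also have "\<dots> = ennreal (\<bar>C\<bar> powr p) * emeasure lborel (cball 0 R :: 'b set)"
    by (rule nn_integral_cmult_indicator) auto
  also have "\<dots> < \<infinity>" using emeasure_lborel_cball_finite[of "0::'b" R] by (simp add: ennreal_mult_less_top)
  finally show ?thesis .
qed

context clipped_subbundle
begin

text \<open>The derivative vanishes outside the ball of radius \<open>\<rho>\<^sub>1\<close>, and
  inside it the projection is the identity; the extension of a field is invisible to the test
  function.\<close>

lemma field_clip_eq:
  assumes \<phi>: "test_function \<rho>\<^sub>1 \<phi> d\<phi>" and \<rho>: "\<rho>\<^sub>1 \<le> r"
  shows "d\<phi> y (V y) = d\<phi> y (V (clip2 y))"
proof (cases "norm y < \<rho>\<^sub>1")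
  case True
  then have "norm (fst y) \<le> r" "norm (snd y) \<le> r"
    using norm_fst_le[of "fst y" "snd y"] norm_snd_le[of "snd y" "fst y"] \<rho> unfolding prod.collapse by linarith+
  then have "clip2 y = y" using clip_id[OF d(1), of "fst y"] clip_id[OF d(1), of "snd y"] by (simp add: clip2_def)
  then show ?thesis by simp
next
  case False
  then show ?thesis using test_functionD(5)[OF \<phi>] by simp
qed

lemma clip2_continuous: "continuous_on UNIV clip2"
proof -
  have "1-lipschitz_on UNIV clip2" using clip2_lipschitz by (intro lipschitz_onI) (auto simp: dist_norm)
  then show ?thesis by (rule lipschitz_on_continuous_on)
qed

lemma clipped_continuous:
  assumes lip: "\<And>y y'. norm y < d \<Longrightarrow> norm y' < d \<Longrightarrow> norm (V y - V y') \<le> \<Lambda> * norm (y - y')"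
  shows "continuous_on UNIV (\<lambda>y. V (clip2 y))"
proof -
  have "\<Lambda>-lipschitz_on (ball 0 d) V" using lip d(3) by (intro lipschitz_onI) (auto simp: dist_norm)
  then have "continuous_on (ball 0 d) V" by (rule lipschitz_on_continuous_on)
  then show ?thesis by (rule continuous_on_compose2[OF _ clip2_continuous]) (use clip2_norm in auto)
qed

lemma X_apply_continuous:
  assumes \<phi>: "test_function \<rho>\<^sub>1 \<phi> d\<phi>" and \<rho>: "\<rho>\<^sub>1 \<le> r" and j: "j \<le> k"
  shows "continuous_on UNIV (\<lambda>y. d\<phi> y (X j y))"
  unfolding field_clip_eq[OF \<phi> \<rho>, of _ "X j"]
  by (rule test_function_field_continuous[OF \<phi> continuous_on_id]) (rule clipped_continuous[OF X_lip[OF j]])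

lemma vertical_apply_bound:
  assumes \<phi>: "test_function \<rho>\<^sub>1 \<phi> d\<phi>" and \<rho>: "\<rho>\<^sub>1 \<le> r" and p: "p > 1"
  shows "lpint p (\<lambda>y. d\<phi> y (Tf y)) \<le> ennreal ((1 / m * card {..k}) powr p) * (\<Sum>j\<le>k. lpint p (\<lambda>y. d\<phi> y (X j y)))"
proof (rule lpint_le_sum)
  fix y
  have "\<bar>d\<phi> y (Tf y)\<bar> = \<bar>inverse (\<sigma> (clip2 y))\<bar> * \<bar>d\<phi> y (X j0 y)\<bar>"
    unfolding Tf_def using field_clip_eq[OF \<phi> \<rho>, of y "X j0"] linear_scale[OF test_functionD(3)[OF \<phi>]] by (simp add: abs_mult)
  also have "\<dots> \<le> 1 / m * (\<Sum>j\<le>k. \<bar>d\<phi> y (X j y)\<bar>)"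
  proof (rule mult_mono)
    show "\<bar>inverse (\<sigma> (clip2 y))\<bar> \<le> 1 / m" using \<sigma>_bound[OF clip2_norm, of y] d(4) by (simp add: inverse_eq_divide frac_le)
    show "\<bar>d\<phi> y (X j0 y)\<bar> \<le> (\<Sum>j\<le>k. \<bar>d\<phi> y (X j y)\<bar>)" using j0(1) by (intro member_le_sum) auto
  qed (use d in auto)
  finally show "\<bar>d\<phi> y (Tf y)\<bar> \<le> 1 / m * (\<Sum>j\<le>k. \<bar>d\<phi> y (X j y)\<bar>)" .
qed (use p d X_apply_continuous[OF \<phi> \<rho>] borel_measurable_continuous_onI in auto)

text \<open>The frame field is a combination of \<open>X j\<close> and \<open>X j0\<close> with
  coefficients \<open>\<sigma>\<close> and \<open>- snd (X j)\<close>, each at most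
  \<open>\<Lambda>\<close> in absolute value, hence the factor \<open>2 * \<Lambda>\<close>.\<close>

lemma tangential_apply_bound:
  assumes \<phi>: "test_function \<rho>\<^sub>1 \<phi> d\<phi>" and \<rho>: "\<rho>\<^sub>1 \<le> r" and p: "p > 1" and j: "j \<in> J"
  shows "lpint p (\<lambda>y. d\<phi> y (\<zeta> j (clip2 y), 0)) \<le> ennreal ((2 * \<Lambda> * card {..k}) powr p) * (\<Sum>j\<le>k. lpint p (\<lambda>y. d\<phi> y (X j y)))"
proof (rule lpint_le_sum)
  fix y
  let ?y = "clip2 y" and ?S = "\<Sum>j\<le>k. \<bar>d\<phi> y (X j y)\<bar>"
  have jk: "j \<le> k" using J(2)[OF j] .
  have "(\<zeta> j ?y, 0) = \<sigma> ?y *\<^sub>R X j ?y - snd (X j ?y) *\<^sub>R X j0 ?y" by (simp add: prod_eq_iff \<zeta>_def \<sigma>_def)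
  then have "d\<phi> y (\<zeta> j ?y, 0) = \<sigma> ?y * d\<phi> y (X j y) - snd (X j ?y) * d\<phi> y (X j0 y)"
    using field_clip_eq[OF \<phi> \<rho>, of y "X j0"] field_clip_eq[OF \<phi> \<rho>, of y "X j"]
    by (simp add: linear_scale[OF test_functionD(3)[OF \<phi>]] linear_diff[OF test_functionD(3)[OF \<phi>]])
  moreover have "\<bar>snd (X i ?y)\<bar> \<le> \<Lambda>" if "i \<le> k" for i
    using X_bd[OF that clip2_norm, of y] norm_snd_le[of "snd (X i ?y)" "fst (X i ?y)"] unfolding prod.collapse by simp
  note sb = this
  moreover have "\<bar>d\<phi> y (X i y)\<bar> \<le> ?S" if "i \<le> k" for i
    using that by (intro member_le_sum[of i "{..k}" "\<lambda>i. \<bar>d\<phi> y (X i y)\<bar>"]) auto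
  note Sb = this
  have "\<bar>\<sigma> ?y * d\<phi> y (X j y)\<bar> \<le> \<Lambda> * ?S" unfolding abs_mult \<sigma>_def using d(3) by (intro mult_mono sb Sb jk j0) auto
  moreover have "\<bar>snd (X j ?y) * d\<phi> y (X j0 y)\<bar> \<le> \<Lambda> * ?S" unfolding abs_mult using d(3) by (intro mult_mono sb Sb jk j0) auto
  ultimately show "\<bar>d\<phi> y (\<zeta> j ?y, 0)\<bar> \<le> 2 * \<Lambda> * ?S" by linarith
qed (use p d X_apply_continuous[OF \<phi> \<rho>] borel_measurable_continuous_onI in auto)

lemma z_apply_continuous:
  assumes \<phi>: "test_function \<rho>\<^sub>1 \<phi> d\<phi>" and j: "j \<in> J"
  shows "continuous_on UNIV (\<lambda>y. d\<phi> y (\<zeta> j (clip2 y), 0))"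
proof (rule test_function_field_continuous[OF \<phi> continuous_on_id])
  have "continuous_on UNIV (\<lambda>y. \<zeta> j (clip2 y))" by (rule clipped_continuous[OF \<zeta>_lip[OF j]])
  then show "continuous_on UNIV (\<lambda>y. (\<zeta> j (clip2 y), 0::real))" by (intro continuous_intros)
qed

text \<open>An integral curve of \<open>Y i\<close> cannot leave the ball on which \<open>Y i\<close> agrees with its extension
  \<open>Yc i\<close>: up to the first exit time it coincides with the flow of \<open>Yc i\<close>, which stays inside.\<close>
lemma flow_eq_gflow:
  assumes i: "i < k" and Yb: "bounded_lipschitz L (Yc i)" and x: "norm x + L * \<bar>\<tau>\<bar> < r"
  shows "integral_curve (Y i) (W' \<inter> ball 0 r) \<tau> x (\<lambda>s. gflow (Yc i) s x)"
    and "flow (Y i) W' \<tau> x = gflow (Yc i) \<tau> x"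
proof -
  have L: "1 \<le> L" using bounded_lipschitzD(1)[OF Yb] .
  let ?g = "\<lambda>s. gflow (Yc i) s x"
  have seg: "\<bar>s\<bar> \<le> \<bar>\<tau>\<bar>" if "s \<in> closed_segment 0 \<tau>" for s
    using that by (auto simp: closed_segment_eq_real_ivl split: if_splits)
  have inb: "norm (?g s) < r" if "\<bar>s\<bar> \<le> \<bar>\<tau>\<bar>" for s
    using gflow_dist[OF Yb, of s x] mult_left_mono[OF that, of L] L x norm_triangle_sub[of "?g s" x] by linarith
  have YcY: "Yc i y = Y i y" if "norm y \<le> r" for y using clip_id[OF d(1) that] by (simp add: Yc_def)
  have rd: "r < d" using d by linarith
  show curve: "integral_curve (Y i) (W' \<inter> ball 0 r) \<tau> x ?g"
    unfolding integral_curve_def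
  proof (intro conjI ballI)
    show "?g 0 = x" by (rule gflow_0[OF Yb])
    fix s assume s: "s \<in> closed_segment 0 \<tau>"
    have n: "norm (?g s) < r" by (rule inb[OF seg[OF s]])
    then have "?g s \<in> W'" using rd by (intro in_W') linarith
    then show "?g s \<in> W' \<inter> ball 0 r" using n by simp
    show "(?g has_vector_derivative Y i (?g s)) (at s within closed_segment 0 \<tau>)"
      using gflow_has_vector_derivative[OF Yb, of x s "closed_segment 0 \<tau>"] YcY[of "?g s"] n by simp
  qed
  have uniq: "\<gamma> \<tau> = ?g \<tau>" if \<gamma>: "integral_curve (Y i) W' \<tau> x \<gamma>" for \<gamma>
  proof -
    have \<gamma>0: "\<gamma> 0 = x" and \<gamma>': "\<And>s. s \<in> closed_segment 0 \<tau> \<Longrightarrow> (\<gamma> has_vector_derivative Y i (\<gamma> s)) (at s within closed_segment 0 \<tau>)"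
      using \<gamma> by (auto simp: integral_curve_def)
    have cont: "continuous_on (closed_segment 0 \<tau>) \<gamma>"
      using \<gamma>' by (meson continuous_on_eq_continuous_within has_vector_derivative_continuous)
    have agree: "\<gamma> s = ?g s" if s: "s \<in> closed_segment 0 \<tau>" and in_ball: "\<And>u. u \<in> closed_segment 0 s \<Longrightarrow> norm (\<gamma> u) \<le> r" for s
    proof (rule gflow_unique[where \<gamma>=\<gamma>, OF Yb \<gamma>0])
      fix u assume u: "u \<in> closed_segment 0 s"
      have sub: "closed_segment 0 s \<subseteq> closed_segment 0 \<tau>" using s by (simp add: subset_closed_segment)
      show "(\<gamma> has_vector_derivative Yc i (\<gamma> u)) (at u within closed_segment 0 s)"
        using has_vector_derivative_within_subset[OF \<gamma>'[of u] sub] u sub YcY[OF in_ball[OF u]] by auto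
    qed
    \<comment> \<open>Rescaling time to the unit interval puts both signs of \<open>\<tau>\<close>
      on the same footing and gives the first exit time as a minimum.\<close>
    define \<Gamma> where "\<Gamma> l = \<gamma> (l * \<tau>)" for l
    have sc: "l * \<tau> \<in> closed_segment 0 \<tau>" if "l \<in> {0..1}" for l using that by (auto simp: in_segment)
    have sc': "\<exists>l'\<in>{0..l}. u = l' * \<tau>" if l: "0 \<le> l" and u: "u \<in> closed_segment 0 (l * \<tau>)" for u l
    proof -
      obtain v where v: "0 \<le> v" "v \<le> 1" "u = v * (l * \<tau>)" using u by (auto simp: in_segment)
      then show ?thesis using l by (intro bexI[of _ "v * l"]) (auto simp: mult_left_le_one_le)
    qed
    have \<Gamma>c: "continuous_on {0..1} (\<lambda>l. norm (\<Gamma> l))"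
      unfolding \<Gamma>_def by (intro continuous_on_norm continuous_on_compose2[OF cont]) (auto intro!: continuous_intros sc)
    have all: "norm (\<Gamma> l\<^sub>0) < r" if l0: "l\<^sub>0 \<in> {0..1}" for l\<^sub>0
    proof (rule ccontr)
      assume "\<not> norm (\<Gamma> l\<^sub>0) < r"
      define E where "E = {l\<in>{0..1}. r \<le> norm (\<Gamma> l)}"
      have Ene: "E \<noteq> {}" using l0 \<open>\<not> norm (\<Gamma> l\<^sub>0) < r\<close> by (auto simp: E_def)
      have "closed E" unfolding E_def by (intro continuous_on_closed_Collect_le \<Gamma>c continuous_on_const) auto
      moreover have "bounded E" by (rule bounded_subset[of "{0..1}"]) (auto simp: E_def)
      ultimately have "compact E" by (simp add: compact_eq_bounded_closed)
      then obtain e where e: "e \<in> E" "\<And>l. l \<in> E \<Longrightarrow> e \<le> l" using compact_attains_inf[OF _ Ene] by metis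
      have e01: "0 \<le> e" "e \<le> 1" "r \<le> norm (\<Gamma> e)" using e(1) by (auto simp: E_def)
      \<comment> \<open>By minimality of \<open>e\<close> and the intermediate value theorem the
        norm at \<open>e\<close> is exactly \<open>r\<close>. So up to and including
        \<open>e\<close> the curve stays in the closed ball, where the extended field agrees with
        \<open>Y i\<close>, and it coincides with the flow; but the flow has norm below
        \<open>r\<close>.\<close>
      have "norm (\<Gamma> 0) \<le> r" using \<gamma>0 inb[of 0] by (simp add: \<Gamma>_def gflow_0[OF Yb])
      then obtain e' where e': "0 \<le> e'" "e' \<le> e" "norm (\<Gamma> e') = r"
        using IVT'[of "\<lambda>l. norm (\<Gamma> l)" 0 r e] e01 continuous_on_subset[OF \<Gamma>c, of "{0..e}"] by auto
      then have "e \<le> e'" using e01 by (intro e(2)) (auto simp: E_def)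
      then have er: "norm (\<Gamma> e) = r" using e' by simp
      have before: "norm (\<Gamma> l) \<le> r" if "l \<in> {0..e}" for l
        using e(2)[of l] that e01 er by (cases "l = e") (auto simp: E_def not_less[symmetric])
      have "\<gamma> (e * \<tau>) = ?g (e * \<tau>)"
      proof (rule agree[OF sc])
        show "e \<in> {0..1}" using e01 by simp
        fix u assume "u \<in> closed_segment 0 (e * \<tau>)"
        then obtain l where "l \<in> {0..e}" "u = l * \<tau>" using sc'[OF e01(1)] by blast
        then show "norm (\<gamma> u) \<le> r" using before by (simp add: \<Gamma>_def)
      qed
      moreover have "\<bar>e * \<tau>\<bar> \<le> \<bar>\<tau>\<bar>" by (rule seg[OF sc]) (use e01 in simp)
      ultimately have "norm (\<Gamma> e) < r" using inb by (simp add: \<Gamma>_def)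
      then show False using er by simp
    qed
    show ?thesis
    proof (rule agree)
      show "\<tau> \<in> closed_segment 0 \<tau>" by simp
      fix u assume "u \<in> closed_segment 0 \<tau>"
      then obtain l where "l \<in> {0..1}" "u = l * \<tau>" using sc'[of 1 u] by auto
      then show "norm (\<gamma> u) \<le> r" using all[of l] by (simp add: \<Gamma>_def)
    qed
  qed
  show "flow (Y i) W' \<tau> x = ?g \<tau>"
    unfolding flow_def
  proof (rule the_equality)
    show "\<exists>\<gamma>. integral_curve (Y i) W' \<tau> x \<gamma> \<and> \<gamma> \<tau> = ?g \<tau>"
      using curve by (intro exI[of _ ?g]) (auto simp: integral_curve_def)
  qed (use uniq in auto)
qed

end

section \<open>The trace theorem\<close>

lemma compactly_supported_test_function:
  fixes \<phi> :: "'b::euclidean_space \<Rightarrow> real"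
  assumes \<phi>: "Cinf_on UNIV \<phi>" and supp: "closure {y. \<phi> y \<noteq> 0} \<subseteq> ball 0 R"
  shows "test_function R \<phi> (\<lambda>y. frechet_derivative \<phi> (at y))"
  unfolding test_function_def
proof (intro conjI allI impI)
  have d: "(\<phi> has_derivative frechet_derivative \<phi> (at y)) (at y)" for y using Cinf_onD(2)[OF \<phi>] by simp
  show "(\<phi> has_derivative frechet_derivative \<phi> (at y)) (at y)" for y by (rule d)
  fix v
  have "frechet_derivative \<phi> (at y) v = (\<Sum>b\<in>Basis. (v \<bullet> b) * frechet_derivative \<phi> (at y) b)" for y
  proof -
    have lin: "linear (frechet_derivative \<phi> (at y))" by (rule has_derivative_linear[OF d])
    have "frechet_derivative \<phi> (at y) (\<Sum>b\<in>Basis. (v \<bullet> b) *\<^sub>R b) = (\<Sum>b\<in>Basis. (v \<bullet> b) * frechet_derivative \<phi> (at y) b)"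
      by (simp add: linear_sum[OF lin] linear_scale[OF lin])
    then show ?thesis by (simp add: euclidean_representation)
  qed
  then show "continuous_on UNIV (\<lambda>y. frechet_derivative \<phi> (at y) v)"
    by (auto intro!: continuous_intros Cinf_onD(3)[OF \<phi>])
next
  fix y :: 'b assume "R \<le> norm y"
  then have y: "y \<in> - closure {y. \<phi> y \<noteq> 0}" using supp by auto
  then show "\<phi> y = 0" using closure_subset[of "{y. \<phi> y \<noteq> 0}"] by auto
  have "(\<phi> has_derivative (\<lambda>v. 0)) (at y)"
  proof (rule has_derivative_transform_within_open[OF has_derivative_const[of 0] _ y])
    show "open (- closure {y. \<phi> y \<noteq> 0})" by (simp add: open_Compl)
    show "0 = \<phi> w" if "w \<in> - closure {y. \<phi> y \<noteq> 0}" for w using that closure_subset[of "{y. \<phi> y \<noteq> 0}"] by auto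
  qed
  then have "frechet_derivative \<phi> (at y) = (\<lambda>v. 0)" by (rule frechet_derivative_at[symmetric])
  then show "frechet_derivative \<phi> (at y) v = 0" for v by simp
qed

text \<open>\<open>E\<close> is the \<open>p\<close>-th power of a norm: the power \<open>p\<close>
  undoes the root, and \<open>(1 - 1/p) * p + 1 = p\<close> collects the two weights.\<close>

lemma besov_integrand:
  fixes p t E :: real
  assumes p: "p > 1" and t: "t > 0" and I: "E \<ge> 0"
  shows "(t powr (- (1 - 1/p)) * E powr (1/p)) powr p / t = t powr (- p) * E"
proof -
  have "(t powr (- (1 - 1/p)) * E powr (1/p)) powr p = t powr (- (1 - 1/p) * p) * E"
  proof -
    have "(E powr (1/p)) powr p = E" using p I by (simp add: powr_powr)
    moreover have "(t powr (- (1 - 1/p))) powr p = t powr (- (1 - 1/p) * p)" by (rule powr_powr)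
    moreover have "(t powr (- (1 - 1/p)) * E powr (1/p)) powr p = (t powr (- (1 - 1/p))) powr p * (E powr (1/p)) powr p"
      by (rule powr_mult)
    ultimately show ?thesis by (simp only:)
  qed
  then have "(t powr (- (1 - 1/p)) * E powr (1/p)) powr p / t = (t powr (- (1 - 1/p) * p) / t) * E" by (simp only: times_divide_eq_left)
  also have "t powr (- (1 - 1/p) * p) / t = t powr (- (1 - 1/p) * p - 1)" using t by (simp add: powr_diff)
  also have "- (1 - 1/p) * p - 1 = - p" using p by (simp add: field_simps)
  finally show ?thesis .
qed

lemma lpint_restrict:
  assumes "p > 0" and "\<And>y. y \<notin> S \<Longrightarrow> f y = 0"
  shows "(\<integral>\<^sup>+y\<in>S. ennreal (\<bar>f y\<bar> powr p) \<partial>lborel) = lpint p f"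
  unfolding lpint_def using assms by (intro nn_integral_cong) (auto split: split_indicator)

theorem theorem1p1:
  fixes p :: real and k :: nat
    and \<V> :: "((real^'n::finite) \<times> real) \<Rightarrow> ((real^'n) \<times> real) set"
    and W :: "((real^'n) \<times> real) set"
    and X :: "nat \<Rightarrow> ((real^'n) \<times> real) \<Rightarrow> ((real^'n) \<times> real)"
    and W' :: "(real^'n) set"
    and Y :: "nat \<Rightarrow> real^'n \<Rightarrow> real^'n"
  assumes p: "1 < p"
    and W: "open W" "0 \<in> W"
    and X_smooth: "\<forall>j\<le>k. vf_smooth W (X j)"
    and X_indep: "\<forall>y\<in>W. inj_on (\<lambda>j. X j y) {..k} \<and> independent ((\<lambda>j. X j y) ` {..k})"
    and V_span: "\<forall>y\<in>W. \<V> y = span ((\<lambda>j. X j y) ` {..k})"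
    and W': "open W'" "0 \<in> W'" "\<forall>x\<in>W'. (x, 0) \<in> W"
    and Y_smooth: "\<forall>i<k. vf_smooth W' (Y i)"
    and Y_indep: "\<forall>x\<in>W'. inj_on (\<lambda>i. Y i x) {..<k} \<and> independent ((\<lambda>i. Y i x) ` {..<k})"
    and Y_span: "\<forall>x\<in>W'. (\<lambda>v. (v, 0)) ` span ((\<lambda>i. Y i x) ` {..<k}) = \<V> (x, 0) \<inter> {v. snd v = 0}"
    and cond_i: "\<exists>v\<in>\<V> 0. snd v \<noteq> 0"
    and cond_ii: "\<exists>N. open N \<and> 0 \<in> N \<and> N \<subseteq> W' \<and>
        (\<forall>x\<in>N. span ({Z x | Z. vf_smooth N Z \<and> (\<forall>y\<in>N. (Z y, 0) \<in> \<V> (y, 0))}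
                  \<union> {lie_bracket Z1 Z2 x | Z1 Z2.
                       vf_smooth N Z1 \<and> (\<forall>y\<in>N. (Z1 y, 0) \<in> \<V> (y, 0)) \<and>
                       vf_smooth N Z2 \<and> (\<forall>y\<in>N. (Z2 y, 0) \<in> \<V> (y, 0))}) = UNIV)"
  shows "\<exists>U V' V \<delta> C.
     open U \<and> 0 \<in> U \<and> U \<subseteq> W \<and>
     open V' \<and> 0 \<in> V' \<and> open V \<and> compact (closure V') \<and> closure V' \<subseteq> V \<and>
     \<delta> > 0 \<and>
     (\<forall>i<k. \<forall>x\<in>V'. \<forall>\<tau>. \<bar>\<tau>\<bar> \<le> \<delta> \<longrightarrow>
        (\<exists>\<gamma>. integral_curve (Y i) (W' \<inter> V) \<tau> x \<gamma>) \<and> flow (Y i) W' \<tau> x \<in> V) \<and>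
     C > 0 \<and>
     (\<forall>\<phi>::((real^'n) \<times> real) \<Rightarrow> real.
        Cinf_on UNIV \<phi> \<and> compact (closure {y. \<phi> y \<noteq> 0}) \<and> closure {y. \<phi> y \<noteq> 0} \<subseteq> U \<longrightarrow>
        (\<forall>i<k. besov_term p \<delta> (Y i) W' V' (\<lambda>x. \<phi> (x, 0)) < \<infinity>) \<and>
        Lp_norm p lborel UNIV (\<lambda>x. \<phi> (x, 0))
          + (\<Sum>i<k. enn2real (besov_term p \<delta> (Y i) W' V' (\<lambda>x. \<phi> (x, 0))) powr (1/p))
        \<le> C * (Lp_norm p lborel U \<phi> + (\<Sum>j\<le>k. Lp_norm p lborel U (vf_apply (X j) \<phi>))))"
proof -
  interpret sb: subbundle k \<V> W X W' Y
    using W X_smooth X_indep V_span W' Y_smooth Y_span cond_i cond_ii by (rule subbundle.intro)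
  obtain d \<Lambda> m where d: "0 < d" "1 \<le> \<Lambda>" "0 < m"
    and b1: "\<forall>y. norm y < d \<longrightarrow> y \<in> W \<and> m \<le> \<bar>sb.\<sigma> y\<bar> \<and> (\<forall>c. m * (\<Sum>j\<in>sb.J. \<bar>c j\<bar>) \<le> norm (\<Sum>j\<in>sb.J. c j *\<^sub>R sb.\<zeta> j y))"
    and b2: "\<forall>x. norm x < d \<longrightarrow> x \<in> W'"
    and b3: "\<forall>j\<le>k. (\<forall>y y'. norm y < d \<longrightarrow> norm y' < d \<longrightarrow> norm (X j y - X j y') \<le> \<Lambda> * norm (y - y')) \<and> (\<forall>y. norm y < d \<longrightarrow> norm (X j y) \<le> \<Lambda>)"
    and b4: "\<forall>j\<in>sb.J. (\<forall>y y'. norm y < d \<longrightarrow> norm y' < d \<longrightarrow> norm (sb.\<zeta> j y - sb.\<zeta> j y') \<le> \<Lambda> * norm (y - y')) \<and> (\<forall>y. norm y < d \<longrightarrow> norm (sb.\<zeta> j y) \<le> \<Lambda>)"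
    and b5: "\<forall>i<k. (\<forall>y y'. norm y < d \<longrightarrow> norm y' < d \<longrightarrow> norm (Y i y - Y i y') \<le> \<Lambda> * norm (y - y')) \<and> (\<forall>y. norm y < d \<longrightarrow> norm (Y i y) \<le> \<Lambda>)"
    using sb.uniform_bounds by (elim exE conjE)
  define r where "r = d / 3"
  have r: "0 < r" "2 * r < d" using d(1) by (auto simp: r_def)
  interpret cs: clipped_subbundle k \<V> W X W' Y d \<Lambda> m r
    by (intro clipped_subbundle.intro clipped_subbundle_axioms.intro sb.subbundle_axioms r d(2,3))
       (use b1 b2 b3 b4 b5 in blast)+
  obtain L \<delta> K \<rho> \<rho>\<^sub>1 \<eta> \<beta> B c where tf: "trace_frame cs.Tf L p \<delta> K \<rho> \<rho>\<^sub>1 \<eta> \<beta> B sb.J {..<k} cs.z cs.Yc cs.Yt sb.a0 sb.A0 c"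
    and \<rho>1: "0 < \<rho>\<^sub>1" "\<rho>\<^sub>1 < r" and L\<delta>: "L * \<delta> < r / 2"
    using cs.trace_frame_exists[OF p] by (elim exE conjE)
  interpret tf: trace_frame cs.Tf L p \<delta> K \<rho> \<rho>\<^sub>1 \<eta> \<beta> B sb.J "{..<k}" cs.z cs.Yc cs.Yt sb.a0 sb.A0 c by (rule tf)
  \<comment> \<open>On the half ball the flow of the statement is the flow of the extended field, so
    all estimates for \<open>gflow\<close> apply to it.\<close>
  have flow: "integral_curve (Y i) (W' \<inter> ball 0 r) \<tau> x (\<lambda>s. gflow (cs.Yc i) s x)"
      "flow (Y i) W' \<tau> x = gflow (cs.Yc i) \<tau> x" "gflow (cs.Yc i) \<tau> x \<in> ball 0 r"
    if i: "i < k" and x: "x \<in> ball 0 (r / 2)" and \<tau>: "\<bar>\<tau>\<bar> \<le> \<delta>" for i x \<tau>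
  proof -
    have "L * \<bar>\<tau>\<bar> \<le> L * \<delta>" using \<tau> tf.L by (intro mult_left_mono) auto
    then have nx: "norm x + L * \<bar>\<tau>\<bar> < r" using x L\<delta> by simp
    have Yb: "bounded_lipschitz L (cs.Yc i)" using i by (intro tf.Y) simp
    show c1: "integral_curve (Y i) (W' \<inter> ball 0 r) \<tau> x (\<lambda>s. gflow (cs.Yc i) s x)" by (rule cs.flow_eq_gflow(1)[OF i Yb nx])
    show "flow (Y i) W' \<tau> x = gflow (cs.Yc i) \<tau> x" by (rule cs.flow_eq_gflow(2)[OF i Yb nx])
    show "gflow (cs.Yc i) \<tau> x \<in> ball 0 r" using c1 by (auto simp: integral_curve_def)
  qed
  \<comment> \<open>\<open>Ct\<close> and \<open>Cz\<close> compare the vertical and tangential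
    integrals with the derivatives along the \<open>X j\<close>; \<open>C1\<close> and
    \<open>C2\<close> are the constants of the two bounds for the trace, and the final
    \<open>1\<close> in \<open>D\<close> ensures positivity.\<close>
  define Ct where "Ct = (1 / m * card {..k}) powr p"
  define Cz where "Cz = card sb.J * (2 * \<Lambda> * card {..k}) powr p"
  define C1 where "C1 = 2 powr p * (tf.vert_const + flow_const TYPE(real^'n)) / \<delta>"
  define C2 where "C2 = tf.trace_const * (1 / (1 - 1/p) + 1)"
  define D where "D = C1 * (1 + Ct) + C2 * (Ct + Cz) + 1"
  have Ct: "0 \<le> Ct" "0 \<le> Cz" by (simp_all add: Ct_def Cz_def)
  have C12: "0 \<le> C1" "0 \<le> C2"
    using tf.vert_const_nonneg flow_const_ge_1[where 'a="real^'n"] tf.\<delta>(1) tf.trace_const_nonneg p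
    by (auto simp: C1_def C2_def intro!: mult_nonneg_nonneg divide_nonneg_nonneg add_nonneg_nonneg)
  have D: "C1 * (1 + Ct) \<le> D" "C2 * (Ct + Cz) \<le> D" "0 < D"
  proof -
    have "0 \<le> C1 * (1 + Ct)" "0 \<le> C2 * (Ct + Cz)" using Ct C12 by (auto intro!: mult_nonneg_nonneg)
    then show "C1 * (1 + Ct) \<le> D" "C2 * (Ct + Cz) \<le> D" "0 < D" unfolding D_def by linarith+
  qed
  \<comment> \<open>One summand for the trace itself and one for each of the \<open>k\<close>
    fields, and \<open>k + 2\<close> terms under the \<open>p\<close>-th root on the right.\<close>
  define C where "C = (1 + real k) * D powr (1/p) * real (card {..Suc k}) powr (1/p)"
  have C: "C > 0" using D(3) by (auto simp: C_def intro!: mult_pos_pos)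
  have main: "(\<forall>i<k. besov_term p \<delta> (Y i) W' (ball 0 (r / 2)) (\<lambda>x. \<phi> (x, 0)) < \<infinity>) \<and>
        Lp_norm p lborel UNIV (\<lambda>x. \<phi> (x, 0))
          + (\<Sum>i<k. enn2real (besov_term p \<delta> (Y i) W' (ball 0 (r / 2)) (\<lambda>x. \<phi> (x, 0))) powr (1/p))
        \<le> C * (Lp_norm p lborel (ball 0 \<rho>\<^sub>1) \<phi> + (\<Sum>j\<le>k. Lp_norm p lborel (ball 0 \<rho>\<^sub>1) (vf_apply (X j) \<phi>)))"
    if \<phi>: "Cinf_on UNIV \<phi>" "closure {y. \<phi> y \<noteq> 0} \<subseteq> ball 0 \<rho>\<^sub>1" for \<phi> :: "(real^'n) \<times> real \<Rightarrow> real"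
  proof -
    let ?d = "\<lambda>y. frechet_derivative \<phi> (at y)"
    have test: "test_function \<rho>\<^sub>1 \<phi> ?d" by (rule compactly_supported_test_function[OF \<phi>])
    note tD = test_functionD[OF test]
    have \<rho>r: "\<rho>\<^sub>1 \<le> r" using \<rho>1 by simp
    have p0: "0 < p" using p by simp
    have fin: "lpint p \<phi> < \<infinity>" by (rule lpint_finite[OF p0 tD(6) tD(4)])
    have finX: "lpint p (\<lambda>y. ?d y (X j y)) < \<infinity>" if "j \<le> k" for j
      by (rule lpint_finite[OF p0 cs.X_apply_continuous[OF test \<rho>r that] tD(5)])
    define P where "P j = enn2real (lpint p (\<lambda>y. ?d y (X j y)))" for j
    define P0 where "P0 = enn2real (lpint p \<phi>)"
    have P: "lpint p (\<lambda>y. ?d y (X j y)) = ennreal (P j)" if "j \<le> k" for j using finX[OF that] by (simp add: P_def)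
    have P0: "lpint p \<phi> = ennreal P0" using fin by (simp add: P0_def)
    have nonneg: "0 \<le> P j" "0 \<le> P0" for j by (simp_all add: P_def P0_def)
    let ?SP = "\<Sum>j\<le>k. P j"
    have SP: "(\<Sum>j\<le>k. lpint p (\<lambda>y. ?d y (X j y))) = ennreal ?SP" using nonneg by (simp add: P)
    have SP0: "0 \<le> ?SP" using nonneg by (simp add: sum_nonneg)
    define s where "s = P0 + ?SP"
    have s: "0 \<le> s" "P0 \<le> s" "?SP \<le> s" using nonneg SP0 by (auto simp: s_def)
    have vert: "(\<integral>\<^sup>+t\<in>{0<..\<delta>}. tf.vertical ?d t \<partial>lborel) \<le> ennreal (Ct * ?SP)"
    proof -
      have "(\<integral>\<^sup>+t\<in>{0<..\<delta>}. tf.vertical ?d t \<partial>lborel) \<le> lpint p (\<lambda>y. ?d y (cs.Tf y))"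
        unfolding tf.vertical_def by (rule lpint_slices_le(2)[OF tf.T_continuous[OF test]])
      also have "\<dots> \<le> ennreal Ct * ennreal ?SP"
        unfolding Ct_def SP[symmetric] by (rule cs.vertical_apply_bound[OF test \<rho>r p])
      finally show ?thesis using Ct SP0 by (simp add: ennreal_mult)
    qed
    have zc: "continuous_on UNIV (\<lambda>y. ?d y (sb.\<zeta> j (cs.clip2 y), 0))" if "j \<in> sb.J" for j
      by (rule cs.z_apply_continuous[OF test that])
    have slice_m: "(\<lambda>t. lpint p (\<lambda>x. ?d (x, t) (cs.z j t x, 0))) \<in> borel_measurable borel" if "j \<in> sb.J" for j
      using lpint_slices_le(1)[OF zc[OF that], of p] by (simp add: cs.z_def)
    have tang_m: "tf.tangential ?d \<in> borel_measurable borel"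
      unfolding tf.tangential_def[abs_def] by (intro borel_measurable_sum slice_m)
    have tang: "(\<integral>\<^sup>+t\<in>{0<..\<delta>}. tf.tangential ?d t \<partial>lborel) \<le> ennreal (Cz * ?SP)"
    proof -
      have "(\<integral>\<^sup>+t\<in>{0<..\<delta>}. tf.tangential ?d t \<partial>lborel) = (\<Sum>j\<in>sb.J. (\<integral>\<^sup>+t\<in>{0<..\<delta>}. lpint p (\<lambda>x. ?d (x, t) (cs.z j t x, 0)) \<partial>lborel))"
        unfolding tf.tangential_def sum_distrib_right by (intro nn_integral_sum borel_measurable_times_ennreal) (auto intro: slice_m)
      also have "\<dots> \<le> (\<Sum>j\<in>sb.J. ennreal ((2 * \<Lambda> * card {..k}) powr p) * ennreal ?SP)"
      proof (rule sum_mono)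
        fix j assume j: "j \<in> sb.J"
        have "(\<integral>\<^sup>+t\<in>{0<..\<delta>}. lpint p (\<lambda>x. ?d (x, t) (cs.z j t x, 0)) \<partial>lborel) \<le> lpint p (\<lambda>y. ?d y (sb.\<zeta> j (cs.clip2 y), 0))"
          unfolding cs.z_def by (rule lpint_slices_le(2)[OF zc[OF j]])
        also have "\<dots> \<le> ennreal ((2 * \<Lambda> * card {..k}) powr p) * ennreal ?SP"
          unfolding SP[symmetric] by (rule cs.tangential_apply_bound[OF test \<rho>r p j])
        finally show "(\<integral>\<^sup>+t\<in>{0<..\<delta>}. lpint p (\<lambda>x. ?d (x, t) (cs.z j t x, 0)) \<partial>lborel) \<le> ennreal ((2 * \<Lambda> * card {..k}) powr p) * ennreal ?SP" .
      qed
      also have "\<dots> = ennreal (Cz * ?SP)" using SP0 by (simp add: Cz_def ennreal_mult ennreal_of_nat_eq_real_of_nat mult.assoc)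
      finally show ?thesis .
    qed
    have lp: "lpint p (\<lambda>x. \<phi> (x, 0)) \<le> ennreal (D * s)"
    proof -
      have "lpint p (\<lambda>x. \<phi> (x, 0)) \<le> ennreal C1 * ((\<integral>\<^sup>+t\<in>{0<..\<delta>}. lpint p (\<lambda>x. \<phi> (x, t)) \<partial>lborel) + (\<integral>\<^sup>+t\<in>{0<..\<delta>}. tf.vertical ?d t \<partial>lborel))"
        unfolding C1_def by (rule tf.trace_lp_bound[OF test])
      also have "\<dots> \<le> ennreal C1 * (ennreal P0 + ennreal (Ct * ?SP))"
        unfolding P0[symmetric] by (intro mult_left_mono add_mono vert lpint_slices_le(2)[OF tD(6)]) auto
      also have "\<dots> = ennreal (C1 * (P0 + Ct * ?SP))"
        using C12 Ct nonneg SP0 by (simp add: ennreal_mult ennreal_plus)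
      also have "\<dots> \<le> ennreal (D * s)"
      proof (rule ennreal_leI)
        have "P0 + Ct * ?SP \<le> (1 + Ct) * s"
          using s mult_left_mono[OF s(3) Ct(1)] by (simp add: distrib_right)
        then have "C1 * (P0 + Ct * ?SP) \<le> C1 * ((1 + Ct) * s)" using C12(1) by (rule mult_left_mono)
        also have "\<dots> \<le> D * s" using mult_right_mono[OF D(1) s(1)] by (simp add: mult.assoc)
        finally show "C1 * (P0 + Ct * ?SP) \<le> D * s" .
      qed
      finally show ?thesis .
    qed
    have bes: "besov_term p \<delta> (Y i) W' (ball 0 (r / 2)) (\<lambda>x. \<phi> (x, 0)) \<le> ennreal (D * s)" if i: "i < k" for i
    proof -
      have pt: "ennreal ((t powr (-(1 - 1/p)) * Lp_norm p lborel (ball 0 (r / 2)) (\<lambda>x. \<phi> (flow (Y i) W' \<tau> x, 0) - \<phi> (x, 0))) powr p / t)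
          \<le> ennreal (t powr (- p)) * lpint p (\<lambda>x. \<phi> (gflow (cs.Yc i) \<tau> x, 0) - \<phi> (x, 0))"
        if t: "0 < t" "t \<le> \<delta>" and \<tau>: "\<tau> \<in> {-t..t}" for t \<tau>
      proof -
        let ?I = "\<integral>\<^sup>+x\<in>ball 0 (r / 2). ennreal (\<bar>\<phi> (flow (Y i) W' \<tau> x, 0) - \<phi> (x, 0)\<bar> powr p) \<partial>lborel"
        have I: "?I \<le> lpint p (\<lambda>x. \<phi> (gflow (cs.Yc i) \<tau> x, 0) - \<phi> (x, 0))"
          unfolding lpint_def
        proof (rule nn_integral_mono)
          fix x :: "real^'n"
          have "\<bar>\<tau>\<bar> \<le> \<delta>" using t \<tau> by auto
          then show "ennreal (\<bar>\<phi> (flow (Y i) W' \<tau> x, 0) - \<phi> (x, 0)\<bar> powr p) * indicator (ball 0 (r / 2)) x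
             \<le> ennreal (\<bar>\<phi> (gflow (cs.Yc i) \<tau> x, 0) - \<phi> (x, 0)\<bar> powr p)"
            using flow(2)[OF i, of x \<tau>] by (auto split: split_indicator)
        qed
        have "(t powr (-(1 - 1/p)) * Lp_norm p lborel (ball 0 (r / 2)) (\<lambda>x. \<phi> (flow (Y i) W' \<tau> x, 0) - \<phi> (x, 0))) powr p / t
           = t powr (- p) * enn2real ?I"
          unfolding Lp_norm_def by (rule besov_integrand[OF p t(1)]) simp
        then have "ennreal ((t powr (-(1 - 1/p)) * Lp_norm p lborel (ball 0 (r / 2)) (\<lambda>x. \<phi> (flow (Y i) W' \<tau> x, 0) - \<phi> (x, 0))) powr p / t)
           = ennreal (t powr (- p)) * ennreal (enn2real ?I)" by (simp add: ennreal_mult)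
        \<comment> \<open>An infinite integral has \<open>enn2real\<close> equal to
          \<open>0\<close>, so the inequality survives in that case.\<close>
        also have "\<dots> \<le> ennreal (t powr (- p)) * lpint p (\<lambda>x. \<phi> (gflow (cs.Yc i) \<tau> x, 0) - \<phi> (x, 0))"
          by (intro mult_left_mono order_trans[OF _ I]) (auto simp: ennreal_enn2real_if)
        finally show ?thesis .
      qed
      have "besov_term p \<delta> (Y i) W' (ball 0 (r / 2)) (\<lambda>x. \<phi> (x, 0))
        \<le> (\<integral>\<^sup>+t\<in>{0<..\<delta>}. (SUP \<tau>\<in>{-t..t}. ennreal (t powr (- p)) * lpint p (\<lambda>x. \<phi> (gflow (cs.Yc i) \<tau> x, 0) - \<phi> (x, 0))) \<partial>lborel)"
        unfolding besov_term_def
      proof (rule nn_integral_mono)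
        fix t :: real
        show "(SUP \<tau>\<in>{-t..t}. ennreal ((t powr (-(1 - 1/p)) * Lp_norm p lborel (ball 0 (r / 2)) (\<lambda>x. \<phi> (flow (Y i) W' \<tau> x, 0) - \<phi> (x, 0))) powr p / t)) * indicator {0<..\<delta>} t
          \<le> (SUP \<tau>\<in>{-t..t}. ennreal (t powr (- p)) * lpint p (\<lambda>x. \<phi> (gflow (cs.Yc i) \<tau> x, 0) - \<phi> (x, 0))) * indicator {0<..\<delta>} t"
        proof (cases "t \<in> {0<..\<delta>}")
          case True
          then have t: "0 < t" "t \<le> \<delta>" by simp_all
          show ?thesis
            by (rule mult_right_mono, rule SUP_mono, rule bexI, rule pt[OF t], assumption, assumption, simp)
        qed simp
      qed
      also have "\<dots> \<le> ennreal C2 * ((\<integral>\<^sup>+t\<in>{0<..\<delta>}. tf.vertical ?d t \<partial>lborel) + (\<integral>\<^sup>+t\<in>{0<..\<delta>}. tf.tangential ?d t \<partial>lborel))"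
        unfolding C2_def using i by (intro tf.besov_integral_bound[OF _ test tang_m]) simp
      also have "\<dots> \<le> ennreal C2 * (ennreal (Ct * ?SP) + ennreal (Cz * ?SP))" by (intro mult_left_mono add_mono vert tang) auto
      also have "\<dots> = ennreal (C2 * ((Ct + Cz) * ?SP))"
        using C12 Ct SP0 by (simp add: ennreal_mult ennreal_plus distrib_right)
      also have "\<dots> \<le> ennreal (D * s)"
      proof (rule ennreal_leI)
        have "C2 * ((Ct + Cz) * ?SP) = (C2 * (Ct + Cz)) * ?SP" by simp
        also have "\<dots> \<le> D * s" using D s SP0 by (intro mult_mono) auto
        finally show "C2 * ((Ct + Cz) * ?SP) \<le> D * s" .
      qed
      finally show ?thesis .
    qed
    have Ds: "0 \<le> D * s" using D(3) s(1) by simp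
    have r1: "Lp_norm p lborel UNIV (\<lambda>x. \<phi> (x, 0)) \<le> (D * s) powr (1/p)"
    proof -
      have "enn2real (lpint p (\<lambda>x. \<phi> (x, 0))) \<le> D * s" using lp Ds by (rule enn2real_leI[rotated])
      then show ?thesis unfolding Lp_norm_def using p by (intro powr_mono2) (auto simp: lpint_def)
    qed
    have r2: "enn2real (besov_term p \<delta> (Y i) W' (ball 0 (r / 2)) (\<lambda>x. \<phi> (x, 0))) powr (1/p) \<le> (D * s) powr (1/p)" if "i < k" for i
      using enn2real_leI[OF Ds bes[OF that]] p by (intro powr_mono2) auto
    have n0: "Lp_norm p lborel (ball 0 \<rho>\<^sub>1) \<phi> = P0 powr (1/p)"
    proof -
      have "(\<integral>\<^sup>+y\<in>ball 0 \<rho>\<^sub>1. ennreal (\<bar>\<phi> y\<bar> powr p) \<partial>lborel) = lpint p \<phi>"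
        using tD(4) by (intro lpint_restrict p0) auto
      then show ?thesis by (simp add: Lp_norm_def P0_def)
    qed
    have nX: "Lp_norm p lborel (ball 0 \<rho>\<^sub>1) (vf_apply (X j) \<phi>) = P j powr (1/p)" for j
    proof -
      have "(\<integral>\<^sup>+y\<in>ball 0 \<rho>\<^sub>1. ennreal (\<bar>vf_apply (X j) \<phi> y\<bar> powr p) \<partial>lborel) = lpint p (vf_apply (X j) \<phi>)"
        using tD(5) by (intro lpint_restrict p0) (auto simp: vf_apply_def)
      then show ?thesis by (simp add: Lp_norm_def P_def vf_apply_def[abs_def])
    qed
    \<comment> \<open>The function and its derivatives are listed as one family, index
      \<open>Suc k\<close> standing for the function, so that a single root inequality splits
      \<open>s\<close>.\<close>
    define f where "f j = (if j \<le> k then P j else P0)" for j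
    have sf: "s = (\<Sum>j\<le>Suc k. f j)" by (simp add: s_def f_def)
    have "s powr (1/p) \<le> real (card {..Suc k}) powr (1/p) * (\<Sum>j\<le>Suc k. f j powr (1/p))"
      unfolding sf using nonneg p by (intro sum_powr_le) (auto simp: f_def)
    also have "(\<Sum>j\<le>Suc k. f j powr (1/p)) = P0 powr (1/p) + (\<Sum>j\<le>k. P j powr (1/p))" by (simp add: f_def)
    finally have sp: "s powr (1/p) \<le> real (card {..Suc k}) powr (1/p) * (P0 powr (1/p) + (\<Sum>j\<le>k. P j powr (1/p)))" .
    have "Lp_norm p lborel UNIV (\<lambda>x. \<phi> (x, 0)) + (\<Sum>i<k. enn2real (besov_term p \<delta> (Y i) W' (ball 0 (r / 2)) (\<lambda>x. \<phi> (x, 0))) powr (1/p))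
      \<le> (D * s) powr (1/p) + (\<Sum>i<k. (D * s) powr (1/p))"
      by (intro add_mono r1 sum_mono r2) simp
    also have "\<dots> = (1 + real k) * (D powr (1/p) * s powr (1/p))" using D(3) s(1) by (simp add: powr_mult distrib_right)
    also have "\<dots> \<le> (1 + real k) * (D powr (1/p) * (real (card {..Suc k}) powr (1/p) * (P0 powr (1/p) + (\<Sum>j\<le>k. P j powr (1/p)))))"
      by (intro mult_left_mono sp) auto
    also have "\<dots> = C * (Lp_norm p lborel (ball 0 \<rho>\<^sub>1) \<phi> + (\<Sum>j\<le>k. Lp_norm p lborel (ball 0 \<rho>\<^sub>1) (vf_apply (X j) \<phi>)))"
      unfolding n0 nX C_def by (simp only: mult.assoc)
    finally show ?thesis
      using bes by (auto intro: le_less_trans[OF _ ennreal_less_top])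
  qed
  show ?thesis
  \<comment> \<open>Orbits starting in radius \<open>r / 2\<close> stay in radius \<open>r\<close>
    because \<open>L * \<delta> < r / 2\<close>; test functions are supported within radius
    \<open>\<rho>\<^sub>1\<close>, where the extended fields agree with the given ones.\<close>
  proof (rule exI[of _ "ball 0 \<rho>\<^sub>1"], rule exI[of _ "ball 0 (r / 2)"], rule exI[of _ "ball 0 r"], rule exI[of _ \<delta>], rule exI[of _ C], intro conjI)
    show "ball 0 \<rho>\<^sub>1 \<subseteq> W" using b1 \<rho>1(2) r by auto
    show "compact (closure (ball (0::real^'n) (r / 2)))" using r(1) by simp
    show "closure (ball (0::real^'n) (r / 2)) \<subseteq> ball 0 r" using r(1) by (auto simp: subset_iff)
    show "\<forall>i<k. \<forall>x\<in>ball 0 (r / 2). \<forall>\<tau>. \<bar>\<tau>\<bar> \<le> \<delta> \<longrightarrow>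
        (\<exists>\<gamma>. integral_curve (Y i) (W' \<inter> ball 0 r) \<tau> x \<gamma>) \<and> flow (Y i) W' \<tau> x \<in> ball 0 r"
      using flow by metis
    show "\<delta> > 0" by (rule tf.\<delta>)
    show "C > 0" by (rule C)
  qed (use \<rho>1 r main in auto)
qed

end
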